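(* Let $f\in L^2(\mu)$ with $f\neq0$ and $\int f\,d\mu=0$. Assume that the process is strongly mixing and that there exists a constant $c_f$ such that for all $F$ in the domain of the Dirichlet form $\mathcal E$, $$\left(\int fF\,d\mu\right)^2\le-c_f^2\int F\,LF\,d\mu .$$ Assume in addition that $\liminf_{t\to\infty}\mathrm{Var}_\mu(S_t)/t>0$ (or equivalently that $V_->0$). Then, under $\mathbb P_\mu$, $S_t/\sqrt{\mathrm{Var}_\mu(S_t)}$ converges in distribution to a standard normal law as $t\to+\infty$. Moreover, in this situation there exist positive constants $c$ and $d$ such that $0<c\le\mathrm{Var}_\mu(S_t)/t\le d$ for all large $t$; again this is satisfied if (in place of the $\liminf$ assumption) (Hpos) holds.
   Context: $(X_t)_{t\ge0}$ is a continuous-time strong Markov diffusion process (continuous sample paths) with state space $\mathbb R^d$, non explosive, irreducible, positive recurrent, with unique invariant probability measure $\mu$ (not assumed reversible). $\mathbb P_\mu$, $\mathbb E_\mu$, $\mathrm{Var}_\mu$ refer to the process with $X_0\sim\mu$. $P_tf(x)=\mathbb E(f(X_t)\mid X_0=x)$ is the semigroup, $L$ its generator in $L^2(\mu)$, and $L^*$, $P_t^*$ are the adjoints in $L^2(\mu)$. There is an algebra of uniformly continuous bounded functions, containing the constants, which is a core for the extended domain of the generator. The carr\'e du champ is $\Gamma(F)=L(F^2)-2FLF$ and the Dirichlet form is $\mathcal E(F,F)=\int\Gamma(F)\,d\mu=-2\int FLF\,d\mu$ (for general $F$ in the domain of $\mathcal E$, $-\int FLF\,d\mu$ means $\frac12\mathcal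 E(F,F)$). $S_t=\int_0^tf(X_s)\,ds$, and $$V_-:=\liminf_{t\to\infty}\int_0^t\left(\int P_sf\,P_s^*f\,d\mu\right)ds .$$ Standing assumption: the closure of $L^S=\frac12(L+L^* )$ is the infinitesimal generator of a $\mu$-stationary Markov semigroup $(P^S_t)_{t\ge0}$, which in addition is ergodic. Strong mixing: let $\mathcal F_s$ (resp. $\mathcal G_s$) be the $\sigma$-field generated by $(X_u)_{u\le s}$ (resp. $(X_u)_{u\ge s}$), and let $\alpha_{mix}(r)=\sup|\mathrm{Cov}(F,G)|$ (covariance under $\mathbb P_\mu$), the supremum being over $s\ge0$ and over $F$ (resp. $G$) $\mathcal F_s$- (resp. $\mathcal G_{s+r}$-) measurable, non-negative and bounded by $1$. The process is strongly mixing if $\lim_{r\to\infty}\alpha_{mix}(r)=0$. (Hpos): $\beta(s):=\int P_sf\,P_s^*f\,d\mu\ge0$ for all $s$ large enough. *)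

theory Defs
  imports "HOL-Probability.Probability"
begin

section \<open>Unbounded operators on \<open>L\<^sup>2\<close>\<close>

text \<open>
  Elements of \<open>L\<^sup>2(M)\<close> are represented by square integrable functions, and an unbounded operator by
  its graph, a set of pairs of representatives. All graphs below are saturated under equality
  \<open>M\<close>-almost everywhere.
\<close>

definition L2 :: "'a measure \<Rightarrow> ('a \<Rightarrow> real) set" where
  "L2 M = {f \<in> borel_measurable M. integrable M (\<lambda>x. (f x)\<^sup>2)}"

definition L2_tendsto :: "'a measure \<Rightarrow> ('i \<Rightarrow> 'a \<Rightarrow> real) \<Rightarrow> ('a \<Rightarrow> real) \<Rightarrow> 'i filter \<Rightarrow> bool" where
  "L2_tendsto M u f \<F> \<longleftrightarrow> ((\<lambda>i. \<integral>x. (u i x - f x)\<^sup>2 \<partial>M) \<longlongrightarrow> 0) \<F>"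

type_synonym 'a operator_graph = "(('a \<Rightarrow> real) \<times> ('a \<Rightarrow> real)) set"

definition L2_generator :: "'a measure \<Rightarrow> (real \<Rightarrow> ('a \<Rightarrow> real) \<Rightarrow> 'a \<Rightarrow> real) \<Rightarrow> 'a operator_graph" where
  "L2_generator M Q = {(F, G). F \<in> L2 M \<and> G \<in> L2 M \<and>
     L2_tendsto M (\<lambda>h x. (Q h F x - F x) / h) G (at_right 0)}"

definition L2_adjoint :: "'a measure \<Rightarrow> 'a operator_graph \<Rightarrow> 'a operator_graph" where
  "L2_adjoint M A = {(F, G). F \<in> L2 M \<and> G \<in> L2 M \<and>
     (\<forall>(H, K)\<in>A. (\<integral>x. K x * F x \<partial>M) = (\<integral>x. H x * G x \<partial>M))}"

definition L2_closure :: "'a measure \<Rightarrow> 'a operator_graph \<Rightarrow> 'a operator_graph" where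
  "L2_closure M A = {(F, G). F \<in> L2 M \<and> G \<in> L2 M \<and>
     (\<exists>u v. (\<forall>n. (u n, v n) \<in> A) \<and> L2_tendsto M u F sequentially \<and> L2_tendsto M v G sequentially)}"

text \<open>\<open>(A + A\<^sup>*) / 2\<close> with its natural domain \<open>D(A) \<inter> D(A\<^sup>*)\<close>.\<close>

definition symmetric_part :: "'a measure \<Rightarrow> 'a operator_graph \<Rightarrow> 'a operator_graph" where
  "symmetric_part M A =
     {(F, \<lambda>x. (G x + H x) / 2) | F G H. (F, G) \<in> A \<and> (F, H) \<in> L2_adjoint M A}"

text \<open>Adjoint of an everywhere defined bounded operator; it is determined up to \<open>M\<close>-null sets.\<close>

definition adjoint_op ::
  "'a measure \<Rightarrow> (('a \<Rightarrow> real) \<Rightarrow> 'a \<Rightarrow> real) \<Rightarrow> ('a \<Rightarrow> real) \<Rightarrow> 'a \<Rightarrow> real" where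
  "adjoint_op M T f =
     (SOME g. g \<in> L2 M \<and> (\<forall>h\<in>L2 M. (\<integral>x. T h x * f x \<partial>M) = (\<integral>x. h x * g x \<partial>M)))"

definition markov_semigroup_L2 :: "'a measure \<Rightarrow> (real \<Rightarrow> ('a \<Rightarrow> real) \<Rightarrow> 'a \<Rightarrow> real) \<Rightarrow> bool" where
  "markov_semigroup_L2 M Q \<longleftrightarrow>
     (\<forall>t\<ge>0. \<forall>F\<in>L2 M. Q t F \<in> L2 M) \<and>
     (\<forall>t\<ge>0. \<forall>F\<in>L2 M. \<forall>G\<in>L2 M. \<forall>a b.
        AE x in M. Q t (\<lambda>y. a * F y + b * G y) x = a * Q t F x + b * Q t G x) \<and>
     (\<forall>t\<ge>0. \<forall>F\<in>L2 M. (AE x in M. 0 \<le> F x) \<longrightarrow> (AE x in M. 0 \<le> Q t F x)) \<and>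
     (\<forall>t\<ge>0. AE x in M. Q t (\<lambda>_. 1) x = 1) \<and>
     (\<forall>F\<in>L2 M. AE x in M. Q 0 F x = F x) \<and>
     (\<forall>s\<ge>0. \<forall>t\<ge>0. \<forall>F\<in>L2 M. AE x in M. Q (s + t) F x = Q s (Q t F) x) \<and>
     (\<forall>F\<in>L2 M. L2_tendsto M (\<lambda>t. Q t F) F (at_right 0))"

definition stationary_semigroup :: "'a measure \<Rightarrow> (real \<Rightarrow> ('a \<Rightarrow> real) \<Rightarrow> 'a \<Rightarrow> real) \<Rightarrow> bool" where
  "stationary_semigroup M Q \<longleftrightarrow> (\<forall>t\<ge>0. \<forall>F\<in>L2 M. (\<integral>x. Q t F x \<partial>M) = (\<integral>x. F x \<partial>M))"

definition ergodic_semigroup :: "'a measure \<Rightarrow> (real \<Rightarrow> ('a \<Rightarrow> real) \<Rightarrow> 'a \<Rightarrow> real) \<Rightarrow> bool" where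
  "ergodic_semigroup M Q \<longleftrightarrow>
     (\<forall>F\<in>L2 M. (\<forall>t\<ge>0. AE x in M. Q t F x = F x) \<longrightarrow> (\<exists>c. AE x in M. F x = c))"


section \<open>Filtrations and local martingales\<close>

text \<open>
  The \<open>\<sigma>\<close>-field on \<open>space Om\<close> generated by \<open>X\<^sub>u\<close>, \<open>u \<in> I\<close>; thus \<open>\<F>\<^sub>s\<close> is the case
  \<open>I = {0..s}\<close> and \<open>\<G>\<^sub>s\<close> the case \<open>I = {s..}\<close>.
\<close>

definition generated_by ::
  "'w measure \<Rightarrow> (real \<Rightarrow> 'w \<Rightarrow> 'a::euclidean_space) \<Rightarrow> real set \<Rightarrow> 'w measure" where
  "generated_by Om X I = sigma (space Om) {X u -` B \<inter> space Om | u B. u \<in> I \<and> B \<in> sets borel}"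

abbreviation past :: "'w measure \<Rightarrow> (real \<Rightarrow> 'w \<Rightarrow> 'a::euclidean_space) \<Rightarrow> real \<Rightarrow> 'w measure" where
  "past Om X s \<equiv> generated_by Om X {0..s}"

abbreviation future :: "'w measure \<Rightarrow> (real \<Rightarrow> 'w \<Rightarrow> 'a::euclidean_space) \<Rightarrow> real \<Rightarrow> 'w measure" where
  "future Om X s \<equiv> generated_by Om X {s..}"

text \<open>The right-continuous augmentation, with the null sets of \<open>N\<close>, of a filtration \<open>Fl\<close>.\<close>

definition usual_augmentation :: "'w measure \<Rightarrow> (real \<Rightarrow> 'w measure) \<Rightarrow> real \<Rightarrow> 'w measure" where
  "usual_augmentation N Fl t = sigma (space N)
     {A \<in> sets N. \<forall>u>t. \<exists>B\<in>sets (Fl u). (A - B) \<union> (B - A) \<in> null_sets N}"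

definition martingale :: "'w measure \<Rightarrow> (real \<Rightarrow> 'w measure) \<Rightarrow> (real \<Rightarrow> 'w \<Rightarrow> real) \<Rightarrow> bool" where
  "martingale N Fl Z \<longleftrightarrow>
     (\<forall>t\<ge>0. Z t \<in> borel_measurable (Fl t) \<and> integrable N (Z t)) \<and>
     (\<forall>s\<ge>0. \<forall>t\<ge>s. AE \<omega> in N. real_cond_exp N (Fl s) (Z t) \<omega> = Z s \<omega>)"

definition local_martingale :: "'w measure \<Rightarrow> (real \<Rightarrow> 'w measure) \<Rightarrow> (real \<Rightarrow> 'w \<Rightarrow> real) \<Rightarrow> bool" where
  "local_martingale N Fl Z \<longleftrightarrow>
     (\<forall>t\<ge>0. Z t \<in> borel_measurable (Fl t)) \<and>
     (AE \<omega> in N. \<forall>t\<ge>0. continuous (at_right t) (\<lambda>t. Z t \<omega>)) \<and>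
     (\<exists>\<tau> :: nat \<Rightarrow> 'w \<Rightarrow> real.
        (\<forall>n. stopping_time Fl (\<tau> n) \<and> (\<forall>\<omega>\<in>space N. 0 \<le> \<tau> n \<omega>)) \<and>
        (AE \<omega> in N. incseq (\<lambda>n. \<tau> n \<omega>) \<and> filterlim (\<lambda>n. \<tau> n \<omega>) at_top sequentially) \<and>
        (\<forall>n. martingale N Fl (\<lambda>t \<omega>. Z (min t (\<tau> n \<omega>)) \<omega>)))"


section \<open>The diffusion process\<close>

text \<open>
  A Markov process is given by one family of random variables \<open>X t\<close>, \<open>t \<ge> 0\<close>, on \<open>Om\<close> and by the
  family of laws \<open>PP x\<close> (the process started from \<open>x\<close>). The process started from the initial
  distribution \<open>\<nu>\<close> has the law \<open>\<nu> \<bind> PP\<close>.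
\<close>

definition semigroup ::
  "(real \<Rightarrow> 'w \<Rightarrow> 'a) \<Rightarrow> ('a \<Rightarrow> 'w measure) \<Rightarrow> real \<Rightarrow> ('a \<Rightarrow> real) \<Rightarrow> 'a \<Rightarrow> real" where
  "semigroup X PP t F x = (\<integral>\<omega>. F (X t \<omega>) \<partial>PP x)"

text \<open>
  Only real-valued stopping times are considered: applied to \<open>min T n\<close>, the property gives the
  strong Markov property on \<open>{T < \<infinity>}\<close> for a general stopping time.
\<close>

definition strong_markov ::
  "'w measure \<Rightarrow> (real \<Rightarrow> 'w \<Rightarrow> 'a::euclidean_space) \<Rightarrow> ('a \<Rightarrow> 'w measure) \<Rightarrow> bool" where
  "strong_markov Om X PP \<longleftrightarrow>
     (\<forall>x T s h. stopping_time (past Om X) T \<longrightarrow> (\<forall>\<omega>\<in>space Om. 0 \<le> T \<omega>) \<longrightarrow> 0 \<le> s \<longrightarrow>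
        h \<in> borel_measurable borel \<longrightarrow> bounded (range h) \<longrightarrow>
        (AE \<omega> in PP x.
           real_cond_exp (PP x) (filtration.pre_sigma (space Om) (past Om X) T)
             (\<lambda>\<omega>. h (X (T \<omega> + s) \<omega>)) \<omega>
           = semigroup X PP s h (X (T \<omega>) \<omega>)))"

definition invariant_probability ::
  "(real \<Rightarrow> 'w \<Rightarrow> 'a::euclidean_space) \<Rightarrow> ('a \<Rightarrow> 'w measure) \<Rightarrow> 'a measure \<Rightarrow> bool" where
  "invariant_probability X PP \<nu> \<longleftrightarrow>
     prob_space \<nu> \<and> sets \<nu> = sets borel \<and> (\<forall>t\<ge>0. distr (\<nu> \<bind> PP) borel (X t) = \<nu>)"

text \<open>Expected time spent in \<open>A\<close> by the process started from \<open>x\<close>.\<close>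

definition potential ::
  "(real \<Rightarrow> 'w \<Rightarrow> 'a::euclidean_space) \<Rightarrow> ('a \<Rightarrow> 'w measure) \<Rightarrow> 'a \<Rightarrow> 'a set \<Rightarrow> ennreal" where
  "potential X PP x A = (\<integral>\<^sup>+t\<in>{0..}. emeasure (distr (PP x) borel (X t)) A \<partial>lborel)"

text \<open>Irreducibility and positive recurrence are understood in the sense of Meyn and Tweedie.\<close>

definition irreducible_process ::
  "(real \<Rightarrow> 'w \<Rightarrow> 'a::euclidean_space) \<Rightarrow> ('a \<Rightarrow> 'w measure) \<Rightarrow> bool" where
  "irreducible_process X PP \<longleftrightarrow>
     (\<exists>\<phi>. sigma_finite_measure \<phi> \<and> sets \<phi> = sets borel \<and> emeasure \<phi> UNIV \<noteq> 0 \<and>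
        (\<forall>A\<in>sets borel. 0 < emeasure \<phi> A \<longrightarrow> (\<forall>x. 0 < potential X PP x A)))"

definition positive_recurrent ::
  "(real \<Rightarrow> 'w \<Rightarrow> 'a::euclidean_space) \<Rightarrow> ('a \<Rightarrow> 'w measure) \<Rightarrow> bool" where
  "positive_recurrent X PP \<longleftrightarrow>
     (\<exists>\<nu>. invariant_probability X PP \<nu> \<and>
        (\<forall>A\<in>sets borel. 0 < emeasure \<nu> A \<longrightarrow> (\<forall>x. potential X PP x A = \<infinity>)))"

text \<open>
  \<open>(F, G)\<close> belongs to the extended generator if, for every starting point,
  \<open>F(X\<^sub>t) - F(X\<^sub>0) - \<integral>\<^sub>0\<^sup>t G(X\<^sub>s) ds\<close> is a local martingale.
\<close>

definition extended_generator ::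
  "'w measure \<Rightarrow> (real \<Rightarrow> 'w \<Rightarrow> 'a::euclidean_space) \<Rightarrow> ('a \<Rightarrow> 'w measure) \<Rightarrow> 'a operator_graph" where
  "extended_generator Om X PP =
     {(F, G). F \<in> borel_measurable borel \<and> G \<in> borel_measurable borel \<and>
        (\<forall>x. (AE \<omega> in PP x. \<forall>t\<ge>0. set_integrable lborel {0..t} (\<lambda>s. G (X s \<omega>))) \<and>
             local_martingale (PP x) (usual_augmentation (PP x) (past Om X))
               (\<lambda>t \<omega>. F (X t \<omega>) - F (X 0 \<omega>) - (LINT s:{0..t}|lborel. G (X s \<omega>))))}"

text \<open>
  The topology on the extended generator for which a core is a dense subset: uniform convergence on
  compact time intervals in \<open>N\<close>-probability of \<open>F\<^sub>n(X)\<close> to \<open>F(X)\<close>, together with convergence in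
  \<open>N\<close>-probability of \<open>\<integral>\<^sub>0\<^sup>T |G\<^sub>n - G|(X\<^sub>s) ds\<close> to \<open>0\<close>. The associated local martingales then converge
  uniformly on compact time intervals in probability. The exceptional events \<open>A n\<close> are explicit because
  the supremum over \<open>{0..T}\<close> need not be measurable.
\<close>

definition ucp_graph_tendsto ::
  "'w measure \<Rightarrow> (real \<Rightarrow> 'w \<Rightarrow> 'a) \<Rightarrow> (nat \<Rightarrow> 'a \<Rightarrow> real) \<Rightarrow> (nat \<Rightarrow> 'a \<Rightarrow> real)
     \<Rightarrow> ('a \<Rightarrow> real) \<Rightarrow> ('a \<Rightarrow> real) \<Rightarrow> bool" where
  "ucp_graph_tendsto N X Fn Gn F G \<longleftrightarrow>
     (\<forall>T\<ge>0. \<forall>\<epsilon>>0. \<exists>A :: nat \<Rightarrow> 'w set. range A \<subseteq> sets N \<and> (\<lambda>n. measure N (A n)) \<longlonglongrightarrow> 0 \<and>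
        (\<forall>n. \<forall>\<omega>\<in>space N - A n.
           (\<forall>t\<in>{0..T}. \<bar>Fn n (X t \<omega>) - F (X t \<omega>)\<bar> \<le> \<epsilon>) \<and>
           (\<integral>\<^sup>+s\<in>{0..T}. ennreal \<bar>Gn n (X s \<omega>) - G (X s \<omega>)\<bar> \<partial>lborel) \<le> ennreal \<epsilon>))"

definition core_of_extended_generator ::
  "'w measure \<Rightarrow> (real \<Rightarrow> 'w \<Rightarrow> 'a::euclidean_space) \<Rightarrow> ('a \<Rightarrow> 'w measure) \<Rightarrow> 'a measure
     \<Rightarrow> ('a \<Rightarrow> real) set \<Rightarrow> bool" where
  "core_of_extended_generator Om X PP mu \<A> \<longleftrightarrow>
     (\<forall>F\<in>\<A>. \<exists>G. (F, G) \<in> extended_generator Om X PP) \<and>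
     (\<forall>(F, G)\<in>extended_generator Om X PP. \<exists>Fn Gn.
        (\<forall>n. Fn n \<in> \<A> \<and> (Fn n, Gn n) \<in> extended_generator Om X PP) \<and>
        ucp_graph_tendsto (mu \<bind> PP) X Fn Gn F G)"

definition bounded_uc_algebra :: "('a::euclidean_space \<Rightarrow> real) set \<Rightarrow> bool" where
  "bounded_uc_algebra \<A> \<longleftrightarrow>
     (\<forall>F\<in>\<A>. uniformly_continuous_on UNIV F \<and> bounded (range F)) \<and>
     (\<forall>c. (\<lambda>_. c) \<in> \<A>) \<and>
     (\<forall>F\<in>\<A>. \<forall>G\<in>\<A>. (\<lambda>x. F x + G x) \<in> \<A> \<and> (\<lambda>x. F x * G x) \<in> \<A>)"

text \<open>
  Non-explosion is part of the setting: \<open>X t\<close> takes values in the state space for all \<open>t \<ge> 0\<close>.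
\<close>

locale ergodic_diffusion =
  fixes Om :: "'w measure"
    and X :: "real \<Rightarrow> 'w \<Rightarrow> 'a::euclidean_space"
    and PP :: "'a \<Rightarrow> 'w measure"
    and mu :: "'a measure"
  assumes X_measurable: "0 \<le> t \<Longrightarrow> X t \<in> measurable Om borel"
    and PP_kernel: "PP \<in> measurable borel (prob_algebra Om)"
    and initial_point: "AE \<omega> in PP x. X 0 \<omega> = x"
    and continuous_paths: "\<omega> \<in> space Om \<Longrightarrow> continuous_on {0..} (\<lambda>t. X t \<omega>)"
    and strong_markov: "strong_markov Om X PP"
    and irreducible: "irreducible_process X PP"
    and positive_recurrent: "positive_recurrent X PP"
    and invariant: "invariant_probability X PP mu"
    and invariant_unique: "invariant_probability X PP \<nu> \<Longrightarrow> \<nu> = mu"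
    and core: "\<exists>\<A>. bounded_uc_algebra \<A> \<and> core_of_extended_generator Om X PP mu \<A>"

abbreviation generator ::
  "(real \<Rightarrow> 'w \<Rightarrow> 'a) \<Rightarrow> ('a \<Rightarrow> 'w measure) \<Rightarrow> 'a measure \<Rightarrow> 'a operator_graph" where
  "generator X PP mu \<equiv> L2_generator mu (semigroup X PP)"

definition ergodic_symmetrization ::
  "(real \<Rightarrow> 'w \<Rightarrow> 'a) \<Rightarrow> ('a \<Rightarrow> 'w measure) \<Rightarrow> 'a measure \<Rightarrow> bool" where
  "ergodic_symmetrization X PP mu \<longleftrightarrow>
     (\<exists>PS. markov_semigroup_L2 mu PS \<and> stationary_semigroup mu PS \<and> ergodic_semigroup mu PS \<and>
        L2_generator mu PS = L2_closure mu (symmetric_part mu (generator X PP mu)))"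


section \<open>The Dirichlet form\<close>

text \<open>
  On \<open>D(L)\<close> the form is \<open>\<E>(F,F) = -2 \<integral> F LF d\<mu>\<close>; this is \<open>\<integral> \<Gamma>(F) d\<mu>\<close>, because \<open>\<integral> L(F\<^sup>2) d\<mu> = 0\<close> by
  invariance. The general domain is the completion of \<open>D(L)\<close>: the limits in \<open>L\<^sup>2(\<mu>)\<close> of \<open>\<E>\<close>-Cauchy
  sequences in \<open>D(L)\<close>, with \<open>\<E>(F,F)\<close> the limit of the values along the sequence. For a closable form
  this limit does not depend on the sequence; the infimum makes the definition meaningful
  without proving closability first.
\<close>

definition generator_fun ::
  "(real \<Rightarrow> 'w \<Rightarrow> 'a) \<Rightarrow> ('a \<Rightarrow> 'w measure) \<Rightarrow> 'a measure \<Rightarrow> ('a \<Rightarrow> real) \<Rightarrow> 'a \<Rightarrow> real" where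
  "generator_fun X PP mu F = (SOME G. (F, G) \<in> generator X PP mu)"

definition pre_dirichlet_form ::
  "(real \<Rightarrow> 'w \<Rightarrow> 'a) \<Rightarrow> ('a \<Rightarrow> 'w measure) \<Rightarrow> 'a measure \<Rightarrow> ('a \<Rightarrow> real) \<Rightarrow> real" where
  "pre_dirichlet_form X PP mu F = - 2 * (\<integral>x. F x * generator_fun X PP mu F x \<partial>mu)"

definition dirichlet_approx ::
  "(real \<Rightarrow> 'w \<Rightarrow> 'a) \<Rightarrow> ('a \<Rightarrow> 'w measure) \<Rightarrow> 'a measure \<Rightarrow> ('a \<Rightarrow> real) \<Rightarrow> (nat \<Rightarrow> 'a \<Rightarrow> real) \<Rightarrow> bool"
where
  "dirichlet_approx X PP mu F u \<longleftrightarrow>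
     (\<forall>n. u n \<in> Domain (generator X PP mu)) \<and>
     L2_tendsto mu u F sequentially \<and>
     (\<forall>\<epsilon>>0. \<exists>N. \<forall>m\<ge>N. \<forall>n\<ge>N. pre_dirichlet_form X PP mu (\<lambda>x. u m x - u n x) < \<epsilon>)"

definition dirichlet_domain ::
  "(real \<Rightarrow> 'w \<Rightarrow> 'a) \<Rightarrow> ('a \<Rightarrow> 'w measure) \<Rightarrow> 'a measure \<Rightarrow> ('a \<Rightarrow> real) set" where
  "dirichlet_domain X PP mu = {F \<in> L2 mu. \<exists>u. dirichlet_approx X PP mu F u}"

definition dirichlet_form ::
  "(real \<Rightarrow> 'w \<Rightarrow> 'a) \<Rightarrow> ('a \<Rightarrow> 'w measure) \<Rightarrow> 'a measure \<Rightarrow> ('a \<Rightarrow> real) \<Rightarrow> real" where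
  "dirichlet_form X PP mu F =
     Inf {e. \<exists>u. dirichlet_approx X PP mu F u \<and> (\<lambda>n. pre_dirichlet_form X PP mu (u n)) \<longlonglongrightarrow> e}"


section \<open>Strong mixing\<close>

definition covariance :: "'w measure \<Rightarrow> ('w \<Rightarrow> real) \<Rightarrow> ('w \<Rightarrow> real) \<Rightarrow> real" where
  "covariance N F G = (\<integral>\<omega>. F \<omega> * G \<omega> \<partial>N) - (\<integral>\<omega>. F \<omega> \<partial>N) * (\<integral>\<omega>. G \<omega> \<partial>N)"

definition alpha_mix ::
  "'w measure \<Rightarrow> (real \<Rightarrow> 'w \<Rightarrow> 'a::euclidean_space) \<Rightarrow> ('a \<Rightarrow> 'w measure) \<Rightarrow> 'a measure
     \<Rightarrow> real \<Rightarrow> real" where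
  "alpha_mix Om X PP mu r =
     Sup {\<bar>covariance (mu \<bind> PP) F G\<bar> | s F G. 0 \<le> s \<and>
       F \<in> borel_measurable (past Om X s) \<and> G \<in> borel_measurable (future Om X (s + r)) \<and>
       (\<forall>\<omega>\<in>space Om. 0 \<le> F \<omega> \<and> F \<omega> \<le> 1) \<and> (\<forall>\<omega>\<in>space Om. 0 \<le> G \<omega> \<and> G \<omega> \<le> 1)}"

definition strongly_mixing ::
  "'w measure \<Rightarrow> (real \<Rightarrow> 'w \<Rightarrow> 'a::euclidean_space) \<Rightarrow> ('a \<Rightarrow> 'w measure) \<Rightarrow> 'a measure \<Rightarrow> bool" where
  "strongly_mixing Om X PP mu \<longleftrightarrow> (alpha_mix Om X PP mu \<longlongrightarrow> 0) at_top"


section \<open>The additive functional\<close>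

definition additive_functional ::
  "(real \<Rightarrow> 'w \<Rightarrow> 'a) \<Rightarrow> ('a \<Rightarrow> real) \<Rightarrow> real \<Rightarrow> 'w \<Rightarrow> real" where
  "additive_functional X f t \<omega> = (LINT s:{0..t}|lborel. f (X s \<omega>))"

definition variance_functional ::
  "(real \<Rightarrow> 'w \<Rightarrow> 'a) \<Rightarrow> ('a \<Rightarrow> 'w measure) \<Rightarrow> 'a measure \<Rightarrow> ('a \<Rightarrow> real) \<Rightarrow> real \<Rightarrow> real" where
  "variance_functional X PP mu f t = prob_space.variance (mu \<bind> PP) (additive_functional X f t)"

definition beta_fun ::
  "(real \<Rightarrow> 'w \<Rightarrow> 'a) \<Rightarrow> ('a \<Rightarrow> 'w measure) \<Rightarrow> 'a measure \<Rightarrow> ('a \<Rightarrow> real) \<Rightarrow> real \<Rightarrow> real" where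
  "beta_fun X PP mu f s =
     (\<integral>x. semigroup X PP s f x * adjoint_op mu (semigroup X PP s) f x \<partial>mu)"

definition V_minus ::
  "(real \<Rightarrow> 'w \<Rightarrow> 'a) \<Rightarrow> ('a \<Rightarrow> 'w measure) \<Rightarrow> 'a measure \<Rightarrow> ('a \<Rightarrow> real) \<Rightarrow> ereal" where
  "V_minus X PP mu f =
     Liminf at_top (\<lambda>t. ereal (LINT s:{0..t}|lborel. beta_fun X PP mu f s))"

definition Hpos ::
  "(real \<Rightarrow> 'w \<Rightarrow> 'a) \<Rightarrow> ('a \<Rightarrow> 'w measure) \<Rightarrow> 'a measure \<Rightarrow> ('a \<Rightarrow> real) \<Rightarrow> bool" where
  "Hpos X PP mu f \<longleftrightarrow> (\<forall>\<^sub>F s in at_top. 0 \<le> beta_fun X PP mu f s)"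

text \<open>Convergence in distribution as \<open>t \<rightarrow> \<infinity>\<close>: the continuous-time version of \<^const>\<open>weak_conv_m\<close>.\<close>

definition weak_conv_at_top :: "(real \<Rightarrow> real measure) \<Rightarrow> real measure \<Rightarrow> bool" where
  "weak_conv_at_top \<nu> \<nu>' \<longleftrightarrow>
     (\<forall>x. isCont (cdf \<nu>') x \<longrightarrow> ((\<lambda>t. cdf (\<nu> t) x) \<longlongrightarrow> cdf \<nu>' x) at_top)"

end

theory Submission
  imports Defs
begin

text \<open>
  Let \<open>L\<close> be the generator of the semigroup \<open>P\<close> in \<open>L\<^sup>2(\<mu>)\<close>, \<open>q(F) = - \<langle>F, L F\<rangle>\<close>, and let \<open>S\<^sub>t(h)\<close>
  be the integral of \<open>h(X\<^sub>s)\<close> over \<open>0 \<le> s \<le> t\<close>. The inequality assumed for \<open>f\<close> says that \<open>f\<close> lies in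
  the dual of the Dirichlet space: \<open>\<langle>f, F\<rangle>\<^sup>2 \<le> c\<^sup>2 q(F)\<close> on the domain of \<open>L\<close>. The proof rests on
  three facts.

  \<^item> \<^emph>\<open>The squares \<open>S\<^sub>t(f)\<^sup>2 / t\<close> are uniformly integrable\<close> (\<open>square_uniformly_integrable\<close>). For
    every \<open>\<epsilon> > 0\<close> there is \<open>v\<close> in the domains of \<open>L\<close> and of \<open>L\<^sup>*\<close> such that
    \<open>r = f + (L v + L\<^sup>* v) / 2\<close> satisfies \<open>\<langle>r, F\<rangle>\<^sup>2 \<le> \<epsilon> q(F)\<close> (\<open>H_minus_one_approximation\<close>): \<open>v\<close>
    almost minimises \<open>q(v) - 2 \<langle>f, v\<rangle>\<close>, and the bound passes from the common domain to all of the
    domain of \<open>L\<close> because the closure of \<open>(L + L\<^sup>*) / 2\<close> generates a semigroup. A function with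
    small dual norm has small variance, \<open>E S\<^sub>t(r)\<^sup>2 \<le> 8 e \<epsilon> t\<close> (\<open>moment_upper_bound\<close>), because the
    Laplace transform of the variance is a resolvent form of \<open>r\<close>. The rest is a sum of martingales:
    \<open>v(X\<^sub>t) - v(X\<^sub>0) - S\<^sub>t(L v)\<close> is a martingale for the past, \<open>v(X\<^sub>0) - v(X\<^sub>t) - S\<^sub>t(L\<^sup>* v)\<close> one
    for the reversed filtration of the future, and in their sum the boundary terms cancel, so that
    \<open>S\<^sub>t(f) = S\<^sub>t(r) + (M\<^sub>t + M\<^sup>*\<^sub>t) / 2\<close>. Martingales with bounded increments have fourth moments
    of order \<open>t\<^sup>2\<close>, and general increments are bounded up to a small error in \<open>L\<^sup>2\<close>.

  \<^item> \<^emph>\<open>The variance grows linearly\<close> (\<open>moment_upper_bound\<close>, \<open>moment_lower_bound\<close>). The second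
    derivative of \<open>E S\<^sub>t(f)\<^sup>2\<close> is twice the correlation \<open>\<langle>P\<^sub>t f, f\<rangle>\<close>, and \<open>\<beta>(s) = \<langle>P\<^bsub>2s\<^esub> f, f\<rangle>\<close>. The
    condition on the lower limit is itself the linear lower bound, and \<open>V\<^sub>- > 0\<close> gives it by
    integration. Under \<open>(Hpos)\<close> the integral of the correlation is eventually monotone, so either it
    is eventually bounded below by a positive constant, or \<open>E S\<^sub>t(f)\<^sup>2\<close> is bounded. In the latter
    case \<open>L g = - f\<close> has a solution with \<open>q(g) = 0\<close>; then \<open>g\<close> is in the kernel of \<open>(L + L\<^sup>*) / 2\<close>,
    hence constant by ergodicity, and \<open>f = 0\<close>.

  \<^item> \<^emph>\<open>Mixing sequences with these two properties satisfy the central limit theorem\<close>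
    (\<open>cf_tendsto_normal\<close>). Bernstein's method cuts \<open>{0..<n}\<close> into a fixed number \<open>k\<close> of long blocks
    separated by gaps of a fixed length. Mixing makes the blocks nearly independent, and by uniform
    integrability nearly uncorrelated, so the variance of the whole is close to \<open>k\<close> times the
    variance of a block. This replaces convergence of \<open>Var S\<^sub>t(f) / t\<close>, which is not known in
    general. The error is small when first \<open>n\<close> and then \<open>k\<close> is large.

  The theorem is the third fact for the integrals over unit intervals; the integral over the
  remaining part of a unit interval is bounded in \<open>L\<^sup>2\<close>.
\<close>

section \<open>Inner product and norm of square integrable functions\<close>

definition l2_inner :: "'a measure \<Rightarrow> ('a \<Rightarrow> real) \<Rightarrow> ('a \<Rightarrow> real) \<Rightarrow> real" where
  "l2_inner M F G = (\<integral>x. F x * G x \<partial>M)"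

definition l2_norm :: "'a measure \<Rightarrow> ('a \<Rightarrow> real) \<Rightarrow> real" where
  "l2_norm M F = sqrt (l2_inner M F F)"

lemma L2_measurable: "F \<in> L2 M \<Longrightarrow> F \<in> borel_measurable M"
  by (simp add: L2_def)

lemma L2_sq_integrable: "F \<in> L2 M \<Longrightarrow> integrable M (\<lambda>x. (F x)\<^sup>2)"
  by (simp add: L2_def)

lemma L2_mult_integrable:
  assumes "F \<in> L2 M" "G \<in> L2 M"
  shows "integrable M (\<lambda>x. F x * G x)"
proof (rule Bochner_Integration.integrable_bound)
  show "integrable M (\<lambda>x. (F x)\<^sup>2 + (G x)\<^sup>2)"
    using assms by (intro Bochner_Integration.integrable_add L2_sq_integrable)
  have [measurable]: "F \<in> borel_measurable M" "G \<in> borel_measurable M"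
    using assms by (auto simp: L2_def)
  show "(\<lambda>x. F x * G x) \<in> borel_measurable M" by measurable
  have "\<bar>a * b\<bar> \<le> a\<^sup>2 + b\<^sup>2" for a b :: real
  proof -
    have "2 * (\<bar>a\<bar> * \<bar>b\<bar>) \<le> a\<^sup>2 + b\<^sup>2"
      using sum_squares_bound[of "\<bar>a\<bar>" "\<bar>b\<bar>"] by (simp add: mult.assoc)
    moreover have "0 \<le> \<bar>a\<bar> * \<bar>b\<bar>" by simp
    ultimately show ?thesis unfolding abs_mult by linarith
  qed
  then show "AE x in M. norm (F x * G x) \<le> norm ((F x)\<^sup>2 + (G x)\<^sup>2)" by simp
qed

lemma L2_lincomb:
  assumes "F \<in> L2 M" "G \<in> L2 M"
  shows "(\<lambda>x. a * F x + b * G x) \<in> L2 M"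
proof -
  have [measurable]: "F \<in> borel_measurable M" "G \<in> borel_measurable M"
    using assms by (auto simp: L2_def)
  have "integrable M (\<lambda>x. a\<^sup>2 * (F x)\<^sup>2 + b\<^sup>2 * (G x)\<^sup>2 + 2 * a * b * (F x * G x))"
    using assms
    by (intro Bochner_Integration.integrable_add integrable_mult_right L2_sq_integrable L2_mult_integrable)
  moreover have "(a * F x + b * G x)\<^sup>2 = a\<^sup>2 * (F x)\<^sup>2 + b\<^sup>2 * (G x)\<^sup>2 + 2 * a * b * (F x * G x)" for x
    by (simp add: power2_eq_square algebra_simps)
  ultimately show ?thesis by (simp add: L2_def)
qed

lemma L2_add: "F \<in> L2 M \<Longrightarrow> G \<in> L2 M \<Longrightarrow> (\<lambda>x. F x + G x) \<in> L2 M"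
  using L2_lincomb[of F M G 1 1] by simp
lemma L2_diff: "F \<in> L2 M \<Longrightarrow> G \<in> L2 M \<Longrightarrow> (\<lambda>x. F x - G x) \<in> L2 M"
  using L2_lincomb[of F M G 1 "-1"] by simp
lemma L2_cmult: "F \<in> L2 M \<Longrightarrow> (\<lambda>x. a * F x) \<in> L2 M"
  using L2_lincomb[of F M F a 0] by simp
lemma L2_uminus: "F \<in> L2 M \<Longrightarrow> (\<lambda>x. - F x) \<in> L2 M"
  using L2_cmult[of F M "-1"] by simp
lemma L2_divide: "F \<in> L2 M \<Longrightarrow> (\<lambda>x. F x / a) \<in> L2 M"
  using L2_cmult[of F M "1/a"] by simp
lemma L2_zero: "(\<lambda>x. 0) \<in> L2 M"
  by (simp add: L2_def)
lemma L2_sum: "(\<And>i. i \<in> I \<Longrightarrow> F i \<in> L2 M) \<Longrightarrow> (\<lambda>x. \<Sum>i\<in>I. F i x) \<in> L2 M"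
  by (induction I rule: infinite_finite_induct) (auto simp: L2_zero intro!: L2_add)

lemmas L2_closed = L2_add L2_diff L2_cmult L2_uminus L2_divide L2_zero L2_sum

lemma (in finite_measure) L2_bounded:
  assumes "F \<in> borel_measurable M" "\<And>x. x \<in> space M \<Longrightarrow> \<bar>F x\<bar> \<le> K"
  shows "F \<in> L2 M"
proof -
  have [measurable]: "F \<in> borel_measurable M" by fact
  have "integrable M (\<lambda>x. (F x)\<^sup>2)"
  proof (rule integrable_const_bound[where B="K\<^sup>2"])
    show "AE x in M. norm ((F x)\<^sup>2) \<le> K\<^sup>2"
      using power_mono[OF assms(2) abs_ge_zero, of _ 2] by (intro AE_I2) simp
  qed measurable
  then show ?thesis by (simp add: L2_def)
qed

lemma (in finite_measure) L2_const: "(\<lambda>x. c) \<in> L2 M"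
  by (rule L2_bounded[of _ "\<bar>c\<bar>"]) auto

lemma (in finite_measure) L2_integrable:
  assumes "F \<in> L2 M" shows "integrable M F"
  using L2_mult_integrable[OF assms L2_const[of 1]] by simp

lemma l2_inner_commute: "l2_inner M F G = l2_inner M G F"
  by (simp add: l2_inner_def mult.commute)

lemma l2_inner_lincomb_left:
  assumes "F \<in> L2 M" "G \<in> L2 M" "H \<in> L2 M"
  shows "l2_inner M (\<lambda>x. a * F x + b * G x) H = a * l2_inner M F H + b * l2_inner M G H"
proof -
  have "l2_inner M (\<lambda>x. a * F x + b * G x) H = (\<integral>x. a * (F x * H x) + b * (G x * H x) \<partial>M)"
    unfolding l2_inner_def by (rule Bochner_Integration.integral_cong) (auto simp: algebra_simps)
  also have "\<dots> = a * l2_inner M F H + b * l2_inner M G H"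
    unfolding l2_inner_def using assms by (simp add: L2_mult_integrable)
  finally show ?thesis .
qed

lemma l2_inner_lincomb_right:
  assumes "F \<in> L2 M" "G \<in> L2 M" "H \<in> L2 M"
  shows "l2_inner M H (\<lambda>x. a * F x + b * G x) = a * l2_inner M H F + b * l2_inner M H G"
  using l2_inner_lincomb_left[OF assms] by (simp add: l2_inner_commute)

lemma l2_inner_add_left: "F \<in> L2 M \<Longrightarrow> G \<in> L2 M \<Longrightarrow> H \<in> L2 M \<Longrightarrow>
    l2_inner M (\<lambda>x. F x + G x) H = l2_inner M F H + l2_inner M G H"
  using l2_inner_lincomb_left[of F M G H 1 1] by simp
lemma l2_inner_add_right: "F \<in> L2 M \<Longrightarrow> G \<in> L2 M \<Longrightarrow> H \<in> L2 M \<Longrightarrow>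
    l2_inner M H (\<lambda>x. F x + G x) = l2_inner M H F + l2_inner M H G"
  using l2_inner_lincomb_right[of F M G H 1 1] by simp
lemma l2_inner_diff_left: "F \<in> L2 M \<Longrightarrow> G \<in> L2 M \<Longrightarrow> H \<in> L2 M \<Longrightarrow>
    l2_inner M (\<lambda>x. F x - G x) H = l2_inner M F H - l2_inner M G H"
  using l2_inner_lincomb_left[of F M G H 1 "-1"] by simp
lemma l2_inner_diff_right: "F \<in> L2 M \<Longrightarrow> G \<in> L2 M \<Longrightarrow> H \<in> L2 M \<Longrightarrow>
    l2_inner M H (\<lambda>x. F x - G x) = l2_inner M H F - l2_inner M H G"
  using l2_inner_lincomb_right[of F M G H 1 "-1"] by simp
lemma l2_inner_cmult_left: "l2_inner M (\<lambda>x. a * F x) H = a * l2_inner M F H"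
  by (simp add: l2_inner_def mult.assoc)
lemma l2_inner_cmult_right: "l2_inner M H (\<lambda>x. a * F x) = a * l2_inner M H F"
  by (simp add: l2_inner_def mult.left_commute)
lemma l2_inner_uminus_left: "l2_inner M (\<lambda>x. - F x) H = - l2_inner M F H"
  by (simp add: l2_inner_def)
lemma l2_inner_uminus_right: "l2_inner M H (\<lambda>x. - F x) = - l2_inner M H F"
  by (simp add: l2_inner_def)
lemma l2_inner_zero_left: "l2_inner M (\<lambda>x. 0) H = 0"
  by (simp add: l2_inner_def)
lemma l2_inner_zero_right: "l2_inner M H (\<lambda>x. 0) = 0"
  by (simp add: l2_inner_def)
lemma l2_inner_divide_left: "l2_inner M (\<lambda>x. F x / a) H = l2_inner M F H / a"
  by (simp add: l2_inner_def)
lemma l2_inner_divide_right: "l2_inner M H (\<lambda>x. F x / a) = l2_inner M H F / a"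
  by (simp add: l2_inner_def)

lemmas l2_inner_simps = l2_inner_add_left l2_inner_add_right l2_inner_diff_left l2_inner_diff_right
  l2_inner_cmult_left l2_inner_cmult_right l2_inner_uminus_left l2_inner_uminus_right
  l2_inner_zero_left l2_inner_zero_right l2_inner_divide_left l2_inner_divide_right

lemma l2_inner_nonneg: "0 \<le> l2_inner M F F"
  by (simp add: l2_inner_def integral_nonneg)

lemma l2_inner_cong_AE:
  assumes "AE x in M. F x = F' x" "AE x in M. G x = G' x"
    and "F \<in> borel_measurable M" "F' \<in> borel_measurable M" "G \<in> borel_measurable M" "G' \<in> borel_measurable M"
  shows "l2_inner M F G = l2_inner M F' G'"
  unfolding l2_inner_def using assms by (intro integral_cong_AE) auto

lemma l2_norm_nonneg: "0 \<le> l2_norm M F"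
  by (simp add: l2_norm_def l2_inner_nonneg)
lemma l2_norm_sq: "(l2_norm M F)\<^sup>2 = l2_inner M F F"
  by (simp add: l2_norm_def l2_inner_nonneg)
lemma l2_norm_sq': "(l2_norm M F)\<^sup>2 = (\<integral>x. (F x)\<^sup>2 \<partial>M)"
  unfolding l2_norm_sq by (simp add: l2_inner_def power2_eq_square)
lemma l2_norm_zero: "l2_norm M (\<lambda>x. 0) = 0"
  by (simp add: l2_norm_def l2_inner_def)
lemma l2_norm_cmult: "l2_norm M (\<lambda>x. a * F x) = \<bar>a\<bar> * l2_norm M F"
proof -
  have "l2_inner M (\<lambda>x. a * F x) (\<lambda>x. a * F x) = a\<^sup>2 * l2_inner M F F"
    by (simp add: l2_inner_cmult_left l2_inner_cmult_right power2_eq_square)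
  then show ?thesis by (simp add: l2_norm_def real_sqrt_mult)
qed
lemma l2_norm_divide: "l2_norm M (\<lambda>x. F x / a) = l2_norm M F / \<bar>a\<bar>"
  using l2_norm_cmult[of M "1/a" F] by simp
lemma l2_norm_uminus: "l2_norm M (\<lambda>x. - F x) = l2_norm M F"
  using l2_norm_cmult[of M "-1" F] by simp
lemma l2_norm_minus_commute: "l2_norm M (\<lambda>x. F x - G x) = l2_norm M (\<lambda>x. G x - F x)"
  using l2_norm_uminus[of M "\<lambda>x. G x - F x"] by simp

text \<open>
  The common source of all inequalities of Cauchy-Schwarz type below, including those for forms that
  are not symmetric.
\<close>

lemma quadratic_nonneg_imp_discriminant:
  fixes b d e :: real
  assumes b: "0 \<le> b" and q: "\<And>s. 0 \<le> s\<^sup>2 * b - 2 * s * d + e"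
  shows "d\<^sup>2 \<le> e * b"
proof (cases "b = 0")
  case True
  have "d = 0"
  proof (rule ccontr)
    assume "d \<noteq> 0"
    then have "0 \<le> - 2 * ((e + 1) / (2 * d)) * d + e" using q[of "(e + 1) / (2 * d)"] True by simp
    then show False using \<open>d \<noteq> 0\<close> by (simp add: field_simps)
  qed
  then show ?thesis using True by simp
next
  case False
  then have "b > 0" using b by simp
  have "0 \<le> (d / b)\<^sup>2 * b - 2 * (d / b) * d + e" by (rule q)
  then have "0 \<le> ((d / b)\<^sup>2 * b - 2 * (d / b) * d + e) * b" using \<open>b > 0\<close> by simp
  also have "\<dots> = e * b - d\<^sup>2" using \<open>b > 0\<close> by (simp add: field_simps power2_eq_square)
  finally show ?thesis by simp
qed

lemma l2_inner_sq_le: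
  assumes "F \<in> L2 M" "G \<in> L2 M"
  shows "(l2_inner M F G)\<^sup>2 \<le> l2_inner M F F * l2_inner M G G"
proof (rule quadratic_nonneg_imp_discriminant[OF l2_inner_nonneg])
  fix s
  have "0 \<le> l2_inner M (\<lambda>x. F x - s * G x) (\<lambda>x. F x - s * G x)" by (rule l2_inner_nonneg)
  also have "\<dots> = s\<^sup>2 * l2_inner M G G - 2 * s * l2_inner M F G + l2_inner M F F"
    using assms by (simp add: l2_inner_simps L2_closed l2_inner_commute[of M G F] power2_eq_square algebra_simps)
  finally show "0 \<le> \<dots>" .
qed

lemma l2_Cauchy_Schwarz:
  assumes "F \<in> L2 M" "G \<in> L2 M"
  shows "\<bar>l2_inner M F G\<bar> \<le> l2_norm M F * l2_norm M G"
  using real_sqrt_le_mono[OF l2_inner_sq_le[OF assms]]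
  by (simp add: l2_norm_def real_sqrt_mult)

lemma l2_norm_triangle:
  assumes "F \<in> L2 M" "G \<in> L2 M"
  shows "l2_norm M (\<lambda>x. F x + G x) \<le> l2_norm M F + l2_norm M G"
proof (rule power2_le_imp_le)
  have "(l2_norm M (\<lambda>x. F x + G x))\<^sup>2 = l2_inner M F F + 2 * l2_inner M F G + l2_inner M G G"
    unfolding l2_norm_sq using assms by (simp add: l2_inner_simps L2_closed l2_inner_commute[of M G F])
  also have "\<dots> \<le> (l2_norm M F + l2_norm M G)\<^sup>2"
    using l2_Cauchy_Schwarz[OF assms] by (simp add: power2_sum l2_norm_sq)
  finally show "(l2_norm M (\<lambda>x. F x + G x))\<^sup>2 \<le> (l2_norm M F + l2_norm M G)\<^sup>2" .
qed (simp add: l2_norm_nonneg)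

lemma l2_norm_triangle_diff:
  assumes "F \<in> L2 M" "G \<in> L2 M"
  shows "l2_norm M (\<lambda>x. F x - G x) \<le> l2_norm M F + l2_norm M G"
  using l2_norm_triangle[OF assms(1) L2_uminus[OF assms(2)]] by (simp add: l2_norm_uminus)

lemma l2_norm_triangle_via:
  assumes "F \<in> L2 M" "G \<in> L2 M" "H \<in> L2 M"
  shows "l2_norm M (\<lambda>x. F x - H x) \<le> l2_norm M (\<lambda>x. F x - G x) + l2_norm M (\<lambda>x. G x - H x)"
  using l2_norm_triangle[OF L2_diff[OF assms(1,2)] L2_diff[OF assms(2,3)]] by simp

lemma l2_norm_diff_ineq:
  assumes "F \<in> L2 M" "G \<in> L2 M"
  shows "\<bar>l2_norm M F - l2_norm M G\<bar> \<le> l2_norm M (\<lambda>x. F x - G x)"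
  using l2_norm_triangle[OF L2_diff[OF assms] assms(2)]
    l2_norm_triangle[OF L2_diff[OF assms(2,1)] assms(1)] l2_norm_minus_commute[of M F G] by simp

lemma l2_norm_sum:
  assumes "\<And>i. i \<in> I \<Longrightarrow> F i \<in> L2 M"
  shows "l2_norm M (\<lambda>x. \<Sum>i\<in>I. F i x) \<le> (\<Sum>i\<in>I. l2_norm M (F i))"
  using assms
proof (induction I rule: infinite_finite_induct)
  case (insert i I)
  then have "l2_norm M (\<lambda>x. F i x + (\<Sum>i\<in>I. F i x)) \<le> l2_norm M (F i) + l2_norm M (\<lambda>x. \<Sum>i\<in>I. F i x)"
    by (intro l2_norm_triangle L2_closed) auto
  with insert show ?case by fastforce
qed (auto simp: l2_norm_zero)

lemma l2_norm_cong_AE: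
  assumes "AE x in M. F x = G x" "F \<in> borel_measurable M" "G \<in> borel_measurable M"
  shows "l2_norm M F = l2_norm M G"
  unfolding l2_norm_def using assms by (simp add: l2_inner_cong_AE[of F G M F G])

lemma l2_norm_eq_0_AE:
  assumes "F \<in> L2 M" "l2_norm M F = 0"
  shows "AE x in M. F x = 0"
proof -
  have "(\<integral>x. (F x)\<^sup>2 \<partial>M) = 0" using assms(2) l2_norm_sq'[of M F] by simp
  then show ?thesis
    using integral_nonneg_eq_0_iff_AE[OF L2_sq_integrable[OF assms(1)]] by simp
qed

lemma (in prob_space) abs_integral_le_l2_norm:
  assumes "F \<in> L2 M"
  shows "(\<integral>x. \<bar>F x\<bar> \<partial>M) \<le> l2_norm M F"
proof -
  have L: "(\<lambda>x. \<bar>F x\<bar>) \<in> L2 M" using assms by (auto simp: L2_def)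
  have "\<bar>l2_inner M (\<lambda>x. \<bar>F x\<bar>) (\<lambda>x. 1)\<bar> \<le> l2_norm M (\<lambda>x. \<bar>F x\<bar>) * l2_norm M (\<lambda>x. 1)"
    by (intro l2_Cauchy_Schwarz L L2_const)
  then show ?thesis by (simp add: l2_inner_def l2_norm_def prob_space)
qed

lemma L2_tendsto_iff: "L2_tendsto M u f \<F> \<longleftrightarrow> ((\<lambda>i. l2_norm M (\<lambda>x. u i x - f x)) \<longlongrightarrow> 0) \<F>"
proof
  assume "L2_tendsto M u f \<F>"
  then have "((\<lambda>i. sqrt (\<integral>x. (u i x - f x)\<^sup>2 \<partial>M)) \<longlongrightarrow> sqrt 0) \<F>"
    unfolding L2_tendsto_def by (intro tendsto_real_sqrt)
  then show "((\<lambda>i. l2_norm M (\<lambda>x. u i x - f x)) \<longlongrightarrow> 0) \<F>"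
    by (simp add: l2_norm_def l2_inner_def power2_eq_square)
next
  assume "((\<lambda>i. l2_norm M (\<lambda>x. u i x - f x)) \<longlongrightarrow> 0) \<F>"
  then have "((\<lambda>i. (l2_norm M (\<lambda>x. u i x - f x))\<^sup>2) \<longlongrightarrow> 0\<^sup>2) \<F>"
    by (intro tendsto_power)
  then show "L2_tendsto M u f \<F>"
    unfolding L2_tendsto_def l2_norm_sq' by simp
qed

lemma tendsto_l2_inner_left:
  assumes "L2_tendsto M u F \<F>" "\<And>i. u i \<in> L2 M" "F \<in> L2 M" "G \<in> L2 M"
  shows "((\<lambda>i. l2_inner M (u i) G) \<longlongrightarrow> l2_inner M F G) \<F>"
proof (rule LIM_zero_cancel)
  have "((\<lambda>i. l2_norm M (\<lambda>x. u i x - F x) * l2_norm M G) \<longlongrightarrow> 0 * l2_norm M G) \<F>"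
    using assms(1) unfolding L2_tendsto_iff by (intro tendsto_mult tendsto_const)
  then have *: "((\<lambda>i. l2_norm M (\<lambda>x. u i x - F x) * l2_norm M G) \<longlongrightarrow> 0) \<F>" by simp
  show "((\<lambda>i. l2_inner M (u i) G - l2_inner M F G) \<longlongrightarrow> 0) \<F>"
    by (rule Lim_null_comparison[OF _ *])
      (use l2_Cauchy_Schwarz[OF L2_diff[OF assms(2,3)] assms(4)] in \<open>simp add: l2_inner_simps assms\<close>)
qed

lemma tendsto_l2_norm:
  assumes "L2_tendsto M u F \<F>" "\<And>i. u i \<in> L2 M" "F \<in> L2 M"
  shows "((\<lambda>i. l2_norm M (u i)) \<longlongrightarrow> l2_norm M F) \<F>"
proof (rule LIM_zero_cancel)
  show "((\<lambda>i. l2_norm M (u i) - l2_norm M F) \<longlongrightarrow> 0) \<F>"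
    by (rule Lim_null_comparison[OF _ assms(1)[unfolded L2_tendsto_iff]])
      (use l2_norm_diff_ineq[OF assms(2,3)] in simp)
qed

lemma tendsto_l2_inner:
  assumes u: "L2_tendsto M u F \<F>" "\<And>i. u i \<in> L2 M" "F \<in> L2 M"
    and v: "L2_tendsto M v G \<F>" "\<And>i. v i \<in> L2 M" "G \<in> L2 M"
  shows "((\<lambda>i. l2_inner M (u i) (v i)) \<longlongrightarrow> l2_inner M F G) \<F>"
proof -
  have "((\<lambda>i. l2_norm M (u i) * l2_norm M (\<lambda>x. v i x - G x)) \<longlongrightarrow> l2_norm M F * 0) \<F>"
    using v(1) unfolding L2_tendsto_iff by (intro tendsto_mult tendsto_l2_norm u)
  then have *: "((\<lambda>i. l2_norm M (u i) * l2_norm M (\<lambda>x. v i x - G x)) \<longlongrightarrow> 0) \<F>" by simp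
  have "((\<lambda>i. l2_inner M (u i) (v i) - l2_inner M (u i) G) \<longlongrightarrow> 0) \<F>"
    by (rule Lim_null_comparison[OF _ *])
      (use l2_Cauchy_Schwarz[OF u(2) L2_diff[OF v(2,3)]] in \<open>simp add: l2_inner_simps u v\<close>)
  from tendsto_add[OF this tendsto_l2_inner_left[OF u v(3)]] show ?thesis by simp
qed

lemma l2_inner_eq_imp_AE_eq:
  assumes "F \<in> L2 M" "G \<in> L2 M" "\<And>H. H \<in> L2 M \<Longrightarrow> l2_inner M F H = l2_inner M G H"
  shows "AE x in M. F x = G x"
proof -
  have D: "(\<lambda>x. F x - G x) \<in> L2 M" by (intro L2_closed assms)
  have "l2_inner M (\<lambda>x. F x - G x) (\<lambda>x. F x - G x) = 0"
    using assms(3)[OF D] by (subst l2_inner_diff_left) (auto simp: assms D)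
  then have "l2_norm M (\<lambda>x. F x - G x) = 0" by (simp add: l2_norm_def)
  from l2_norm_eq_0_AE[OF D this] show ?thesis by simp
qed

lemma l2_norm_le_if_weak:
  assumes "F \<in> L2 M" "0 \<le> c" "\<And>H. H \<in> L2 M \<Longrightarrow> \<bar>l2_inner M F H\<bar> \<le> c * l2_norm M H"
  shows "l2_norm M F \<le> c"
proof (cases "l2_norm M F = 0")
  case False
  then have "l2_norm M F > 0" using l2_norm_nonneg[of M F] by simp
  have "(l2_norm M F)\<^sup>2 \<le> c * l2_norm M F"
    using assms(3)[OF assms(1)] by (simp add: l2_norm_sq)
  then show ?thesis using \<open>l2_norm M F > 0\<close> by (simp add: power2_eq_square)
qed (use assms in simp)

section \<open>Completeness and representation of functionals\<close>

text \<open>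
  The usual argument: a subsequence with summable increments converges almost everywhere, and by
  Fatou's lemma its limit is the limit in \<open>L\<^sup>2\<close>.
\<close>

lemma (in prob_space) L2_complete:
  fixes u :: "nat \<Rightarrow> 'a \<Rightarrow> real"
  assumes u: "\<And>n. u n \<in> L2 M"
    and Cau: "\<And>e. 0 < e \<Longrightarrow> \<exists>K. \<forall>m\<ge>K. \<forall>n\<ge>K. l2_norm M (\<lambda>x. u m x - u n x) < e"
  obtains g where "g \<in> L2 M" "L2_tendsto M u g sequentially"
proof -
  have um[measurable]: "\<And>n. u n \<in> borel_measurable M" using u by (auto simp: L2_def)
  have "\<forall>k. \<exists>K. \<forall>m\<ge>K. \<forall>n\<ge>K. l2_norm M (\<lambda>x. u m x - u n x) < (1/2)^k"
    using Cau by simp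
  then obtain K where K: "\<And>k m n. m \<ge> K k \<Longrightarrow> n \<ge> K k \<Longrightarrow> l2_norm M (\<lambda>x. u m x - u n x) < (1/2)^k"
    by metis
  \<comment> \<open>indices of the subsequence; the summand \<open>k\<close> makes them tend to infinity\<close>
  define r where "r k = (\<Sum>i\<le>k. K i) + k" for k
  have rK: "K k \<le> r k" for k unfolding r_def
    using member_le_sum[of k "{..k}" K] by simp
  have rS: "r k \<le> r (Suc k)" for k unfolding r_def by simp
  have rk: "k \<le> r k" for k unfolding r_def by simp
  define d where "d k x = \<bar>u (r (Suc k)) x - u (r k) x\<bar>" for k x
  have dm[measurable]: "\<And>k. d k \<in> borel_measurable M" unfolding d_def by measurable
  have d_int: "integrable M (d k)" "(\<integral>x. d k x \<partial>M) \<le> (1/2)^k" for k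
  proof -
    have L: "(\<lambda>x. u (r (Suc k)) x - u (r k) x) \<in> L2 M" by (intro L2_closed u)
    show "integrable M (d k)" unfolding d_def using L2_integrable[OF L] by simp
    have "(\<integral>x. d k x \<partial>M) \<le> l2_norm M (\<lambda>x. u (r (Suc k)) x - u (r k) x)"
      unfolding d_def by (rule abs_integral_le_l2_norm[OF L])
    also have "\<dots> \<le> (1/2)^k" using K[of k "r (Suc k)" "r k"] rK[of k] rS[of k] by simp
    finally show "(\<integral>x. d k x \<partial>M) \<le> (1/2)^k" .
  qed
  have "(\<integral>\<^sup>+x. (\<Sum>k. ennreal (d k x)) \<partial>M) = (\<Sum>k. \<integral>\<^sup>+x. ennreal (d k x) \<partial>M)"
    by (rule nn_integral_suminf) measurable
  also have "\<dots> = (\<Sum>k. ennreal (\<integral>x. d k x \<partial>M))"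
    by (intro suminf_cong nn_integral_eq_integral d_int) (simp add: d_def)
  also have "\<dots> \<le> (\<Sum>k. ennreal ((1/2)^k))"
    using d_int by (intro suminf_le ennreal_leI) auto
  also have "\<dots> < \<infinity>"
  proof -
    have "summable (\<lambda>k. (1/2::real)^k)" by (intro summable_geometric) simp
    then have "(\<Sum>k. ennreal ((1/2)^k)) = ennreal (\<Sum>k. (1/2)^k)"
      by (intro suminf_ennreal2) auto
    then show ?thesis by simp
  qed
  finally have "AE x in M. (\<Sum>k. ennreal (d k x)) \<noteq> \<infinity>"
    by (intro nn_integral_PInf_AE) (auto simp: top.not_eq_extremum)
  then have conv: "AE x in M. convergent (\<lambda>k. u (r k) x)"
  proof eventually_elim
    case (elim x)
    then have "summable (\<lambda>k. d k x)"
      by (intro summable_suminf_not_top) (auto simp: d_def)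
    then have "summable (\<lambda>k. u (r (Suc k)) x - u (r k) x)"
      unfolding d_def by (rule summable_rabs_cancel)
    then have "convergent (\<lambda>n. u (r 0) x + (\<Sum>k<n. u (r (Suc k)) x - u (r k) x))"
      by (intro convergent_add convergent_const) (simp add: summable_iff_convergent)
    then show ?case by (simp add: sum_lessThan_telescope[of "\<lambda>k. u (r k) x"])
  qed
  define g where "g x = lim (\<lambda>k. u (r k) x)" for x
  have gm[measurable]: "g \<in> borel_measurable M" unfolding g_def by measurable
  have conv': "AE x in M. (\<lambda>k. u (r k) x) \<longlonglongrightarrow> g x"
    using conv by eventually_elim (simp add: g_def convergent_LIMSEQ_iff)
  have bound: "(\<integral>\<^sup>+x. ennreal ((u n x - g x)\<^sup>2) \<partial>M) \<le> ennreal (e\<^sup>2)"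
    if e: "\<And>m. m \<ge> k \<Longrightarrow> l2_norm M (\<lambda>x. u n x - u m x) \<le> e" and "0 \<le> e" for e n k
  proof -
    have "(\<integral>\<^sup>+x. ennreal ((u n x - g x)\<^sup>2) \<partial>M) = (\<integral>\<^sup>+x. liminf (\<lambda>j. ennreal ((u n x - u (r j) x)\<^sup>2)) \<partial>M)"
    proof (rule nn_integral_cong_AE)
      show "AE x in M. ennreal ((u n x - g x)\<^sup>2) = liminf (\<lambda>j. ennreal ((u n x - u (r j) x)\<^sup>2))"
        using conv'
      proof eventually_elim
        case (elim x)
        then have "(\<lambda>j. ennreal ((u n x - u (r j) x)\<^sup>2)) \<longlonglongrightarrow> ennreal ((u n x - g x)\<^sup>2)"
          by (intro tendsto_intros)
        from lim_imp_Liminf[OF _ this] show ?case by simp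
      qed
    qed
    also have "\<dots> \<le> liminf (\<lambda>j. \<integral>\<^sup>+x. ennreal ((u n x - u (r j) x)\<^sup>2) \<partial>M)"
      by (rule nn_integral_liminf) measurable
    also have "\<dots> \<le> limsup (\<lambda>j. \<integral>\<^sup>+x. ennreal ((u n x - u (r j) x)\<^sup>2) \<partial>M)"
      by (rule Liminf_le_Limsup) simp
    also have "\<dots> \<le> ennreal (e\<^sup>2)"
    proof (rule Limsup_bounded)
      show "\<forall>\<^sub>F j in sequentially. (\<integral>\<^sup>+x. ennreal ((u n x - u (r j) x)\<^sup>2) \<partial>M) \<le> ennreal (e\<^sup>2)"
        using eventually_ge_at_top[of k]
      proof eventually_elim
        case (elim j)
        then have "r j \<ge> k" using rk[of j] by simp
        have "(\<integral>\<^sup>+x. ennreal ((u n x - u (r j) x)\<^sup>2) \<partial>M) = ennreal (\<integral>x. (u n x - u (r j) x)\<^sup>2 \<partial>M)"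
          by (intro nn_integral_eq_integral L2_sq_integrable[OF L2_diff[OF u u]]) simp
        also have "\<dots> = ennreal ((l2_norm M (\<lambda>x. u n x - u (r j) x))\<^sup>2)" by (simp add: l2_norm_sq')
        also have "\<dots> \<le> ennreal (e\<^sup>2)"
          using e[OF \<open>r j \<ge> k\<close>] by (intro ennreal_leI power_mono l2_norm_nonneg)
        finally show ?case .
      qed
    qed
    finally show ?thesis .
  qed
  have diffL2: "(\<lambda>x. u n x - g x) \<in> L2 M \<and> l2_norm M (\<lambda>x. u n x - g x) \<le> e"
    if e: "\<And>m. m \<ge> k \<Longrightarrow> l2_norm M (\<lambda>x. u n x - u m x) \<le> e" and "0 \<le> e" for e n k
  proof -
    note b = bound[of k n e, OF e \<open>0 \<le> e\<close>]
    have i: "integrable M (\<lambda>x. (u n x - g x)\<^sup>2)"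
      using b by (intro integrableI_bounded) (auto intro: le_less_trans)
    have "ennreal (\<integral>x. (u n x - g x)\<^sup>2 \<partial>M) \<le> ennreal (e\<^sup>2)"
      using b nn_integral_eq_integral[OF i] by simp
    then have "(l2_norm M (\<lambda>x. u n x - g x))\<^sup>2 \<le> e\<^sup>2"
      by (simp add: l2_norm_sq')
    then show ?thesis using i \<open>0 \<le> e\<close> by (auto simp: L2_def intro: power2_le_imp_le)
  qed
  obtain K1 where K1: "\<And>m n. m \<ge> K1 \<Longrightarrow> n \<ge> K1 \<Longrightarrow> l2_norm M (\<lambda>x. u m x - u n x) < 1"
    using Cau[of 1] by auto
  have "(\<lambda>x. u K1 x - g x) \<in> L2 M" using diffL2[of K1 K1 1] K1 by (auto intro: less_imp_le)
  then have "(\<lambda>x. u K1 x - (u K1 x - g x)) \<in> L2 M" by (rule L2_diff[OF u])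
  then have gL: "g \<in> L2 M" by simp
  have "L2_tendsto M u g sequentially"
    unfolding L2_tendsto_iff
  proof (rule LIMSEQ_I)
    fix e :: real assume "0 < e"
    then obtain K where K: "\<And>m n. m \<ge> K \<Longrightarrow> n \<ge> K \<Longrightarrow> l2_norm M (\<lambda>x. u m x - u n x) < e/2"
      using Cau[of "e/2"] by auto
    have "l2_norm M (\<lambda>x. u n x - g x) < e" if "n \<ge> K" for n
    proof -
      have "l2_norm M (\<lambda>x. u n x - g x) \<le> e / 2"
        using diffL2[of K n "e/2"] K \<open>0 < e\<close> that by (auto intro: less_imp_le)
      then show ?thesis using \<open>0 < e\<close> by simp
    qed
    then show "\<exists>no. \<forall>n\<ge>no. norm (l2_norm M (\<lambda>x. u n x - g x) - 0) < e"
      by (auto simp: l2_norm_nonneg)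
  qed
  with gL that show ?thesis by blast
qed

text \<open>
  A functional bounded by a quadratic form is represented by an element of the form domain up to an
  arbitrarily small error in the dual norm: take an almost minimiser of \<open>B u u - 2 \<phi> u\<close> and vary it
  along lines. The form domain is a set closed under \<open>lc u s v\<close>, which stands for \<open>u + s v\<close>. This
  allows \<open>u\<close> to be a function together with its images under an operator and its adjoint.
\<close>

lemma approximate_representer:
  fixes B :: "'v \<Rightarrow> 'v \<Rightarrow> real" and \<phi> :: "'v \<Rightarrow> real" and lc :: "'v \<Rightarrow> real \<Rightarrow> 'v \<Rightarrow> 'v"
  assumes ne: "v0 \<in> D"
    and lc: "\<And>u v s. u \<in> D \<Longrightarrow> v \<in> D \<Longrightarrow> lc u s v \<in> D"
    and Bl: "\<And>u v w s. u \<in> D \<Longrightarrow> v \<in> D \<Longrightarrow> w \<in> D \<Longrightarrow> B (lc u s v) w = B u w + s * B v w"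
    and sym: "\<And>u v. u \<in> D \<Longrightarrow> v \<in> D \<Longrightarrow> B u v = B v u"
    and pos: "\<And>u. u \<in> D \<Longrightarrow> 0 \<le> B u u"
    and \<phi>l: "\<And>u v s. u \<in> D \<Longrightarrow> v \<in> D \<Longrightarrow> \<phi> (lc u s v) = \<phi> u + s * \<phi> v"
    and bd: "\<And>u. u \<in> D \<Longrightarrow> (\<phi> u)\<^sup>2 \<le> c * B u u" and c: "0 \<le> c" and \<epsilon>: "0 < \<epsilon>"
  obtains v where "v \<in> D" "\<And>w. w \<in> D \<Longrightarrow> (\<phi> w - B v w)\<^sup>2 \<le> \<epsilon> * B w w"
proof -
  define J where "J u = B u u - 2 * \<phi> u" for u
  have Jb: "- c \<le> J u" if "u \<in> D" for u
  proof -
    have "\<phi> u \<le> sqrt (c * B u u)"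
      using bd[OF that] by (meson abs_le_D1 real_le_rsqrt)
    also have "2 * \<dots> \<le> c + B u u"
      using arith_geo_mean_sqrt[OF c pos[OF that]] by simp
    finally show ?thesis unfolding J_def by simp
  qed
  have bb: "bdd_below (J ` D)" using Jb by (auto intro!: bdd_belowI[of _ "-c"])
  have "Inf (J ` D) < Inf (J ` D) + \<epsilon>" using \<epsilon> by simp
  then obtain v where v: "v \<in> D" "J v < Inf (J ` D) + \<epsilon>"
    using cInf_less_iff[OF _ bb, of "Inf (J ` D) + \<epsilon>"] ne by auto
  have "(\<phi> w - B v w)\<^sup>2 \<le> \<epsilon> * B w w" if w: "w \<in> D" for w
  proof (rule quadratic_nonneg_imp_discriminant[OF pos[OF w]])
    fix s
    have m: "lc v s w \<in> D" by (intro lc v w)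
    have "Inf (J ` D) \<le> J (lc v s w)" using bb m by (intro cInf_lower) auto
    moreover have "B (lc v s w) (lc v s w) = B v v + 2 * s * B v w + s\<^sup>2 * B w w"
      using v(1) w m
      by (simp add: Bl sym[of v "lc v s w"] sym[of w "lc v s w"] sym[of w v] power2_eq_square algebra_simps)
    moreover have "\<phi> (lc v s w) = \<phi> v + s * \<phi> w" by (rule \<phi>l[OF v(1) w])
    ultimately show "0 \<le> s\<^sup>2 * B w w - 2 * s * (\<phi> w - B v w) + \<epsilon>"
      using v(2) unfolding J_def by (simp add: algebra_simps)
  qed
  with v(1) show ?thesis using that by blast
qed

text \<open>
  The approximate representers of \<open>\<phi>\<close> for \<open>\<epsilon> = 1/n\<^sup>2\<close> form a Cauchy sequence.
\<close>

lemma (in prob_space) L2_Riesz: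
  assumes lin: "\<And>F G s. F \<in> L2 M \<Longrightarrow> G \<in> L2 M \<Longrightarrow> \<phi> (\<lambda>x. F x + s * G x) = \<phi> F + s * \<phi> G"
    and bd: "\<And>F. F \<in> L2 M \<Longrightarrow> \<bar>\<phi> F\<bar> \<le> c * l2_norm M F"
  obtains g where "g \<in> L2 M" "\<And>F. F \<in> L2 M \<Longrightarrow> l2_inner M g F = \<phi> F"
proof -
  have bd2: "(\<phi> F)\<^sup>2 \<le> c\<^sup>2 * l2_inner M F F" if "F \<in> L2 M" for F
    using power_mono[OF bd[OF that], of 2] by (simp add: power_mult_distrib l2_norm_sq)
  have "\<exists>v\<in>L2 M. \<forall>w\<in>L2 M. (\<phi> w - l2_inner M v w)\<^sup>2 \<le> (1 / real (Suc n))\<^sup>2 * l2_inner M w w" for n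
    by (rule approximate_representer[of "\<lambda>x. 0" "L2 M" "\<lambda>F s G. (\<lambda>x. F x + s * G x)" "l2_inner M" \<phi> "c\<^sup>2" "(1 / real (Suc n))\<^sup>2"])
      (auto simp: L2_closed l2_inner_simps lin bd2 l2_inner_nonneg intro: l2_inner_commute)
  then obtain v where v: "\<And>n. v n \<in> L2 M"
    and v2: "\<And>n w. w \<in> L2 M \<Longrightarrow> (\<phi> w - l2_inner M (v n) w)\<^sup>2 \<le> (1 / real (Suc n))\<^sup>2 * l2_inner M w w"
    by metis
  have v3: "\<bar>\<phi> w - l2_inner M (v n) w\<bar> \<le> inverse (real (Suc n)) * l2_norm M w" if "w \<in> L2 M" for n w
    using real_sqrt_le_mono[OF v2[OF that, of n]] by (simp add: real_sqrt_mult l2_norm_def inverse_eq_divide)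
  have dist: "l2_norm M (\<lambda>x. v m x - v n x) \<le> inverse (real (Suc m)) + inverse (real (Suc n))" for m n
  proof (rule l2_norm_le_if_weak)
    fix H assume H: "H \<in> L2 M"
    have "\<bar>l2_inner M (\<lambda>x. v m x - v n x) H\<bar> = \<bar>(\<phi> H - l2_inner M (v n) H) - (\<phi> H - l2_inner M (v m) H)\<bar>"
      by (simp add: l2_inner_simps v H)
    also have "\<dots> \<le> (inverse (real (Suc m)) + inverse (real (Suc n))) * l2_norm M H"
      using v3[OF H, of m] v3[OF H, of n] by (simp add: algebra_simps)
    finally show "\<bar>l2_inner M (\<lambda>x. v m x - v n x) H\<bar> \<le> \<dots>" .
  qed (auto intro: L2_closed v)
  have Cau: "\<exists>K. \<forall>m\<ge>K. \<forall>n\<ge>K. l2_norm M (\<lambda>x. v m x - v n x) < e" if e: "0 < e" for e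
  proof -
    obtain K where K: "inverse (real (Suc K)) < e / 2" using reals_Archimedean[of "e/2"] e by (meson half_gt_zero)
    have "l2_norm M (\<lambda>x. v m x - v n x) < e" if "m \<ge> K" "n \<ge> K" for m n
    proof -
      have "inverse (real (Suc m)) \<le> inverse (real (Suc K))" "inverse (real (Suc n)) \<le> inverse (real (Suc K))"
        using that by (auto intro!: le_imp_inverse_le)
      then show ?thesis using dist[of m n] K by linarith
    qed
    then show ?thesis by blast
  qed
  obtain g where g: "g \<in> L2 M" "L2_tendsto M v g sequentially"
    using L2_complete[OF v Cau] by blast
  have "l2_inner M g F = \<phi> F" if F: "F \<in> L2 M" for F
  proof (rule LIMSEQ_unique)
    show "(\<lambda>n. l2_inner M (v n) F) \<longlonglongrightarrow> l2_inner M g F"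
      by (rule tendsto_l2_inner_left[OF g(2) v g(1) F])
    have "(\<lambda>n. inverse (real (Suc n)) * l2_norm M F) \<longlonglongrightarrow> 0 * l2_norm M F"
      by (intro tendsto_mult tendsto_const LIMSEQ_inverse_real_of_nat)
    then have *: "(\<lambda>n. inverse (real (Suc n)) * l2_norm M F) \<longlonglongrightarrow> 0" by simp
    show "(\<lambda>n. l2_inner M (v n) F) \<longlonglongrightarrow> \<phi> F"
      by (rule LIM_zero_cancel, rule Lim_null_comparison[OF _ *])
        (use v3[OF F] in \<open>auto simp: abs_minus_commute\<close>)
  qed
  with g(1) that show ?thesis by blast
qed

section \<open>Contraction semigroups\<close>

locale L2_contraction_semigroup = prob_space M for M :: "'a measure" +
  fixes Q :: "real \<Rightarrow> ('a \<Rightarrow> real) \<Rightarrow> 'a \<Rightarrow> real"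
  assumes Q_L2: "0 \<le> t \<Longrightarrow> F \<in> L2 M \<Longrightarrow> Q t F \<in> L2 M"
    and Q_lincomb: "0 \<le> t \<Longrightarrow> F \<in> L2 M \<Longrightarrow> G \<in> L2 M \<Longrightarrow>
          AE x in M. Q t (\<lambda>y. a * F y + b * G y) x = a * Q t F x + b * Q t G x"
    and Q_contraction: "0 \<le> t \<Longrightarrow> F \<in> L2 M \<Longrightarrow> l2_norm M (Q t F) \<le> l2_norm M F"
    and Q_zero: "F \<in> L2 M \<Longrightarrow> AE x in M. Q 0 F x = F x"
    and Q_add: "0 \<le> s \<Longrightarrow> 0 \<le> t \<Longrightarrow> F \<in> L2 M \<Longrightarrow> AE x in M. Q (s + t) F x = Q s (Q t F) x"
    and Q_continuous: "F \<in> L2 M \<Longrightarrow> L2_tendsto M (\<lambda>t. Q t F) F (at_right 0)"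
begin

abbreviation "gen \<equiv> L2_generator M Q"

lemma Q_measurable: "0 \<le> t \<Longrightarrow> F \<in> L2 M \<Longrightarrow> Q t F \<in> borel_measurable M"
  using Q_L2 by (auto simp: L2_def)

lemma l2_inner_Q_lincomb:
  assumes "0 \<le> t" "F \<in> L2 M" "G \<in> L2 M" "H \<in> L2 M"
  shows "l2_inner M (Q t (\<lambda>y. a * F y + b * G y)) H = a * l2_inner M (Q t F) H + b * l2_inner M (Q t G) H"
proof -
  have "l2_inner M (Q t (\<lambda>y. a * F y + b * G y)) H = l2_inner M (\<lambda>x. a * Q t F x + b * Q t G x) H"
    using assms L2_measurable[OF Q_L2[OF assms(1) L2_lincomb[OF assms(2,3)]]]
    by (intro l2_inner_cong_AE Q_lincomb) (auto intro!: L2_measurable L2_closed Q_L2)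
  then show ?thesis using assms by (simp add: l2_inner_lincomb_left Q_L2)
qed

lemma Q_diff_norm:
  assumes "0 \<le> t" "F \<in> L2 M" "G \<in> L2 M"
  shows "l2_norm M (\<lambda>x. Q t F x - Q t G x) \<le> l2_norm M (\<lambda>x. F x - G x)"
proof -
  have L: "(\<lambda>x. F x - G x) \<in> L2 M" using assms by (intro L2_closed)
  have "AE x in M. Q t (\<lambda>x. F x - G x) x = Q t F x - Q t G x"
    using Q_lincomb[OF assms, of 1 "-1"] by simp
  then have "l2_norm M (\<lambda>x. Q t F x - Q t G x) = l2_norm M (Q t (\<lambda>x. F x - G x))"
    using assms L by (intro l2_norm_cong_AE) (auto intro!: Q_measurable borel_measurable_diff)
  also have "\<dots> \<le> l2_norm M (\<lambda>x. F x - G x)" by (rule Q_contraction[OF assms(1) L])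
  finally show ?thesis .
qed

lemma Q_cong_AE:
  assumes "0 \<le> t" "F \<in> L2 M" "G \<in> L2 M" "AE x in M. F x = G x"
  shows "AE x in M. Q t F x = Q t G x"
proof -
  have "l2_norm M (\<lambda>x. F x - G x) = l2_norm M (\<lambda>x. 0)"
    using assms by (intro l2_norm_cong_AE) (auto intro!: borel_measurable_diff simp: L2_def)
  then have "l2_norm M (\<lambda>x. Q t F x - Q t G x) = 0"
    using Q_diff_norm[OF assms(1-3)] l2_norm_nonneg[of M "\<lambda>x. Q t F x - Q t G x"] by (simp add: l2_norm_zero)
  from l2_norm_eq_0_AE[OF L2_diff[OF Q_L2[OF assms(1,2)] Q_L2[OF assms(1,3)]] this] show ?thesis by simp
qed

lemma l2_inner_Q_add:
  assumes "0 \<le> s" "0 \<le> t" "F \<in> L2 M" "H \<in> L2 M"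
  shows "l2_inner M (Q (s + t) F) H = l2_inner M (Q s (Q t F)) H"
  using assms by (intro l2_inner_cong_AE Q_add) (auto intro!: Q_measurable Q_L2 L2_measurable)

lemma l2_inner_Q_zero:
  assumes "F \<in> L2 M" "H \<in> L2 M"
  shows "l2_inner M (Q 0 F) H = l2_inner M F H"
  using assms by (intro l2_inner_cong_AE Q_zero) (auto intro!: Q_L2 L2_measurable)

lemma abs_l2_inner_Q_le:
  assumes "0 \<le> t" "F \<in> L2 M" "H \<in> L2 M"
  shows "\<bar>l2_inner M (Q t F) H\<bar> \<le> l2_norm M F * l2_norm M H"
  using l2_Cauchy_Schwarz[OF Q_L2[OF assms(1,2)] assms(3)]
    mult_right_mono[OF Q_contraction[OF assms(1,2)] l2_norm_nonneg[of M H]] by linarith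

lemma Q_increment_norm:
  assumes "0 \<le> s" "0 \<le> h" "F \<in> L2 M"
  shows "l2_norm M (\<lambda>x. Q (s + h) F x - Q s F x) \<le> l2_norm M (\<lambda>x. Q h F x - F x)"
proof -
  have "l2_norm M (\<lambda>x. Q (s + h) F x - Q s F x) = l2_norm M (\<lambda>x. Q s (Q h F) x - Q s F x)"
    using Q_add[OF assms] assms
    by (intro l2_norm_cong_AE) (auto intro!: borel_measurable_diff Q_measurable Q_L2)
  also have "\<dots> \<le> l2_norm M (\<lambda>x. Q h F x - F x)"
    using assms by (intro Q_diff_norm Q_L2)
  finally show ?thesis .
qed

lemma Q_norm_tendsto:
  assumes "F \<in> L2 M"
  shows "((\<lambda>h. l2_norm M (\<lambda>x. Q h F x - F x)) \<longlongrightarrow> 0) (at_right 0)"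
  using Q_continuous[OF assms] unfolding L2_tendsto_iff .

text \<open>
  All time dependence is used through the scalar functions \<open>s \<mapsto> \<langle>Q\<^sub>s F, H\<rangle>\<close>; strong continuity at
  \<open>0\<close> and contractivity make them continuous on the half line.
\<close>

lemma continuous_on_l2_inner_Q:
  assumes F: "F \<in> L2 M" and H: "H \<in> L2 M"
  shows "continuous_on {0..} (\<lambda>s. l2_inner M (Q s F) H)"
  unfolding continuous_on_iff
proof (intro ballI allI impI)
  fix s e :: real assume s: "s \<in> {0..}" and e: "0 < e"
  have "((\<lambda>h. l2_norm M (\<lambda>x. Q h F x - F x) * l2_norm M H) \<longlongrightarrow> 0 * l2_norm M H) (at_right 0)"
    by (intro tendsto_mult Q_norm_tendsto F tendsto_const)
  then have "\<forall>\<^sub>F h in at_right 0. l2_norm M (\<lambda>x. Q h F x - F x) * l2_norm M H < e"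
    using e by (intro order_tendstoD) auto
  then obtain d where d: "0 < d" "\<And>h. 0 < h \<Longrightarrow> h < d \<Longrightarrow> l2_norm M (\<lambda>x. Q h F x - F x) * l2_norm M H < e"
    unfolding eventually_at_right_field by auto
  have key: "\<bar>l2_inner M (Q (a + h) F) H - l2_inner M (Q a F) H\<bar> < e" if "0 \<le> a" "0 \<le> h" "h < d" for a h
  proof (cases "h = 0")
    case False
    have "\<bar>l2_inner M (Q (a + h) F) H - l2_inner M (Q a F) H\<bar> = \<bar>l2_inner M (\<lambda>x. Q (a + h) F x - Q a F x) H\<bar>"
      using that F H by (simp add: l2_inner_simps Q_L2)
    also have "\<dots> \<le> l2_norm M (\<lambda>x. Q (a + h) F x - Q a F x) * l2_norm M H"
      using that F H by (intro l2_Cauchy_Schwarz L2_closed Q_L2) auto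
    also have "\<dots> \<le> l2_norm M (\<lambda>x. Q h F x - F x) * l2_norm M H"
      using that F by (intro mult_right_mono Q_increment_norm l2_norm_nonneg)
    also have "\<dots> < e" using d(2)[of h] that False by simp
    finally show ?thesis .
  qed (use e in simp)
  show "\<exists>d>0. \<forall>x'\<in>{0..}. dist x' s < d \<longrightarrow> dist (l2_inner M (Q x' F) H) (l2_inner M (Q s F) H) < e"
  proof (intro exI[of _ d] conjI ballI impI)
    fix r assume r: "r \<in> {0..}" "dist r s < d"
    show "dist (l2_inner M (Q r F) H) (l2_inner M (Q s F) H) < e"
    proof (cases "s \<le> r")
      case True
      then show ?thesis using key[of s "r - s"] s r by (simp add: dist_real_def)
    next
      case False
      then show ?thesis using key[of r "s - r"] s r by (simp add: dist_real_def abs_minus_commute)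
    qed
  qed (rule d)
qed

lemma continuous_on_l2_inner_Q':
  assumes "F \<in> L2 M" "H \<in> L2 M" "0 \<le> a"
  shows "continuous_on {a..b} (\<lambda>s. l2_inner M (Q s F) H)"
  using continuous_on_subset[OF continuous_on_l2_inner_Q[OF assms(1,2)], of "{a..b}"] assms(3) by auto

lemma adjoint_exists:
  assumes t: "0 \<le> t" and H: "H \<in> L2 M"
  obtains g where "g \<in> L2 M" "\<And>F. F \<in> L2 M \<Longrightarrow> l2_inner M (Q t F) H = l2_inner M F g"
proof -
  obtain g where "g \<in> L2 M" "\<And>F. F \<in> L2 M \<Longrightarrow> l2_inner M g F = l2_inner M (Q t F) H"
  proof (rule L2_Riesz[of "\<lambda>F. l2_inner M (Q t F) H" "l2_norm M H"])
    fix F G s assume "F \<in> L2 M" "G \<in> L2 M"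
    then show "l2_inner M (Q t (\<lambda>x. F x + s * G x)) H = l2_inner M (Q t F) H + s * l2_inner M (Q t G) H"
      using l2_inner_Q_lincomb[OF t, of F G H 1 s] H by simp
  next
    fix F assume "F \<in> L2 M"
    then show "\<bar>l2_inner M (Q t F) H\<bar> \<le> l2_norm M H * l2_norm M F"
      using abs_l2_inner_Q_le[OF t _ H] by (simp add: mult.commute)
  qed blast
  then show ?thesis using that by (metis l2_inner_commute)
qed

section \<open>The generator\<close>

lemma generator_L2:
  assumes "(F, G) \<in> gen" shows "F \<in> L2 M" "G \<in> L2 M"
  using assms by (auto simp: L2_generator_def)

lemma generator_tendsto:
  assumes "(F, G) \<in> gen"
  shows "((\<lambda>h. l2_norm M (\<lambda>x. (Q h F x - F x) / h - G x)) \<longlongrightarrow> 0) (at_right 0)"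
  using assms unfolding L2_generator_def L2_tendsto_iff by auto

lemma generatorI:
  assumes "F \<in> L2 M" "G \<in> L2 M"
    "((\<lambda>h. l2_norm M (\<lambda>x. (Q h F x - F x) / h - G x)) \<longlongrightarrow> 0) (at_right 0)"
  shows "(F, G) \<in> gen"
  using assms unfolding L2_generator_def L2_tendsto_iff by auto

lemma generator_lincomb:
  assumes 1: "(F, G) \<in> gen" and 2: "(F', G') \<in> gen"
  shows "(\<lambda>x. a * F x + b * F' x, \<lambda>x. a * G x + b * G' x) \<in> gen"
proof (rule generatorI)
  note L = generator_L2[OF 1] generator_L2[OF 2]
  show "(\<lambda>x. a * F x + b * F' x) \<in> L2 M" "(\<lambda>x. a * G x + b * G' x) \<in> L2 M"
    by (intro L2_closed L)+
  define d where "d h x = (Q h F x - F x) / h - G x" for h x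
  define d' where "d' h x = (Q h F' x - F' x) / h - G' x" for h x
  have dL: "d h \<in> L2 M" "d' h \<in> L2 M" if "0 < h" for h
    unfolding d_def d'_def using that by (intro L2_closed L Q_L2; simp)+
  have "((\<lambda>h. \<bar>a\<bar> * l2_norm M (d h) + \<bar>b\<bar> * l2_norm M (d' h)) \<longlongrightarrow> \<bar>a\<bar> * 0 + \<bar>b\<bar> * 0) (at_right 0)"
    unfolding d_def d'_def by (intro tendsto_intros generator_tendsto 1 2)
  then have *: "((\<lambda>h. \<bar>a\<bar> * l2_norm M (d h) + \<bar>b\<bar> * l2_norm M (d' h)) \<longlongrightarrow> 0) (at_right 0)" by simp
  show "((\<lambda>h. l2_norm M (\<lambda>x. (Q h (\<lambda>x. a * F x + b * F' x) x - (a * F x + b * F' x)) / h - (a * G x + b * G' x))) \<longlongrightarrow> 0) (at_right 0)"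
  proof (rule Lim_null_comparison[OF _ *])
    show "\<forall>\<^sub>F h in at_right 0. norm (l2_norm M (\<lambda>x. (Q h (\<lambda>x. a * F x + b * F' x) x - (a * F x + b * F' x)) / h - (a * G x + b * G' x)))
       \<le> \<bar>a\<bar> * l2_norm M (d h) + \<bar>b\<bar> * l2_norm M (d' h)"
      using eventually_at_right_less[of 0]
    proof eventually_elim
      case (elim h)
      have "l2_norm M (\<lambda>x. (Q h (\<lambda>x. a * F x + b * F' x) x - (a * F x + b * F' x)) / h - (a * G x + b * G' x))
        = l2_norm M (\<lambda>x. a * d h x + b * d' h x)"
      proof (rule l2_norm_cong_AE)
        show "AE x in M. (Q h (\<lambda>x. a * F x + b * F' x) x - (a * F x + b * F' x)) / h - (a * G x + b * G' x) = a * d h x + b * d' h x"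
          using Q_lincomb[OF less_imp_le[OF elim] L(1,3), of a b]
          by eventually_elim (use elim in \<open>simp add: d_def d'_def field_simps\<close>)
        show "(\<lambda>x. a * d h x + b * d' h x) \<in> borel_measurable M"
          by (intro L2_measurable L2_closed dL elim)
        show "(\<lambda>x. (Q h (\<lambda>x. a * F x + b * F' x) x - (a * F x + b * F' x)) / h - (a * G x + b * G' x)) \<in> borel_measurable M"
          using elim by (intro L2_measurable L2_closed Q_L2 L) auto
      qed
      also have "\<dots> \<le> l2_norm M (\<lambda>x. a * d h x) + l2_norm M (\<lambda>x. b * d' h x)"
        by (intro l2_norm_triangle L2_closed dL elim)
      finally show ?case by (simp add: l2_norm_cmult l2_norm_nonneg)
    qed
  qed
qed

lemma generator_zero: "(\<lambda>x. 0, \<lambda>x. 0) \<in> gen"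
proof (rule generatorI)
  have "l2_norm M (\<lambda>x. (Q h (\<lambda>x. 0) x - 0) / h - 0) = 0" if "0 < h" for h
  proof -
    have "l2_norm M (Q h (\<lambda>x. 0)) = 0"
      using Q_contraction[of h "\<lambda>x. 0"] l2_norm_nonneg[of M "Q h (\<lambda>x. 0)"] that by (simp add: L2_zero l2_norm_zero)
    then show ?thesis by (simp add: l2_norm_divide)
  qed
  then show "((\<lambda>h. l2_norm M (\<lambda>x. (Q h (\<lambda>x. 0) x - 0) / h - 0)) \<longlongrightarrow> 0) (at_right 0)"
    by (intro tendsto_eventually) (simp add: eventually_at_right_less eventually_at_filter)
qed (auto simp: L2_zero)

lemma generator_unique:
  assumes 1: "(F, G) \<in> gen" and 2: "(F, G') \<in> gen"
  shows "AE x in M. G x = G' x"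
proof -
  note L = generator_L2[OF 1] generator_L2[OF 2]
  have "((\<lambda>h. l2_norm M (\<lambda>x. (Q h F x - F x) / h - G x) + l2_norm M (\<lambda>x. (Q h F x - F x) / h - G' x)) \<longlongrightarrow> 0 + 0) (at_right 0)"
    by (intro tendsto_add generator_tendsto 1 2)
  moreover have "\<forall>\<^sub>F h in at_right 0. l2_norm M (\<lambda>x. G x - G' x) \<le> l2_norm M (\<lambda>x. (Q h F x - F x) / h - G x) + l2_norm M (\<lambda>x. (Q h F x - F x) / h - G' x)"
    using eventually_at_right_less[of 0]
  proof eventually_elim
    case (elim h)
    have "(\<lambda>x. (Q h F x - F x) / h) \<in> L2 M" using elim by (intro L2_closed Q_L2 L) auto
    from l2_norm_triangle_via[OF L(2) this L(4)] show ?case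
      using l2_norm_minus_commute[of M G "\<lambda>x. (Q h F x - F x) / h"] by simp
  qed
  ultimately have "l2_norm M (\<lambda>x. G x - G' x) \<le> 0"
    by (intro tendsto_lowerbound[where F="at_right (0::real)"]) auto
  then have "l2_norm M (\<lambda>x. G x - G' x) = 0" using l2_norm_nonneg[of M "\<lambda>x. G x - G' x"] by simp
  from l2_norm_eq_0_AE[OF L2_diff[OF L(2,4)] this] show ?thesis by simp
qed

lemma generator_dissipative:
  assumes 1: "(F, G) \<in> gen"
  shows "l2_inner M F G \<le> 0"
proof -
  note L = generator_L2[OF 1]
  have "((\<lambda>h. l2_norm M F * l2_norm M (\<lambda>x. (Q h F x - F x) / h - G x)) \<longlongrightarrow> l2_norm M F * 0) (at_right 0)"
    by (intro tendsto_intros generator_tendsto 1)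
  moreover have "\<forall>\<^sub>F h in at_right 0. l2_inner M F G \<le> l2_norm M F * l2_norm M (\<lambda>x. (Q h F x - F x) / h - G x)"
    using eventually_at_right_less[of 0]
  proof eventually_elim
    case (elim h)
    have QL: "Q h F \<in> L2 M" using elim by (intro Q_L2 L) auto
    have "l2_inner M F (Q h F) \<le> l2_inner M F F"
      using abs_l2_inner_Q_le[of h F F] elim L by (simp add: l2_inner_commute l2_norm_sq[symmetric] power2_eq_square)
    then have "l2_inner M F (\<lambda>x. (Q h F x - F x) / h) \<le> 0"
      using elim by (simp add: l2_inner_simps L2_closed QL L divide_le_0_iff)
    moreover have "l2_inner M F (\<lambda>x. (Q h F x - F x) / h - G x) = l2_inner M F (\<lambda>x. (Q h F x - F x) / h) - l2_inner M F G"
      by (intro l2_inner_diff_right L2_closed QL L)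
    moreover have "\<bar>l2_inner M F (\<lambda>x. (Q h F x - F x) / h - G x)\<bar> \<le> l2_norm M F * l2_norm M (\<lambda>x. (Q h F x - F x) / h - G x)"
      by (intro l2_Cauchy_Schwarz L2_closed QL L)
    ultimately show ?case by linarith
  qed
  ultimately have "l2_inner M F G \<le> l2_norm M F * 0"
    by (intro tendsto_lowerbound[where F="at_right (0::real)"]) auto
  then show ?thesis by simp
qed

end

text \<open>
  A function whose right difference quotients tend to \<open>0\<close> uniformly is constant; it replaces the
  derivative of \<open>Q\<^sub>t u\<close>, which is one-sided in the definition of the generator.
\<close>

lemma const_if_increments_small:
  fixes \<phi> :: "real \<Rightarrow> real"
  assumes inc: "\<And>a h. 0 \<le> a \<Longrightarrow> 0 < h \<Longrightarrow> \<bar>\<phi> (a + h) - \<phi> a\<bar> \<le> h * \<epsilon> h"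
    and \<epsilon>: "(\<epsilon> \<longlongrightarrow> 0) (at_right 0)" and t: "0 \<le> t"
  shows "\<phi> t = \<phi> 0"
proof (cases "t = 0")
  case False
  then have t: "0 < t" using assms by simp
  have "\<bar>\<phi> t - \<phi> 0\<bar> \<le> t * \<epsilon> (t / real (Suc n))" for n
  proof -
    define h where "h = t / real (Suc n)"
    have h: "0 < h" "real (Suc n) * h = t" using t by (auto simp: h_def)
    have "\<bar>\<phi> (real k * h) - \<phi> 0\<bar> \<le> real k * (h * \<epsilon> h)" for k
    proof (induction k)
      case (Suc k)
      have "\<bar>\<phi> (real k * h + h) - \<phi> (real k * h)\<bar> \<le> h * \<epsilon> h" using h by (intro inc) auto
      moreover have "real (Suc k) * h = real k * h + h" by (simp add: algebra_simps)
      ultimately show ?case using Suc by (simp add: algebra_simps)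
    qed simp
    from this[of "Suc n"] show ?thesis unfolding h(2) using h(2) by (simp only: h_def[symmetric] mult.assoc[symmetric])
  qed
  moreover have "(\<lambda>n. t * \<epsilon> (t / real (Suc n))) \<longlonglongrightarrow> t * 0"
  proof (intro tendsto_mult tendsto_const filterlim_compose[OF \<epsilon>])
    have "(\<lambda>n. t / real (Suc n)) \<longlonglongrightarrow> 0" by (rule LIMSEQ_Suc[OF lim_const_over_n])
    then show "LIM n sequentially. t / real (Suc n) :> at_right 0"
      using t by (simp add: filterlim_at)
  qed
  ultimately have "\<bar>\<phi> t - \<phi> 0\<bar> \<le> t * 0"
    by (intro tendsto_lowerbound[of "\<lambda>n. t * \<epsilon> (t / real (Suc n))"]) auto
  then show ?thesis by simp
qed simp

section \<open>Integrals over time intervals and Laplace transforms\<close>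

lemma LINT_const: "a \<le> b \<Longrightarrow> (LINT s:{a..b::real}|lborel. (c::real)) = (b - a) * c"
  by (simp add: set_lebesgue_integral_def mult.commute)

lemma LINT_singleton: "(LINT s:{a..a::real}|lborel. (g s :: real)) = 0"
  unfolding set_lebesgue_integral_def
proof (rule integral_eq_zero_AE)
  show "AE s in lborel. indicat_real {a..a} s *\<^sub>R g s = 0"
    using AE_lborel_singleton[of a] by eventually_elim (simp add: indicator_def)
qed

lemma LINT_abs_le:
  fixes c :: "real \<Rightarrow> real"
  assumes "continuous_on {a..b} c" "a \<le> b" "\<And>s. s \<in> {a..b} \<Longrightarrow> \<bar>c s\<bar> \<le> K"
  shows "\<bar>LINT s:{a..b}|lborel. c s\<bar> \<le> (b - a) * K"
proof -
  have i: "set_integrable lborel {a..b} c" by (rule borel_integrable_atLeastAtMost'[OF assms(1)])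
  have i': "set_integrable lborel {a..b} (\<lambda>s. norm (c s))"
    by (intro borel_integrable_atLeastAtMost' continuous_intros assms(1))
  have k: "set_integrable lborel {a..b} (\<lambda>s. K)"
    by (intro borel_integrable_atLeastAtMost' continuous_intros)
  have "\<bar>LINT s:{a..b}|lborel. c s\<bar> \<le> (LINT s:{a..b}|lborel. norm (c s))"
    using set_integral_norm_bound[OF i] by simp
  also have "\<dots> \<le> (LINT s:{a..b}|lborel. K)"
    by (rule set_integral_mono[OF i' k]) (use assms(3) in auto)
  finally show ?thesis by (simp add: LINT_const assms(2))
qed

lemma LINT_split:
  fixes g :: "real \<Rightarrow> real"
  assumes "set_integrable lborel {a..c} g" "a \<le> b" "b \<le> c"
  shows "(LINT s:{a..c}|lborel. g s) = (LINT s:{a..b}|lborel. g s) + (LINT s:{b..c}|lborel. g s)"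
proof -
  have "{a..c} = {a..b} \<union> {b..c}" using assms by auto
  moreover have "(LINT s:{a..b}\<union>{b..c}|lborel. g s) = (LINT s:{a..b}|lborel. g s) + (LINT s:{b..c}|lborel. g s)"
  proof (rule set_integral_Un_AE)
    have "AE s in lborel. s \<noteq> b" by (rule AE_lborel_singleton)
    then show "AE s in lborel. \<not> (s \<in> {a..b} \<and> s \<in> {b..c})" by eventually_elim auto
    show "set_integrable lborel {a..b} g" "set_integrable lborel {b..c} g"
      using assms by (auto intro: set_integrable_subset)
  qed auto
  ultimately show ?thesis by simp
qed

lemma LINT_shift:
  fixes g :: "real \<Rightarrow> real"
  shows "(LINT s:{a+h..b+h}|lborel. g s) = (LINT s:{a..b}|lborel. g (s + h))"
  unfolding set_lebesgue_integral_def
  by (subst lborel_integral_real_affine[where t=h and c=1])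
    (auto intro!: Bochner_Integration.integral_cong simp: indicator_def add.commute)

lemma LINT_reflect:
  fixes g :: "real \<Rightarrow> real"
  shows "(LINT s:{0..t}|lborel. g (t - s)) = (LINT s:{0..t}|lborel. g s)"
  unfolding set_lebesgue_integral_def
  by (subst lborel_integral_real_affine[where t=t and c="-1"])
    (auto intro!: Bochner_Integration.integral_cong simp: indicator_def)

lemma LINT_has_derivative:
  fixes c :: "real \<Rightarrow> real"
  assumes c: "continuous_on {a..T} c" and t: "t \<in> {a..T}"
  shows "((\<lambda>t. LINT s:{a..t}|lborel. c s) has_real_derivative c t) (at t within {a..T})"
proof (rule has_field_derivative_transform_within[OF integral_has_real_derivative[OF c t] zero_less_one t])
  fix x assume "x \<in> {a..T}"
  then have "continuous_on {a..x} c" using c by (auto intro: continuous_on_subset)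
  then show "integral {a..x} c = (LINT s:{a..x}|lborel. c s)"
    by (intro set_borel_integral_eq_integral(2)[symmetric] borel_integrable_atLeastAtMost')
qed

lemma LINT_FTC:
  fixes F f :: "real \<Rightarrow> real"
  assumes "a \<le> b" "\<And>x. x \<in> {a..b} \<Longrightarrow> (F has_real_derivative f x) (at x within {a..b})" "continuous_on {a..b} f"
  shows "(LINT s:{a..b}|lborel. f s) = F b - F a"
  unfolding set_lebesgue_integral_def
  using assms by (intro integral_FTC_atLeastAtMost) (auto simp: has_real_derivative_iff_has_vector_derivative)

lemma continuous_on_LINT:
  fixes c :: "real \<Rightarrow> real"
  assumes c: "continuous_on {a..} c"
  shows "continuous_on {a..} (\<lambda>t. LINT s:{a..t}|lborel. c s)"
  unfolding continuous_on_eq_continuous_within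
proof
  fix t assume t: "t \<in> {a..}"
  have "continuous_on {a..t+1} c" using c by (auto intro: continuous_on_subset)
  from LINT_has_derivative[OF this, of t]
  have "continuous (at t within {a..t+1}) (\<lambda>t. LINT s:{a..t}|lborel. c s)"
    using t by (auto intro: has_field_derivative_imp_has_derivative has_derivative_continuous)
  moreover have "at t within {a..t+1} = at t within {a..}"
    by (rule at_within_nhd[of _ "{..<t+1}"]) auto
  ultimately show "continuous (at t within {a..}) (\<lambda>t. LINT s:{a..t}|lborel. c s)" by simp
qed

definition laplace :: "real \<Rightarrow> (real \<Rightarrow> real) \<Rightarrow> real" where
  "laplace l c = (LINT s:{0..}|lborel. exp (- l * s) * c s)"

lemma exp_set_integrable:
  assumes "0 < l"
  shows "set_integrable lborel {0..} (\<lambda>s. exp (- l * s))" "laplace l (\<lambda>s. 1) = 1 / l"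
proof -
  interpret E: prob_space "density lborel (exponential_density l)"
    by (rule prob_space_exponential_density[OF assms])
  have "(\<integral>\<^sup>+s. ennreal (exponential_density l s) \<partial>lborel) = 1"
    using E.emeasure_space_1 by (simp add: emeasure_density)
  then have *: "(\<integral>\<^sup>+s. ennreal (indicator {0..} s * (l * exp (- l * s))) \<partial>lborel) = 1"
    by (auto intro!: nn_integral_cong simp: exponential_density_def indicator_def mult.commute elim!: back_subst[where P="\<lambda>x. x = 1"])
  have i: "integrable lborel (\<lambda>s. indicator {0..} s * (l * exp (- l * s)))"
    using assms by (intro integrableI_nonneg) (use * in auto)
  then have i2: "integrable lborel (\<lambda>s. (1/l) * (indicator {0..} s * (l * exp (- l * s))))"
    by (rule integrable_mult_right)
  also have "(\<lambda>s. (1/l) * (indicator {0..} s * (l * exp (- l * s)))) = (\<lambda>s. indicator {0..} s *\<^sub>R exp (- l * s))"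
    using assms by auto
  finally show "set_integrable lborel {0..} (\<lambda>s. exp (- l * s))" unfolding set_integrable_def .
  have "ennreal (\<integral>s. indicator {0..} s * (l * exp (- l * s)) \<partial>lborel) = 1"
    unfolding *[symmetric] using assms by (intro nn_integral_eq_integral[symmetric] i) auto
  then have "(\<integral>s. indicator {0..} s * (l * exp (- l * s)) \<partial>lborel) = 1"
    using assms by (subst (asm) ennreal_1[symmetric], subst (asm) ennreal_inj) (auto intro!: integral_nonneg)
  then have "l * (\<integral>s. indicator {0..} s * exp (- l * s) \<partial>lborel) = 1"
    by (simp add: mult.left_commute)
  then show "laplace l (\<lambda>s. 1) = 1 / l"
    unfolding laplace_def set_lebesgue_integral_def using assms by (simp add: field_simps)
qed

lemma laplace_integrable:
  fixes l a K :: real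
  assumes c: "continuous_on {0..} c" and K: "\<And>s. 0 \<le> s \<Longrightarrow> \<bar>c s\<bar> \<le> K * exp (a * s)" and a: "a < l"
  shows "set_integrable lborel {0..} (\<lambda>s. exp (- l * s) * c s)"
proof (rule set_integrable_bound[where f="\<lambda>s. K * exp (- (l - a) * s)"])
  show "set_integrable lborel {0..} (\<lambda>s. K * exp (- (l - a) * s))"
    using exp_set_integrable(1)[of "l - a"] a by (intro set_integrable_mult_right) auto
  have "continuous_on {0..} (\<lambda>s. exp (- l * s) * c s)" by (intro continuous_intros c)
  from borel_measurable_continuous_on_indicator[OF _ this]
  show "set_borel_measurable lborel {0..} (\<lambda>s. exp (- l * s) * c s)"
    unfolding set_borel_measurable_def by simp
  have "norm (exp (- l * s) * c s) \<le> norm (K * exp (- (l - a) * s))" if "s \<in> {0..}" for s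
  proof -
    have "\<bar>exp (- l * s) * c s\<bar> = exp (- l * s) * \<bar>c s\<bar>" by (simp add: abs_mult)
    also have "\<dots> \<le> exp (- l * s) * (K * exp (a * s))" using K that by (intro mult_left_mono) auto
    also have "\<dots> = K * exp (- (l - a) * s)" by (simp add: exp_add[symmetric] algebra_simps flip: exp_add)
    finally show ?thesis by simp
  qed
  then show "AE s in lborel. s \<in> {0..} \<longrightarrow> norm (exp (- l * s) * c s) \<le> norm (K * exp (- (l - a) * s))"
    by auto
qed

lemma laplace_tendsto:
  assumes "set_integrable lborel {0..} (\<lambda>s. exp (- l * s) * c s)"
  shows "((\<lambda>T. LINT s:{0..T}|lborel. exp (- l * s) * c s) \<longlongrightarrow> laplace l c) at_top"
  unfolding laplace_def using assms by (intro tendsto_set_lebesgue_integral_at_top) auto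

lemma laplace_abs_le:
  assumes c: "continuous_on {0..} c" and K: "\<And>s. 0 \<le> s \<Longrightarrow> \<bar>c s\<bar> \<le> K" and l: "0 < l"
  shows "\<bar>laplace l c\<bar> \<le> K / l"
proof -
  have i: "set_integrable lborel {0..} (\<lambda>s. exp (- l * s) * c s)"
    by (rule laplace_integrable[where a=0, OF c _ l]) (use K in simp)
  have "\<bar>laplace l c\<bar> \<le> (LINT s:{0..}|lborel. norm (exp (- l * s) * c s))"
    unfolding laplace_def using set_integral_norm_bound[OF i] by simp
  also have "\<dots> \<le> (LINT s:{0..}|lborel. K * exp (- l * s))"
    using exp_set_integrable(1)[OF l] K
    by (intro set_integral_mono set_integrable_norm i set_integrable_mult_right) (auto simp: abs_mult mult.commute mult_right_mono)
  also have "\<dots> = K * laplace l (\<lambda>s. 1)" unfolding laplace_def by simp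
  finally show ?thesis using exp_set_integrable(2)[OF l] by simp
qed

text \<open>
  Substitution \<open>s \<mapsto> s + h\<close>.
\<close>

lemma laplace_shift:
  assumes i: "set_integrable lborel {0..} (\<lambda>s. exp (- l * s) * c s)"
    and i': "set_integrable lborel {0..} (\<lambda>s. exp (- l * s) * c (h + s))" and h: "0 \<le> h"
  shows "laplace l (\<lambda>s. c (h + s)) = exp (l * h) * (laplace l c - (LINT s:{0..h}|lborel. exp (- l * s) * c s))"
proof (rule tendsto_unique[OF _ laplace_tendsto[OF i']])
  let ?I = "\<lambda>T. LINT s:{0..T}|lborel. exp (- l * s) * c s"
  have "((\<lambda>T. ?I (T + h)) \<longlongrightarrow> laplace l c) at_top"
    by (rule filterlim_compose[OF laplace_tendsto[OF i]]) (subst add.commute, rule filterlim_tendsto_add_at_top[OF tendsto_const filterlim_ident])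
  then have "((\<lambda>T. exp (l * h) * (?I (T + h) - ?I h)) \<longlongrightarrow> exp (l * h) * (laplace l c - ?I h)) at_top"
    by (intro tendsto_intros)
  moreover have "\<forall>\<^sub>F T in at_top. exp (l * h) * (?I (T + h) - ?I h) = (LINT s:{0..T}|lborel. exp (- l * s) * c (h + s))"
    using eventually_ge_at_top[of 0]
  proof eventually_elim
    case (elim T)
    have "?I (T + h) - ?I h = (LINT s:{0+h..T+h}|lborel. exp (- l * s) * c s)"
      using LINT_split[of 0 "T+h" "\<lambda>s. exp (- l * s) * c s" h] set_integrable_subset[OF i, of "{0..T+h}"] h elim by simp
    also have "\<dots> = (LINT s:{0..T}|lborel. exp (- l * (s+h)) * c (s+h))" by (rule LINT_shift)
    also have "\<dots> = (LINT s:{0..T}|lborel. exp (- l * h) * (exp (- l * s) * c (h+s)))"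
      by (intro set_lebesgue_integral_cong) (auto simp: exp_add[symmetric] algebra_simps simp flip: exp_add)
    also have "\<dots> = exp (- l * h) * (LINT s:{0..T}|lborel. exp (- l * s) * c (h+s))" by simp
    finally show ?case by (simp add: exp_minus field_simps)
  qed
  ultimately show "((\<lambda>T. LINT s:{0..T}|lborel. exp (- l * s) * c (h + s)) \<longlongrightarrow> exp (l * h) * (laplace l c - ?I h)) at_top"
    by (rule Lim_transform_eventually)
qed simp

text \<open>
  Integration by parts. The bounds are exponential because the lemma is also applied to primitives,
  which may grow linearly.
\<close>

lemma laplace_LINT:
  fixes l a K :: real
  assumes c: "continuous_on {0..} c" and K: "\<And>s. 0 \<le> s \<Longrightarrow> \<bar>c s\<bar> \<le> K * exp (a * s)"
    and a: "0 < a" "a < l"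
  defines "I \<equiv> \<lambda>t. LINT s:{0..t}|lborel. c s"
  shows "\<And>t. 0 \<le> t \<Longrightarrow> \<bar>I t\<bar> \<le> (K / a) * exp (a * t)" "laplace l c = l * laplace l I"
proof -
  have cI: "continuous_on {0..} I" unfolding I_def by (rule continuous_on_LINT[OF c])
  have K0: "0 \<le> K" using K[of 0] by simp
  show Ib: "\<bar>I t\<bar> \<le> (K / a) * exp (a * t)" if t: "0 \<le> t" for t
  proof -
    have ct: "continuous_on {0..t} c" using c by (rule continuous_on_subset) auto
    have i: "set_integrable lborel {0..t} c" by (rule borel_integrable_atLeastAtMost'[OF ct])
    have "\<bar>I t\<bar> \<le> (LINT s:{0..t}|lborel. norm (c s))"
      unfolding I_def using set_integral_norm_bound[OF i] by simp
    also have "\<dots> \<le> (LINT s:{0..t}|lborel. K * exp (a * s))"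
      using K by (intro set_integral_mono set_integrable_norm i borel_integrable_atLeastAtMost' continuous_intros) auto
    also have "\<dots> = K / a * exp (a * t) - K / a * exp (a * 0)"
      using t a by (intro LINT_FTC) (auto intro!: derivative_eq_intros continuous_intros)
    also have "\<dots> \<le> K / a * exp (a * t)" using K0 a by simp
    finally show ?thesis .
  qed
  have ic: "set_integrable lborel {0..} (\<lambda>s. exp (- l * s) * c s)"
    by (rule laplace_integrable[OF c K a(2)])
  have iI: "set_integrable lborel {0..} (\<lambda>s. exp (- l * s) * I s)"
    by (rule laplace_integrable[OF cI Ib a(2)])
  have eq: "(LINT s:{0..T}|lborel. exp (- l * s) * c s) - l * (LINT s:{0..T}|lborel. exp (- l * s) * I s) = exp (- l * T) * I T"
    if T: "0 \<le> T" for T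
  proof -
    have cT: "continuous_on {0..T} c" "continuous_on {0..T} I" using c cI by (auto intro: continuous_on_subset)
    have "(LINT s:{0..T}|lborel. exp (- l * s) * c s) - l * (LINT s:{0..T}|lborel. exp (- l * s) * I s)
      = (LINT s:{0..T}|lborel. exp (- l * s) * c s - l * (exp (- l * s) * I s))"
      using set_integrable_subset[OF ic, of "{0..T}"] set_integrable_subset[OF iI, of "{0..T}"]
      by (subst set_integral_diff) auto
    also have "\<dots> = exp (- l * T) * I T - exp (- l * 0) * I 0"
    proof (rule LINT_FTC[OF T])
      fix x assume x: "x \<in> {0..T}"
      have "(I has_real_derivative c x) (at x within {0..T})"
        unfolding I_def by (rule LINT_has_derivative[OF cT(1) x])
      then show "((\<lambda>s. exp (- l * s) * I s) has_real_derivative exp (- l * x) * c x - l * (exp (- l * x) * I x)) (at x within {0..T})"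
        by (auto intro!: derivative_eq_intros)
    qed (intro continuous_intros cT)
    also have "I 0 = 0" unfolding I_def by (rule LINT_singleton)
    finally show ?thesis by simp
  qed
  have "((\<lambda>T. exp (- l * T) * I T) \<longlongrightarrow> 0) at_top"
  proof (rule Lim_null_comparison)
    have "((\<lambda>T. K / a * exp (- ((l - a) * T))) \<longlongrightarrow> K / a * 0) at_top"
      using a by (intro tendsto_mult tendsto_const filterlim_compose[OF exp_at_bot]
        filterlim_compose[OF filterlim_uminus_at_bot_at_top] filterlim_tendsto_pos_mult_at_top[OF tendsto_const] filterlim_ident) auto
    then show "((\<lambda>T. K / a * exp (- ((l - a) * T))) \<longlongrightarrow> 0) at_top" by simp
    show "\<forall>\<^sub>F T in at_top. norm (exp (- l * T) * I T) \<le> K / a * exp (- ((l - a) * T))"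
      using eventually_ge_at_top[of 0]
    proof eventually_elim
      case (elim T)
      have "norm (exp (- l * T) * I T) = exp (- l * T) * \<bar>I T\<bar>" by (simp add: abs_mult)
      also have "\<dots> \<le> exp (- l * T) * ((K / a) * exp (a * T))" using Ib[OF elim] by (intro mult_left_mono) auto
      also have "\<dots> = K / a * exp (- ((l - a) * T))" by (simp add: algebra_simps flip: exp_add)
      finally show ?case .
    qed
  qed
  moreover have "((\<lambda>T. (LINT s:{0..T}|lborel. exp (- l * s) * c s) - l * (LINT s:{0..T}|lborel. exp (- l * s) * I s))
     \<longlongrightarrow> laplace l c - l * laplace l I) at_top"
    by (intro tendsto_intros laplace_tendsto ic iI)
  then have "((\<lambda>T. exp (- l * T) * I T) \<longlongrightarrow> laplace l c - l * laplace l I) at_top"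
    by (rule Lim_transform_eventually[OF _ eventually_mono[OF eventually_ge_at_top[of "0::real"] eq]])
  ultimately have "laplace l c - l * laplace l I = 0" using tendsto_unique trivial_limit_at_top_linorder by blast
  then show "laplace l c = l * laplace l I" by simp
qed

section \<open>Resolvents\<close>

context L2_contraction_semigroup
begin

text \<open>
  Weak differentiability at \<open>0\<close>, uniformly on the unit ball, is strong differentiability.
\<close>

lemma generatorI_weak:
  assumes L: "u \<in> L2 M" "k \<in> L2 M"
    and w: "\<And>e. 0 < e \<Longrightarrow> \<exists>d>0. \<forall>h. 0 < h \<longrightarrow> h < d \<longrightarrow>
      (\<forall>H\<in>L2 M. \<bar>l2_inner M (Q h u) H - l2_inner M u H - h * l2_inner M k H\<bar> \<le> e * h * l2_norm M H)"
  shows "(u, k) \<in> gen"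
proof (rule generatorI[OF L], rule tendstoI)
  fix e :: real assume e: "0 < e"
  then obtain d where d: "0 < d" and dd: "\<And>h H. 0 < h \<Longrightarrow> h < d \<Longrightarrow> H \<in> L2 M \<Longrightarrow>
      \<bar>l2_inner M (Q h u) H - l2_inner M u H - h * l2_inner M k H\<bar> \<le> e/2 * h * l2_norm M H"
    using w[of "e/2"] by auto
  have "l2_norm M (\<lambda>x. (Q h u x - u x) / h - k x) \<le> e / 2" if h: "0 < h" "h < d" for h
  proof (rule l2_norm_le_if_weak)
    have QL: "Q h u \<in> L2 M" using h L by (intro Q_L2) auto
    show "(\<lambda>x. (Q h u x - u x) / h - k x) \<in> L2 M" by (intro L2_closed QL L)
    fix H assume H: "H \<in> L2 M"
    define D where "D = l2_inner M (Q h u) H - l2_inner M u H - h * l2_inner M k H"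
    have 1: "l2_inner M (\<lambda>x. (Q h u x - u x) / h - k x) H = D / h"
      unfolding D_def using h by (simp add: l2_inner_simps L2_closed QL L H field_simps)
    have "\<bar>D\<bar> \<le> e / 2 * h * l2_norm M H" unfolding D_def by (rule dd[OF h H])
    then have "\<bar>D\<bar> / h \<le> (e / 2 * h * l2_norm M H) / h" using h(1) by (intro divide_right_mono) auto
    also have "\<dots> = e / 2 * l2_norm M H" using h(1) by simp
    finally show "\<bar>l2_inner M (\<lambda>x. (Q h u x - u x) / h - k x) H\<bar> \<le> e / 2 * l2_norm M H"
      unfolding 1 abs_divide using h(1) by simp
  qed (use e in auto)
  then have "dist (l2_norm M (\<lambda>x. (Q h u x - u x) / h - k x)) 0 < e" if "0 < h" "h < d" for h
    using that e by (fastforce simp: l2_norm_nonneg)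
  then show "\<forall>\<^sub>F h in at_right 0. dist (l2_norm M (\<lambda>x. (Q h u x - u x) / h - k x)) 0 < e"
    unfolding eventually_at_right_field using d by blast
qed

lemma Q_near_identity:
  assumes F: "F \<in> L2 M" and e: "0 < e"
  obtains d where "0 < d" "\<And>s. 0 \<le> s \<Longrightarrow> s < d \<Longrightarrow> l2_norm M (\<lambda>x. Q s F x - F x) < e"
proof -
  have "\<forall>\<^sub>F h in at_right 0. l2_norm M (\<lambda>x. Q h F x - F x) < e"
    using Q_norm_tendsto[OF F] e by (rule order_tendstoD)
  then obtain d where d: "0 < d" "\<And>h. 0 < h \<Longrightarrow> h < d \<Longrightarrow> l2_norm M (\<lambda>x. Q h F x - F x) < e"
    unfolding eventually_at_right_field by auto
  have "l2_norm M (\<lambda>x. Q 0 F x - F x) = l2_norm M (\<lambda>x. 0)"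
    using Q_zero[OF F] by (intro l2_norm_cong_AE) (auto intro!: borel_measurable_diff L2_measurable[OF F] L2_measurable[OF Q_L2[OF _ F]])
  then have "l2_norm M (\<lambda>x. Q 0 F x - F x) < e" using e by (simp add: l2_norm_zero)
  then have "l2_norm M (\<lambda>x. Q s F x - F x) < e" if "0 \<le> s" "s < d" for s
    using d that by (cases "s = 0") auto
  then show ?thesis using d that by blast
qed

lemma LINT_Q_minus_le:
  assumes k: "k \<in> L2 M" and H: "H \<in> L2 M" and h: "0 \<le> h" and a: "0 \<le> a"
    and e: "\<And>s. 0 \<le> s \<Longrightarrow> s \<le> h \<Longrightarrow> l2_norm M (\<lambda>x. Q s k x - k x) \<le> e"
  shows "\<bar>(LINT s:{a..a+h}|lborel. l2_inner M (Q s k) H) - h * l2_inner M (Q a k) H\<bar> \<le> h * (e * l2_norm M H)"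
proof -
  have c: "continuous_on {a..a+h} (\<lambda>s. l2_inner M (Q s k) H)"
    by (rule continuous_on_l2_inner_Q'[OF k H a])
  have "(LINT s:{a..a+h}|lborel. l2_inner M (Q s k) H) - h * l2_inner M (Q a k) H
     = (LINT s:{a..a+h}|lborel. l2_inner M (Q s k) H - l2_inner M (Q a k) H)"
    using h by (subst set_integral_diff) (auto intro!: borel_integrable_atLeastAtMost' c continuous_intros simp: LINT_const)
  also have "\<bar>\<dots>\<bar> \<le> (a + h - a) * (e * l2_norm M H)"
  proof (rule LINT_abs_le)
    fix s assume s: "s \<in> {a..a+h}"
    have "\<bar>l2_inner M (Q s k) H - l2_inner M (Q a k) H\<bar> = \<bar>l2_inner M (\<lambda>x. Q s k x - Q a k x) H\<bar>"
      using s a by (simp add: l2_inner_simps Q_L2 k H)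
    also have "\<dots> \<le> l2_norm M (\<lambda>x. Q s k x - Q a k x) * l2_norm M H"
      using s a by (intro l2_Cauchy_Schwarz L2_closed Q_L2 k H) auto
    also have "\<dots> \<le> e * l2_norm M H"
      using Q_increment_norm[of a "s - a" k] e[of "s - a"] s a k
      by (intro mult_right_mono l2_norm_nonneg) auto
    finally show "\<bar>l2_inner M (Q s k) H - l2_inner M (Q a k) H\<bar> \<le> e * l2_norm M H" .
  qed (use h in \<open>auto intro!: c continuous_intros\<close>)
  finally show ?thesis by simp
qed

text \<open>
  Together with \<open>generator_mild\<close>, the generator is characterised by
  \<open>\<langle>Q\<^sub>h u, H\<rangle> - \<langle>u, H\<rangle> = \<integral>\<^sub>0\<^sup>h \<langle>Q\<^sub>s k, H\<rangle> ds\<close>, which involves only integrals of real functions.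
\<close>

lemma generatorI_mild:
  assumes L: "u \<in> L2 M" "k \<in> L2 M"
    and m: "\<And>h H. 0 \<le> h \<Longrightarrow> H \<in> L2 M \<Longrightarrow>
        l2_inner M (Q h u) H - l2_inner M u H = (LINT s:{0..h}|lborel. l2_inner M (Q s k) H)"
  shows "(u, k) \<in> gen"
proof (rule generatorI_weak[OF L])
  fix e :: real assume "0 < e"
  from Q_near_identity[OF L(2) this] obtain d where d: "0 < d"
    "\<And>s. 0 \<le> s \<Longrightarrow> s < d \<Longrightarrow> l2_norm M (\<lambda>x. Q s k x - k x) < e" by blast
  show "\<exists>d>0. \<forall>h. 0 < h \<longrightarrow> h < d \<longrightarrow>
      (\<forall>H\<in>L2 M. \<bar>l2_inner M (Q h u) H - l2_inner M u H - h * l2_inner M k H\<bar> \<le> e * h * l2_norm M H)"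
  proof (intro exI[of _ d] conjI allI impI ballI d(1))
    fix h H assume h: "0 < h" "h < d" and H: "H \<in> L2 M"
    show "\<bar>l2_inner M (Q h u) H - l2_inner M u H - h * l2_inner M k H\<bar> \<le> e * h * l2_norm M H"
      using LINT_Q_minus_le[OF L(2) H, of h 0 e] d(2) h m[OF _ H, of h] L
      by (force simp: l2_inner_Q_zero[OF L(2) H] algebra_simps intro: less_imp_le)
  qed
qed

lemma generator_mild:
  assumes g: "(u, k) \<in> gen" and t: "0 \<le> t" and H: "H \<in> L2 M"
  shows "l2_inner M (Q t u) H - l2_inner M u H = (LINT s:{0..t}|lborel. l2_inner M (Q s k) H)"
proof -
  note L = generator_L2[OF g]
  define \<phi> where "\<phi> t = l2_inner M (Q t u) H - (LINT s:{0..t}|lborel. l2_inner M (Q s k) H)" for t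
  \<comment> \<open>modulus of continuity of \<open>s \<mapsto> Q\<^sub>s k\<close> at \<open>0\<close>\<close>
  define \<delta> where "\<delta> h = (SUP s\<in>{0..h}. l2_norm M (\<lambda>x. Q s k x - k x))" for h
  have bdd: "bdd_above ((\<lambda>s. l2_norm M (\<lambda>x. Q s k x - k x)) ` {0..h})" for h
  proof (rule bdd_aboveI2)
    fix s assume "s \<in> {0..h}"
    then show "l2_norm M (\<lambda>x. Q s k x - k x) \<le> 2 * l2_norm M k"
      using l2_norm_triangle_diff[OF Q_L2[OF _ L(2), of s] L(2)] Q_contraction[OF _ L(2), of s] by auto
  qed
  have \<delta>: "l2_norm M (\<lambda>x. Q s k x - k x) \<le> \<delta> h" if "0 \<le> s" "s \<le> h" for s h
    unfolding \<delta>_def using that by (intro cSUP_upper bdd) auto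
  have \<delta>0: "(\<delta> \<longlongrightarrow> 0) (at_right 0)"
  proof (rule tendstoI)
    fix e :: real assume "0 < e"
    then obtain d where d: "0 < d" "\<And>s. 0 \<le> s \<Longrightarrow> s < d \<Longrightarrow> l2_norm M (\<lambda>x. Q s k x - k x) < e/2"
      using Q_near_identity[OF L(2), of "e/2"] by (metis half_gt_zero)
    have "\<bar>\<delta> h\<bar> < e" if h: "0 < h" "h < d" for h
    proof -
      have "\<delta> h \<le> e/2" unfolding \<delta>_def using h d by (intro cSUP_least) (auto intro: less_imp_le)
      moreover have "0 \<le> \<delta> h" using order_trans[OF l2_norm_nonneg \<delta>[of 0 h]] h by simp
      ultimately show ?thesis using \<open>0 < e\<close> by simp
    qed
    then show "\<forall>\<^sub>F h in at_right 0. dist (\<delta> h) 0 < e"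
      unfolding eventually_at_right_field using d by (auto intro!: exI[of _ d])
  qed
  have "\<phi> t = \<phi> 0"
  proof (rule const_if_increments_small[where \<epsilon>="\<lambda>h. (l2_norm M (\<lambda>x. (Q h u x - u x) / h - k x) + \<delta> h) * l2_norm M H"])
    have "((\<lambda>h. (l2_norm M (\<lambda>x. (Q h u x - u x) / h - k x) + \<delta> h) * l2_norm M H) \<longlongrightarrow> (0 + 0) * l2_norm M H) (at_right 0)"
      by (intro tendsto_intros generator_tendsto g \<delta>0)
    then show "((\<lambda>h. (l2_norm M (\<lambda>x. (Q h u x - u x) / h - k x) + \<delta> h) * l2_norm M H) \<longlongrightarrow> 0) (at_right 0)" by simp
    fix a h :: real assume a: "0 \<le> a" and h: "0 < h"
    have QL: "Q h u \<in> L2 M" "Q a u \<in> L2 M" "Q (a + h) u \<in> L2 M" "Q a k \<in> L2 M"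
      using a h L by (auto intro!: Q_L2)
    have dL: "(\<lambda>x. (Q h u x - u x) / h - k x) \<in> L2 M" by (intro L2_closed QL L)
    have w: "(\<lambda>x. 1 * Q h u x + (-1) * u x) \<in> L2 M" "(\<lambda>x. (1/h) * (1 * Q h u x + (-1) * u x) + (-1) * k x) \<in> L2 M"
      by (intro L2_lincomb QL L)+
    have i1: "l2_inner M (Q a (\<lambda>x. (1/h) * (1 * Q h u x + (-1) * u x) + (-1) * k x)) H
      = (1/h) * (l2_inner M (Q (a + h) u) H - l2_inner M (Q a u) H) - l2_inner M (Q a k) H"
      using a h by (simp only: l2_inner_Q_lincomb w QL L H l2_inner_Q_add less_imp_le) simp
    have "\<bar>l2_inner M (Q a (\<lambda>x. (1/h) * (1 * Q h u x + (-1) * u x) + (-1) * k x)) H\<bar>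
       \<le> l2_norm M (\<lambda>x. (1/h) * (1 * Q h u x + (-1) * u x) + (-1) * k x) * l2_norm M H"
      by (rule abs_l2_inner_Q_le[OF a w(2) H])
    then have "\<bar>(1/h) * (l2_inner M (Q (a + h) u) H - l2_inner M (Q a u) H) - l2_inner M (Q a k) H\<bar>
       \<le> l2_norm M (\<lambda>x. (Q h u x - u x) / h - k x) * l2_norm M H"
      unfolding i1 by simp
    then have "h * \<bar>(1/h) * (l2_inner M (Q (a + h) u) H - l2_inner M (Q a u) H) - l2_inner M (Q a k) H\<bar>
       \<le> h * (l2_norm M (\<lambda>x. (Q h u x - u x) / h - k x) * l2_norm M H)" (is "h * \<bar>?x\<bar> \<le> ?b")
      using h by (intro mult_left_mono) auto
    moreover have "h * \<bar>?x\<bar> = \<bar>l2_inner M (Q (a + h) u) H - l2_inner M (Q a u) H - h * l2_inner M (Q a k) H\<bar>"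
    proof -
      have "h * \<bar>?x\<bar> = \<bar>h * ?x\<bar>" using h by (simp add: abs_mult)
      also have "h * ?x = l2_inner M (Q (a + h) u) H - l2_inner M (Q a u) H - h * l2_inner M (Q a k) H"
        using h by (simp add: field_simps)
      finally show ?thesis .
    qed
    ultimately have 1: "\<bar>l2_inner M (Q (a + h) u) H - l2_inner M (Q a u) H - h * l2_inner M (Q a k) H\<bar> \<le> ?b" by simp
    have 2: "\<bar>(LINT s:{a..a+h}|lborel. l2_inner M (Q s k) H) - h * l2_inner M (Q a k) H\<bar> \<le> h * (\<delta> h * l2_norm M H)"
      using h a by (intro LINT_Q_minus_le L H \<delta>) auto
    have "(LINT s:{0..a+h}|lborel. l2_inner M (Q s k) H) = (LINT s:{0..a}|lborel. l2_inner M (Q s k) H) + (LINT s:{a..a+h}|lborel. l2_inner M (Q s k) H)"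
      using a h by (intro LINT_split borel_integrable_atLeastAtMost' continuous_on_l2_inner_Q' L H) auto
    then show "\<bar>\<phi> (a + h) - \<phi> a\<bar> \<le> h * ((l2_norm M (\<lambda>x. (Q h u x - u x) / h - k x) + \<delta> h) * l2_norm M H)"
      using 1 2 unfolding \<phi>_def by (simp add: algebra_simps)
  qed (rule t)
  moreover have "\<phi> 0 = l2_inner M u H"
  proof -
    have "(LINT s:{0..0}|lborel. l2_inner M (Q s k) H) = 0"
      by (rule LINT_singleton)
    then show ?thesis unfolding \<phi>_def by (simp add: l2_inner_Q_zero L H)
  qed
  ultimately show ?thesis unfolding \<phi>_def by simp
qed

text \<open>
  The resolvent, the solution of \<open>(l - L) u = F\<close>, is obtained weakly, as the Laplace transform of
  \<open>Q\<^sub>s F\<close>.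
\<close>

lemma resolvent_exists:
  assumes F: "F \<in> L2 M" and l: "0 < l"
  obtains u where "u \<in> L2 M" "\<And>H. H \<in> L2 M \<Longrightarrow> l2_inner M u H = laplace l (\<lambda>s. l2_inner M (Q s F) H)"
proof -
  note c = continuous_on_l2_inner_Q[OF F]
  have i: "set_integrable lborel {0..} (\<lambda>s. exp (- l * s) * l2_inner M (Q s F) H)" if "H \<in> L2 M" for H
    by (rule laplace_integrable[where a=0 and K="l2_norm M F * l2_norm M H"])
      (use abs_l2_inner_Q_le[OF _ F that] l c[OF that] in auto)
  obtain u where "u \<in> L2 M" "\<And>H. H \<in> L2 M \<Longrightarrow> l2_inner M u H = laplace l (\<lambda>s. l2_inner M (Q s F) H)"
  proof (rule L2_Riesz[of "\<lambda>H. laplace l (\<lambda>s. l2_inner M (Q s F) H)" "l2_norm M F / l"])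
    fix H K s assume HK: "H \<in> L2 M" "K \<in> L2 M"
    have "laplace l (\<lambda>r. l2_inner M (Q r F) (\<lambda>x. H x + s * K x))
      = (LINT r:{0..}|lborel. exp (- l * r) * l2_inner M (Q r F) H + s * (exp (- l * r) * l2_inner M (Q r F) K))"
      unfolding laplace_def using HK F
      by (intro set_lebesgue_integral_cong) (auto simp: l2_inner_simps L2_closed Q_L2 algebra_simps)
    also have "\<dots> = laplace l (\<lambda>r. l2_inner M (Q r F) H) + s * laplace l (\<lambda>r. l2_inner M (Q r F) K)"
      unfolding laplace_def set_integral_mult_right[symmetric]
      by (rule set_integral_add(2)[OF i[OF HK(1)] set_integrable_mult_right[OF i[OF HK(2)]]])
    finally show "laplace l (\<lambda>r. l2_inner M (Q r F) (\<lambda>x. H x + s * K x)) = \<dots>" .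
  next
    fix H assume H: "H \<in> L2 M"
    show "\<bar>laplace l (\<lambda>s. l2_inner M (Q s F) H)\<bar> \<le> l2_norm M F / l * l2_norm M H"
      using laplace_abs_le[OF c[OF H] _ l, of "l2_norm M F * l2_norm M H"] abs_l2_inner_Q_le[OF _ F H] by simp
  qed blast
  then show ?thesis using that by blast
qed

lemma resolvent_shift:
  assumes F: "F \<in> L2 M" and l: "0 < l" and u: "u \<in> L2 M"
    and res: "\<And>H. H \<in> L2 M \<Longrightarrow> l2_inner M u H = laplace l (\<lambda>s. l2_inner M (Q s F) H)"
    and h: "0 \<le> h" and H: "H \<in> L2 M"
  shows "l2_inner M (Q h u) H = exp (l * h) * (l2_inner M u H - (LINT s:{0..h}|lborel. exp (- l * s) * l2_inner M (Q s F) H))"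
proof -
  \<comment> \<open>moving \<open>Q\<^sub>h\<close> to the other side turns \<open>\<langle>Q\<^sub>h u, H\<rangle>\<close> into a Laplace transform\<close>
  obtain g where g: "g \<in> L2 M" "\<And>F. F \<in> L2 M \<Longrightarrow> l2_inner M (Q h F) H = l2_inner M F g"
    using adjoint_exists[OF h H] by blast
  have i: "set_integrable lborel {0..} (\<lambda>s. exp (- l * s) * l2_inner M (Q s F) H)" if "H \<in> L2 M" for H
    by (rule laplace_integrable[where a=0 and K="l2_norm M F * l2_norm M H"])
      (use abs_l2_inner_Q_le[OF _ F that] l continuous_on_l2_inner_Q[OF F that] in auto)
  have eq: "l2_inner M (Q s F) g = l2_inner M (Q (h + s) F) H" if "0 \<le> s" for s
    using g(2)[OF Q_L2[OF that F]] l2_inner_Q_add[OF h that F H] by simp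
  have "l2_inner M (Q h u) H = laplace l (\<lambda>s. l2_inner M (Q s F) g)"
    using g u by (simp add: res)
  also have "\<dots> = laplace l (\<lambda>s. l2_inner M (Q (h + s) F) H)"
    unfolding laplace_def by (intro set_lebesgue_integral_cong) (auto simp: eq)
  also have "\<dots> = exp (l * h) * (laplace l (\<lambda>s. l2_inner M (Q s F) H) - (LINT s:{0..h}|lborel. exp (- l * s) * l2_inner M (Q s F) H))"
  proof (rule laplace_shift[OF i[OF H] _ h])
    show "set_integrable lborel {0..} (\<lambda>s. exp (- l * s) * l2_inner M (Q (h + s) F) H)"
      using i[OF g(1)] by (rule set_integrable_cong[THEN iffD1, rotated -1]) (auto simp: eq)
  qed
  finally show ?thesis by (simp add: res H)
qed

text \<open>
  By \<open>resolvent_shift\<close> the function \<open>y(s) = \<langle>Q\<^sub>s u, H\<rangle>\<close> is explicit and solves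
  \<open>y' = l y - \<langle>Q\<^sub>s F, H\<rangle>\<close>.
\<close>

lemma resolvent_in_generator:
  assumes F: "F \<in> L2 M" and l: "0 < l" and u: "u \<in> L2 M"
    and res: "\<And>H. H \<in> L2 M \<Longrightarrow> l2_inner M u H = laplace l (\<lambda>s. l2_inner M (Q s F) H)"
  shows "(u, \<lambda>x. l * u x - F x) \<in> gen"
proof (rule generatorI_mild[OF u])
  show k: "(\<lambda>x. l * u x - F x) \<in> L2 M" by (intro L2_closed u F)
  fix h H assume h: "0 \<le> (h::real)" and H: "H \<in> L2 M"
  define c where "c s = l2_inner M (Q s F) H" for s
  define y where "y s = exp (l * s) * (l2_inner M u H - (LINT r:{0..s}|lborel. exp (- l * r) * c r))" for s
  have y: "l2_inner M (Q s u) H = y s" if "0 \<le> s" for s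
    unfolding y_def c_def by (rule resolvent_shift[OF F l u res that H])
  have cc: "continuous_on {0..h} c" unfolding c_def by (rule continuous_on_l2_inner_Q'[OF F H]) simp
  have yc: "continuous_on {0..h} y"
    using continuous_on_l2_inner_Q'[OF u H, of 0 h] by (rule continuous_on_eq) (auto simp: y)
  have "(LINT s:{0..h}|lborel. l2_inner M (Q s (\<lambda>x. l * u x - F x)) H) = (LINT s:{0..h}|lborel. l * y s - c s)"
  proof (intro set_lebesgue_integral_cong allI impI)
    fix s assume "s \<in> {0..h}"
    then show "l2_inner M (Q s (\<lambda>x. l * u x - F x)) H = l * y s - c s"
      using l2_inner_Q_lincomb[of s u F H l "-1"] u F H by (simp add: y c_def)
  qed simp
  also have "\<dots> = y h - y 0"
  proof (rule LINT_FTC[OF h])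
    fix x assume x: "x \<in> {0..h}"
    have "((\<lambda>s. LINT r:{0..s}|lborel. exp (- l * r) * c r) has_real_derivative exp (- l * x) * c x) (at x within {0..h})"
      by (intro LINT_has_derivative x continuous_intros cc)
    then show "(y has_real_derivative l * y x - c x) (at x within {0..h})"
      unfolding y_def by (auto intro!: derivative_eq_intros simp: algebra_simps simp flip: exp_add)
  qed (intro continuous_intros cc yc)
  also have "\<dots> = l2_inner M (Q h u) H - l2_inner M u H"
    using y[OF h] y[of 0] l2_inner_Q_zero[OF u H] by simp
  finally show "l2_inner M (Q h u) H - l2_inner M u H = (LINT s:{0..h}|lborel. l2_inner M (Q s (\<lambda>x. l * u x - F x)) H)" by simp
qed

end

section \<open>Markov semigroups are contractions\<close>

definition trunc :: "nat \<Rightarrow> ('a \<Rightarrow> real) \<Rightarrow> 'a \<Rightarrow> real" where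
  "trunc n F x = max (- real n) (min (real n) (F x))"

lemma trunc_measurable[measurable]:
  assumes "F \<in> borel_measurable M" shows "trunc n F \<in> borel_measurable M"
  using assms unfolding trunc_def[abs_def] by measurable

lemma abs_trunc_le: "\<bar>trunc n F x\<bar> \<le> real n" "\<bar>trunc n F x\<bar> \<le> \<bar>F x\<bar>" "\<bar>trunc n F x - F x\<bar> \<le> \<bar>F x\<bar>"
  unfolding trunc_def by auto

lemma (in finite_measure) trunc_L2: "F \<in> borel_measurable M \<Longrightarrow> trunc n F \<in> L2 M"
  by (rule L2_bounded[of _ "real n"]) (auto simp: abs_trunc_le)

lemma trunc_eventually_eq: "\<forall>\<^sub>F n in sequentially. trunc n F x = F x"
proof -
  obtain N where N: "\<bar>F x\<bar> \<le> real N" using real_arch_simple by blast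
  show ?thesis
    using eventually_ge_at_top[of N]
  proof eventually_elim
    case (elim n)
    then have "\<bar>F x\<bar> \<le> real n" using N by linarith
    then show ?case unfolding trunc_def by linarith
  qed
qed

lemma trunc_tendsto:
  assumes F: "F \<in> L2 M"
  shows "L2_tendsto M (\<lambda>n. trunc n F) F sequentially"
proof -
  have Fm[measurable]: "F \<in> borel_measurable M" using F by (rule L2_measurable)
  have "(\<lambda>n. \<integral>x. (trunc n F x - F x)\<^sup>2 \<partial>M) \<longlonglongrightarrow> (\<integral>x. 0 \<partial>M)"
  proof (rule integral_dominated_convergence[where w="\<lambda>x. (F x)\<^sup>2"], goal_cases)
    case 1 show ?case by simp
  next
    case (2 n) show ?case by measurable
  next
    case 3 show ?case by (rule L2_sq_integrable[OF F])
  next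
    case 4
    have "(\<lambda>n. (trunc n F x - F x)\<^sup>2) \<longlonglongrightarrow> 0" for x
      by (rule tendsto_eventually) (use trunc_eventually_eq[of F x] in eventually_elim, simp)
    then show ?case by simp
  next
    case (5 n)
    have "(trunc n F x - F x)\<^sup>2 \<le> (F x)\<^sup>2" for x
      using abs_trunc_le(3)[of n F x] by (simp only: abs_le_square_iff)
    then show ?case by simp
  qed
  then show ?thesis unfolding L2_tendsto_def by simp
qed

text \<open>
  Rational \<open>c\<close> only, so that the hypothesis can hold almost everywhere for all \<open>c\<close> at once.
\<close>

lemma sq_le_if_rational_quadratic:
  fixes a b :: real
  assumes "\<And>c. c \<in> \<rat> \<Longrightarrow> 0 \<le> a - 2 * c * b + c\<^sup>2"
  shows "b\<^sup>2 \<le> a"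
proof (rule field_le_epsilon)
  fix e :: real assume "0 < e"
  then have "b < b + sqrt e" by simp
  from Rats_dense_in_real[OF this] obtain c where c: "c \<in> \<rat>" "b < c" "c < b + sqrt e" by blast
  have "(c - b)\<^sup>2 \<le> (sqrt e)\<^sup>2" using c(2,3) by (intro power_mono) linarith+
  also have "\<dots> = e" using \<open>0 < e\<close> by simp
  finally have "c\<^sup>2 - 2 * c * b + b\<^sup>2 \<le> e" by (simp add: power2_diff algebra_simps)
  then show "b\<^sup>2 \<le> a + e" using assms[OF c(1)] by linarith
qed

text \<open>
  For bounded \<open>F\<close> this is Jensen's inequality \<open>(Q\<^sub>t F)\<^sup>2 \<le> Q\<^sub>t (F\<^sup>2)\<close> and stationarity. Positivity
  gives no continuity of \<open>Q\<^sub>t\<close> in \<open>L\<^sup>2\<close> beforehand; it only gives contractivity for the norm of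
  \<open>L\<^sup>1\<close>. For general \<open>F\<close> the bound on \<open>\<langle>Q\<^sub>t F, H\<rangle>\<close> is therefore obtained for bounded \<open>H\<close>, by
  truncation of \<open>F\<close> and convergence in \<open>L\<^sup>1\<close>, and then applied to the truncations of \<open>H = Q\<^sub>t F\<close>.
\<close>

lemma markov_semigroup_contraction:
  assumes M: "prob_space M" and Q: "markov_semigroup_L2 M Q" and st: "stationary_semigroup M Q"
  shows "L2_contraction_semigroup M Q"
proof -
  interpret prob_space M by fact
  have QL: "\<And>t F. 0 \<le> t \<Longrightarrow> F \<in> L2 M \<Longrightarrow> Q t F \<in> L2 M"
    and lin: "\<And>t F G a b. 0 \<le> t \<Longrightarrow> F \<in> L2 M \<Longrightarrow> G \<in> L2 M \<Longrightarrow>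
        AE x in M. Q t (\<lambda>y. a * F y + b * G y) x = a * Q t F x + b * Q t G x"
    and pos: "\<And>t F. 0 \<le> t \<Longrightarrow> F \<in> L2 M \<Longrightarrow> AE x in M. 0 \<le> F x \<Longrightarrow> AE x in M. 0 \<le> Q t F x"
    and one: "\<And>t. 0 \<le> t \<Longrightarrow> AE x in M. Q t (\<lambda>_. 1) x = 1"
    using Q unfolding markov_semigroup_L2_def by (elim conjE; simp)+
  have stat: "\<And>t F. 0 \<le> t \<Longrightarrow> F \<in> L2 M \<Longrightarrow> (\<integral>x. Q t F x \<partial>M) = (\<integral>x. F x \<partial>M)"
    using st unfolding stationary_semigroup_def by simp
  have contr_bounded: "l2_norm M (Q t F) \<le> l2_norm M F"
    if t: "0 \<le> t" and Fm: "F \<in> borel_measurable M" and Fb: "\<And>x. \<bar>F x\<bar> \<le> K" for t F K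
  proof -
    have F: "F \<in> L2 M" by (rule L2_bounded[OF Fm, of K]) (rule Fb)
    have F2: "(\<lambda>x. (F x)\<^sup>2) \<in> L2 M"
      using Fm power_mono[OF Fb abs_ge_zero, of _ 2] by (intro L2_bounded[of _ "K\<^sup>2"]) auto
    have "AE x in M. \<forall>c\<in>\<rat>. 0 \<le> Q t (\<lambda>x. (F x)\<^sup>2) x - 2 * c * Q t F x + c\<^sup>2"
    proof (rule AE_ball_countable')
      fix c :: real
      have L: "(\<lambda>x. (- 2 * c) * F x + c\<^sup>2 * 1) \<in> L2 M" by (intro L2_lincomb F L2_const)
      have "AE x in M. 0 \<le> Q t (\<lambda>x. 1 * (F x)\<^sup>2 + 1 * ((- 2 * c) * F x + c\<^sup>2 * 1)) x"
      proof (rule pos[OF t L2_lincomb[OF F2 L]], rule AE_I2)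
        fix x have "1 * (F x)\<^sup>2 + 1 * ((- 2 * c) * F x + c\<^sup>2 * 1) = (F x - c)\<^sup>2"
          by (simp add: power2_eq_square algebra_simps)
        then show "0 \<le> 1 * (F x)\<^sup>2 + 1 * ((- 2 * c) * F x + c\<^sup>2 * 1)" by simp
      qed
      with lin[OF t F2 L, of 1 1] lin[OF t F L2_const[of 1], of "- 2 * c" "c\<^sup>2"] one[OF t]
      show "AE x in M. 0 \<le> Q t (\<lambda>x. (F x)\<^sup>2) x - 2 * c * Q t F x + c\<^sup>2"
        by eventually_elim simp
    qed (rule countable_rat)
    then have "AE x in M. (Q t F x)\<^sup>2 \<le> Q t (\<lambda>x. (F x)\<^sup>2) x"
      by eventually_elim (rule sq_le_if_rational_quadratic, blast)
    then have "(\<integral>x. (Q t F x)\<^sup>2 \<partial>M) \<le> (\<integral>x. Q t (\<lambda>x. (F x)\<^sup>2) x \<partial>M)"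
      by (intro integral_mono_AE L2_sq_integrable L2_integrable QL t F F2)
    then have "(l2_norm M (Q t F))\<^sup>2 \<le> (l2_norm M F)\<^sup>2"
      by (simp add: l2_norm_sq' stat[OF t F2])
    then show ?thesis by (rule power2_le_imp_le) (rule l2_norm_nonneg)
  qed
  have L1: "(\<integral>x. \<bar>Q t G x\<bar> \<partial>M) \<le> (\<integral>x. \<bar>G x\<bar> \<partial>M)" if t: "0 \<le> t" and G: "G \<in> L2 M" for t G
  proof -
    have A: "(\<lambda>x. \<bar>G x\<bar>) \<in> L2 M" using G by (auto simp: L2_def)
    have "AE x in M. 0 \<le> Q t (\<lambda>x. 1 * \<bar>G x\<bar> + 1 * G x) x"
      by (rule pos[OF t L2_lincomb[OF A G]]) auto
    moreover have "AE x in M. 0 \<le> Q t (\<lambda>x. 1 * \<bar>G x\<bar> + (-1) * G x) x"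
      by (rule pos[OF t L2_lincomb[OF A G]]) auto
    ultimately have "AE x in M. \<bar>Q t G x\<bar> \<le> Q t (\<lambda>x. \<bar>G x\<bar>) x"
      using lin[OF t A G, of 1 1] lin[OF t A G, of 1 "-1"] by eventually_elim auto
    then have "(\<integral>x. \<bar>Q t G x\<bar> \<partial>M) \<le> (\<integral>x. Q t (\<lambda>x. \<bar>G x\<bar>) x \<partial>M)"
      by (intro integral_mono_AE L2_integrable QL t G A integrable_abs)
    then show ?thesis by (simp add: stat[OF t A])
  qed
  have contr: "l2_norm M (Q t F) \<le> l2_norm M F" if t: "0 \<le> t" and F: "F \<in> L2 M" for t F
  proof -
    note Fm[measurable] = L2_measurable[OF F]
    note QFL = QL[OF t F]
    have Tn: "trunc n F \<in> L2 M" for n by (rule trunc_L2[OF Fm])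
    have "\<bar>l2_inner M (Q t F) H\<bar> \<le> l2_norm M F * l2_norm M H"
      if Hm: "H \<in> borel_measurable M" and Hb: "\<And>x. \<bar>H x\<bar> \<le> K" for H K
    proof -
      have H: "H \<in> L2 M" by (rule L2_bounded[OF Hm, of K]) (rule Hb)
      have K0: "0 \<le> K" using order_trans[OF abs_ge_zero Hb] .
      have "(\<lambda>n. K * l2_norm M (\<lambda>x. trunc n F x - F x)) \<longlonglongrightarrow> K * 0"
        using trunc_tendsto[OF F] unfolding L2_tendsto_iff by (intro tendsto_intros)
      then have *: "(\<lambda>n. K * l2_norm M (\<lambda>x. trunc n F x - F x)) \<longlonglongrightarrow> 0" by simp
      have "(\<lambda>n. l2_inner M (Q t (trunc n F)) H - l2_inner M (Q t F) H) \<longlonglongrightarrow> 0"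
      proof (rule Lim_null_comparison[OF _ *], rule always_eventually, rule allI)
        fix n
        have D: "(\<lambda>x. trunc n F x - F x) \<in> L2 M" by (intro L2_closed Tn F)
        have "l2_inner M (Q t (trunc n F)) H - l2_inner M (Q t F) H = (\<integral>x. (Q t (trunc n F) x - Q t F x) * H x \<partial>M)"
          by (subst l2_inner_diff_left[symmetric]) (auto simp: QL t Tn F H l2_inner_def)
        also have "\<bar>\<dots>\<bar> \<le> (\<integral>x. \<bar>(Q t (trunc n F) x - Q t F x) * H x\<bar> \<partial>M)"
          by (rule integral_abs_bound)
        also have "\<dots> \<le> (\<integral>x. K * \<bar>Q t (\<lambda>x. trunc n F x - F x) x\<bar> \<partial>M)"
        proof (rule integral_mono_AE)
          show "integrable M (\<lambda>x. \<bar>(Q t (trunc n F) x - Q t F x) * H x\<bar>)"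
            by (intro integrable_abs L2_mult_integrable L2_closed QL t Tn F H)
          show "integrable M (\<lambda>x. K * \<bar>Q t (\<lambda>x. trunc n F x - F x) x\<bar>)"
            by (intro integrable_abs integrable_mult_right L2_integrable QL t D)
          have "AE x in M. Q t (\<lambda>x. trunc n F x - F x) x = Q t (trunc n F) x - Q t F x"
            using lin[OF t Tn[of n] F, of 1 "-1"] by simp
          then show "AE x in M. \<bar>(Q t (trunc n F) x - Q t F x) * H x\<bar> \<le> K * \<bar>Q t (\<lambda>x. trunc n F x - F x) x\<bar>"
            by eventually_elim (use Hb in \<open>simp add: abs_mult mult.commute mult_right_mono\<close>)
        qed
        also have "\<dots> = K * (\<integral>x. \<bar>Q t (\<lambda>x. trunc n F x - F x) x\<bar> \<partial>M)" by simp
        also have "\<dots> \<le> K * l2_norm M (\<lambda>x. trunc n F x - F x)"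
          using order_trans[OF L1[OF t D] abs_integral_le_l2_norm[OF D]] K0 by (rule mult_left_mono)
        finally show "norm (l2_inner M (Q t (trunc n F)) H - l2_inner M (Q t F) H) \<le> K * l2_norm M (\<lambda>x. trunc n F x - F x)" by simp
      qed
      then have "(\<lambda>n. \<bar>l2_inner M (Q t (trunc n F)) H\<bar>) \<longlonglongrightarrow> \<bar>l2_inner M (Q t F) H\<bar>"
        by (rule tendsto_rabs[OF LIM_zero_cancel])
      moreover have "\<bar>l2_inner M (Q t (trunc n F)) H\<bar> \<le> l2_norm M (trunc n F) * l2_norm M H" for n
      proof -
        have "l2_norm M (Q t (trunc n F)) \<le> l2_norm M (trunc n F)"
          by (rule contr_bounded[OF t trunc_measurable[OF Fm] abs_trunc_le(1)])
        from mult_right_mono[OF this l2_norm_nonneg[of M H]] show ?thesis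
          using l2_Cauchy_Schwarz[OF QL[OF t Tn] H, of n] by linarith
      qed
      moreover have "(\<lambda>n. l2_norm M (trunc n F) * l2_norm M H) \<longlonglongrightarrow> l2_norm M F * l2_norm M H"
        by (intro tendsto_intros tendsto_l2_norm trunc_tendsto F Tn)
      ultimately show ?thesis by (intro LIMSEQ_le[of "\<lambda>n. \<bar>l2_inner M (Q t (trunc n F)) H\<bar>"]) auto
    qed note bnd = this
    have QFm[measurable]: "Q t F \<in> borel_measurable M" by (rule L2_measurable[OF QFL])
    have "(\<lambda>n. \<bar>l2_inner M (trunc n (Q t F)) (Q t F)\<bar>) \<longlonglongrightarrow> \<bar>l2_inner M (Q t F) (Q t F)\<bar>"
      by (intro tendsto_rabs tendsto_l2_inner_left trunc_tendsto trunc_L2 QFL QFm)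
    moreover have "(\<lambda>n. l2_norm M F * l2_norm M (trunc n (Q t F))) \<longlonglongrightarrow> l2_norm M F * l2_norm M (Q t F)"
      by (intro tendsto_intros tendsto_l2_norm trunc_tendsto QFL trunc_L2 QFm)
    moreover have "\<bar>l2_inner M (trunc n (Q t F)) (Q t F)\<bar> \<le> l2_norm M F * l2_norm M (trunc n (Q t F))" for n
      using bnd[of "trunc n (Q t F)" "real n"] by (simp add: abs_trunc_le l2_inner_commute)
    ultimately have "\<bar>l2_inner M (Q t F) (Q t F)\<bar> \<le> l2_norm M F * l2_norm M (Q t F)"
      by (intro LIMSEQ_le[of "\<lambda>n. \<bar>l2_inner M (trunc n (Q t F)) (Q t F)\<bar>"]) auto
    then have "l2_norm M (Q t F) * l2_norm M (Q t F) \<le> l2_norm M F * l2_norm M (Q t F)"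
      by (simp add: l2_norm_sq[symmetric] power2_eq_square)
    then show ?thesis
      using l2_norm_nonneg[of M "Q t F"] l2_norm_nonneg[of M F] by (cases "l2_norm M (Q t F) = 0") auto
  qed
  show ?thesis
  proof unfold_locales
    show "AE x in M. Q 0 F x = F x" if "F \<in> L2 M" for F
      using Q that unfolding markov_semigroup_L2_def by (elim conjE; simp)
    show "AE x in M. Q (s + t) F x = Q s (Q t F) x" if "0 \<le> s" "0 \<le> t" "F \<in> L2 M" for s t F
      using Q that unfolding markov_semigroup_L2_def by (elim conjE; simp)
    show "L2_tendsto M (\<lambda>t. Q t F) F (at_right 0)" if "F \<in> L2 M" for F
      using Q that unfolding markov_semigroup_L2_def by (elim conjE; simp)
  qed (rule QL lin contr; assumption)+
qed

section \<open>Approximation in the dual norm of the Dirichlet form\<close>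

lemma L2_adjoint_iff:
  "(F, G) \<in> L2_adjoint M A \<longleftrightarrow> F \<in> L2 M \<and> G \<in> L2 M \<and> (\<forall>H K. (H, K) \<in> A \<longrightarrow> l2_inner M K F = l2_inner M H G)"
  unfolding L2_adjoint_def l2_inner_def by auto

lemma L2_adjoint_lincomb:
  assumes "(F, G) \<in> L2_adjoint M A" "(F', G') \<in> L2_adjoint M A" "A \<subseteq> L2 M \<times> L2 M"
  shows "(\<lambda>x. a * F x + b * F' x, \<lambda>x. a * G x + b * G' x) \<in> L2_adjoint M A"
  using assms unfolding L2_adjoint_iff by (auto simp: L2_lincomb l2_inner_lincomb_right subset_iff)

lemma L2_tendsto_const: "L2_tendsto M (\<lambda>_. F) F \<F>"
  unfolding L2_tendsto_iff by (simp add: l2_norm_zero)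

context L2_contraction_semigroup
begin


lemma gen_subset_L2: "gen \<subseteq> L2 M \<times> L2 M"
  using generator_L2 by auto

lemma symmetrized_form:
  assumes "(v, a) \<in> gen" "(v, b) \<in> L2_adjoint M gen"
  shows "l2_inner M (\<lambda>x. (a x + b x) / 2) v = l2_inner M v a"
proof -
  have L: "v \<in> L2 M" "a \<in> L2 M" "b \<in> L2 M" using generator_L2[OF assms(1)] assms(2) by (auto simp: L2_adjoint_iff)
  have "l2_inner M a v = l2_inner M v b" using assms by (auto simp: L2_adjoint_iff)
  then show ?thesis using L by (simp add: l2_inner_simps L2_closed l2_inner_commute)
qed

text \<open>
  The form \<open>\<langle>F, L F\<rangle>\<close> sees only the symmetric part of \<open>L\<close>: dissipativity of \<open>L\<close> along \<open>v + s F\<close>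
  gives a Cauchy-Schwarz inequality for \<open>(L + L\<^sup>*) / 2\<close>, even if \<open>F\<close> is not in the domain of \<open>L\<^sup>*\<close>.
\<close>

lemma symmetrized_form_Cauchy_Schwarz:
  assumes v: "(v, a) \<in> gen" "(v, b) \<in> L2_adjoint M gen" and F: "(F, G) \<in> gen"
  shows "(l2_inner M (\<lambda>x. (a x + b x) / 2) F)\<^sup>2 \<le> (- l2_inner M v a) * (- l2_inner M F G)"
proof -
  have L: "v \<in> L2 M" "a \<in> L2 M" "b \<in> L2 M" "F \<in> L2 M" "G \<in> L2 M"
    using generator_L2[OF v(1)] generator_L2[OF F] v(2) by (auto simp: L2_adjoint_iff)
  have adj: "l2_inner M G v = l2_inner M F b" using v(2) F by (auto simp: L2_adjoint_iff)
  show ?thesis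
  proof (rule quadratic_nonneg_imp_discriminant)
    show "0 \<le> - l2_inner M F G" using generator_dissipative[OF F] by simp
    fix s
    have "(\<lambda>x. 1 * v x + s * F x, \<lambda>x. 1 * a x + s * G x) \<in> gen" by (rule generator_lincomb[OF v(1) F])
    from generator_dissipative[OF this]
    have "l2_inner M (\<lambda>x. v x + s * F x) (\<lambda>x. a x + s * G x) \<le> 0" by simp
    moreover have "l2_inner M (\<lambda>x. v x + s * F x) (\<lambda>x. a x + s * G x)
       = l2_inner M v a + s * l2_inner M G v + s * l2_inner M F a + s\<^sup>2 * l2_inner M F G"
      using L by (simp add: l2_inner_simps L2_closed l2_inner_commute[of M v G] power2_eq_square algebra_simps)
    moreover have "l2_inner M (\<lambda>x. (a x + b x) / 2) F = (l2_inner M F a + l2_inner M F b) / 2"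
      using L by (simp add: l2_inner_simps L2_closed l2_inner_commute)
    ultimately show "0 \<le> s\<^sup>2 * - l2_inner M F G - 2 * s * l2_inner M (\<lambda>x. (a x + b x) / 2) F + - l2_inner M v a"
      using adj by (simp add: field_simps)
  qed
qed

text \<open>
  A dual norm bound on the common domain of \<open>L\<close> and \<open>L\<^sup>*\<close> extends to the domain of \<open>L\<close>. That is not
  automatic, as the common domain could be small; here the hypothesis on \<open>S\<close> enters. Given \<open>F\<close>, the
  function \<open>w\<close> with \<open>(l - L\<^sup>S) w = l F\<close>, a resolvent of the symmetrised semigroup, is a limit of
  elements of the common domain with energy at most \<open>q(F)\<close>, and it tends to \<open>F\<close> as \<open>l \<rightarrow> \<infinity>\<close>.
\<close>

lemma symmetric_core_approximation:
  assumes S: "L2_contraction_semigroup M S"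
    and SL: "L2_generator M S = L2_closure M (symmetric_part M gen)"
    and F: "(F, G) \<in> gen" and r: "r \<in> L2 M" and \<epsilon>: "0 \<le> \<epsilon>"
    and core: "\<And>v a b. (v, a) \<in> gen \<Longrightarrow> (v, b) \<in> L2_adjoint M gen \<Longrightarrow> (l2_inner M r v)\<^sup>2 \<le> \<epsilon> * (- l2_inner M v a)"
  shows "(l2_inner M r F)\<^sup>2 \<le> \<epsilon> * (- l2_inner M F G)"
proof -
  interpret S: L2_contraction_semigroup M S by (rule S)
  define q where "q = - l2_inner M F G"
  note L = generator_L2[OF F]
  have q0: "0 \<le> q" unfolding q_def using generator_dissipative[OF F] by simp
  \<comment> \<open>\<open>w\<close> is \<open>l\<close> times the resolvent of \<open>F\<close> for the symmetrised semigroup\<close>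
  have step: "\<exists>w\<in>L2 M. (l2_inner M r w)\<^sup>2 \<le> \<epsilon> * q \<and> (l2_norm M (\<lambda>x. w x - F x))\<^sup>2 \<le> q / l" if l: "0 < l" for l
  proof -
    obtain u where u: "u \<in> L2 M" "\<And>H. H \<in> L2 M \<Longrightarrow> l2_inner M u H = laplace l (\<lambda>s. l2_inner M (S s F) H)"
      using S.resolvent_exists[OF L(1) l] by blast
    have "(u, \<lambda>x. l * u x - F x) \<in> L2_generator M S" by (rule S.resolvent_in_generator[OF L(1) l u])
    from S.generator_lincomb[OF this this, of l 0]
    have g: "(\<lambda>x. l * u x, \<lambda>x. l * (l * u x - F x)) \<in> L2_generator M S" by simp
    define w where "w x = l * u x" for x
    have wL: "w \<in> L2 M" unfolding w_def by (intro L2_closed u)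
    define k where "k x = l * (w x - F x)" for x
    have kL: "k \<in> L2 M" unfolding k_def by (intro L2_closed wL L)
    have "(w, k) \<in> L2_closure M (symmetric_part M gen)"
      using g unfolding SL w_def[symmetric] k_def[symmetric] by simp
    then obtain v s where vs: "\<And>n. (v n, s n) \<in> symmetric_part M gen"
      and conv: "L2_tendsto M v w sequentially" "L2_tendsto M s k sequentially"
      unfolding L2_closure_def by blast
    have "\<forall>n. \<exists>a b. s n = (\<lambda>x. (a x + b x) / 2) \<and> (v n, a) \<in> gen \<and> (v n, b) \<in> L2_adjoint M gen"
      using vs unfolding symmetric_part_def by blast
    from choice[OF this] obtain a where
      "\<forall>n. \<exists>b. s n = (\<lambda>x. (a n x + b x) / 2) \<and> (v n, a n) \<in> gen \<and> (v n, b) \<in> L2_adjoint M gen" by blast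
    from choice[OF this] obtain b where s: "\<And>n. s n = (\<lambda>x. (a n x + b n x) / 2)"
      and va: "\<And>n. (v n, a n) \<in> gen" and vb: "\<And>n. (v n, b n) \<in> L2_adjoint M gen" by blast
    have vL: "v n \<in> L2 M" and sL: "s n \<in> L2 M" for n
      using generator_L2[OF va[of n]] vb[of n] unfolding s by (auto simp: L2_adjoint_iff intro!: L2_closed)
    \<comment> \<open>the energy of \<open>w\<close>; \<open>A + l \<Delta> \<le> q\<close> below bounds the energy and the distance to \<open>F\<close> together\<close>
    define A where "A = - l2_inner M w k"
    have qv: "(\<lambda>n. - l2_inner M (v n) (s n)) \<longlonglongrightarrow> A"
      unfolding A_def by (intro tendsto_minus tendsto_l2_inner conv vL sL wL kL)
    have vs_eq: "l2_inner M (v n) (a n) = l2_inner M (v n) (s n)" for n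
      using symmetrized_form[OF va vb, of n] unfolding s by (simp add: l2_inner_commute)
    have A0: "0 \<le> A"
      by (rule tendsto_lowerbound[OF qv]) (use generator_dissipative[OF va] vs_eq in auto)
    have 1: "(l2_inner M r w)\<^sup>2 \<le> \<epsilon> * A"
    proof (rule LIMSEQ_le)
      show "(\<lambda>n. (l2_inner M (v n) r)\<^sup>2) \<longlonglongrightarrow> (l2_inner M r w)\<^sup>2"
        unfolding l2_inner_commute[of M r w] by (intro tendsto_power tendsto_l2_inner_left conv vL wL r)
      show "(\<lambda>n. \<epsilon> * - l2_inner M (v n) (s n)) \<longlonglongrightarrow> \<epsilon> * A" by (intro tendsto_intros qv)
      show "\<exists>N. \<forall>n\<ge>N. (l2_inner M (v n) r)\<^sup>2 \<le> \<epsilon> * - l2_inner M (v n) (s n)"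
        using core[OF va vb] unfolding vs_eq l2_inner_commute[of M r] by blast
    qed
    have 2: "(l2_inner M k F)\<^sup>2 \<le> A * q"
    proof (rule LIMSEQ_le)
      show "(\<lambda>n. (l2_inner M (s n) F)\<^sup>2) \<longlonglongrightarrow> (l2_inner M k F)\<^sup>2"
        by (intro tendsto_power tendsto_l2_inner_left conv sL kL L)
      show "(\<lambda>n. - l2_inner M (v n) (s n) * q) \<longlonglongrightarrow> A * q" by (intro tendsto_intros qv)
      show "\<exists>N. \<forall>n\<ge>N. (l2_inner M (s n) F)\<^sup>2 \<le> - l2_inner M (v n) (s n) * q"
        using symmetrized_form_Cauchy_Schwarz[OF va vb F] by (auto simp: vs_eq s q_def)
    qed
    define \<Delta> where "\<Delta> = (l2_norm M (\<lambda>x. w x - F x))\<^sup>2"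
    have X: "- l2_inner M k F = A + l * \<Delta>"
      unfolding A_def \<Delta>_def k_def l2_norm_sq using wL L
      by (simp add: l2_inner_simps L2_closed l2_inner_commute[of M F w] algebra_simps)
    have lD: "0 \<le> l * \<Delta>" using l unfolding \<Delta>_def by simp
    have "(A + l * \<Delta>)\<^sup>2 \<le> A * q" using 2 unfolding X[symmetric] by simp
    also have "\<dots> \<le> (A + l * \<Delta>) * q" using lD q0 by (intro mult_right_mono) auto
    finally have "A + l * \<Delta> \<le> q"
      using A0 lD q0 by (cases "A + l * \<Delta> = 0") (auto simp: power2_eq_square)
    then have "A \<le> q" "l * \<Delta> \<le> q" using A0 lD by auto
    then have "(l2_inner M r w)\<^sup>2 \<le> \<epsilon> * q" "\<Delta> \<le> q / l"
      using 1 mult_left_mono[OF \<open>A \<le> q\<close> \<epsilon>] l by (auto simp: field_simps)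
    then show ?thesis using wL unfolding \<Delta>_def by blast
  qed
  have "\<exists>w\<in>L2 M. (l2_inner M r w)\<^sup>2 \<le> \<epsilon> * q \<and> (l2_norm M (\<lambda>x. w x - F x))\<^sup>2 \<le> q / real (Suc n)" for n
    by (rule step) simp
  then obtain w where w: "\<And>n. w n \<in> L2 M" "\<And>n. (l2_inner M r (w n))\<^sup>2 \<le> \<epsilon> * q"
    "\<And>n. (l2_norm M (\<lambda>x. w n x - F x))\<^sup>2 \<le> q / real (Suc n)" by metis
  have "L2_tendsto M w F sequentially"
    unfolding L2_tendsto_def
  proof (rule Lim_null_comparison)
    show "(\<lambda>n. q / real (Suc n)) \<longlonglongrightarrow> 0" by (rule LIMSEQ_Suc[OF lim_const_over_n])
    show "\<forall>\<^sub>F n in sequentially. norm (\<integral>x. (w n x - F x)\<^sup>2 \<partial>M) \<le> q / real (Suc n)"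
      using w(3) unfolding l2_norm_sq' by (auto intro!: always_eventually)
  qed
  then have "(\<lambda>n. (l2_inner M (w n) r)\<^sup>2) \<longlonglongrightarrow> (l2_inner M F r)\<^sup>2"
    by (intro tendsto_power tendsto_l2_inner_left w L r)
  then have "(l2_inner M F r)\<^sup>2 \<le> \<epsilon> * q"
    by (rule LIMSEQ_le_const2) (use w(2) in \<open>auto simp: l2_inner_commute\<close>)
  then show ?thesis unfolding q_def by (simp add: l2_inner_commute)
qed

text \<open>
  \<open>approximate_representer\<close> for the symmetrised form on triples \<open>(v, L v, L\<^sup>* v)\<close>; carrying the
  images along avoids choosing values of the operators.
\<close>

lemma H_minus_one_approximation:
  assumes S: "L2_contraction_semigroup M S"
    and SL: "L2_generator M S = L2_closure M (symmetric_part M gen)"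
    and f: "f \<in> L2 M" and c: "0 \<le> c" and \<epsilon>: "0 < \<epsilon>"
    and H: "\<And>F G. (F, G) \<in> gen \<Longrightarrow> (l2_inner M f F)\<^sup>2 \<le> c * (- l2_inner M F G)"
  obtains v a b where "(v, a) \<in> gen" "(v, b) \<in> L2_adjoint M gen"
    "\<And>F G. (F, G) \<in> gen \<Longrightarrow> (l2_inner M (\<lambda>x. f x + (a x + b x) / 2) F)\<^sup>2 \<le> \<epsilon> * (- l2_inner M F G)"
proof -
  define D where "D = {(v, a, b). (v, a) \<in> gen \<and> (v, b) \<in> L2_adjoint M gen}"
  define lc :: "('a \<Rightarrow> real) \<times> ('a \<Rightarrow> real) \<times> ('a \<Rightarrow> real) \<Rightarrow> real \<Rightarrow> _ \<Rightarrow> _" where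
    "lc = (\<lambda>(v, a, b) s (v', a', b'). (\<lambda>x. v x + s * v' x, \<lambda>x. a x + s * a' x, \<lambda>x. b x + s * b' x))"
  define B :: "('a \<Rightarrow> real) \<times> ('a \<Rightarrow> real) \<times> ('a \<Rightarrow> real) \<Rightarrow> ('a \<Rightarrow> real) \<times> ('a \<Rightarrow> real) \<times> ('a \<Rightarrow> real) \<Rightarrow> real" where
    "B = (\<lambda>(v, a, b) (v', a', b'). - l2_inner M (\<lambda>x. (a x + b x) / 2) v')"
  have DL: "v \<in> L2 M \<and> a \<in> L2 M \<and> b \<in> L2 M" if "(v, a, b) \<in> D" for v a b
    using that generator_L2[of v a] unfolding D_def L2_adjoint_iff by auto
  have Dadj: "l2_inner M a v' = l2_inner M v b'" if "(v, a, b) \<in> D" "(v', a', b') \<in> D" for v a b v' a' b'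
    using that unfolding D_def L2_adjoint_iff by auto
  obtain p where p: "p \<in> D" "\<And>w. w \<in> D \<Longrightarrow> (l2_inner M f (fst w) - B p w)\<^sup>2 \<le> \<epsilon> * B w w"
  proof (rule approximate_representer[of "(\<lambda>_. 0, \<lambda>_. 0, \<lambda>_. 0)" D lc B "\<lambda>w. l2_inner M f (fst w)" c \<epsilon>])
    show "(\<lambda>_. 0, \<lambda>_. 0, \<lambda>_. 0) \<in> D"
      unfolding D_def L2_adjoint_iff by (auto simp: generator_zero L2_zero l2_inner_simps)
    fix u v s assume u: "u \<in> D" and v: "v \<in> D"
    obtain u1 u2 u3 v1 v2 v3 where e: "u = (u1, u2, u3)" "v = (v1, v2, v3)" by (metis prod_cases3)
    show "lc u s v \<in> D"
      using generator_lincomb[of u1 u2 v1 v2 1 s] L2_adjoint_lincomb[of u1 u3 M gen v1 v3 1 s] u v gen_subset_L2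
      unfolding e D_def lc_def by auto
    have L: "u1 \<in> L2 M" "u2 \<in> L2 M" "u3 \<in> L2 M" "v1 \<in> L2 M" "v2 \<in> L2 M" "v3 \<in> L2 M"
      using DL[OF u[unfolded e]] DL[OF v[unfolded e]] by auto
    show "l2_inner M f (fst (lc u s v)) = l2_inner M f (fst u) + s * l2_inner M f (fst v)"
      unfolding e lc_def using L f by (simp add: l2_inner_simps L2_closed)
    show "B u v = B v u"
      using Dadj[OF u[unfolded e] v[unfolded e]] Dadj[OF v[unfolded e] u[unfolded e]]
      unfolding e B_def using L by (simp add: l2_inner_simps L2_closed l2_inner_commute)
    fix w assume w: "w \<in> D"
    obtain w1 w2 w3 where ew: "w = (w1, w2, w3)" by (metis prod_cases3)
    show "B (lc u s v) w = B u w + s * B v w"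
      unfolding e ew B_def lc_def using L DL[OF w[unfolded ew]] by (simp add: l2_inner_simps L2_closed field_simps)
  next
    fix u assume u: "u \<in> D"
    obtain u1 u2 u3 where e: "u = (u1, u2, u3)" by (metis prod_cases3)
    have eq: "B u u = - l2_inner M u1 u2"
      using u symmetrized_form[of u1 u2 u3] unfolding e B_def D_def by auto
    show "0 \<le> B u u" unfolding eq using u generator_dissipative[of u1 u2] unfolding e D_def by auto
    show "(l2_inner M f (fst u))\<^sup>2 \<le> c * B u u" unfolding eq using u H[of u1 u2] unfolding e D_def by auto
  qed (use c \<epsilon> in auto)
  obtain v a b where e: "p = (v, a, b)" by (metis prod_cases3)
  have v: "(v, a) \<in> gen" "(v, b) \<in> L2_adjoint M gen" using p(1) unfolding e D_def by auto
  have L: "v \<in> L2 M" "a \<in> L2 M" "b \<in> L2 M" using DL p(1) unfolding e by auto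
  have r: "(\<lambda>x. f x + (a x + b x) / 2) \<in> L2 M" by (intro L2_closed f L)
  show ?thesis
  proof (rule that[OF v])
    fix F G assume "(F, G) \<in> gen"
    then show "(l2_inner M (\<lambda>x. f x + (a x + b x) / 2) F)\<^sup>2 \<le> \<epsilon> * (- l2_inner M F G)"
    proof (rule symmetric_core_approximation[OF S SL _ r])
      fix w a' b' assume w: "(w, a') \<in> gen" "(w, b') \<in> L2_adjoint M gen"
      then have wD: "(w, a', b') \<in> D" unfolding D_def by auto
      have "B (w, a', b') (w, a', b') = - l2_inner M w a'"
        using symmetrized_form[OF w] unfolding B_def by auto
      moreover have "l2_inner M f w - B p (w, a', b') = l2_inner M (\<lambda>x. f x + (a x + b x) / 2) w"
        unfolding e B_def using L f DL[OF wD] by (simp add: l2_inner_add_left L2_closed)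
      ultimately show "(l2_inner M (\<lambda>x. f x + (a x + b x) / 2) w)\<^sup>2 \<le> \<epsilon> * (- l2_inner M w a')"
        using p(2)[OF wD] by simp
    qed (use \<epsilon> in auto)
  qed
qed

text \<open>
  Such a \<open>g\<close> is in the kernel of the generator of the symmetrised semigroup, hence invariant under
  it.
\<close>

lemma symmetric_kernel_constant:
  assumes S: "L2_contraction_semigroup M S" and erg: "ergodic_semigroup M S"
    and SL: "L2_generator M S = L2_closure M (symmetric_part M gen)"
    and g: "(g, k) \<in> gen" "(g, \<lambda>x. - k x) \<in> L2_adjoint M gen"
  shows "\<exists>c. AE x in M. g x = c"
proof -
  interpret S: L2_contraction_semigroup M S by (rule S)
  note L = generator_L2[OF g(1)]
  have "(g, \<lambda>x. (k x + - k x) / 2) \<in> symmetric_part M gen"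
    unfolding symmetric_part_def mem_Collect_eq using g by (intro exI[of _ g] exI[of _ k] exI[of _ "\<lambda>x. - k x"]) simp
  then have "(g, \<lambda>x. 0) \<in> L2_generator M S"
    unfolding SL L2_closure_def mem_Collect_eq case_prod_conv using L
    by (intro conjI L2_zero exI[of _ "\<lambda>_. g"] exI[of _ "\<lambda>_ _. 0"] L2_tendsto_const) auto
  note m = S.generator_mild[OF this]
  have "AE x in M. S t g x = g x" if t: "0 \<le> t" for t
  proof (rule l2_inner_eq_imp_AE_eq[OF S.Q_L2[OF t L(1)] L(1)])
    fix H assume H: "H \<in> L2 M"
    have "(LINT s:{0..t}|lborel. l2_inner M (S s (\<lambda>x. 0)) H) = (LINT s:{0..t}|lborel. 0)"
      using S.abs_l2_inner_Q_le[OF _ L2_zero H] by (intro set_lebesgue_integral_cong) (auto simp: l2_norm_zero)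
    then show "l2_inner M (S t g) H = l2_inner M g H"
      using m[OF t H] by (simp add: set_lebesgue_integral_def)
  qed
  then show ?thesis using erg L(1) unfolding ergodic_semigroup_def by blast
qed

end

text \<open>
  The Dirichlet form is an infimum over approximating sequences. On the domain of \<open>L\<close> the constant
  sequence is one of them, which bounds the form by \<open>- 2 \<langle>F, L F\<rangle>\<close>.
\<close>

lemma dual_norm_bound_on_generator:
  assumes P: "L2_contraction_semigroup mu (semigroup X PP)"
    and H: "\<forall>F\<in>dirichlet_domain X PP mu. (\<integral>x. f x * F x \<partial>mu)\<^sup>2 \<le> cf\<^sup>2 * (dirichlet_form X PP mu F / 2)"
    and F: "(F, G) \<in> generator X PP mu"
  shows "(l2_inner mu f F)\<^sup>2 \<le> cf\<^sup>2 * (- l2_inner mu F G)"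
proof -
  interpret L2_contraction_semigroup mu "semigroup X PP" by (rule P)
  have pre: "pre_dirichlet_form X PP mu u = - 2 * l2_inner mu u k" if "(u, k) \<in> generator X PP mu" for u k
  proof -
    have k': "(u, generator_fun X PP mu u) \<in> generator X PP mu"
      unfolding generator_fun_def by (rule someI[where P="\<lambda>k. (u, k) \<in> generator X PP mu", OF that])
    have "l2_inner mu u (generator_fun X PP mu u) = l2_inner mu u k"
      using generator_unique[OF k' that] generator_L2[OF k'] generator_L2[OF that]
      by (intro l2_inner_cong_AE) (auto intro!: L2_measurable)
    then show ?thesis unfolding pre_dirichlet_form_def l2_inner_def by simp
  qed
  have pre0: "0 \<le> pre_dirichlet_form X PP mu u" if u: "u \<in> Domain (generator X PP mu)" for u
  proof -
    obtain k where "(u, k) \<in> generator X PP mu" using u by auto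
    then show ?thesis using pre[of u k] generator_dissipative[of u k] by simp
  qed
  have appr: "dirichlet_approx X PP mu F (\<lambda>_. F)"
    unfolding dirichlet_approx_def using F by (auto simp: L2_tendsto_const pre_dirichlet_form_def)
  then have "F \<in> dirichlet_domain X PP mu"
    unfolding dirichlet_domain_def using generator_L2[OF F] by auto
  moreover have "dirichlet_form X PP mu F \<le> - 2 * l2_inner mu F G"
    unfolding dirichlet_form_def
  proof (rule cInf_lower)
    show "- 2 * l2_inner mu F G \<in> {e. \<exists>u. dirichlet_approx X PP mu F u \<and> (\<lambda>n. pre_dirichlet_form X PP mu (u n)) \<longlonglongrightarrow> e}"
      using appr pre[OF F] by (auto intro!: exI[of _ "\<lambda>_. F"])
    show "bdd_below {e. \<exists>u. dirichlet_approx X PP mu F u \<and> (\<lambda>n. pre_dirichlet_form X PP mu (u n)) \<longlonglongrightarrow> e}"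
      by (rule bdd_belowI[of _ 0]) (auto simp: dirichlet_approx_def intro!: LIMSEQ_le_const pre0)
  qed
  then have "cf\<^sup>2 * (dirichlet_form X PP mu F / 2) \<le> cf\<^sup>2 * (- l2_inner mu F G)"
    by (intro mult_left_mono) auto
  ultimately have "(\<integral>x. f x * F x \<partial>mu)\<^sup>2 \<le> cf\<^sup>2 * (dirichlet_form X PP mu F / 2)"
    "cf\<^sup>2 * (dirichlet_form X PP mu F / 2) \<le> cf\<^sup>2 * (- l2_inner mu F G)"
    using H by auto
  then show ?thesis unfolding l2_inner_def by linarith
qed

section \<open>The process in its stationary regime\<close>

text \<open>
  From indicators to square integrable functions, through the conditional expectation of \<open>D\<close>.
\<close>

lemma sub_sigma_orthogonal:
  assumes N: "prob_space N" and F: "subalgebra N F" and D: "D \<in> L2 N"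
    and ind: "\<And>A. A \<in> sets F \<Longrightarrow> (\<integral>\<omega>. indicator A \<omega> * D \<omega> \<partial>N) = 0"
    and W: "W \<in> L2 N" "W \<in> borel_measurable F"
  shows "l2_inner N W D = 0"
proof -
  interpret prob_space N by (rule N)
  interpret finite_measure_subalgebra N F by unfold_locales (rule F)
  have "AE \<omega> in N. real_cond_exp N F D \<omega> = 0"
    by (rule real_cond_exp_charact) (use ind D in \<open>auto simp: set_lebesgue_integral_def L2_integrable\<close>)
  then have "(\<integral>\<omega>. W \<omega> * real_cond_exp N F D \<omega> \<partial>N) = (\<integral>\<omega>. 0 \<partial>N)"
    by (intro integral_cong_AE) (auto intro!: borel_measurable_times L2_measurable[OF W(1)] elim: eventually_mono)
  moreover have "(\<integral>\<omega>. W \<omega> * real_cond_exp N F D \<omega> \<partial>N) = (\<integral>\<omega>. W \<omega> * D \<omega> \<partial>N)"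
    by (rule real_cond_exp_intg(2)) (use W D L2_mult_integrable[OF W(1) D] L2_measurable[OF D] in auto)
  ultimately show ?thesis by (simp add: l2_inner_def)
qed

lemma space_generated_by: "space (generated_by Om X I) = space Om"
  unfolding generated_by_def by (intro space_measure_of) auto

lemma sets_generated_by:
  "sets (generated_by Om X I) = sigma_sets (space Om) {X u -` B \<inter> space Om | u B. u \<in> I \<and> B \<in> sets borel}"
  unfolding generated_by_def by (intro sets_measure_of) auto

lemma generated_by_mono: "I \<subseteq> J \<Longrightarrow> sets (generated_by Om X I) \<subseteq> sets (generated_by Om X J)"
  unfolding sets_generated_by by (intro sigma_sets_mono') auto

lemma measurable_generated_by: "u \<in> I \<Longrightarrow> X u \<in> borel_measurable (generated_by Om X I)"
  by (intro measurableI) (auto simp: space_generated_by sets_generated_by intro!: sigma_sets.Basic)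

lemma measurable_generated_by_mono:
  "f \<in> borel_measurable (generated_by Om X I) \<Longrightarrow> I \<subseteq> J \<Longrightarrow> f \<in> borel_measurable (generated_by Om X J)"
  using generated_by_mono[of I J Om X] by (auto simp: measurable_def space_generated_by)

context ergodic_diffusion
begin

abbreviation "N \<equiv> mu \<bind> PP"
abbreviation "P \<equiv> semigroup X PP"

lemma mu_prob: "prob_space mu" and sets_mu: "sets mu = sets borel"
  using invariant unfolding invariant_probability_def by auto

lemma space_mu: "space mu = UNIV"
  using sets_eq_imp_space_eq[OF sets_mu] by simp

lemma borel_measurable_mu: "borel_measurable mu = borel_measurable borel"
  by (rule measurable_cong_sets[OF sets_mu refl])

lemma PP_subprob: "PP \<in> measurable mu (subprob_algebra Om)"
  using measurable_prob_algebraD[OF PP_kernel] by (simp add: measurable_cong_sets[OF sets_mu refl])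

lemma PP_prob: "prob_space (PP x)" and sets_PP: "sets (PP x) = sets Om"
  using measurable_space[OF PP_kernel, of x] by (auto simp: space_prob_algebra)

lemma space_PP: "space (PP x) = space Om"
  by (rule sets_eq_imp_space_eq[OF sets_PP])

lemma sets_N: "sets N = sets Om"
  by (rule sets_bind[OF sets_PP]) (simp add: space_mu)

lemma space_N: "space N = space Om"
  by (rule sets_eq_imp_space_eq[OF sets_N])

lemma N_prob: "prob_space N"
  by (rule prob_space.prob_space_bind[OF mu_prob _ PP_subprob]) (simp add: PP_prob)

sublocale mu: prob_space mu by (rule mu_prob)
sublocale N: prob_space N by (rule N_prob)

lemma measurable_N_iff: "f \<in> borel_measurable N \<longleftrightarrow> f \<in> borel_measurable Om"
  by (simp add: measurable_cong_sets[OF sets_N refl])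

lemma measurable_PP_iff: "f \<in> borel_measurable (PP x) \<longleftrightarrow> f \<in> borel_measurable Om"
  by (simp add: measurable_cong_sets[OF sets_PP refl])

lemma X_N: "0 \<le> t \<Longrightarrow> X t \<in> borel_measurable N"
  using X_measurable by (simp add: measurable_N_iff)

lemma distr_X: "0 \<le> t \<Longrightarrow> distr N borel (X t) = mu"
  using invariant unfolding invariant_probability_def by auto

lemma generated_by_subset: "I \<subseteq> {0..} \<Longrightarrow> sets (generated_by Om X I) \<subseteq> sets Om"
  unfolding sets_generated_by
  by (rule sets.sigma_sets_subset) (use X_measurable in \<open>auto intro: measurable_sets\<close>)

lemma subalgebra_generated_by: "I \<subseteq> {0..} \<Longrightarrow> subalgebra N (generated_by Om X I)"
  unfolding subalgebra_def using generated_by_subset[of I] by (simp add: space_N space_generated_by sets_N)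

lemma generated_by_measurable_N: "I \<subseteq> {0..} \<Longrightarrow> f \<in> borel_measurable (generated_by Om X I) \<Longrightarrow> f \<in> borel_measurable N"
  by (rule measurable_from_subalg[OF subalgebra_generated_by])

lemma comp_X_measurable:
  assumes "F \<in> borel_measurable mu" "0 \<le> t"
  shows "(\<lambda>\<omega>. F (X t \<omega>)) \<in> borel_measurable N"
  using measurable_compose[OF X_N[OF assms(2)], of F borel] assms(1) by (simp add: borel_measurable_mu)

lemma comp_X_generated:
  assumes "F \<in> borel_measurable mu" "t \<in> I"
  shows "(\<lambda>\<omega>. F (X t \<omega>)) \<in> borel_measurable (generated_by Om X I)"
  using measurable_compose[OF measurable_generated_by[OF assms(2), of X Om], of F borel] assms(1)
  by (simp add: borel_measurable_mu)

lemma comp_X_L2: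
  assumes "F \<in> L2 mu" "0 \<le> t"
  shows "(\<lambda>\<omega>. F (X t \<omega>)) \<in> L2 N"
proof -
  have F: "F \<in> borel_measurable borel" using L2_measurable[OF assms(1)] by (simp add: borel_measurable_mu)
  have "integrable (distr N borel (X t)) (\<lambda>x. (F x)\<^sup>2)"
    unfolding distr_X[OF assms(2)] by (rule L2_sq_integrable[OF assms(1)])
  then have "integrable N (\<lambda>\<omega>. (F (X t \<omega>))\<^sup>2)"
    using X_N[OF assms(2)] F by (subst (asm) integrable_distr_eq) auto
  then show ?thesis using comp_X_measurable[OF L2_measurable[OF assms(1)] assms(2)] by (simp add: L2_def)
qed

lemma integral_X:
  fixes F :: "'a \<Rightarrow> real"
  assumes "F \<in> borel_measurable mu" "0 \<le> t"
  shows "(\<integral>\<omega>. F (X t \<omega>) \<partial>N) = (\<integral>x. F x \<partial>mu)"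
  using integral_distr[OF X_N[OF assms(2)], of F] assms(1) by (simp add: distr_X[OF assms(2)] borel_measurable_mu)

lemma l2_inner_X:
  assumes "F \<in> L2 mu" "G \<in> L2 mu" "0 \<le> t"
  shows "l2_inner N (\<lambda>\<omega>. F (X t \<omega>)) (\<lambda>\<omega>. G (X t \<omega>)) = l2_inner mu F G"
  unfolding l2_inner_def
  using integral_X[of "\<lambda>x. F x * G x" t] assms by (simp add: L2_measurable borel_measurable_times)

lemma l2_norm_X: "F \<in> L2 mu \<Longrightarrow> 0 \<le> t \<Longrightarrow> l2_norm N (\<lambda>\<omega>. F (X t \<omega>)) = l2_norm mu F"
  unfolding l2_norm_def by (simp add: l2_inner_X)

lemma nn_integral_N: "F \<in> borel_measurable Om \<Longrightarrow> (\<integral>\<^sup>+\<omega>. F \<omega> \<partial>N) = (\<integral>\<^sup>+x. \<integral>\<^sup>+\<omega>. F \<omega> \<partial>PP x \<partial>mu)"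
  by (rule nn_integral_bind[OF _ PP_subprob])

lemma P_measurable:
  assumes "F \<in> borel_measurable mu" "0 \<le> t"
  shows "P t F \<in> borel_measurable mu"
proof -
  have "(\<lambda>\<omega>. F (X t \<omega>)) \<in> borel_measurable Om"
    using comp_X_measurable[OF assms] by (simp add: measurable_N_iff)
  from measurable_compose[OF PP_subprob integral_measurable_subprob_algebra[OF this]]
  show ?thesis unfolding semigroup_def[abs_def] .
qed

text \<open>
  In extended nonnegative numbers, since \<open>F(X\<^sub>t)\<close> may fail to be integrable for some starting
  points.
\<close>

lemma P_sq_le:
  assumes F: "F \<in> borel_measurable mu" and t: "0 \<le> t"
  shows "ennreal ((P t F x)\<^sup>2) \<le> (\<integral>\<^sup>+\<omega>. ennreal ((F (X t \<omega>))\<^sup>2) \<partial>PP x)"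
proof (cases "(\<integral>\<^sup>+\<omega>. ennreal ((F (X t \<omega>))\<^sup>2) \<partial>PP x) = \<infinity>")
  case False
  interpret prob_space "PP x" by (rule PP_prob)
  have m: "(\<lambda>\<omega>. F (X t \<omega>)) \<in> borel_measurable (PP x)"
    using comp_X_measurable[OF F t] by (simp add: measurable_N_iff measurable_PP_iff)
  have i: "integrable (PP x) (\<lambda>\<omega>. (F (X t \<omega>))\<^sup>2)"
    using False m by (intro integrableI_nonneg) (auto simp: less_top)
  then have L: "(\<lambda>\<omega>. F (X t \<omega>)) \<in> L2 (PP x)" using m by (simp add: L2_def)
  have "(l2_inner (PP x) (\<lambda>\<omega>. F (X t \<omega>)) (\<lambda>\<omega>. 1))\<^sup>2
     \<le> l2_inner (PP x) (\<lambda>\<omega>. F (X t \<omega>)) (\<lambda>\<omega>. F (X t \<omega>)) * l2_inner (PP x) (\<lambda>\<omega>. 1) (\<lambda>\<omega>. 1)"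
    by (rule l2_inner_sq_le[OF L L2_const])
  then have "(P t F x)\<^sup>2 \<le> (\<integral>\<omega>. (F (X t \<omega>))\<^sup>2 \<partial>PP x)"
    by (simp add: l2_inner_def semigroup_def prob_space power2_eq_square)
  then show ?thesis using nn_integral_eq_integral[OF i] by (simp add: ennreal_leI)
qed simp

lemma P_nn_sq_le:
  assumes F: "F \<in> L2 mu" and t: "0 \<le> t"
  shows "(\<integral>\<^sup>+x. ennreal ((P t F x)\<^sup>2) \<partial>mu) \<le> ennreal ((l2_norm mu F)\<^sup>2)"
proof -
  note m = L2_measurable[OF F]
  have m': "(\<lambda>\<omega>. ennreal ((F (X t \<omega>))\<^sup>2)) \<in> borel_measurable Om"
    using comp_X_measurable[OF m t] by (simp add: measurable_N_iff)
  have "(\<integral>\<^sup>+x. ennreal ((P t F x)\<^sup>2) \<partial>mu) \<le> (\<integral>\<^sup>+x. \<integral>\<^sup>+\<omega>. ennreal ((F (X t \<omega>))\<^sup>2) \<partial>PP x \<partial>mu)"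
    by (intro nn_integral_mono P_sq_le m t)
  also have "\<dots> = (\<integral>\<^sup>+\<omega>. ennreal ((F (X t \<omega>))\<^sup>2) \<partial>N)" by (rule nn_integral_N[OF m', symmetric])
  also have "\<dots> = ennreal (\<integral>\<omega>. (F (X t \<omega>))\<^sup>2 \<partial>N)"
    by (rule nn_integral_eq_integral[OF L2_sq_integrable[OF comp_X_L2[OF F t]]]) simp
  finally show ?thesis using l2_norm_X[OF F t] by (simp add: l2_norm_sq'[symmetric])
qed

lemma P_L2:
  assumes F: "F \<in> L2 mu" and t: "0 \<le> t"
  shows "P t F \<in> L2 mu" "l2_norm mu (P t F) \<le> l2_norm mu F"
proof -
  have i: "integrable mu (\<lambda>x. (P t F x)\<^sup>2)"
    using P_nn_sq_le[OF F t] P_measurable[OF L2_measurable[OF F] t]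
    by (intro integrableI_nonneg) (auto intro: le_less_trans)
  then show "P t F \<in> L2 mu" using P_measurable[OF L2_measurable[OF F] t] by (simp add: L2_def)
  have "ennreal ((l2_norm mu (P t F))\<^sup>2) \<le> ennreal ((l2_norm mu F)\<^sup>2)"
    using P_nn_sq_le[OF F t] nn_integral_eq_integral[OF i] by (simp add: l2_norm_sq')
  then show "l2_norm mu (P t F) \<le> l2_norm mu F"
    by (auto intro: power2_le_imp_le l2_norm_nonneg)
qed

lemma AE_integrable_PP:
  assumes F: "F \<in> L2 mu" and t: "0 \<le> t"
  shows "AE x in mu. integrable (PP x) (\<lambda>\<omega>. F (X t \<omega>))"
proof -
  note m = L2_measurable[OF F]
  have m': "(\<lambda>\<omega>. ennreal ((F (X t \<omega>))\<^sup>2)) \<in> borel_measurable Om"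
    using comp_X_measurable[OF m t] by (simp add: measurable_N_iff)
  have "(\<integral>\<^sup>+x. \<integral>\<^sup>+\<omega>. ennreal ((F (X t \<omega>))\<^sup>2) \<partial>PP x \<partial>mu) = ennreal (\<integral>\<omega>. (F (X t \<omega>))\<^sup>2 \<partial>N)"
    unfolding nn_integral_N[OF m', symmetric]
    by (rule nn_integral_eq_integral[OF L2_sq_integrable[OF comp_X_L2[OF F t]]]) simp
  then have "AE x in mu. (\<integral>\<^sup>+\<omega>. ennreal ((F (X t \<omega>))\<^sup>2) \<partial>PP x) \<noteq> \<infinity>"
    by (intro nn_integral_PInf_AE measurable_compose[OF PP_subprob nn_integral_measurable_subprob_algebra[OF m']]) auto
  then show ?thesis
  proof eventually_elim
    case (elim x)
    interpret prob_space "PP x" by (rule PP_prob)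
    have mx: "(\<lambda>\<omega>. F (X t \<omega>)) \<in> borel_measurable (PP x)"
      using comp_X_measurable[OF m t] by (simp add: measurable_N_iff measurable_PP_iff)
    then have "(\<lambda>\<omega>. F (X t \<omega>)) \<in> L2 (PP x)"
      using elim unfolding L2_def by (auto intro!: integrableI_nonneg simp: less_top)
    then show ?case by (rule L2_integrable)
  qed
qed

lemma P_lincomb:
  assumes "0 \<le> t" "F \<in> L2 mu" "G \<in> L2 mu"
  shows "AE x in mu. P t (\<lambda>y. a * F y + b * G y) x = a * P t F x + b * P t G x"
  using AE_integrable_PP[OF assms(2,1)] AE_integrable_PP[OF assms(3,1)]
  by eventually_elim (simp add: semigroup_def)

lemma P_diff_norm:
  assumes "0 \<le> t" "F \<in> L2 mu" "G \<in> L2 mu"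
  shows "l2_norm mu (\<lambda>x. P t F x - P t G x) \<le> l2_norm mu (\<lambda>x. F x - G x)"
proof -
  have L: "(\<lambda>x. F x - G x) \<in> L2 mu" using assms by (intro L2_closed)
  have "AE x in mu. P t (\<lambda>x. F x - G x) x = P t F x - P t G x"
    using P_lincomb[OF assms, of 1 "-1"] by simp
  then have "l2_norm mu (\<lambda>x. P t F x - P t G x) = l2_norm mu (P t (\<lambda>x. F x - G x))"
    using assms L by (intro l2_norm_cong_AE) (auto intro!: L2_measurable L2_diff P_L2(1))
  also have "\<dots> \<le> l2_norm mu (\<lambda>x. F x - G x)" by (rule P_L2(2)[OF L assms(1)])
  finally show ?thesis .
qed

text \<open>
  The strong Markov property at a constant time is the Markov property for the past.
\<close>

lemma pre_sigma_const:
  assumes "0 \<le> s"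
  shows "sets (filtration.pre_sigma (space Om) (past Om X) (\<lambda>_. s)) = sets (past Om X s)"
    "space (filtration.pre_sigma (space Om) (past Om X) (\<lambda>_. s)) = space Om"
proof -
  interpret F: filtration "space Om" "past Om X"
    by unfold_locales (simp_all add: space_generated_by generated_by_mono)
  have "{A. \<forall>t. {\<omega>\<in>A. s \<le> t} \<in> sets (past Om X t)} = sets (past Om X s)"
  proof (intro set_eqI iffI CollectI allI; (elim CollectE)?)
    fix A assume "\<forall>t. {\<omega>\<in>A. s \<le> t} \<in> sets (past Om X t)"
    from spec[OF this, of s] show "A \<in> sets (past Om X s)" by simp
  next
    fix A t assume "A \<in> sets (past Om X s)"
    then show "{\<omega>\<in>A. s \<le> t} \<in> sets (past Om X t)"
      using F.sets_F_mono[of s t] by (cases "s \<le> t") auto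
  qed
  then show "sets (filtration.pre_sigma (space Om) (past Om X) (\<lambda>_. s)) = sets (past Om X s)"
    unfolding F.sets_pre_sigma[OF stopping_time_const] .
  show "space (filtration.pre_sigma (space Om) (past Om X) (\<lambda>_. s)) = space Om"
    by (rule F.space_pre_sigma)
qed

lemma P_bounded:
  assumes m: "h \<in> borel_measurable mu" and b: "\<And>x. \<bar>h x\<bar> \<le> B" and t: "0 \<le> t" shows "\<bar>P t h x\<bar> \<le> B"
proof -
  interpret prob_space "PP x" by (rule PP_prob)
  have "\<bar>P t h x\<bar> \<le> (\<integral>\<omega>. \<bar>h (X t \<omega>)\<bar> \<partial>PP x)" unfolding semigroup_def by (rule integral_abs_bound)
  also have "\<dots> \<le> B"
    using comp_X_measurable[OF m t] b
    by (intro integral_le_const integrable_const_bound[where B=B] AE_I2) (auto simp: measurable_N_iff measurable_PP_iff)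
  finally show ?thesis .
qed

lemma Markov_indicator_bounded:
  assumes h: "h \<in> borel_measurable borel" "\<And>x. \<bar>h x\<bar> \<le> B" and s: "0 \<le> s" and t: "0 \<le> t" and A: "A \<in> sets (past Om X s)"
  shows "(\<integral>\<omega>. indicator A \<omega> * h (X (s + t) \<omega>) \<partial>N) = (\<integral>\<omega>. indicator A \<omega> * P t h (X s \<omega>) \<partial>N)"
proof -
  let ?F = "filtration.pre_sigma (space Om) (past Om X) (\<lambda>_. s)"
  have B0: "0 \<le> B" using order_trans[OF abs_ge_zero h(2)] .
  have AO: "A \<in> sets Om" using generated_by_subset[of "{0..s}"] A by auto
  have hm: "h \<in> borel_measurable mu" using h(1) by (simp add: borel_measurable_mu)
  have m1: "(\<lambda>\<omega>. h (X (s + t) \<omega>)) \<in> borel_measurable Om"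
    using comp_X_measurable[OF hm, of "s + t"] s t by (simp add: measurable_N_iff)
  have m2: "(\<lambda>\<omega>. P t h (X s \<omega>)) \<in> borel_measurable Om"
    using comp_X_measurable[OF P_measurable[OF hm t] s] by (simp add: measurable_N_iff)
  have Pb: "\<bar>P t h x\<bar> \<le> B" for x by (rule P_bounded[OF hm h(2) t])
  have ind: "indicat_real A \<in> borel_measurable Om" using AO by simp
  have bind: "(\<integral>\<omega>. indicator A \<omega> * k \<omega> \<partial>N) = (\<integral>x. \<integral>\<omega>. indicator A \<omega> * k \<omega> \<partial>PP x \<partial>mu)"
    if "k \<in> borel_measurable Om" "\<And>\<omega>. \<bar>k \<omega>\<bar> \<le> B" for k :: "'w \<Rightarrow> real"
  proof (rule integral_bind[where B=B and B'=1])
    show "(\<lambda>\<omega>. indicat_real A \<omega> * k \<omega>) \<in> borel_measurable Om"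
      using ind that(1) by (rule borel_measurable_times)
    show "finite_measure mu" by unfold_locales
    show "AE x in mu. emeasure (PP x) (space (PP x)) \<le> ennreal 1"
      using prob_space.emeasure_space_1[OF PP_prob] by simp
  qed (use PP_subprob that(2) B0 in \<open>auto simp: indicator_def\<close>)
  have "(\<integral>\<omega>. indicator A \<omega> * h (X (s + t) \<omega>) \<partial>PP x) = (\<integral>\<omega>. indicator A \<omega> * P t h (X s \<omega>) \<partial>PP x)" for x
  proof -
    interpret prob_space "PP x" by (rule PP_prob)
    have "sets (past Om X s) \<subseteq> sets Om" by (rule generated_by_subset) auto
    then have sub: "subalgebra (PP x) ?F"
      unfolding subalgebra_def pre_sigma_const[OF s] space_PP sets_PP by simp
    interpret finite_measure_subalgebra "PP x" ?F
      by (intro finite_measure_subalgebra.intro finite_measure_axioms finite_measure_subalgebra_axioms.intro sub)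
    have "AE \<omega> in PP x. real_cond_exp (PP x) ?F (\<lambda>\<omega>. h (X (s + t) \<omega>)) \<omega> = P t h (X s \<omega>)"
      using strong_markov[unfolded strong_markov_def, rule_format, of "\<lambda>_. s" t h x] h s t
      by (auto simp: stopping_time_const bounded_iff)
    then have "(\<integral>\<omega>. indicator A \<omega> * P t h (X s \<omega>) \<partial>PP x) = (\<integral>\<omega>. indicator A \<omega> * real_cond_exp (PP x) ?F (\<lambda>\<omega>. h (X (s + t) \<omega>)) \<omega> \<partial>PP x)"
    proof (intro integral_cong_AE)
      show "(\<lambda>\<omega>. indicat_real A \<omega> * P t h (X s \<omega>)) \<in> borel_measurable (PP x)"
        using borel_measurable_times[OF ind m2] by (simp add: measurable_PP_iff)
      show "(\<lambda>\<omega>. indicat_real A \<omega> * real_cond_exp (PP x) ?F (\<lambda>\<omega>. h (X (s + t) \<omega>)) \<omega>) \<in> borel_measurable (PP x)"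
        using ind by (intro borel_measurable_times borel_measurable_cond_exp2) (simp add: measurable_PP_iff)
    qed (auto elim: eventually_mono)
    also have "\<dots> = (\<integral>\<omega>. indicator A \<omega> * h (X (s + t) \<omega>) \<partial>PP x)"
    proof (rule real_cond_exp_intg(2))
      show "indicat_real A \<in> borel_measurable ?F"
        using A by (intro borel_measurable_indicator) (simp add: pre_sigma_const[OF s])
      show "(\<lambda>\<omega>. h (X (s + t) \<omega>)) \<in> borel_measurable (PP x)" using m1 by (simp add: measurable_PP_iff)
      show "integrable (PP x) (\<lambda>\<omega>. indicat_real A \<omega> * h (X (s + t) \<omega>))"
      proof (rule integrable_const_bound[where B=B])
        show "(\<lambda>\<omega>. indicat_real A \<omega> * h (X (s + t) \<omega>)) \<in> borel_measurable (PP x)"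
          using borel_measurable_times[OF ind m1] by (simp add: measurable_PP_iff)
        show "AE \<omega> in PP x. norm (indicat_real A \<omega> * h (X (s + t) \<omega>)) \<le> B"
          using h(2) B0 by (intro AE_I2) (simp add: indicator_def)
      qed
    qed
    finally show ?thesis by simp
  qed
  then show ?thesis using bind[OF m1] bind[OF m2] h(2) Pb by simp
qed

text \<open>
  By truncation of \<open>h\<close>.
\<close>

lemma Markov_indicator:
  assumes h: "h \<in> L2 mu" and s: "0 \<le> s" and t: "0 \<le> t" and A: "A \<in> sets (past Om X s)"
  shows "l2_inner N (indicator A) (\<lambda>\<omega>. h (X (s + t) \<omega>)) = l2_inner N (indicator A) (\<lambda>\<omega>. P t h (X s \<omega>))"
proof (rule LIMSEQ_unique)
  have AO: "A \<in> sets N" using generated_by_subset[of "{0..s}"] A by (auto simp: sets_N)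
  have IL: "indicator A \<in> L2 N" by (rule N.L2_bounded[of _ 1]) (use AO in \<open>auto simp: indicator_def\<close>)
  note hm = L2_measurable[OF h]
  have TL: "trunc n h \<in> L2 mu" for n by (rule mu.trunc_L2[OF hm])
  have st: "0 \<le> s + t" using s t by simp
  have c1: "L2_tendsto N (\<lambda>n \<omega>. trunc n h (X (s + t) \<omega>)) (\<lambda>\<omega>. h (X (s + t) \<omega>)) sequentially"
    unfolding L2_tendsto_iff using trunc_tendsto[OF h] st
    by (simp add: l2_norm_X[OF L2_diff[OF TL h]] L2_tendsto_iff)
  have c2: "L2_tendsto N (\<lambda>n \<omega>. P t (trunc n h) (X s \<omega>)) (\<lambda>\<omega>. P t h (X s \<omega>)) sequentially"
    unfolding L2_tendsto_iff
  proof (rule Lim_null_comparison)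
    show "(\<lambda>n. l2_norm mu (\<lambda>x. trunc n h x - h x)) \<longlonglongrightarrow> 0" using trunc_tendsto[OF h] unfolding L2_tendsto_iff .
    show "\<forall>\<^sub>F n in sequentially. norm (l2_norm N (\<lambda>\<omega>. P t (trunc n h) (X s \<omega>) - P t h (X s \<omega>))) \<le> l2_norm mu (\<lambda>x. trunc n h x - h x)"
      using l2_norm_X[OF L2_diff[OF P_L2(1)[OF TL t] P_L2(1)[OF h t]] s] P_diff_norm[OF t TL h]
      by (intro always_eventually allI) (simp add: l2_norm_nonneg)
  qed
  show "(\<lambda>n. l2_inner N (indicator A) (\<lambda>\<omega>. trunc n h (X (s + t) \<omega>))) \<longlonglongrightarrow> l2_inner N (indicator A) (\<lambda>\<omega>. h (X (s + t) \<omega>))"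
    unfolding l2_inner_commute[of N "indicator A"]
    by (intro tendsto_l2_inner_left c1 comp_X_L2 TL h st IL)
  have "(\<lambda>n. l2_inner N (indicator A) (\<lambda>\<omega>. P t (trunc n h) (X s \<omega>))) \<longlonglongrightarrow> l2_inner N (indicator A) (\<lambda>\<omega>. P t h (X s \<omega>))"
    unfolding l2_inner_commute[of N "indicator A"]
    by (intro tendsto_l2_inner_left c2 comp_X_L2 P_L2 TL h s t IL)
  moreover have "l2_inner N (indicator A) (\<lambda>\<omega>. P t (trunc n h) (X s \<omega>)) = l2_inner N (indicator A) (\<lambda>\<omega>. trunc n h (X (s + t) \<omega>))" for n
    unfolding l2_inner_def
    by (rule Markov_indicator_bounded[OF _ abs_trunc_le(1) s t A, symmetric])
      (use trunc_measurable[OF hm] in \<open>simp add: borel_measurable_mu\<close>)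
  ultimately show "(\<lambda>n. l2_inner N (indicator A) (\<lambda>\<omega>. trunc n h (X (s + t) \<omega>))) \<longlonglongrightarrow> l2_inner N (indicator A) (\<lambda>\<omega>. P t h (X s \<omega>))"
    by simp
qed

lemma Markov:
  assumes h: "h \<in> L2 mu" and s: "0 \<le> s" and t: "0 \<le> t"
    and W: "W \<in> L2 N" "W \<in> borel_measurable (past Om X s)"
  shows "l2_inner N W (\<lambda>\<omega>. h (X (s + t) \<omega>)) = l2_inner N W (\<lambda>\<omega>. P t h (X s \<omega>))"
proof -
  have L: "(\<lambda>\<omega>. h (X (s + t) \<omega>)) \<in> L2 N" "(\<lambda>\<omega>. P t h (X s \<omega>)) \<in> L2 N"
    using s t h by (auto intro!: comp_X_L2 P_L2)
  have "l2_inner N W (\<lambda>\<omega>. h (X (s + t) \<omega>) - P t h (X s \<omega>)) = 0"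
  proof (rule sub_sigma_orthogonal[OF N_prob subalgebra_generated_by _ _ W])
    fix A assume A: "A \<in> sets (past Om X s)"
    have AO: "A \<in> sets N" using generated_by_subset[of "{0..s}"] A by (auto simp: sets_N)
    have IL: "indicator A \<in> L2 N" by (rule N.L2_bounded[of _ 1]) (use AO in \<open>auto simp: indicator_def\<close>)
    have "l2_inner N (indicator A) (\<lambda>\<omega>. h (X (s + t) \<omega>) - P t h (X s \<omega>)) = 0"
      using Markov_indicator[OF h s t A] by (simp add: l2_inner_diff_right L IL)
    then show "(\<integral>\<omega>. indicator A \<omega> * (h (X (s + t) \<omega>) - P t h (X s \<omega>)) \<partial>N) = 0" by (simp add: l2_inner_def)
  qed (use L in \<open>auto intro: L2_closed\<close>)
  then show ?thesis using L W by (simp add: l2_inner_diff_right)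
qed

lemma Markov_two_times:
  assumes h: "h \<in> L2 mu" and g: "g \<in> L2 mu" and s: "0 \<le> s" and t: "0 \<le> t"
  shows "l2_inner N (\<lambda>\<omega>. g (X s \<omega>)) (\<lambda>\<omega>. h (X (s + t) \<omega>)) = l2_inner mu g (P t h)"
proof -
  have "l2_inner N (\<lambda>\<omega>. g (X s \<omega>)) (\<lambda>\<omega>. h (X (s + t) \<omega>)) = l2_inner N (\<lambda>\<omega>. g (X s \<omega>)) (\<lambda>\<omega>. P t h (X s \<omega>))"
    by (rule Markov[OF h s t comp_X_L2[OF g s] comp_X_generated[OF L2_measurable[OF g]]]) (use s in auto)
  also have "\<dots> = l2_inner mu g (P t h)" by (rule l2_inner_X[OF g P_L2(1)[OF h t] s])
  finally show ?thesis .
qed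

lemma P_zero:
  assumes F: "F \<in> L2 mu" shows "AE x in mu. P 0 F x = F x"
proof (rule AE_I2)
  fix x
  interpret prob_space "PP x" by (rule PP_prob)
  have "(\<integral>\<omega>. F (X 0 \<omega>) \<partial>PP x) = (\<integral>\<omega>. F x \<partial>PP x)"
    using initial_point[of x] comp_X_measurable[OF L2_measurable[OF F], of 0]
    by (intro integral_cong_AE) (auto simp: measurable_N_iff measurable_PP_iff elim: eventually_mono)
  then show "P 0 F x = F x" by (simp add: semigroup_def prob_space)
qed

lemma P_add:
  assumes s: "0 \<le> s" and t: "0 \<le> t" and F: "F \<in> L2 mu"
  shows "AE x in mu. P (s + t) F x = P s (P t F) x"
proof (rule l2_inner_eq_imp_AE_eq)
  show "P (s + t) F \<in> L2 mu" "P s (P t F) \<in> L2 mu" using s t by (auto intro!: P_L2 F)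
  fix G assume G: "G \<in> L2 mu"
  have G0: "(\<lambda>\<omega>. G (X 0 \<omega>)) \<in> L2 N" "(\<lambda>\<omega>. G (X 0 \<omega>)) \<in> borel_measurable (past Om X s)"
    using s by (auto intro!: comp_X_L2 G comp_X_generated L2_measurable[OF G])
  have "l2_inner mu G (P (s + t) F) = l2_inner N (\<lambda>\<omega>. G (X 0 \<omega>)) (\<lambda>\<omega>. F (X (s + t) \<omega>))"
    using Markov_two_times[OF F G, of 0 "s + t"] s t by simp
  also have "\<dots> = l2_inner N (\<lambda>\<omega>. G (X 0 \<omega>)) (\<lambda>\<omega>. P t F (X s \<omega>))"
    by (rule Markov[OF F s t G0])
  also have "\<dots> = l2_inner mu G (P s (P t F))"
    using Markov_two_times[OF P_L2(1)[OF F t] G, of 0 s] s by simp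
  finally show "l2_inner mu (P (s + t) F) G = l2_inner mu (P s (P t F)) G" by (simp add: l2_inner_commute)
qed

end

section \<open>Strong continuity of the semigroup\<close>

lemma lim_integral_dominated_at_right:
  fixes g :: "real \<Rightarrow> 'a \<Rightarrow> real"
  assumes M: "finite_measure M" and m: "\<And>t. 0 \<le> t \<Longrightarrow> g t \<in> borel_measurable M"
    and lim: "\<And>x. x \<in> space M \<Longrightarrow> ((\<lambda>t. g t x) \<longlongrightarrow> 0) (at_right 0)"
    and bd: "\<And>t x. \<bar>g t x\<bar> \<le> K"
  shows "((\<lambda>t. \<integral>x. g t x \<partial>M) \<longlongrightarrow> 0) (at_right 0)"
proof (rule tendsto_at_right_sequentially[of 0 1])
  interpret finite_measure M by (rule M)
  fix S :: "nat \<Rightarrow> real" assume S: "\<And>n. 0 < S n" "S \<longlonglongrightarrow> 0"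
  have "S n \<noteq> 0" for n using S(1)[of n] by simp
  then have SR: "filterlim S (at_right 0) sequentially"
    using S by (auto simp: filterlim_at)
  have "(\<lambda>n. \<integral>x. g (S n) x \<partial>M) \<longlonglongrightarrow> (\<integral>x. 0 \<partial>M)"
  proof (rule integral_dominated_convergence[where w="\<lambda>x. K"])
    show "(\<lambda>x. 0) \<in> borel_measurable M" by simp
    show "g (S n) \<in> borel_measurable M" for n using S(1)[of n] by (intro m) simp
    show "AE x in M. (\<lambda>n. g (S n) x) \<longlonglongrightarrow> 0"
      by (intro AE_I2 filterlim_compose[OF lim SR])
    show "AE x in M. norm (g (S n) x) \<le> K" for n using bd by simp
  qed simp
  then show "(\<lambda>n. \<integral>x. g (S n) x \<partial>M) \<longlonglongrightarrow> 0" by simp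
qed simp

context ergodic_diffusion
begin

text \<open>
  Mean oscillation in \<open>L\<^sup>1\<close>, from which strong continuity of the semigroup is derived.
\<close>

definition osc :: "('a \<Rightarrow> real) \<Rightarrow> real \<Rightarrow> real" where
  "osc F t = (\<integral>\<omega>. \<bar>F (X t \<omega>) - F (X 0 \<omega>)\<bar> \<partial>N)"

lemma comp_X_integrable:
  fixes F :: "'a \<Rightarrow> real"
  assumes "integrable mu F" "0 \<le> t" shows "integrable N (\<lambda>\<omega>. F (X t \<omega>))"
  using assms integrable_distr_eq[OF X_N[OF assms(2)], of F]
  by (simp add: distr_X borel_measurable_mu borel_measurable_integrable flip: borel_measurable_mu)

text \<open>
  Stationarity makes \<open>osc\<close> continuous for the norm of \<open>L\<^sup>1(\<mu>)\<close>, uniformly in time.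
\<close>

lemma osc_approx:
  assumes F: "integrable mu F" and ap: "\<And>e. 0 < e \<Longrightarrow> \<exists>g. integrable mu g \<and> (osc g \<longlongrightarrow> 0) (at_right 0) \<and> (\<integral>x. \<bar>F x - g x\<bar> \<partial>mu) \<le> e"
  shows "(osc F \<longlongrightarrow> 0) (at_right 0)"
proof (rule tendstoI)
  fix e :: real assume e: "0 < e"
  then obtain g where g: "integrable mu g" "(osc g \<longlongrightarrow> 0) (at_right 0)" "(\<integral>x. \<bar>F x - g x\<bar> \<partial>mu) \<le> e / 4"
    using ap[of "e/4"] by auto
  have "\<forall>\<^sub>F t in at_right 0. osc g t < e / 4" using g(2) e by (intro order_tendstoD) auto
  then show "\<forall>\<^sub>F t in at_right 0. dist (osc F t) 0 < e"
    using eventually_at_right_less[of 0]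
  proof eventually_elim
    case (elim t)
    note i = comp_X_integrable[OF F] comp_X_integrable[OF g(1)]
    have d: "(\<integral>\<omega>. \<bar>F (X s \<omega>) - g (X s \<omega>)\<bar> \<partial>N) \<le> e / 4" if "0 \<le> s" for s
      using integral_X[of "\<lambda>x. \<bar>F x - g x\<bar>" s] that g F by simp
    have "osc F t \<le> (\<integral>\<omega>. \<bar>F (X t \<omega>) - g (X t \<omega>)\<bar> + \<bar>g (X t \<omega>) - g (X 0 \<omega>)\<bar> + \<bar>F (X 0 \<omega>) - g (X 0 \<omega>)\<bar> \<partial>N)"
      unfolding osc_def using elim i by (intro integral_mono) auto
    also have "\<dots> = (\<integral>\<omega>. \<bar>F (X t \<omega>) - g (X t \<omega>)\<bar> \<partial>N) + osc g t + (\<integral>\<omega>. \<bar>F (X 0 \<omega>) - g (X 0 \<omega>)\<bar> \<partial>N)"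
      unfolding osc_def using elim i by simp
    finally show ?case using d[of t] d[of 0] elim e by (simp add: osc_def)
  qed
qed

text \<open>
  Continuity of paths enters here, by dominated convergence.
\<close>

lemma osc_continuous:
  assumes g: "continuous_on UNIV g" and b: "\<And>x. \<bar>g x\<bar> \<le> K"
  shows "(osc g \<longlongrightarrow> 0) (at_right 0)"
  unfolding osc_def
proof (rule lim_integral_dominated_at_right[where K="2 * K"])
  show "finite_measure N" by unfold_locales
  have gm: "g \<in> borel_measurable mu"
    using borel_measurable_continuous_onI[OF g] by (simp add: borel_measurable_mu)
  show "(\<lambda>\<omega>. \<bar>g (X t \<omega>) - g (X 0 \<omega>)\<bar>) \<in> borel_measurable N" if "0 \<le> t" for t
    by (intro borel_measurable_abs borel_measurable_diff comp_X_measurable gm that) simp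
  show "\<bar>\<bar>g (X t \<omega>) - g (X 0 \<omega>)\<bar>\<bar> \<le> 2 * K" for t \<omega> using b[of "X t \<omega>"] b[of "X 0 \<omega>"] by simp
  fix \<omega> assume "\<omega> \<in> space N"
  then have "continuous_on {0..} (\<lambda>t. X t \<omega>)" using continuous_paths by (simp add: space_N)
  then have "continuous_on {0..} (\<lambda>t. g (X t \<omega>))"
    by (rule continuous_on_compose2[OF g]) auto
  then have "((\<lambda>t. g (X t \<omega>)) \<longlongrightarrow> g (X 0 \<omega>)) (at 0 within {0..})"
    by (auto simp: continuous_on)
  then have "((\<lambda>t. g (X t \<omega>)) \<longlongrightarrow> g (X 0 \<omega>)) (at_right 0)"
    by (rule tendsto_within_subset) auto
  then show "((\<lambda>t. \<bar>g (X t \<omega>) - g (X 0 \<omega>)\<bar>) \<longlongrightarrow> 0) (at_right 0)"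
    by (intro tendsto_rabs_zero LIM_zero)
qed

text \<open>
  By regularity of \<open>\<mu>\<close>, an indicator is close in \<open>L\<^sup>1\<close> to an Urysohn function, which is continuous.
\<close>

lemma osc_indicator:
  assumes A: "A \<in> sets borel"
  shows "(osc (indicator A) \<longlongrightarrow> 0) (at_right 0)"
proof (rule osc_approx)
  show "integrable mu (indicator A :: 'a \<Rightarrow> real)"
    using A by (intro integrable_real_indicator) (simp_all add: sets_mu less_top[symmetric])
  fix e :: real assume e: "0 < e"
  have fin: "emeasure mu (space mu) \<noteq> \<infinity>" by simp
  have "emeasure mu A < emeasure mu A + ennreal (e/2)" using e by (simp add: mu.emeasure_eq_measure ennreal_plus[symmetric] ennreal_less_iff del: ennreal_plus)
  then have "(INF U \<in> {U. A \<subseteq> U \<and> open U}. emeasure mu U) < emeasure mu A + ennreal (e/2)"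
    using outer_regular[OF sets_mu fin A] by simp
  then obtain U where U: "A \<subseteq> U" "open U" "emeasure mu U < emeasure mu A + ennreal (e/2)"
    by (auto simp: INF_less_iff)
  have "\<exists>K. K \<subseteq> A \<and> compact K \<and> measure mu A < measure mu K + e/2"
  proof (cases "measure mu A < e/2")
    case True then show ?thesis by (intro exI[of _ "{}"]) auto
  next
    case False
    have "emeasure mu A = ennreal (measure mu A)" by (rule mu.emeasure_eq_measure)
    moreover have "ennreal (measure mu A - e/2) < ennreal (measure mu A)"
      using e False by (intro ennreal_lessI) auto
    ultimately have "ennreal (measure mu A - e/2) < (SUP K \<in> {K. K \<subseteq> A \<and> compact K}. emeasure mu K)"
      using inner_regular[OF sets_mu fin A] by simp
    then obtain K where "K \<subseteq> A" "compact K" "ennreal (measure mu A - e/2) < emeasure mu K"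
      by (auto simp: less_SUP_iff)
    then show ?thesis using False by (intro exI[of _ K]) (auto simp: mu.emeasure_eq_measure ennreal_less_iff)
  qed
  then obtain K where K: "K \<subseteq> A" "compact K" "measure mu A < measure mu K + e/2" by blast
  have UK: "measure mu (U - K) \<le> e"
  proof -
    have "measure mu U < measure mu A + e/2"
      using U(3) e by (simp add: mu.emeasure_eq_measure ennreal_plus[symmetric] ennreal_less_iff del: ennreal_plus)
    moreover have "measure mu (U - K) = measure mu U - measure mu K"
      using U K by (intro mu.finite_measure_Diff) (auto simp: sets_mu intro: borel_compact)
    ultimately show ?thesis using K(3) by simp
  qed
  obtain g :: "'a \<Rightarrow> real" where g: "continuous_on UNIV g" "\<And>x. g x \<in> closed_segment 1 0"
    "\<And>x. x \<in> K \<Longrightarrow> g x = 1" "\<And>x. x \<in> - U \<Longrightarrow> g x = 0"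
    using Urysohn[of K "- U" 1 0] compact_imp_closed[OF K(2)] U K(1) by (auto simp: closed_Compl)
  have g01: "0 \<le> g x" "g x \<le> 1" for x using g(2)[of x] by (auto simp: closed_segment_eq_real_ivl)
  have gm: "g \<in> borel_measurable mu"
    using borel_measurable_continuous_onI[OF g(1)] by (simp add: borel_measurable_mu)
  have gi: "integrable mu g" by (rule mu.integrable_const_bound[where B=1]) (use g01 gm in auto)
  have UKs: "U - K \<in> sets mu" using U K by (auto simp: sets_mu intro: borel_compact)
  have "(\<integral>x. \<bar>indicator A x - g x\<bar> \<partial>mu) \<le> (\<integral>x. indicator (U - K) x \<partial>mu)"
  proof (rule integral_mono)
    show "integrable mu (\<lambda>x. \<bar>indicator A x - g x\<bar>)"
      using A by (intro integrable_abs Bochner_Integration.integrable_diff gi integrable_real_indicator)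
        (simp_all add: sets_mu less_top[symmetric])
    show "integrable mu (indicat_real (U - K))"
      using UKs by (intro integrable_real_indicator) (simp_all add: less_top[symmetric])
    fix x show "\<bar>indicator A x - g x\<bar> \<le> indicat_real (U - K) x"
      using g01[of x] g(3)[of x] g(4)[of x] K(1) U(1) by (auto simp: indicator_def)
  qed
  also have "\<dots> = measure mu (U - K)" using UKs by simp
  finally have "(\<integral>x. \<bar>indicator A x - g x\<bar> \<partial>mu) \<le> e" using UK by simp
  moreover have "(osc g \<longlongrightarrow> 0) (at_right 0)"
    by (rule osc_continuous[OF g(1), of 1]) (use g01 in auto)
  ultimately show "\<exists>g. integrable mu g \<and> (osc g \<longlongrightarrow> 0) (at_right 0) \<and> (\<integral>x. \<bar>indicator A x - g x\<bar> \<partial>mu) \<le> e"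
    using gi by blast
qed

lemma osc_tendsto:
  assumes F: "integrable mu F"
  shows "(osc F \<longlongrightarrow> 0) (at_right 0)"
  using F
proof (induction rule: integrable_induct)
  case (base A c)
  have "osc (\<lambda>x. indicator A x *\<^sub>R c) = (\<lambda>t. \<bar>c\<bar> * osc (indicator A) t)"
  proof
    fix t
    have "\<bar>indicat_real A x *\<^sub>R c - indicat_real A y *\<^sub>R c\<bar> = \<bar>c\<bar> * \<bar>indicator A x - indicator A y\<bar>" for x y
      by (simp add: indicator_def)
    then show "osc (\<lambda>x. indicator A x *\<^sub>R c) t = \<bar>c\<bar> * osc (indicator A) t"
      unfolding osc_def by simp
  qed
  moreover have "((\<lambda>t. \<bar>c\<bar> * osc (indicator A) t) \<longlongrightarrow> \<bar>c\<bar> * 0) (at_right 0)"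
    using base by (intro tendsto_mult tendsto_const osc_indicator) (simp add: sets_mu)
  ultimately show ?case by simp
next
  case (add f g)
  have "((\<lambda>t. osc f t + osc g t) \<longlongrightarrow> 0 + 0) (at_right 0)" by (intro tendsto_add add)
  then have *: "((\<lambda>t. osc f t + osc g t) \<longlongrightarrow> 0) (at_right 0)" by simp
  show ?case
  proof (rule Lim_null_comparison[OF _ *])
    show "\<forall>\<^sub>F t in at_right 0. norm (osc (\<lambda>x. f x + g x) t) \<le> osc f t + osc g t"
      using eventually_at_right_less[of 0]
    proof eventually_elim
      case (elim t)
      note i = comp_X_integrable[OF add(1)] comp_X_integrable[OF add(2)]
      have "osc (\<lambda>x. f x + g x) t \<le> (\<integral>\<omega>. \<bar>f (X t \<omega>) - f (X 0 \<omega>)\<bar> + \<bar>g (X t \<omega>) - g (X 0 \<omega>)\<bar> \<partial>N)"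
        unfolding osc_def using elim i by (intro integral_mono) auto
      also have "\<dots> = osc f t + osc g t" unfolding osc_def using elim i by simp
      finally show ?case by (simp add: osc_def)
    qed
  qed
next
  case (lim f s)
  show ?case
  proof (rule osc_approx[OF lim(4)])
    fix e :: real assume e: "0 < e"
    have "(\<lambda>i. \<integral>x. \<bar>f x - s i x\<bar> \<partial>mu) \<longlonglongrightarrow> (\<integral>x. 0 \<partial>mu)"
    proof (rule integral_dominated_convergence[where w="\<lambda>x. 3 * \<bar>f x\<bar>"])
      show "integrable mu (\<lambda>x. 3 * \<bar>f x\<bar>)" using lim(4) by simp
      show "(\<lambda>x. \<bar>f x - s i x\<bar>) \<in> borel_measurable mu" for i using lim(1)[of i] lim(4) by auto
      show "AE x in mu. (\<lambda>i. \<bar>f x - s i x\<bar>) \<longlonglongrightarrow> 0"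
      proof (rule AE_I2)
        fix x assume "x \<in> space mu"
        from tendsto_diff[OF tendsto_const[of "f x"] lim(2)[OF this]]
        show "(\<lambda>i. \<bar>f x - s i x\<bar>) \<longlonglongrightarrow> 0" by (intro tendsto_rabs_zero) simp
      qed
      show "AE x in mu. norm \<bar>f x - s i x\<bar> \<le> 3 * \<bar>f x\<bar>" for i
        using lim(3)[of _ i] by (intro AE_I2) (smt (verit) real_norm_def)
    qed simp
    then have "\<forall>\<^sub>F i in sequentially. (\<integral>x. \<bar>f x - s i x\<bar> \<partial>mu) < e"
      using e by (intro order_tendstoD(2)) simp_all
    then obtain i where "(\<integral>x. \<bar>f x - s i x\<bar> \<partial>mu) < e" by (auto simp: eventually_sequentially)
    then show "\<exists>g. integrable mu g \<and> (osc g \<longlongrightarrow> 0) (at_right 0) \<and> (\<integral>x. \<bar>f x - g x\<bar> \<partial>mu) \<le> e"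
      using lim(1,5) by (intro exI[of _ "s i"]) auto
  qed
qed

text \<open>
  For bounded functions the norms of \<open>L\<^sup>1\<close> and \<open>L\<^sup>2\<close> of the oscillation are comparable.
\<close>

lemma l2_osc_bounded:
  assumes gm: "g \<in> borel_measurable mu" and b: "\<And>x. \<bar>g x\<bar> \<le> K"
  shows "((\<lambda>t. l2_norm N (\<lambda>\<omega>. g (X t \<omega>) - g (X 0 \<omega>))) \<longlongrightarrow> 0) (at_right 0)"
proof -
  have gL: "g \<in> L2 mu" by (rule mu.L2_bounded[OF gm, of K]) (rule b)
  have K0: "0 \<le> K" using order_trans[OF abs_ge_zero b] .
  have "((\<lambda>t. sqrt (2 * K * osc g t)) \<longlongrightarrow> sqrt (2 * K * 0)) (at_right 0)"
    by (intro tendsto_intros osc_tendsto mu.L2_integrable gL)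
  then have *: "((\<lambda>t. sqrt (2 * K * osc g t)) \<longlongrightarrow> 0) (at_right 0)" by simp
  show ?thesis
  proof (rule Lim_null_comparison[OF _ *])
    show "\<forall>\<^sub>F t in at_right 0. norm (l2_norm N (\<lambda>\<omega>. g (X t \<omega>) - g (X 0 \<omega>))) \<le> sqrt (2 * K * osc g t)"
      using eventually_at_right_less[of 0]
    proof eventually_elim
      case (elim t)
      have L: "(\<lambda>\<omega>. g (X t \<omega>) - g (X 0 \<omega>)) \<in> L2 N" using elim by (intro L2_closed comp_X_L2 gL) auto
      have "(l2_norm N (\<lambda>\<omega>. g (X t \<omega>) - g (X 0 \<omega>)))\<^sup>2 \<le> (\<integral>\<omega>. 2 * K * \<bar>g (X t \<omega>) - g (X 0 \<omega>)\<bar> \<partial>N)"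
        unfolding l2_norm_sq'
      proof (rule integral_mono)
        show "integrable N (\<lambda>\<omega>. 2 * K * \<bar>g (X t \<omega>) - g (X 0 \<omega>)\<bar>)"
          using N.L2_integrable[OF L] by simp
        fix \<omega>
        have "\<bar>g (X t \<omega>) - g (X 0 \<omega>)\<bar> \<le> 2 * K" using b[of "X t \<omega>"] b[of "X 0 \<omega>"] by simp
        then have "\<bar>g (X t \<omega>) - g (X 0 \<omega>)\<bar> * \<bar>g (X t \<omega>) - g (X 0 \<omega>)\<bar> \<le> 2 * K * \<bar>g (X t \<omega>) - g (X 0 \<omega>)\<bar>"
          by (intro mult_right_mono) auto
        then show "(g (X t \<omega>) - g (X 0 \<omega>))\<^sup>2 \<le> 2 * K * \<bar>g (X t \<omega>) - g (X 0 \<omega>)\<bar>"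
          by (simp add: power2_eq_square)
      qed (rule L2_sq_integrable[OF L])
      also have "\<dots> = 2 * K * osc g t" unfolding osc_def by simp
      finally show ?case using l2_norm_nonneg[of N] by (simp add: real_le_rsqrt)
    qed
  qed
qed

lemma l2_osc:
  assumes F: "F \<in> L2 mu"
  shows "((\<lambda>t. l2_norm N (\<lambda>\<omega>. F (X t \<omega>) - F (X 0 \<omega>))) \<longlongrightarrow> 0) (at_right 0)"
proof (rule tendstoI)
  fix e :: real assume e: "0 < e"
  note Fm = L2_measurable[OF F]
  have TL: "trunc n F \<in> L2 mu" for n by (rule mu.trunc_L2[OF Fm])
  have "\<forall>\<^sub>F n in sequentially. l2_norm mu (\<lambda>x. trunc n F x - F x) < e / 3"
    using trunc_tendsto[OF F] e unfolding L2_tendsto_iff by (intro order_tendstoD(2)) auto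
  then obtain n where n: "l2_norm mu (\<lambda>x. trunc n F x - F x) < e / 3" by (auto simp: eventually_sequentially)
  have "\<forall>\<^sub>F t in at_right 0. l2_norm N (\<lambda>\<omega>. trunc n F (X t \<omega>) - trunc n F (X 0 \<omega>)) < e / 3"
    using e by (intro order_tendstoD(2)[OF l2_osc_bounded[OF trunc_measurable[OF Fm] abs_trunc_le(1)]]) auto
  then show "\<forall>\<^sub>F t in at_right 0. dist (l2_norm N (\<lambda>\<omega>. F (X t \<omega>) - F (X 0 \<omega>))) 0 < e"
    using eventually_at_right_less[of 0]
  proof eventually_elim
    case (elim t)
    have L: "(\<lambda>\<omega>. F (X t \<omega>)) \<in> L2 N" "(\<lambda>\<omega>. F (X 0 \<omega>)) \<in> L2 N" "(\<lambda>\<omega>. trunc n F (X t \<omega>)) \<in> L2 N" "(\<lambda>\<omega>. trunc n F (X 0 \<omega>)) \<in> L2 N"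
      using elim by (auto intro!: comp_X_L2 F TL)
    have d: "l2_norm N (\<lambda>\<omega>. trunc n F (X s \<omega>) - F (X s \<omega>)) < e / 3" if "0 \<le> s" for s
      using n l2_norm_X[OF L2_diff[OF TL F] that] by simp
    have "l2_norm N (\<lambda>\<omega>. F (X t \<omega>) - F (X 0 \<omega>)) \<le> l2_norm N (\<lambda>\<omega>. F (X t \<omega>) - trunc n F (X t \<omega>)) + l2_norm N (\<lambda>\<omega>. trunc n F (X t \<omega>) - F (X 0 \<omega>))"
      by (rule l2_norm_triangle_via[OF L(1,3,2)])
    also have "\<dots> \<le> l2_norm N (\<lambda>\<omega>. F (X t \<omega>) - trunc n F (X t \<omega>)) + (l2_norm N (\<lambda>\<omega>. trunc n F (X t \<omega>) - trunc n F (X 0 \<omega>)) + l2_norm N (\<lambda>\<omega>. trunc n F (X 0 \<omega>) - F (X 0 \<omega>)))"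
      using l2_norm_triangle_via[OF L(3,4,2)] by simp
    also have "\<dots> < e / 3 + (e / 3 + e / 3)"
      using d[of t] d[of 0] elim l2_norm_minus_commute[of N "\<lambda>\<omega>. F (X t \<omega>)" "\<lambda>\<omega>. trunc n F (X t \<omega>)"]
      by (intro add_strict_mono) auto
    finally show ?case by (simp add: l2_norm_nonneg)
  qed
qed

lemma P_strongly_continuous:
  assumes F: "F \<in> L2 mu" shows "L2_tendsto mu (\<lambda>t. P t F) F (at_right 0)"
  unfolding L2_tendsto_iff
proof (rule Lim_null_comparison[OF _ l2_osc[OF F]])
  show "\<forall>\<^sub>F t in at_right 0. norm (l2_norm mu (\<lambda>x. P t F x - F x)) \<le> l2_norm N (\<lambda>\<omega>. F (X t \<omega>) - F (X 0 \<omega>))"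
    using eventually_at_right_less[of 0]
  proof eventually_elim
    case (elim t)
    then have t: "0 \<le> t" by simp
    have "l2_norm mu (\<lambda>x. P t F x - F x) \<le> l2_norm N (\<lambda>\<omega>. F (X t \<omega>) - F (X 0 \<omega>))"
    proof (rule l2_norm_le_if_weak)
      show "(\<lambda>x. P t F x - F x) \<in> L2 mu" by (intro L2_closed P_L2 F t)
      fix H assume H: "H \<in> L2 mu"
      have "l2_inner mu (\<lambda>x. P t F x - F x) H = l2_inner N (\<lambda>\<omega>. F (X t \<omega>) - F (X 0 \<omega>)) (\<lambda>\<omega>. H (X 0 \<omega>))"
        using Markov_two_times[OF F H, of 0 t] l2_inner_X[OF F H, of 0] t
        by (simp add: l2_inner_diff_left l2_inner_diff_right P_L2 F H comp_X_L2 l2_inner_commute)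
      then show "\<bar>l2_inner mu (\<lambda>x. P t F x - F x) H\<bar> \<le> l2_norm N (\<lambda>\<omega>. F (X t \<omega>) - F (X 0 \<omega>)) * l2_norm mu H"
        using l2_Cauchy_Schwarz[of "\<lambda>\<omega>. F (X t \<omega>) - F (X 0 \<omega>)" N "\<lambda>\<omega>. H (X 0 \<omega>)"] t l2_norm_X[OF H, of 0]
        by (simp add: L2_diff comp_X_L2 F H)
    qed (rule l2_norm_nonneg)
    then show ?case by (simp add: l2_norm_nonneg)
  qed
qed

lemma P_contraction_semigroup: "L2_contraction_semigroup mu P"
  by unfold_locales (use P_L2 P_lincomb P_zero P_add P_strongly_continuous in blast)+

sublocale S: L2_contraction_semigroup mu P by (rule P_contraction_semigroup)

section \<open>Integrals along the path\<close>

text \<open>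
  For paths along which \<open>h\<close> is not integrable the value is \<open>0\<close>; for \<open>h\<close> in \<open>L\<^sup>2(\<mu>)\<close> these paths form
  a null set.
\<close>

definition path_integral :: "('a \<Rightarrow> real) \<Rightarrow> real \<Rightarrow> real \<Rightarrow> 'w \<Rightarrow> real" where
  "path_integral h a b \<omega> = (LINT s:{a..b}|lborel. h (X s \<omega>))"

text \<open>
  Joint measurability with respect to an arbitrary \<open>\<sigma>\<close>-field \<open>F\<close>, so that integrals over \<open>{a..b}\<close>
  are measurable for the \<open>\<sigma>\<close>-field generated by this time interval: approximate the path by its
  values at multiples of \<open>1/n\<close>, clamped to \<open>{a..b}\<close>.
\<close>

lemma X_joint_measurable:
  assumes a: "0 \<le> a" "a \<le> b" and F: "space F = space Om" "\<And>u. u \<in> {a..b} \<Longrightarrow> X u \<in> borel_measurable F"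
  shows "(\<lambda>z. X (snd z) (fst z)) \<in> borel_measurable (F \<Otimes>\<^sub>M restrict_space lborel {a..b})"
proof (rule borel_measurable_LIMSEQ_metric)
  let ?c = "\<lambda>s. max a (min b s)"
  let ?R = "restrict_space lborel {a..b}"
  fix n
  show "(\<lambda>z. X (?c (real_of_int \<lfloor>real (Suc n) * snd z\<rfloor> / real (Suc n))) (fst z)) \<in> borel_measurable (F \<Otimes>\<^sub>M ?R)"
  proof (rule measurable_compose_countable[where f="\<lambda>k z. X (?c (real_of_int k / real (Suc n))) (fst z)"])
    show "(\<lambda>z. X (?c (real_of_int k / real (Suc n))) (fst z)) \<in> borel_measurable (F \<Otimes>\<^sub>M ?R)" for k
      using a by (intro measurable_compose[OF measurable_fst] F(2)) auto
    have "(\<lambda>s. \<lfloor>real (Suc n) * s\<rfloor>) \<in> measurable ?R (count_space UNIV)"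
      by (intro measurable_restrict_space1) (simp, measurable)
    then show "(\<lambda>z. \<lfloor>real (Suc n) * snd z\<rfloor>) \<in> measurable (F \<Otimes>\<^sub>M ?R) (count_space UNIV)"
      by (rule measurable_compose[OF measurable_snd])
  qed
next
  let ?c = "\<lambda>s. max a (min b s)"
  fix z assume "z \<in> space (F \<Otimes>\<^sub>M restrict_space lborel {a..b})"
  then have z: "fst z \<in> space Om" "snd z \<in> {a..b}" by (auto simp: space_pair_measure F space_restrict_space)
  have "(\<lambda>n. real_of_int \<lfloor>real (Suc n) * snd z\<rfloor> / real (Suc n) - snd z) \<longlonglongrightarrow> 0"
  proof (rule Lim_null_comparison[OF always_eventually LIMSEQ_inverse_real_of_nat], rule allI)
    fix n
    have "\<bar>real_of_int \<lfloor>real (Suc n) * snd z\<rfloor> - real (Suc n) * snd z\<bar> \<le> 1" by linarith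
    then have "\<bar>real_of_int \<lfloor>real (Suc n) * snd z\<rfloor> - real (Suc n) * snd z\<bar> / real (Suc n) \<le> 1 / real (Suc n)"
      by (intro divide_right_mono) auto
    moreover have "\<bar>real_of_int \<lfloor>real (Suc n) * snd z\<rfloor> / real (Suc n) - snd z\<bar>
       = \<bar>real_of_int \<lfloor>real (Suc n) * snd z\<rfloor> - real (Suc n) * snd z\<bar> / real (Suc n)"
      by (subst abs_div_pos) (auto simp: diff_divide_distrib)
    ultimately show "norm (real_of_int \<lfloor>real (Suc n) * snd z\<rfloor> / real (Suc n) - snd z) \<le> inverse (real (Suc n))"
      by (simp add: inverse_eq_divide)
  qed
  then have "(\<lambda>n. real_of_int \<lfloor>real (Suc n) * snd z\<rfloor> / real (Suc n)) \<longlonglongrightarrow> snd z" by (rule LIM_zero_cancel)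
  then have "(\<lambda>n. ?c (real_of_int \<lfloor>real (Suc n) * snd z\<rfloor> / real (Suc n))) \<longlonglongrightarrow> ?c (snd z)"
    by (intro tendsto_intros)
  moreover have "?c (snd z) = snd z" using z by auto
  ultimately show "(\<lambda>n. X (?c (real_of_int \<lfloor>real (Suc n) * snd z\<rfloor> / real (Suc n))) (fst z)) \<longlonglongrightarrow> X (snd z) (fst z)"
    using z a by (intro continuous_on_tendsto_compose[OF continuous_paths[OF z(1)]]) (auto intro!: always_eventually)
qed

lemma path_integral_restrict: "path_integral h a b \<omega> = (\<integral>s. h (X s \<omega>) \<partial>restrict_space lborel {a..b})"
  unfolding path_integral_def set_lebesgue_integral_def by (subst integral_restrict_space) auto

lemma finite_restrict: "finite_measure (restrict_space lborel {a..b::real})"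
  by (intro finite_measureI) (simp add: emeasure_restrict_space space_restrict_space emeasure_lborel_Icc_eq)

lemma path_integral_measurable:
  assumes h: "h \<in> borel_measurable mu" and a: "0 \<le> a" "a \<le> b" and F: "space F = space Om" "\<And>u. u \<in> {a..b} \<Longrightarrow> X u \<in> borel_measurable F"
  shows "path_integral h a b \<in> borel_measurable F"
proof -
  interpret R: finite_measure "restrict_space lborel {a..b}" by (rule finite_restrict)
  have "(\<lambda>z. h (X (snd z) (fst z))) \<in> borel_measurable (F \<Otimes>\<^sub>M restrict_space lborel {a..b})"
    using measurable_compose[OF X_joint_measurable[OF a F], of h borel] h by (simp add: borel_measurable_mu)
  then have "(\<lambda>\<omega>. \<integral>s. h (X s \<omega>) \<partial>restrict_space lborel {a..b}) \<in> borel_measurable F"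
    by (intro R.borel_measurable_lebesgue_integral) (simp add: case_prod_beta')
  then show ?thesis unfolding path_integral_restrict[abs_def] .
qed

lemma path_integral_generated:
  assumes "h \<in> borel_measurable mu" "0 \<le> a" "a \<le> b"
  shows "path_integral h a b \<in> borel_measurable (generated_by Om X {a..b})"
  by (rule path_integral_measurable[OF assms space_generated_by measurable_generated_by])

lemma joint_integrable:
  assumes h: "h \<in> L2 mu" and a: "0 \<le> a" "a \<le> b" and Z: "Z \<in> L2 N"
  shows "integrable (N \<Otimes>\<^sub>M restrict_space lborel {a..b}) (\<lambda>(\<omega>, s). Z \<omega> * h (X s \<omega>))"
proof -
  let ?R = "restrict_space lborel {a..b}"
  interpret R: finite_measure ?R by (rule finite_restrict)
  interpret pair_sigma_finite N ?R by unfold_locales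
  note hm = L2_measurable[OF h]
  have X: "X u \<in> borel_measurable N" if "u \<in> {a..b}" for u using X_N[of u] that a by auto
  have m: "(\<lambda>z. h (X (snd z) (fst z))) \<in> borel_measurable (N \<Otimes>\<^sub>M ?R)"
    using measurable_compose[OF X_joint_measurable[OF a space_N X], of h borel] hm by (simp add: borel_measurable_mu)
  have m2: "(\<lambda>z. Z (fst z) * h (X (snd z) (fst z))) \<in> borel_measurable (N \<Otimes>\<^sub>M ?R)"
    by (intro borel_measurable_times m measurable_compose[OF measurable_fst L2_measurable[OF Z]])
  have "(\<integral>\<^sup>+z. ennreal (norm (Z (fst z) * h (X (snd z) (fst z)))) \<partial>(N \<Otimes>\<^sub>M ?R))
    = (\<integral>\<^sup>+s. \<integral>\<^sup>+\<omega>. ennreal (norm (Z \<omega> * h (X s \<omega>))) \<partial>N \<partial>?R)"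
    using m2 by (subst nn_integral_snd[symmetric]) auto
  also have "\<dots> \<le> (\<integral>\<^sup>+s. ennreal (l2_norm N Z * l2_norm mu h) \<partial>?R)"
  proof (rule nn_integral_mono)
    fix s assume "s \<in> space ?R"
    then have s: "0 \<le> s" using a by (auto simp: space_restrict_space)
    have L: "(\<lambda>\<omega>. \<bar>Z \<omega>\<bar>) \<in> L2 N" "(\<lambda>\<omega>. \<bar>h (X s \<omega>)\<bar>) \<in> L2 N"
      using Z comp_X_L2[OF h s] by (auto simp: L2_def)
    have i: "integrable N (\<lambda>\<omega>. norm (Z \<omega> * h (X s \<omega>)))"
      by (intro integrable_norm L2_mult_integrable Z comp_X_L2 h s)
    have "(\<integral>\<omega>. norm (Z \<omega> * h (X s \<omega>)) \<partial>N) = l2_inner N (\<lambda>\<omega>. \<bar>Z \<omega>\<bar>) (\<lambda>\<omega>. \<bar>h (X s \<omega>)\<bar>)"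
      by (simp add: l2_inner_def abs_mult)
    also have "\<dots> \<le> l2_norm N (\<lambda>\<omega>. \<bar>Z \<omega>\<bar>) * l2_norm N (\<lambda>\<omega>. \<bar>h (X s \<omega>)\<bar>)"
      using l2_Cauchy_Schwarz[OF L] by simp
    also have "\<dots> = l2_norm N Z * l2_norm mu h"
      using l2_norm_X[OF h s] by (simp add: l2_norm_def l2_inner_def)
    finally show "(\<integral>\<^sup>+\<omega>. ennreal (norm (Z \<omega> * h (X s \<omega>))) \<partial>N) \<le> ennreal (l2_norm N Z * l2_norm mu h)"
      using nn_integral_eq_integral[OF i] by (simp add: ennreal_leI)
  qed
  also have "\<dots> < \<infinity>" by (simp add: ennreal_mult_less_top space_restrict_space emeasure_restrict_space emeasure_lborel_Icc_eq)
  finally show ?thesis using m2 by (intro integrableI_bounded) (auto simp: case_prod_beta')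
qed

text \<open>
  Fubini's theorem; all later computations with path integrals use inner products with them.
\<close>

lemma path_integral_inner_aux:
  assumes h: "h \<in> L2 mu" and a: "0 \<le> a" "a \<le> b" and Z: "Z \<in> L2 N"
  shows "set_integrable lborel {a..b} (\<lambda>s. l2_inner N Z (\<lambda>\<omega>. h (X s \<omega>)))"
    "l2_inner N Z (path_integral h a b) = (LINT s:{a..b}|lborel. l2_inner N Z (\<lambda>\<omega>. h (X s \<omega>)))"
proof -
  let ?R = "restrict_space lborel {a..b}"
  interpret R: finite_measure ?R by (rule finite_restrict)
  interpret pair_sigma_finite N ?R by unfold_locales
  note i = joint_integrable[OF assms]
  show "set_integrable lborel {a..b} (\<lambda>s. l2_inner N Z (\<lambda>\<omega>. h (X s \<omega>)))"
    using integrable_snd[OF i] unfolding set_integrable_def l2_inner_def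
    by (subst (asm) integrable_restrict_space) auto
  have "l2_inner N Z (path_integral h a b) = (\<integral>\<omega>. (\<integral>s. Z \<omega> * h (X s \<omega>) \<partial>?R) \<partial>N)"
    unfolding l2_inner_def path_integral_restrict by simp
  also have "\<dots> = (\<integral>s. (\<integral>\<omega>. Z \<omega> * h (X s \<omega>) \<partial>N) \<partial>?R)"
    by (rule Fubini_integral[OF i, symmetric])
  also have "\<dots> = (LINT s:{a..b}|lborel. l2_inner N Z (\<lambda>\<omega>. h (X s \<omega>)))"
    unfolding l2_inner_def set_lebesgue_integral_def by (subst integral_restrict_space) auto
  finally show "l2_inner N Z (path_integral h a b) = \<dots>" .
qed

lemma path_integral_L2:
  assumes h: "h \<in> L2 mu" and a: "0 \<le> a" "a \<le> b"
  shows "path_integral h a b \<in> L2 N"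
proof -
  let ?R = "restrict_space lborel {a..b}"
  interpret R: finite_measure ?R by (rule finite_restrict)
  interpret pair_sigma_finite N ?R by unfold_locales
  note hm = L2_measurable[OF h]
  have X: "X u \<in> borel_measurable N" if "u \<in> {a..b}" for u using X_N[of u] that a by auto
  have m: "(\<lambda>z. h (X (snd z) (fst z))) \<in> borel_measurable (N \<Otimes>\<^sub>M ?R)"
    using measurable_compose[OF X_joint_measurable[OF a space_N X], of h borel] hm by (simp add: borel_measurable_mu)
  have "(\<integral>\<^sup>+z. ennreal ((h (X (snd z) (fst z)))\<^sup>2) \<partial>(N \<Otimes>\<^sub>M ?R))
    = (\<integral>\<^sup>+s. \<integral>\<^sup>+\<omega>. ennreal ((h (X s \<omega>))\<^sup>2) \<partial>N \<partial>?R)"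
    using m by (subst nn_integral_snd[symmetric]) auto
  also have "\<dots> = (\<integral>\<^sup>+s. ennreal ((l2_norm mu h)\<^sup>2) \<partial>?R)"
  proof (rule nn_integral_cong)
    fix s assume "s \<in> space ?R"
    then have s: "0 \<le> s" using a by (auto simp: space_restrict_space)
    have "(\<integral>\<^sup>+\<omega>. ennreal ((h (X s \<omega>))\<^sup>2) \<partial>N) = ennreal (\<integral>\<omega>. (h (X s \<omega>))\<^sup>2 \<partial>N)"
      by (rule nn_integral_eq_integral[OF L2_sq_integrable[OF comp_X_L2[OF h s]]]) simp
    then show "(\<integral>\<^sup>+\<omega>. ennreal ((h (X s \<omega>))\<^sup>2) \<partial>N) = ennreal ((l2_norm mu h)\<^sup>2)"
      by (simp add: l2_norm_sq'[symmetric] l2_norm_X[OF h s])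
  qed
  also have "\<dots> < \<infinity>" by (simp add: ennreal_mult_less_top space_restrict_space emeasure_restrict_space emeasure_lborel_Icc_eq)
  finally have i: "integrable (N \<Otimes>\<^sub>M ?R) (\<lambda>(\<omega>, s). (h (X s \<omega>))\<^sup>2)"
    using m by (intro integrableI_nonneg) (auto simp: case_prod_beta')
  have pm: "path_integral h a b \<in> borel_measurable N" by (rule path_integral_measurable[OF hm a space_N X])
  have "integrable N (\<lambda>\<omega>. (path_integral h a b \<omega>)\<^sup>2)"
  proof (rule Bochner_Integration.integrable_bound)
    show "integrable N (\<lambda>\<omega>. (b - a) * (\<integral>s. (h (X s \<omega>))\<^sup>2 \<partial>?R))"
      using integrable_fst[OF i] by simp
    show "(\<lambda>\<omega>. (path_integral h a b \<omega>)\<^sup>2) \<in> borel_measurable N" using pm by simp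
    show "AE \<omega> in N. norm ((path_integral h a b \<omega>)\<^sup>2) \<le> norm ((b - a) * (\<integral>s. (h (X s \<omega>))\<^sup>2 \<partial>?R))"
      using AE_integrable_fst[OF i] AE_space
    proof eventually_elim
      case (elim \<omega>)
      have "(\<lambda>s. X s \<omega>) \<in> borel_measurable ?R"
      proof -
        have "continuous_on {a..b} (\<lambda>s. X s \<omega>)"
          using continuous_paths[of \<omega>] elim(2) a by (auto simp: space_N intro: continuous_on_subset)
        from borel_measurable_continuous_on_restrict[OF this] show ?thesis
          by (simp add: measurable_cong_sets[OF sets_restrict_space_cong[OF sets_lborel] refl])
      qed
      then have "(\<lambda>s. h (X s \<omega>)) \<in> borel_measurable ?R"
        using hm measurable_compose[of "\<lambda>s. X s \<omega>" ?R borel h borel] by (simp add: borel_measurable_mu)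
      then have L: "(\<lambda>s. h (X s \<omega>)) \<in> L2 ?R" using elim(1) by (simp add: L2_def)
      have "(l2_inner ?R (\<lambda>s. h (X s \<omega>)) (\<lambda>s. 1))\<^sup>2 \<le> l2_inner ?R (\<lambda>s. h (X s \<omega>)) (\<lambda>s. h (X s \<omega>)) * l2_inner ?R (\<lambda>s. 1) (\<lambda>s. 1)"
        by (rule l2_inner_sq_le[OF L R.L2_const])
      moreover have "l2_inner ?R (\<lambda>s. 1) (\<lambda>s. 1) = b - a"
        using a by (simp add: l2_inner_def measure_restrict_space space_restrict_space)
      ultimately have "(path_integral h a b \<omega>)\<^sup>2 \<le> (b - a) * (\<integral>s. (h (X s \<omega>))\<^sup>2 \<partial>?R)"
        unfolding path_integral_restrict by (simp add: l2_inner_def power2_eq_square mult.commute)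
      then show ?case using a by simp
    qed
  qed
  then show ?thesis using pm by (simp add: L2_def)
qed

end

section \<open>Density of the domain and the adjoint equation\<close>

lemma LINT_abs_le':
  fixes g :: "real \<Rightarrow> real"
  assumes i: "set_integrable lborel {a..b} g" and ab: "a \<le> b" and K: "\<And>s. s \<in> {a..b} \<Longrightarrow> \<bar>g s\<bar> \<le> K"
  shows "\<bar>LINT s:{a..b}|lborel. g s\<bar> \<le> (b - a) * K"
proof -
  have k: "set_integrable lborel {a..b} (\<lambda>s. K)"
    by (intro borel_integrable_atLeastAtMost' continuous_intros)
  have "\<bar>LINT s:{a..b}|lborel. g s\<bar> \<le> (LINT s:{a..b}|lborel. norm (g s))"
    using set_integral_norm_bound[OF i] by simp
  also have "\<dots> \<le> (LINT s:{a..b}|lborel. K)"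
    by (rule set_integral_mono[OF set_integrable_norm[OF i] k]) (use K in auto)
  finally show ?thesis by (simp add: LINT_const ab)
qed

lemma laplace_abs_mono:
  assumes c: "set_integrable lborel {0..} (\<lambda>s. exp (- l * s) * c s)" and d: "set_integrable lborel {0..} (\<lambda>s. exp (- l * s) * d s)"
    and le: "\<And>s. 0 \<le> s \<Longrightarrow> \<bar>c s\<bar> \<le> d s"
  shows "\<bar>laplace l c\<bar> \<le> laplace l d"
proof -
  have "\<bar>laplace l c\<bar> \<le> (LINT s:{0..}|lborel. norm (exp (- l * s) * c s))"
    unfolding laplace_def using set_integral_norm_bound[OF c] by simp
  also have "\<dots> \<le> laplace l d"
    unfolding laplace_def
    by (rule set_integral_mono[OF set_integrable_norm[OF c] d]) (use le in \<open>simp add: abs_mult\<close>)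
  finally show ?thesis .
qed

lemma laplace_linear:
  assumes "0 < l"
  shows "laplace l (\<lambda>s. A + B * s) = A / l + B / l\<^sup>2" "set_integrable lborel {0..} (\<lambda>s. exp (- l * s) * (A + B * s))"
proof -
  have b1: "\<bar>1::real\<bar> \<le> 1 * exp ((l/2) * s)" if "0 \<le> s" for s using that assms by simp
  note L = laplace_LINT[of "\<lambda>_. 1" 1 "l/2" l, OF continuous_on_const b1]
  have I: "(LINT s:{0..t}|lborel. (1::real)) = t" if "0 \<le> t" for t using that by (simp add: LINT_const)
  have b2: "\<bar>s\<bar> \<le> 1 / (l/2) * exp ((l/2) * s)" if "0 \<le> s" for s
    using L(1)[OF _ _ _ that] I[OF that] assms by simp
  have i1: "set_integrable lborel {0..} (\<lambda>s. exp (- l * s))" by (rule exp_set_integrable(1)[OF assms])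
  have i2: "set_integrable lborel {0..} (\<lambda>s. exp (- l * s) * s)"
    by (rule laplace_integrable[OF continuous_on_id b2]) (use assms in auto)
  have "laplace l (\<lambda>s. LINT r:{0..s}|lborel. (1::real)) = laplace l (\<lambda>s. s)"
    unfolding laplace_def by (intro set_lebesgue_integral_cong) (auto simp: I)
  then have l2: "laplace l (\<lambda>s. s) = 1 / l\<^sup>2"
    using L(2) exp_set_integrable(2)[OF assms] assms by (simp add: field_simps power2_eq_square)
  have eq: "exp (- l * s) * (A + B * s) = A * exp (- l * s) + B * (exp (- l * s) * s)" for s by (simp add: algebra_simps)
  have j: "set_integrable lborel {0..} (\<lambda>s. A * exp (- l * s))" "set_integrable lborel {0..} (\<lambda>s. B * (exp (- l * s) * s))"
    using i1 i2 by (auto intro!: set_integrable_mult_right)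
  show "set_integrable lborel {0..} (\<lambda>s. exp (- l * s) * (A + B * s))"
    unfolding eq by (rule set_integral_add(1)[OF j])
  have "laplace l (\<lambda>s. A + B * s) = A * laplace l (\<lambda>s. 1) + B * laplace l (\<lambda>s. s)"
    unfolding laplace_def eq by (subst set_integral_add(2)[OF j]) simp
  then show "laplace l (\<lambda>s. A + B * s) = A / l + B / l\<^sup>2"
    using l2 exp_set_integrable(2)[OF assms] by simp
qed

context L2_contraction_semigroup
begin

lemma generator_invariant:
  assumes g: "(u, k) \<in> gen" and s: "0 \<le> s"
  shows "(Q s u, Q s k) \<in> gen"
proof (rule generatorI_mild)
  note L = generator_L2[OF g]
  show "Q s u \<in> L2 M" "Q s k \<in> L2 M" by (intro Q_L2 s L)+
  fix h H assume h: "0 \<le> (h::real)" and H: "H \<in> L2 M"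
  have "(LINT r:{0..h+s}|lborel. l2_inner M (Q r k) H) = (LINT r:{0..s}|lborel. l2_inner M (Q r k) H) + (LINT r:{s..h+s}|lborel. l2_inner M (Q r k) H)"
    using h s by (intro LINT_split borel_integrable_atLeastAtMost' continuous_on_l2_inner_Q' L H) auto
  moreover have "(LINT r:{0+s..h+s}|lborel. l2_inner M (Q r k) H) = (LINT r:{0..h}|lborel. l2_inner M (Q (r + s) k) H)"
    by (rule LINT_shift)
  moreover have "(LINT r:{0..h}|lborel. l2_inner M (Q (r + s) k) H) = (LINT r:{0..h}|lborel. l2_inner M (Q r (Q s k)) H)"
    using s L H by (intro set_lebesgue_integral_cong) (auto simp: l2_inner_Q_add)
  ultimately show "l2_inner M (Q h (Q s u)) H - l2_inner M (Q s u) H = (LINT r:{0..h}|lborel. l2_inner M (Q r (Q s k)) H)"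
    using generator_mild[OF g _ H, of "h + s"] generator_mild[OF g s H] h s L H
    by (simp add: l2_inner_Q_add)
qed

text \<open>
  \<open>l u\<close> is close to \<open>H\<close> for the resolvent \<open>u\<close> at a large value \<open>l\<close>, because the exponential weight
  concentrates at time \<open>0\<close>. The linear bound on \<open>Q\<^sub>s H - H\<close> makes the Laplace transform explicit.
\<close>

lemma generator_dense:
  assumes H: "H \<in> L2 M" and e: "0 < e"
  obtains u k where "(u, k) \<in> gen" "l2_norm M (\<lambda>x. u x - H x) < e"
proof -
  obtain d where d: "0 < d" "\<And>s. 0 \<le> s \<Longrightarrow> s < d \<Longrightarrow> l2_norm M (\<lambda>x. Q s H x - H x) < e/3"
    using Q_near_identity[OF H, of "e/3"] e by auto
  \<comment> \<open>for \<open>s \<ge> d\<close> the trivial bound \<open>2 \<parallel>H\<parallel>\<close> is at most \<open>B s\<close>\<close>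
  define B where "B = 2 * l2_norm M H / d"
  have B0: "0 \<le> B" unfolding B_def using d by (simp add: l2_norm_nonneg)
  have bnd: "l2_norm M (\<lambda>x. Q s H x - H x) \<le> e/3 + B * s" if s: "0 \<le> s" for s
  proof (cases "s < d")
    case True
    then show ?thesis using d(2)[OF s True] mult_nonneg_nonneg[OF B0 s] by simp
  next
    case False
    have "l2_norm M (\<lambda>x. Q s H x - H x) \<le> 2 * l2_norm M H"
      using l2_norm_triangle_diff[OF Q_L2[OF s H] H] Q_contraction[OF s H] by simp
    also have "\<dots> = B * d" unfolding B_def using d by simp
    also have "\<dots> \<le> B * s" using False B0 by (intro mult_left_mono) auto
    finally show ?thesis using e by simp
  qed
  define l where "l = 3 * B / e + 1"
  have l: "0 < l" "B / l < e / 3"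
  proof -
    have "0 \<le> 3 * B / e" using B0 e by simp
    then show l0: "0 < l" unfolding l_def by simp
    have "B = (e / 3) * (3 * B / e)" using e by simp
    also have "\<dots> < (e / 3) * l" using e unfolding l_def by (intro mult_strict_left_mono) auto
    finally show "B / l < e / 3" using l0 by (simp add: field_simps)
  qed
  obtain u where u: "u \<in> L2 M" "\<And>G. G \<in> L2 M \<Longrightarrow> l2_inner M u G = laplace l (\<lambda>s. l2_inner M (Q s H) G)"
    using resolvent_exists[OF H l(1)] by blast
  from resolvent_in_generator[OF H l(1) u]
  have g: "(u, \<lambda>x. l * u x - H x) \<in> gen" .
  from generator_lincomb[OF g g, of l 0]
  have g2: "(\<lambda>x. l * u x, \<lambda>x. l * (l * u x - H x)) \<in> gen" by simp
  have "l2_norm M (\<lambda>x. l * u x - H x) \<le> e/3 + B / l"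
  proof (rule l2_norm_le_if_weak)
    show "(\<lambda>x. l * u x - H x) \<in> L2 M" by (intro L2_closed u H)
    show "0 \<le> e/3 + B / l" using e B0 l by simp
    fix G assume G: "G \<in> L2 M"
    have i1: "set_integrable lborel {0..} (\<lambda>s. exp (- l * s) * l2_inner M (Q s H) G)"
      by (rule laplace_integrable[where a=0 and K="l2_norm M H * l2_norm M G"])
        (use abs_l2_inner_Q_le[OF _ H G] l continuous_on_l2_inner_Q[OF H G] in auto)
    have i2: "set_integrable lborel {0..} (\<lambda>s. exp (- l * s) * l2_inner M H G)"
      using laplace_linear(2)[OF l(1), of "l2_inner M H G" 0] by simp
    have c2: "laplace l (\<lambda>s. l2_inner M H G) = l2_inner M H G / l"
      using laplace_linear(1)[OF l(1), of "l2_inner M H G" 0] by simp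
    have eq: "exp (- l * s) * (l2_inner M (Q s H) G - l2_inner M H G) = exp (- l * s) * l2_inner M (Q s H) G - exp (- l * s) * l2_inner M H G" for s
      by (simp add: algebra_simps)
    have "laplace l (\<lambda>s. l2_inner M (Q s H) G - l2_inner M H G) = laplace l (\<lambda>s. l2_inner M (Q s H) G) - laplace l (\<lambda>s. l2_inner M H G)"
      unfolding laplace_def eq by (rule set_integral_diff(2)[OF i1 i2])
    then have 1: "l2_inner M (\<lambda>x. l * u x - H x) G = l * laplace l (\<lambda>s. l2_inner M (Q s H) G - l2_inner M H G)"
    proof -
      have "l2_inner M (\<lambda>x. l * u x - H x) G = l * laplace l (\<lambda>s. l2_inner M (Q s H) G) - l2_inner M H G"
        using u H G by (simp add: l2_inner_diff_left l2_inner_cmult_left L2_closed)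
      moreover have "l * (laplace l (\<lambda>s. l2_inner M (Q s H) G) - l2_inner M H G / l) = l * laplace l (\<lambda>s. l2_inner M (Q s H) G) - l2_inner M H G"
        using l by (simp add: right_diff_distrib)
      ultimately show ?thesis
        using \<open>laplace l (\<lambda>s. l2_inner M (Q s H) G - l2_inner M H G) = _\<close> unfolding c2 by simp
    qed
    have "\<bar>laplace l (\<lambda>s. l2_inner M (Q s H) G - l2_inner M H G)\<bar> \<le> laplace l (\<lambda>s. e/3 * l2_norm M G + (B * l2_norm M G) * s)"
    proof (rule laplace_abs_mono)
      show "set_integrable lborel {0..} (\<lambda>s. exp (- l * s) * (l2_inner M (Q s H) G - l2_inner M H G))"
        unfolding eq by (rule set_integral_diff(1)[OF i1 i2])
      show "set_integrable lborel {0..} (\<lambda>s. exp (- l * s) * (e / 3 * l2_norm M G + B * l2_norm M G * s))"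
        by (rule laplace_linear(2)[OF l(1)])
      fix s :: real assume s: "0 \<le> s"
      have "\<bar>l2_inner M (Q s H) G - l2_inner M H G\<bar> = \<bar>l2_inner M (\<lambda>x. Q s H x - H x) G\<bar>"
        using s H G by (simp add: l2_inner_simps Q_L2)
      also have "\<dots> \<le> l2_norm M (\<lambda>x. Q s H x - H x) * l2_norm M G"
        using s H G by (intro l2_Cauchy_Schwarz L2_closed Q_L2)
      also have "\<dots> \<le> (e/3 + B * s) * l2_norm M G" by (intro mult_right_mono bnd s l2_norm_nonneg)
      finally show "\<bar>l2_inner M (Q s H) G - l2_inner M H G\<bar> \<le> e / 3 * l2_norm M G + B * l2_norm M G * s"
        by (simp add: algebra_simps)
    qed
    also have "\<dots> = (e/3 + B / l) * l2_norm M G / l"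
      unfolding laplace_linear(1)[OF l(1)] using l by (simp add: field_simps power2_eq_square)
    finally have "l * \<bar>laplace l (\<lambda>s. l2_inner M (Q s H) G - l2_inner M H G)\<bar> \<le> l * ((e/3 + B / l) * l2_norm M G / l)"
      using l by (intro mult_left_mono) auto
    then show "\<bar>l2_inner M (\<lambda>x. l * u x - H x) G\<bar> \<le> (e/3 + B / l) * l2_norm M G"
      unfolding 1 using l by (simp add: abs_mult)
  qed
  also have "\<dots> < e" using l(2) e by linarith
  finally show ?thesis using g2 that by blast
qed

text \<open>
  The mild equation for the adjoint semigroup, stated without it. It follows from \<open>generator_mild\<close>
  for \<open>H\<close> in the domain of the generator, and extends by density.
\<close>

lemma adjoint_mild:
  assumes v: "(v, k) \<in> L2_adjoint M gen" and H: "H \<in> L2 M" and t: "0 \<le> t"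
  shows "l2_inner M (Q t H) v - l2_inner M H v = (LINT s:{0..t}|lborel. l2_inner M (Q s H) k)"
proof -
  have L: "v \<in> L2 M" "k \<in> L2 M" using v by (auto simp: L2_adjoint_iff)
  define \<Phi> where "\<Phi> H = l2_inner M (Q t H) v - l2_inner M H v - (LINT s:{0..t}|lborel. l2_inner M (Q s H) k)" for H
  have dom: "\<Phi> u = 0" if g: "(u, w) \<in> gen" for u w
  proof -
    have "(LINT s:{0..t}|lborel. l2_inner M (Q s w) v) = (LINT s:{0..t}|lborel. l2_inner M (Q s u) k)"
      using generator_invariant[OF g] v by (intro set_lebesgue_integral_cong) (auto simp: L2_adjoint_iff)
    then show ?thesis unfolding \<Phi>_def using generator_mild[OF g t L(1)] by simp
  qed
  \<comment> \<open>Lipschitz constant of \<open>\<Phi>\<close>\<close>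
  define c where "c = 2 * l2_norm M v + t * l2_norm M k"
  have c0: "0 \<le> c" unfolding c_def using t by (simp add: l2_norm_nonneg)
  have lip: "\<bar>\<Phi> H - \<Phi> u\<bar> \<le> l2_norm M (\<lambda>x. u x - H x) * c" if u: "u \<in> L2 M" for u
  proof -
    have D: "(\<lambda>x. u x - H x) \<in> L2 M" by (intro L2_closed u H)
    have b: "\<bar>l2_inner M (Q s u) G - l2_inner M (Q s H) G\<bar> \<le> l2_norm M (\<lambda>x. u x - H x) * l2_norm M G" if "0 \<le> s" "G \<in> L2 M" for s G
    proof -
      have "\<bar>l2_inner M (Q s u) G - l2_inner M (Q s H) G\<bar> = \<bar>l2_inner M (\<lambda>x. Q s u x - Q s H x) G\<bar>"
        using that u H by (simp add: l2_inner_simps Q_L2)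
      also have "\<dots> \<le> l2_norm M (\<lambda>x. Q s u x - Q s H x) * l2_norm M G"
        using that u H by (intro l2_Cauchy_Schwarz L2_closed Q_L2)
      also have "\<dots> \<le> l2_norm M (\<lambda>x. u x - H x) * l2_norm M G"
        using that u H by (intro mult_right_mono Q_diff_norm l2_norm_nonneg)
      finally show ?thesis .
    qed
    have b0: "\<bar>l2_inner M u v - l2_inner M H v\<bar> \<le> l2_norm M (\<lambda>x. u x - H x) * l2_norm M v"
      using l2_Cauchy_Schwarz[OF D L(1)] by (simp add: l2_inner_simps u H L)
    have c: "continuous_on {0..t} (\<lambda>s. l2_inner M (Q s G) k)" if "G \<in> L2 M" for G
      using that by (intro continuous_on_l2_inner_Q' L) auto
    have "\<bar>LINT s:{0..t}|lborel. l2_inner M (Q s u) k - l2_inner M (Q s H) k\<bar> \<le> (t - 0) * (l2_norm M (\<lambda>x. u x - H x) * l2_norm M k)"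
      using t by (intro LINT_abs_le continuous_intros c u H b L) auto
    then have "\<bar>LINT s:{0..t}|lborel. l2_inner M (Q s u) k - l2_inner M (Q s H) k\<bar> \<le> t * (l2_norm M (\<lambda>x. u x - H x) * l2_norm M k)"
      by simp
    moreover have "(LINT s:{0..t}|lborel. l2_inner M (Q s u) k - l2_inner M (Q s H) k)
       = (LINT s:{0..t}|lborel. l2_inner M (Q s u) k) - (LINT s:{0..t}|lborel. l2_inner M (Q s H) k)"
      by (intro set_integral_diff borel_integrable_atLeastAtMost' c u H)
    ultimately have "\<bar>\<Phi> H - \<Phi> u\<bar> \<le> l2_norm M (\<lambda>x. u x - H x) * l2_norm M v + l2_norm M (\<lambda>x. u x - H x) * l2_norm M v
        + t * (l2_norm M (\<lambda>x. u x - H x) * l2_norm M k)"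
      unfolding \<Phi>_def using b[OF t L(1)] b0 by linarith
    then show ?thesis unfolding c_def by (simp add: algebra_simps)
  qed
  have "\<bar>\<Phi> H\<bar> \<le> 0"
  proof (rule field_le_epsilon)
    fix e :: real assume e: "0 < e"
    obtain u w where g: "(u, w) \<in> gen" "l2_norm M (\<lambda>x. u x - H x) < e / (c + 1)"
      using generator_dense[OF H, of "e / (c + 1)"] e c0 by auto
    have "\<bar>\<Phi> H\<bar> \<le> l2_norm M (\<lambda>x. u x - H x) * c"
      using lip[OF generator_L2(1)[OF g(1)]] dom[OF g(1)] by simp
    also have "\<dots> \<le> e / (c + 1) * c" using g(2) c0 by (intro mult_right_mono) auto
    also have "\<dots> \<le> e" using e c0 by (simp add: field_simps)
    finally show "\<bar>\<Phi> H\<bar> \<le> 0 + e" by simp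
  qed
  then show ?thesis unfolding \<Phi>_def by simp
qed

end

context ergodic_diffusion
begin

lemmas path_integral_inner = path_integral_inner_aux(2)
lemmas path_integral_set_integrable = path_integral_inner_aux(1)

lemma l2_inner_N_X_le:
  assumes "Z \<in> L2 N" "h \<in> L2 mu" "0 \<le> s"
  shows "\<bar>l2_inner N Z (\<lambda>\<omega>. h (X s \<omega>))\<bar> \<le> l2_norm N Z * l2_norm mu h"
  using l2_Cauchy_Schwarz[OF assms(1) comp_X_L2[OF assms(2,3)]] by (simp add: l2_norm_X assms)

lemma path_integral_norm:
  assumes h: "h \<in> L2 mu" and a: "0 \<le> a" "a \<le> b"
  shows "l2_norm N (path_integral h a b) \<le> (b - a) * l2_norm mu h"
proof (rule l2_norm_le_if_weak[OF path_integral_L2[OF assms]])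
  show "0 \<le> (b - a) * l2_norm mu h" using a by (simp add: l2_norm_nonneg)
  fix Z assume Z: "Z \<in> L2 N"
  have "\<bar>l2_inner N Z (path_integral h a b)\<bar> \<le> (b - a) * (l2_norm N Z * l2_norm mu h)"
    unfolding path_integral_inner[OF assms Z]
    using a by (intro LINT_abs_le' path_integral_set_integrable assms Z l2_inner_N_X_le) auto
  then show "\<bar>l2_inner N (path_integral h a b) Z\<bar> \<le> (b - a) * l2_norm mu h * l2_norm N Z"
    by (simp add: l2_inner_commute algebra_simps)
qed

lemma path_integral_split:
  assumes h: "h \<in> L2 mu" and a: "0 \<le> a" "a \<le> b" "b \<le> c"
  shows "AE \<omega> in N. path_integral h a c \<omega> = path_integral h a b \<omega> + path_integral h b c \<omega>"
proof (rule l2_inner_eq_imp_AE_eq)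
  have L: "path_integral h a b \<in> L2 N" "path_integral h b c \<in> L2 N" "path_integral h a c \<in> L2 N"
    using a by (auto intro!: path_integral_L2 h)
  show "path_integral h a c \<in> L2 N" "(\<lambda>\<omega>. path_integral h a b \<omega> + path_integral h b c \<omega>) \<in> L2 N"
    by (intro L2_closed L)+
  fix Z assume Z: "Z \<in> L2 N"
  have "l2_inner N Z (path_integral h a c) = l2_inner N Z (path_integral h a b) + l2_inner N Z (path_integral h b c)"
    using LINT_split[OF path_integral_set_integrable[OF h a(1) order_trans[OF a(2,3)] Z] a(2,3)] a
    by (simp add: path_integral_inner h Z)
  then show "l2_inner N (path_integral h a c) Z = l2_inner N (\<lambda>\<omega>. path_integral h a b \<omega> + path_integral h b c \<omega>) Z"
    using L Z by (simp add: l2_inner_add_left l2_inner_add_right l2_inner_commute[of N _ Z])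
qed

lemma path_integral_lincomb:
  assumes h: "h \<in> L2 mu" and k: "k \<in> L2 mu" and a: "0 \<le> a" "a \<le> b"
  shows "AE \<omega> in N. path_integral (\<lambda>x. p * h x + q * k x) a b \<omega> = p * path_integral h a b \<omega> + q * path_integral k a b \<omega>"
proof (rule l2_inner_eq_imp_AE_eq)
  have hk: "(\<lambda>x. p * h x + q * k x) \<in> L2 mu" by (intro L2_lincomb h k)
  have L: "path_integral h a b \<in> L2 N" "path_integral k a b \<in> L2 N" "path_integral (\<lambda>x. p * h x + q * k x) a b \<in> L2 N"
    using a by (auto intro!: path_integral_L2 h k hk)
  show "path_integral (\<lambda>x. p * h x + q * k x) a b \<in> L2 N" "(\<lambda>\<omega>. p * path_integral h a b \<omega> + q * path_integral k a b \<omega>) \<in> L2 N"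
    by (intro L2_closed L)+
  fix Z assume Z: "Z \<in> L2 N"
  have i: "set_integrable lborel {a..b} (\<lambda>s. p * l2_inner N Z (\<lambda>\<omega>. h (X s \<omega>)))" "set_integrable lborel {a..b} (\<lambda>s. q * l2_inner N Z (\<lambda>\<omega>. k (X s \<omega>)))"
    using path_integral_set_integrable[OF h a Z] path_integral_set_integrable[OF k a Z]
    by (auto intro!: set_integrable_mult_right)
  have "l2_inner N Z (path_integral (\<lambda>x. p * h x + q * k x) a b)
     = (LINT s:{a..b}|lborel. p * l2_inner N Z (\<lambda>\<omega>. h (X s \<omega>)) + q * l2_inner N Z (\<lambda>\<omega>. k (X s \<omega>)))"
    unfolding path_integral_inner[OF hk a Z] using a
    by (intro set_lebesgue_integral_cong) (auto simp: l2_inner_lincomb_right comp_X_L2 h k Z)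
  also have "\<dots> = p * l2_inner N Z (path_integral h a b) + q * l2_inner N Z (path_integral k a b)"
    using set_integral_add(2)[OF i] by (simp add: path_integral_inner h k a Z)
  finally show "l2_inner N (path_integral (\<lambda>x. p * h x + q * k x) a b) Z = l2_inner N (\<lambda>\<omega>. p * path_integral h a b \<omega> + q * path_integral k a b \<omega>) Z"
    using L Z by (simp add: l2_inner_lincomb_left l2_inner_lincomb_right l2_inner_commute[of N _ Z])
qed

section \<open>Forward and backward martingale increments\<close>

definition fwd :: "('a \<Rightarrow> real) \<Rightarrow> ('a \<Rightarrow> real) \<Rightarrow> real \<Rightarrow> real \<Rightarrow> 'w \<Rightarrow> real" where
  "fwd v k a b \<omega> = v (X b \<omega>) - v (X a \<omega>) - path_integral k a b \<omega>"

text \<open>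
  The increment over \<open>{a..b}\<close> of the martingale of the reversed process, if \<open>k\<close> is the image of \<open>v\<close>
  under the adjoint generator.
\<close>

definition bwd :: "('a \<Rightarrow> real) \<Rightarrow> ('a \<Rightarrow> real) \<Rightarrow> real \<Rightarrow> real \<Rightarrow> 'w \<Rightarrow> real" where
  "bwd v k a b \<omega> = v (X a \<omega>) - v (X b \<omega>) - path_integral k a b \<omega>"

lemma fwd_bwd_L2:
  assumes "v \<in> L2 mu" "k \<in> L2 mu" "0 \<le> a" "a \<le> b"
  shows "fwd v k a b \<in> L2 N" "bwd v k a b \<in> L2 N"
  unfolding fwd_def[abs_def] bwd_def[abs_def]
  using assms by (auto intro!: L2_diff comp_X_L2 path_integral_L2)

lemma fwd_bwd_measurable:
  assumes "v \<in> L2 mu" "k \<in> L2 mu" "0 \<le> a" "a \<le> b"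
  shows "fwd v k a b \<in> borel_measurable (generated_by Om X {a..b})" "bwd v k a b \<in> borel_measurable (generated_by Om X {a..b})"
  unfolding fwd_def[abs_def] bwd_def[abs_def]
  using assms by (auto intro!: borel_measurable_diff comp_X_generated[OF L2_measurable] path_integral_generated[OF L2_measurable])

text \<open>
  The martingale property. By Riesz, \<open>W\<close> acts on functions of \<open>X\<^sub>a\<close> as some \<open>z\<close> in \<open>L\<^sup>2(\<mu>)\<close>, and the
  claim becomes the mild equation tested with \<open>z\<close>.
\<close>

lemma fwd_orthogonal:
  assumes v: "(v, k) \<in> S.gen" and a: "0 \<le> a" "a \<le> b" and W: "W \<in> L2 N" "W \<in> borel_measurable (past Om X a)"
  shows "l2_inner N W (fwd v k a b) = 0"
proof -
  note L = S.generator_L2[OF v]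
  have lin: "l2_inner N W (\<lambda>\<omega>. F (X a \<omega>) + s * G (X a \<omega>)) = l2_inner N W (\<lambda>\<omega>. F (X a \<omega>)) + s * l2_inner N W (\<lambda>\<omega>. G (X a \<omega>))"
    if "F \<in> L2 mu" "G \<in> L2 mu" for F G s
    using l2_inner_lincomb_right[OF comp_X_L2[OF that(1) a(1)] comp_X_L2[OF that(2) a(1)] W(1), of 1 s] by simp
  have bd: "\<bar>l2_inner N W (\<lambda>\<omega>. F (X a \<omega>))\<bar> \<le> l2_norm N W * l2_norm mu F" if "F \<in> L2 mu" for F
    by (rule l2_inner_N_X_le[OF W(1) that a(1)])
  obtain z where z: "z \<in> L2 mu" "\<And>F. F \<in> L2 mu \<Longrightarrow> l2_inner mu z F = l2_inner N W (\<lambda>\<omega>. F (X a \<omega>))"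
    using mu.L2_Riesz[of "\<lambda>F. l2_inner N W (\<lambda>\<omega>. F (X a \<omega>))" "l2_norm N W", OF lin bd] by blast
  have M: "l2_inner N W (\<lambda>\<omega>. h (X (a + t) \<omega>)) = l2_inner mu (P t h) z" if "h \<in> L2 mu" "0 \<le> t" for h t
    using Markov[OF that(1) a(1) that(2) W] z(2)[OF P_L2(1)[OF that]] by (simp add: l2_inner_commute)
  have 1: "l2_inner N W (\<lambda>\<omega>. v (X b \<omega>)) = l2_inner mu (P (b - a) v) z" using M[OF L(1), of "b - a"] a by simp
  have 2: "l2_inner N W (\<lambda>\<omega>. v (X a \<omega>)) = l2_inner mu v z" using z(2)[OF L(1)] by (simp add: l2_inner_commute)
  have "l2_inner N W (path_integral k a b) = (LINT s:{0+a..(b-a)+a}|lborel. l2_inner N W (\<lambda>\<omega>. k (X s \<omega>)))"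
    using path_integral_inner[OF L(2) a W(1)] by simp
  also have "\<dots> = (LINT s:{0..b-a}|lborel. l2_inner N W (\<lambda>\<omega>. k (X (s + a) \<omega>)))" by (rule LINT_shift)
  also have "\<dots> = (LINT s:{0..b-a}|lborel. l2_inner mu (P s k) z)"
    using M[OF L(2)] by (intro set_lebesgue_integral_cong) (auto simp: add.commute)
  also have "\<dots> = l2_inner mu (P (b - a) v) z - l2_inner mu v z"
    using S.generator_mild[OF v _ z(1), of "b - a"] a by simp
  finally show ?thesis
    unfolding fwd_def[abs_def] using 1 2 a L W
    by (simp add: l2_inner_diff_right L2_diff comp_X_L2 path_integral_L2)
qed

text \<open>
  Cylinder sets of the future of time \<open>b\<close>; the times are given by their increments, which suits the
  Markov property.
\<close>

fun cyl :: "real \<Rightarrow> (real \<times> 'a set) list \<Rightarrow> 'w set" where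
  "cyl b [] = space Om"
| "cyl b ((d, B) # l) = {\<omega> \<in> space Om. X (b + d) \<omega> \<in> B} \<inter> cyl (b + d) l"

text \<open>
  \<open>cyl_fun l x\<close> is, by the Markov property, the probability of the cylinder \<open>l\<close> for the process
  started from \<open>x\<close>.
\<close>

fun cyl_fun :: "(real \<times> 'a set) list \<Rightarrow> 'a \<Rightarrow> real" where
  "cyl_fun [] = (\<lambda>x. 1)"
| "cyl_fun ((d, B) # l) = P d (\<lambda>x. indicator B x * cyl_fun l x)"

abbreviation "good_cyl l \<equiv> \<forall>(d, B)\<in>set l. 0 \<le> d \<and> B \<in> sets borel"

lemma cyl_fun_props:
  assumes "good_cyl l"
  shows "cyl_fun l \<in> borel_measurable mu \<and> (\<forall>x. \<bar>cyl_fun l x\<bar> \<le> 1)"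
  using assms
proof (induction l)
  case (Cons p l)
  obtain d B where p: "p = (d, B)" by force
  have IH: "cyl_fun l \<in> borel_measurable mu" "\<And>x. \<bar>cyl_fun l x\<bar> \<le> 1" using Cons by auto
  have d: "0 \<le> d" "B \<in> sets borel" using Cons p by auto
  have m: "(\<lambda>x. indicator B x * cyl_fun l x) \<in> borel_measurable mu"
    using d IH by (intro borel_measurable_times borel_measurable_indicator) (auto simp: sets_mu)
  have b: "\<bar>indicator B x * cyl_fun l x\<bar> \<le> 1" for x using IH(2)[of x] by (simp add: indicator_def)
  show ?case unfolding p using P_measurable[OF m d(1)] P_bounded[OF m b d(1)] by simp
qed simp

lemma cyl_sets:
  assumes "good_cyl l" "c \<le> b"
  shows "cyl b l \<in> sets (generated_by Om X {c..})"
  using assms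
proof (induction l arbitrary: b)
  case Nil then show ?case using sets.top[of "generated_by Om X {c..}"] by (simp add: space_generated_by)
next
  case (Cons p l)
  obtain d B where p: "p = (d, B)" by force
  have d: "0 \<le> d" "B \<in> sets borel" using Cons p by auto
  have "X (b + d) -` B \<inter> space Om \<in> sets (generated_by Om X {c..})"
    unfolding sets_generated_by using Cons.prems d
    by (intro sigma_sets.Basic CollectI exI[of _ "b + d"] exI[of _ B]) auto
  moreover have "X (b + d) -` B \<inter> space Om = {\<omega> \<in> space Om. X (b + d) \<omega> \<in> B}" by auto
  moreover have "cyl (b + d) l \<in> sets (generated_by Om X {c..})" using Cons d by (intro Cons.IH) auto
  ultimately show ?case unfolding p by auto
qed

lemma cyl_Int_single:
  assumes "good_cyl l" "b \<le> u" "B \<in> sets borel"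
  shows "\<exists>l'. good_cyl l' \<and> cyl b l' = cyl b l \<inter> {\<omega> \<in> space Om. X u \<omega> \<in> B}"
  using assms
proof (induction l arbitrary: b)
  case Nil
  then show ?case by (intro exI[of _ "[(u - b, B)]"]) auto
next
  case (Cons p l)
  obtain d A where p: "p = (d, A)" by force
  have d: "0 \<le> d" "A \<in> sets borel" "good_cyl l" using Cons p by auto
  show ?case
  proof (cases "u \<le> b + d")
    case True
    then show ?thesis using Cons d unfolding p
      by (intro exI[of _ "(u - b, B) # (b + d - u, A) # l"]) (auto simp: algebra_simps)
  next
    case False
    then obtain l' where "good_cyl l'" "cyl (b + d) l' = cyl (b + d) l \<inter> {\<omega> \<in> space Om. X u \<omega> \<in> B}"
      using Cons.IH[of "b + d"] Cons.prems d by auto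
    then show ?thesis using d unfolding p by (intro exI[of _ "(d, A) # l'"]) auto
  qed
qed

lemma cyl_Int:
  assumes "good_cyl l" "good_cyl m" "b \<le> c"
  shows "\<exists>l'. good_cyl l' \<and> cyl b l' = cyl b l \<inter> cyl c m"
  using assms
proof (induction m arbitrary: l c)
  case Nil
  have "cyl b l \<subseteq> space Om" for l by (induction l arbitrary: b) auto
  then show ?case using Nil by (intro exI[of _ l]) auto
next
  case (Cons p m)
  obtain d A where p: "p = (d, A)" by force
  have d: "0 \<le> d" "A \<in> sets borel" "good_cyl m" using Cons p by auto
  obtain l1 where l1: "good_cyl l1" "cyl b l1 = cyl b l \<inter> {\<omega> \<in> space Om. X (c + d) \<omega> \<in> A}"
    using cyl_Int_single[of l b "c + d" A] Cons.prems d by auto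
  obtain l2 where "good_cyl l2" "cyl b l2 = cyl b l1 \<inter> cyl (c + d) m"
    using Cons.IH[of l1 "c + d"] l1 Cons.prems d by auto
  then show ?case using l1 unfolding p by (intro exI[of _ l2]) auto
qed

lemma cyl_Markov:
  assumes "good_cyl l" "0 \<le> b" "V \<in> L2 N" "V \<in> borel_measurable (past Om X b)"
  shows "l2_inner N (indicator (cyl b l)) V = l2_inner N (\<lambda>\<omega>. cyl_fun l (X b \<omega>)) V"
  using assms
proof (induction l arbitrary: b V)
  case Nil
  show ?case unfolding l2_inner_def by (intro Bochner_Integration.integral_cong) (auto simp: space_N)
next
  case (Cons p l)
  obtain d B where p: "p = (d, B)" by force
  have d: "0 \<le> d" "B \<in> sets borel" "good_cyl l" using Cons p by auto
  note cf = cyl_fun_props[OF d(3)]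
  define h where "h x = indicator B x * cyl_fun l x" for x
  have hm: "h \<in> borel_measurable mu" unfolding h_def
    using d cf by (intro borel_measurable_times borel_measurable_indicator) (auto simp: sets_mu)
  have hL: "h \<in> L2 mu" using cf by (intro mu.L2_bounded[OF hm, of 1]) (auto simp: h_def indicator_def)
  have Bm: "indicat_real B \<in> borel_measurable mu"
    using d by (intro borel_measurable_indicator) (simp add: sets_mu)
  define V' where "V' \<omega> = indicator B (X (b + d) \<omega>) * V \<omega>" for \<omega>
  have V'm: "V' \<in> borel_measurable (past Om X (b + d))"
    unfolding V'_def using Cons.prems d
    by (intro borel_measurable_times comp_X_generated[OF Bm] measurable_generated_by_mono[OF Cons.prems(4)]) auto
  have V'L: "V' \<in> L2 N"
  proof -
    have m: "V' \<in> borel_measurable N"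
      by (rule generated_by_measurable_N[OF _ V'm]) auto
    have "integrable N (\<lambda>\<omega>. (V' \<omega>)\<^sup>2)"
    proof (rule Bochner_Integration.integrable_bound[OF L2_sq_integrable[OF Cons.prems(3)]])
      show "(\<lambda>\<omega>. (V' \<omega>)\<^sup>2) \<in> borel_measurable N" using m by (rule borel_measurable_power)
      show "AE \<omega> in N. norm ((V' \<omega>)\<^sup>2) \<le> norm ((V \<omega>)\<^sup>2)" by (simp add: V'_def indicator_def)
    qed
    then show ?thesis using m by (simp add: L2_def)
  qed
  have "l2_inner N (indicator (cyl b (p # l))) V = l2_inner N (indicator (cyl (b + d) l)) V'"
    unfolding l2_inner_def p
    by (intro Bochner_Integration.integral_cong) (auto simp: space_N V'_def indicator_def)
  also have "\<dots> = l2_inner N (\<lambda>\<omega>. cyl_fun l (X (b + d) \<omega>)) V'"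
    using Cons.prems d by (intro Cons.IH V'L V'm) auto
  also have "\<dots> = l2_inner N V (\<lambda>\<omega>. h (X (b + d) \<omega>))"
    unfolding l2_inner_def by (intro Bochner_Integration.integral_cong) (auto simp: V'_def h_def)
  also have "\<dots> = l2_inner N V (\<lambda>\<omega>. P d h (X b \<omega>))"
    using Cons.prems d by (intro Markov hL) auto
  finally show ?case unfolding p by (simp add: l2_inner_commute h_def[abs_def])
qed

text \<open>
  Past and future are conditionally independent given the present: a variable of the past orthogonal
  to all functions of \<open>X\<^sub>b\<close> is orthogonal to the future of \<open>b\<close>. Cylinder sets form an
  intersection-stable generator, and for them the claim is the Markov property.
\<close>

lemma future_orthogonal:
  assumes b: "0 \<le> b" and D: "D \<in> L2 N" "D \<in> borel_measurable (past Om X b)"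
    and orth: "\<And>H. H \<in> L2 mu \<Longrightarrow> l2_inner N (\<lambda>\<omega>. H (X b \<omega>)) D = 0"
    and W: "W \<in> L2 N" "W \<in> borel_measurable (future Om X b)"
  shows "l2_inner N W D = 0"
proof (rule sub_sigma_orthogonal[OF N_prob subalgebra_generated_by D(1) _ W])
  define G where "G = {cyl b l | l. good_cyl l}"
  have cylsub: "cyl b l \<subseteq> space Om" for b l by (induction l arbitrary: b) auto
  have G1: "G \<subseteq> Pow (space Om)" unfolding G_def using cylsub by auto
  have G2: "Int_stable G"
  proof (rule Int_stableI)
    fix A B assume "A \<in> G" "B \<in> G"
    then show "A \<inter> B \<in> G" unfolding G_def using cyl_Int[of _ _ b b] by (auto simp del: cyl.simps) metis
  qed
  have sub: "sets (future Om X b) \<subseteq> sigma_sets (space Om) G"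
    unfolding sets_generated_by
  proof (rule sigma_sets_mono, rule subsetI)
    fix A assume "A \<in> {X u -` B \<inter> space Om |u B. u \<in> {b..} \<and> B \<in> sets borel}"
    then obtain u B where u: "A = X u -` B \<inter> space Om" "b \<le> u" "B \<in> sets borel" by auto
    then have "A = cyl b [(u - b, B)]" by auto
    moreover have "good_cyl [(u - b, B)]" using u by auto
    ultimately have "A \<in> G" unfolding G_def by blast
    then show "A \<in> sigma_sets (space Om) G" by (rule sigma_sets.Basic)
  qed
  have sN: "sigma_sets (space Om) G \<subseteq> sets N"
  proof -
    have "G \<subseteq> sets N"
      unfolding G_def using cyl_sets[of _ b b] generated_by_subset[of "{b..}"] b by (auto simp: sets_N)
    then show ?thesis using sets.sigma_sets_subset[of G N] by (simp add: space_N)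
  qed
  have iD: "integrable N D" by (rule N.L2_integrable[OF D(1)])
  have int: "integrable N (\<lambda>\<omega>. indicator A \<omega> * D \<omega>)" if "A \<in> sets N" for A
    using integrable_mult_indicator[OF that iD] by simp
  have cylD: "(\<integral>\<omega>. indicator A \<omega> * D \<omega> \<partial>N) = 0" if AG: "A \<in> G" for A
  proof -
    obtain l where l: "A = cyl b l" "good_cyl l" using AG unfolding G_def by blast
    have "cyl_fun l \<in> L2 mu" using cyl_fun_props[OF l(2)] by (intro mu.L2_bounded[of _ 1]) auto
    from orth[OF this] cyl_Markov[OF l(2) b D] show ?thesis unfolding l(1) l2_inner_def by simp
  qed
  have topD: "(\<integral>\<omega>. indicator (space Om) \<omega> * D \<omega> \<partial>N) = 0"
  proof -
    have "cyl b [] \<in> G" unfolding G_def by (intro CollectI exI[of _ "[]"]) auto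
    from cylD[OF this] show ?thesis by simp
  qed
  fix A assume A: "A \<in> sets (future Om X b)"
  have "A \<in> sigma_sets (space Om) G" using A sub by auto
  then show "(\<integral>\<omega>. indicator A \<omega> * D \<omega> \<partial>N) = 0"
  proof (induction rule: sigma_sets_induct_disjoint[OF G2 G1, consumes 1, case_names basic empty compl union])
    case (basic A) then show ?case by (rule cylD)
  next
    case empty then show ?case by simp
  next
    case (compl A)
    have AN: "A \<in> sets N" "space Om \<in> sets N" using compl sN sets.top[of N] by (auto simp: space_N)
    have "(\<integral>\<omega>. indicator (space Om - A) \<omega> * D \<omega> \<partial>N) = (\<integral>\<omega>. indicator (space Om) \<omega> * D \<omega> - indicator A \<omega> * D \<omega> \<partial>N)"
      using sets.sets_into_space[OF AN(1)] by (intro Bochner_Integration.integral_cong) (auto simp: indicator_def space_N)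
    also have "\<dots> = 0" using compl topD by (subst Bochner_Integration.integral_diff) (auto intro!: int AN)
    finally show ?case .
  next
    case (union A)
    have AN: "range A \<subseteq> sets N" using union sN by auto
    have "(LINT \<omega>:\<Union>(range A)|N. D \<omega>) = (\<Sum>n. LINT \<omega>:A n|N. D \<omega>)"
    proof (rule lebesgue_integral_countable_add)
      show "\<And>n. A n \<in> sets N" using AN by auto
      show "\<And>i j. i \<noteq> j \<Longrightarrow> A i \<inter> A j = {}" using union by (auto simp: disjoint_family_on_def)
      show "set_integrable N (\<Union>(range A)) D"
        unfolding set_integrable_def using AN by (intro integrable_mult_indicator iD) auto
    qed
    moreover have "(LINT \<omega>:A n|N. D \<omega>) = 0" for n using union by (simp add: set_lebesgue_integral_def)
    ultimately show ?case by (simp add: set_lebesgue_integral_def)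
  qed
qed (use b in auto)

text \<open>
  The martingale property in reversed time. By \<open>future_orthogonal\<close> it suffices to test with
  functions of \<open>X\<^sub>b\<close>, and this is the mild equation for the adjoint.
\<close>

lemma bwd_orthogonal:
  assumes v: "(v, k) \<in> L2_adjoint mu S.gen" and a: "0 \<le> a" "a \<le> b" and W: "W \<in> L2 N" "W \<in> borel_measurable (future Om X b)"
  shows "l2_inner N W (bwd v k a b) = 0"
proof (rule future_orthogonal[OF _ _ _ _ W])
  have L: "v \<in> L2 mu" "k \<in> L2 mu" using v by (auto simp: L2_adjoint_iff)
  show "bwd v k a b \<in> L2 N" by (rule fwd_bwd_L2(2)[OF L a])
  show "bwd v k a b \<in> borel_measurable (past Om X b)"
    using a by (intro measurable_generated_by_mono[OF fwd_bwd_measurable(2)[OF L a]]) auto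
  show "0 \<le> b" using a by simp
  fix H assume H: "H \<in> L2 mu"
  have HL: "(\<lambda>\<omega>. H (X b \<omega>)) \<in> L2 N" using a by (intro comp_X_L2 H) auto
  have M: "l2_inner N (\<lambda>\<omega>. H (X b \<omega>)) (\<lambda>\<omega>. g (X s \<omega>)) = l2_inner mu (P (b - s) H) g" if "g \<in> L2 mu" "0 \<le> s" "s \<le> b" for g s
    using Markov_two_times[OF H that(1,2), of "b - s"] that by (simp add: l2_inner_commute)
  have 2: "l2_inner N (\<lambda>\<omega>. H (X b \<omega>)) (\<lambda>\<omega>. v (X b \<omega>)) = l2_inner mu H v"
    using l2_inner_X[OF H L(1), of b] a by simp
  have "l2_inner N (\<lambda>\<omega>. H (X b \<omega>)) (path_integral k a b) = (LINT s:{0+a..(b-a)+a}|lborel. l2_inner N (\<lambda>\<omega>. H (X b \<omega>)) (\<lambda>\<omega>. k (X s \<omega>)))"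
    using path_integral_inner[OF L(2) a HL] by simp
  also have "\<dots> = (LINT s:{0..b-a}|lborel. l2_inner N (\<lambda>\<omega>. H (X b \<omega>)) (\<lambda>\<omega>. k (X (s + a) \<omega>)))" by (rule LINT_shift)
  also have "\<dots> = (LINT s:{0..b-a}|lborel. l2_inner mu (P ((b - a) - s) H) k)"
    using M[OF L(2)] a by (intro set_lebesgue_integral_cong) (auto simp: algebra_simps)
  also have "\<dots> = (LINT s:{0..b-a}|lborel. l2_inner mu (P s H) k)" by (rule LINT_reflect)
  also have "\<dots> = l2_inner mu (P (b - a) H) v - l2_inner mu H v"
    using S.adjoint_mild[OF v H, of "b - a"] a by simp
  finally show "l2_inner N (\<lambda>\<omega>. H (X b \<omega>)) (bwd v k a b) = 0"
    unfolding bwd_def[abs_def] using 2 M[OF L(1), of a] a L HL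
    by (simp add: l2_inner_diff_right L2_diff comp_X_L2 path_integral_L2)
qed

section \<open>The variance of the additive functional\<close>

definition corr :: "('a \<Rightarrow> real) \<Rightarrow> real \<Rightarrow> real" where
  "corr f s = l2_inner mu (P s f) f"

definition corr_integral :: "('a \<Rightarrow> real) \<Rightarrow> real \<Rightarrow> real" where
  "corr_integral f t = (LINT s:{0..t}|lborel. corr f s)"

lemma corr_continuous: "f \<in> L2 mu \<Longrightarrow> continuous_on {0..} (corr f)"
  unfolding corr_def[abs_def] by (rule S.continuous_on_l2_inner_Q)

lemma corr_abs_le: "f \<in> L2 mu \<Longrightarrow> 0 \<le> s \<Longrightarrow> \<bar>corr f s\<bar> \<le> (l2_norm mu f)\<^sup>2"
  unfolding corr_def using S.abs_l2_inner_Q_le[of s f f] by (simp add: power2_eq_square)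

lemma corr_integral_continuous: "f \<in> L2 mu \<Longrightarrow> continuous_on {0..} (corr_integral f)"
  unfolding corr_integral_def[abs_def] by (rule continuous_on_LINT[OF corr_continuous])

lemma corr_two_times:
  assumes f: "f \<in> L2 mu" and "0 \<le> r" "0 \<le> s"
  shows "l2_inner N (\<lambda>\<omega>. f (X r \<omega>)) (\<lambda>\<omega>. f (X s \<omega>)) = corr f \<bar>s - r\<bar>"
proof (cases "r \<le> s")
  case True
  then show ?thesis using Markov_two_times[OF f f assms(2), of "s - r"] by (simp add: corr_def l2_inner_commute)
next
  case False
  then show ?thesis using Markov_two_times[OF f f assms(3), of "r - s"] by (simp add: corr_def l2_inner_commute)
qed

text \<open>
  The right-hand side does not depend on \<open>a\<close>: the variance depends on two-time correlations only.
\<close>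

lemma second_moment:
  assumes f: "f \<in> L2 mu" and a: "0 \<le> a" and t: "0 \<le> t"
  shows "(l2_norm N (path_integral f a (a + t)))\<^sup>2 = 2 * (LINT s:{0..t}|lborel. corr_integral f s)"
proof -
  let ?I = "path_integral f a (a + t)"
  have ab: "0 \<le> a" "a \<le> a + t" using a t by auto
  have IL: "?I \<in> L2 N" by (rule path_integral_L2[OF f ab])
  have cc: "continuous_on A (corr_integral f)" if "A \<subseteq> {0..}" for A
    using corr_integral_continuous[OF f] that by (rule continuous_on_subset)
  have inner: "l2_inner N ?I (\<lambda>\<omega>. f (X (s + a) \<omega>)) = corr_integral f s + corr_integral f (t - s)" if s: "s \<in> {0..t}" for s
  proof -
    have sL: "(\<lambda>\<omega>. f (X (s + a) \<omega>)) \<in> L2 N" using s a by (intro comp_X_L2 f) auto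
    have "l2_inner N ?I (\<lambda>\<omega>. f (X (s + a) \<omega>)) = (LINT r:{0+a..t+a}|lborel. l2_inner N (\<lambda>\<omega>. f (X (s + a) \<omega>)) (\<lambda>\<omega>. f (X r \<omega>)))"
      using path_integral_inner[OF f ab sL] by (simp add: l2_inner_commute add.commute)
    also have "\<dots> = (LINT r:{0..t}|lborel. l2_inner N (\<lambda>\<omega>. f (X (s + a) \<omega>)) (\<lambda>\<omega>. f (X (r + a) \<omega>)))" by (rule LINT_shift)
    also have "\<dots> = (LINT r:{0..t}|lborel. corr f \<bar>r - s\<bar>)"
      using s a by (intro set_lebesgue_integral_cong) (auto simp: corr_two_times f)
    also have "\<dots> = (LINT r:{0..s}|lborel. corr f \<bar>r - s\<bar>) + (LINT r:{s..t}|lborel. corr f \<bar>r - s\<bar>)"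
      using s by (intro LINT_split borel_integrable_atLeastAtMost' continuous_on_compose2[OF corr_continuous[OF f]] continuous_intros) auto
    also have "(LINT r:{0..s}|lborel. corr f \<bar>r - s\<bar>) = (LINT r:{0..s}|lborel. corr f (s - r))"
      by (intro set_lebesgue_integral_cong) auto
    also have "\<dots> = corr_integral f s" unfolding corr_integral_def by (rule LINT_reflect)
    also have "(LINT r:{s..t}|lborel. corr f \<bar>r - s\<bar>) = (LINT r:{0+s..(t-s)+s}|lborel. corr f (r - s))"
      unfolding add_0_left diff_add_cancel by (intro set_lebesgue_integral_cong) auto
    also have "\<dots> = (LINT r:{0..t-s}|lborel. corr f (r + s - s))" by (rule LINT_shift)
    finally show ?thesis unfolding corr_integral_def by simp
  qed
  have "(l2_norm N ?I)\<^sup>2 = (LINT s:{0+a..t+a}|lborel. l2_inner N ?I (\<lambda>\<omega>. f (X s \<omega>)))"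
    unfolding l2_norm_sq using path_integral_inner[OF f ab IL] by (simp add: add.commute)
  also have "\<dots> = (LINT s:{0..t}|lborel. l2_inner N ?I (\<lambda>\<omega>. f (X (s + a) \<omega>)))" by (rule LINT_shift)
  also have "\<dots> = (LINT s:{0..t}|lborel. corr_integral f s + corr_integral f (t - s))"
    by (intro set_lebesgue_integral_cong) (auto simp: inner)
  also have "\<dots> = (LINT s:{0..t}|lborel. corr_integral f s) + (LINT s:{0..t}|lborel. corr_integral f (t - s))"
    by (intro set_integral_add borel_integrable_atLeastAtMost' cc continuous_on_compose2[OF cc[OF order_refl]] continuous_intros) auto
  also have "(LINT s:{0..t}|lborel. corr_integral f (t - s)) = (LINT s:{0..t}|lborel. corr_integral f s)" by (rule LINT_reflect)
  finally show ?thesis by simp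
qed

end

section \<open>Fourth moments of martingales\<close>

abbreviation tail_moment :: "'a measure \<Rightarrow> real \<Rightarrow> ('a \<Rightarrow> real) \<Rightarrow> real" where
  "tail_moment M m S \<equiv> (\<integral>x. indicator {x. m < (S x)\<^sup>2} x * (S x)\<^sup>2 \<partial>M)"

text \<open>
  The cubic term in \<open>Y\<close> is split by the inequality of means; the linear term is kept, as its
  expectation vanishes for a martingale.
\<close>

lemma fourth_power_increment:
  fixes T Y L :: real
  assumes "\<bar>Y\<bar> \<le> L"
  shows "(T + Y)^4 \<le> T^4 + 4 * (T^3 * Y) + 8 * L\<^sup>2 * T\<^sup>2 + 3 * L^4"
proof -
  have L0: "0 \<le> L" using assms by simp
  have y2: "Y\<^sup>2 \<le> L\<^sup>2" using assms by (simp add: abs_le_square_iff[symmetric])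
  have y4: "Y^4 \<le> L^4"
  proof -
    have "Y^4 = (Y\<^sup>2)\<^sup>2" "L^4 = (L\<^sup>2)\<^sup>2" by (simp_all only: power2_eq_square power4_eq_xxxx mult.assoc)
    then show ?thesis using power_mono[OF y2 zero_le_power2, of 2] by simp
  qed
  have t2: "6 * (T\<^sup>2 * Y\<^sup>2) \<le> 6 * (T\<^sup>2 * L\<^sup>2)" using y2 by (intro mult_left_mono) auto
  have "2 * (T * Y) * Y\<^sup>2 \<le> (T * Y)\<^sup>2 + (Y\<^sup>2)\<^sup>2" by (rule sum_squares_bound)
  then have "4 * (T * Y^3) \<le> 2 * (T\<^sup>2 * Y\<^sup>2) + 2 * Y^4" by (simp add: power_mult_distrib power2_eq_square power3_eq_cube power4_eq_xxxx algebra_simps)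
  also have "\<dots> \<le> 2 * (T\<^sup>2 * L\<^sup>2) + 2 * L^4" using y2 y4 by (intro add_mono mult_left_mono) auto
  finally have t3: "4 * (T * Y^3) \<le> 2 * (T\<^sup>2 * L\<^sup>2) + 2 * L^4" .
  have "(T + Y)^4 = T^4 + 4 * (T^3 * Y) + 6 * (T\<^sup>2 * Y\<^sup>2) + 4 * (T * Y^3) + Y^4"
    by (simp add: power2_eq_square power3_eq_cube power4_eq_xxxx algebra_simps)
  then show ?thesis using t2 t3 y4 by (simp add: algebra_simps)
qed

context prob_space
begin

lemma orthogonal_increments_norm:
  assumes R: "\<And>i. R i \<in> L2 M" and \<delta>: "\<And>i. (l2_norm M (R i))\<^sup>2 \<le> \<delta>"
    and orth: "\<And>i. l2_inner M (\<lambda>x. \<Sum>j<i. R j x) (R i) = 0"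
  shows "(l2_norm M (\<lambda>x. \<Sum>j<n. R j x))\<^sup>2 \<le> real n * \<delta>"
proof (induction n)
  case 0 then show ?case by (simp add: l2_norm_zero)
next
  case (Suc n)
  have L: "(\<lambda>x. \<Sum>j<n. R j x) \<in> L2 M" by (intro L2_sum R)
  have "(l2_norm M (\<lambda>x. \<Sum>j<Suc n. R j x))\<^sup>2 = (l2_norm M (\<lambda>x. \<Sum>j<n. R j x))\<^sup>2 + (l2_norm M (R n))\<^sup>2"
    unfolding l2_norm_sq using L R orth[of n]
    by (simp add: l2_inner_add_left l2_inner_add_right L2_add l2_inner_commute[of M "R n" "\<lambda>x. \<Sum>j<n. R j x"])
  then show ?case using Suc \<delta>[of n] by (simp add: algebra_simps)
qed

lemma bounded_martingale_fourth_moment: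
  assumes Y: "\<And>i. Y i \<in> borel_measurable M" and b: "\<And>i x. \<bar>Y i x\<bar> \<le> L"
    and orth2: "\<And>i. (\<integral>x. (\<Sum>j<i. Y j x) * Y i x \<partial>M) = 0"
    and orth4: "\<And>i. (\<integral>x. (\<Sum>j<i. Y j x)^3 * Y i x \<partial>M) = 0"
  shows "(\<integral>x. (\<Sum>j<n. Y j x)^4 \<partial>M) \<le> 8 * L^4 * (real n)\<^sup>2"
proof -
  have L0: "0 \<le> L" using order_trans[OF abs_ge_zero b] .
  have YL: "Y i \<in> L2 M" for i by (rule L2_bounded[OF Y, of i L]) (rule b)
  have sm: "(\<lambda>x. \<Sum>j<n. Y j x) \<in> borel_measurable M" for n by (intro borel_measurable_sum Y)
  have sb: "\<bar>\<Sum>j<n. Y j x\<bar> \<le> real n * L" for n x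
    using order_trans[OF sum_abs sum_bounded_above[of "{..<n}" "\<lambda>j. \<bar>Y j x\<bar>" L]] b by simp
  have bi: "integrable M g" if "g \<in> borel_measurable M" "\<And>x. \<bar>g x\<bar> \<le> B" for g :: "'a \<Rightarrow> real" and B
    using that by (intro integrable_const_bound[where B=B]) auto
  have pi: "integrable M (\<lambda>x. (\<Sum>j<n. Y j x)^k)" for n k
  proof (rule bi)
    show "\<bar>(\<Sum>j<n. Y j x)^k\<bar> \<le> (real n * L)^k" for x
      unfolding power_abs by (intro power_mono sb) simp
  qed (intro borel_measurable_power sm)
  have pyi: "integrable M (\<lambda>x. (\<Sum>j<n. Y j x)^3 * Y n x)" for n
  proof (rule bi)
    show "\<bar>(\<Sum>j<n. Y j x)^3 * Y n x\<bar> \<le> (real n * L)^3 * L" for x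
      unfolding power_abs abs_mult using L0 by (intro mult_mono power_mono sb b) auto
  qed (intro borel_measurable_times borel_measurable_power sm Y)
  have sq: "(\<integral>x. (\<Sum>j<n. Y j x)\<^sup>2 \<partial>M) \<le> real n * L\<^sup>2" for n
  proof -
    have d: "(l2_norm M (Y i))\<^sup>2 \<le> L\<^sup>2" for i
    proof -
      have "(\<integral>x. (Y i x)\<^sup>2 \<partial>M) \<le> L\<^sup>2"
        using L2_sq_integrable[OF YL[of i]] b[of i] by (intro integral_le_const AE_I2) (auto simp: abs_le_square_iff[symmetric] L0)
      then show ?thesis by (simp add: l2_norm_sq')
    qed
    show ?thesis
      using orthogonal_increments_norm[of Y "L\<^sup>2" n, OF YL d] orth2
      by (simp add: l2_norm_sq' l2_inner_def)
  qed
  have step: "(\<integral>x. (\<Sum>j<Suc n. Y j x)^4 \<partial>M) \<le> (\<integral>x. (\<Sum>j<n. Y j x)^4 \<partial>M) + 8 * L^4 * (real n + 1)" for n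
  proof -
    have "(\<integral>x. (\<Sum>j<Suc n. Y j x)^4 \<partial>M) \<le> (\<integral>x. (\<Sum>j<n. Y j x)^4 + 4 * ((\<Sum>j<n. Y j x)^3 * Y n x) + 8 * L\<^sup>2 * (\<Sum>j<n. Y j x)\<^sup>2 + 3 * L^4 \<partial>M)"
      using fourth_power_increment[OF b] pi[of "Suc n" 4]
      by (intro integral_mono) (auto intro!: pi pyi Bochner_Integration.integrable_add integrable_mult_right simp del: sum.lessThan_Suc simp: sum.lessThan_Suc[where g="\<lambda>j. Y j _"])
    also have "\<dots> = (\<integral>x. (\<Sum>j<n. Y j x)^4 \<partial>M) + 8 * L\<^sup>2 * (\<integral>x. (\<Sum>j<n. Y j x)\<^sup>2 \<partial>M) + 3 * L^4"
      using pi pyi orth4[of n] by (simp add: prob_space)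
    also have "8 * L\<^sup>2 * (\<integral>x. (\<Sum>j<n. Y j x)\<^sup>2 \<partial>M) \<le> 8 * L\<^sup>2 * (real n * L\<^sup>2)"
      using sq by (intro mult_left_mono) auto
    also have "8 * L\<^sup>2 * (real n * L\<^sup>2) = 8 * L^4 * real n" by (simp add: power2_eq_square power4_eq_xxxx)
    finally show ?thesis using zero_le_power[OF L0, of 4] unfolding distrib_left by linarith
  qed
  show ?thesis
  proof (induction n)
    case (Suc n)
    have "(\<integral>x. (\<Sum>j<Suc n. Y j x)^4 \<partial>M) \<le> 8 * L^4 * (real n)\<^sup>2 + 8 * L^4 * (real n + 1)"
      using step[of n] Suc by simp
    also have "\<dots> = 8 * L^4 * ((real n)\<^sup>2 + real n + 1)" by (simp add: algebra_simps)
    also have "\<dots> \<le> 8 * L^4 * (real (Suc n))\<^sup>2"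
      using L0 by (intro mult_left_mono) (auto simp: power2_eq_square algebra_simps)
    finally show ?case .
  qed simp
qed

text \<open>
  Martingale increments that are bounded up to a small error are sums of bounded martingale
  increments and small martingale increments: subtract from \<open>A\<close> its conditional expectation \<open>c\<close>
  given \<open>F i\<close> and add it to \<open>B\<close>. The new small part is no larger, because \<open>B\<close> has conditional
  expectation \<open>- c\<close>.
\<close>

lemma martingale_truncation:
  fixes A B :: "nat \<Rightarrow> 'a \<Rightarrow> real" and F :: "nat \<Rightarrow> 'a measure"
  assumes F: "\<And>i. subalgebra M (F i)" "\<And>i j. i \<le> j \<Longrightarrow> sets (F i) \<subseteq> sets (F j)"
    and A: "\<And>i. A i \<in> borel_measurable (F (Suc i))" "\<And>i x. \<bar>A i x\<bar> \<le> K"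
    and B: "\<And>i. B i \<in> borel_measurable (F (Suc i))" "\<And>i. B i \<in> L2 M" "\<And>i. (l2_norm M (B i))\<^sup>2 \<le> \<delta>"
    and orth: "\<And>i W. W \<in> L2 M \<Longrightarrow> W \<in> borel_measurable (F i) \<Longrightarrow> l2_inner M W (\<lambda>x. A i x + B i x) = 0"
  obtains Y R where "Y \<in> borel_measurable M" "bounded (range Y)" "R \<in> L2 M" "\<And>x. (\<Sum>i<n. A i x + B i x) = Y x + R x"
    "(\<integral>x. (Y x)^4 \<partial>M) \<le> 8 * (2 * K)^4 * (real n)\<^sup>2" "(l2_norm M R)\<^sup>2 \<le> real n * \<delta>"
proof -
  have K0: "0 \<le> K" using order_trans[OF abs_ge_zero A(2)] .
  have Fm: "f \<in> borel_measurable M" if "f \<in> borel_measurable (F i)" for f :: "'a \<Rightarrow> real" and i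
    by (rule measurable_from_subalg[OF F(1) that])
  have FF: "f \<in> borel_measurable (F j)" if "f \<in> borel_measurable (F i)" "i \<le> j" for f :: "'a \<Rightarrow> real" and i j
    using that F(2)[OF that(2)] F(1)[of i] F(1)[of j] by (auto simp: measurable_def subalgebra_def)
  \<comment> \<open>clipping changes \<open>c\<close> on a null set only and makes it bounded everywhere\<close>
  define c where "c i x = max (- K) (min K (real_cond_exp M (F i) (A i) x))" for i x
  have cF: "c i \<in> borel_measurable (F i)" for i unfolding c_def[abs_def] by measurable
  have cb: "\<bar>c i x\<bar> \<le> K" for i x unfolding c_def using K0 by auto
  have AL: "A i \<in> L2 M" for i by (rule L2_bounded[OF Fm[OF A(1)], of i K]) (rule A(2))
  have cL: "c i \<in> L2 M" for i by (rule L2_bounded[OF Fm[OF cF], of i K]) (rule cb)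
  have c_orth: "l2_inner M W (\<lambda>x. A i x - c i x) = 0" if W: "W \<in> L2 M" "W \<in> borel_measurable (F i)" for W i
  proof -
    interpret finite_measure_subalgebra M "F i"
      by (intro finite_measure_subalgebra.intro finite_measure_axioms finite_measure_subalgebra_axioms.intro F)
    have iA: "integrable M (A i)" by (rule L2_integrable[OF AL])
    have "AE x in M. real_cond_exp M (F i) (A i) x \<ge> - K"
      by (rule real_cond_exp_ge_c[OF iA]) (use A(2)[of i] in \<open>auto simp: abs_le_iff minus_le_iff\<close>)
    moreover have "AE x in M. real_cond_exp M (F i) (A i) x \<le> K"
      by (rule real_cond_exp_le_c[OF iA]) (use A(2)[of i] in \<open>auto simp: abs_le_iff\<close>)
    ultimately have "AE x in M. c i x = real_cond_exp M (F i) (A i) x"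
      by eventually_elim (simp add: c_def)
    then have "l2_inner M W (c i) = (\<integral>x. W x * real_cond_exp M (F i) (A i) x \<partial>M)"
      unfolding l2_inner_def using W cL[of i]
      by (intro integral_cong_AE borel_measurable_times borel_measurable_cond_exp2) (auto simp: L2_measurable)
    also have "\<dots> = l2_inner M W (A i)" unfolding l2_inner_def
      using W AL[of i] by (intro real_cond_exp_intg(2) L2_mult_integrable) (auto simp: L2_measurable)
    finally show ?thesis using W cL AL by (simp add: l2_inner_diff_right)
  qed
  define Y where "Y i x = A i x - c i x" for i x
  define R where "R i x = B i x + c i x" for i x
  have YF: "Y i \<in> borel_measurable (F (Suc i))" and RF: "R i \<in> borel_measurable (F (Suc i))" for i
    unfolding Y_def[abs_def] R_def[abs_def] using A(1) B(1) FF[OF cF, of i "Suc i"]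
    by (auto intro!: borel_measurable_diff borel_measurable_add)
  have Yb: "\<bar>Y i x\<bar> \<le> 2 * K" for i x using A(2)[of i x] cb[of i x] unfolding Y_def by simp
  have YL: "Y i \<in> L2 M" and RL: "R i \<in> L2 M" for i
    unfolding Y_def[abs_def] R_def[abs_def] by (intro L2_closed AL cL B(2))+
  have sumYF: "(\<lambda>x. \<Sum>j<i. Y j x) \<in> borel_measurable (F i)" and sumRF: "(\<lambda>x. \<Sum>j<i. R j x) \<in> borel_measurable (F i)" for i
    by (intro borel_measurable_sum FF[OF YF] FF[OF RF]; simp)+
  have Y_orth: "l2_inner M W (Y i) = 0" if "W \<in> L2 M" "W \<in> borel_measurable (F i)" for W i
    using c_orth[OF that] unfolding Y_def[abs_def] .
  have R_orth: "l2_inner M W (R i) = 0" if W: "W \<in> L2 M" "W \<in> borel_measurable (F i)" for W i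
  proof -
    have "l2_inner M W (\<lambda>x. A i x + B i x) = l2_inner M W (Y i) + l2_inner M W (R i)"
      unfolding Y_def[abs_def] R_def[abs_def] using AL[of i] B(2)[of i] cL[of i] W
      by (simp add: l2_inner_add_right l2_inner_diff_right)
    then show ?thesis using orth[OF W] Y_orth[OF W] by simp
  qed
  have Rn: "(l2_norm M (R i))\<^sup>2 \<le> \<delta>" for i
  proof -
    have "l2_inner M (c i) (R i) = 0" by (rule R_orth[OF cL cF])
    moreover have "B i = (\<lambda>x. R i x - c i x)" unfolding R_def by simp
    then have "l2_inner M (B i) (B i) = l2_inner M (R i) (R i) - 2 * l2_inner M (c i) (R i) + l2_inner M (c i) (c i)"
      using RL[of i] cL[of i]
      by (simp add: l2_inner_diff_left l2_inner_diff_right L2_diff l2_inner_commute[of M "R i" "c i"])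
    ultimately have "l2_inner M (R i) (R i) \<le> l2_inner M (B i) (B i)" using l2_inner_nonneg[of M "c i"] by simp
    then show ?thesis using B(3)[of i] by (simp add: l2_norm_sq)
  qed
  have sumYb: "\<bar>\<Sum>j<i. Y j x\<bar> \<le> real i * (2 * K)" for i x
    using order_trans[OF sum_abs sum_bounded_above[of "{..<i}" "\<lambda>j. \<bar>Y j x\<bar>" "2 * K"]] Yb by simp
  have sumYL: "(\<lambda>x. \<Sum>j<i. Y j x) \<in> L2 M" and sumRL: "(\<lambda>x. \<Sum>j<i. R j x) \<in> L2 M" for i
    by (intro L2_sum YL RL)+
  have powL: "(\<lambda>x. (\<Sum>j<i. Y j x)^k) \<in> L2 M" for i k
  proof (rule L2_bounded[where K="(real i * (2 * K))^k"])
    show "(\<lambda>x. (\<Sum>j<i. Y j x)^k) \<in> borel_measurable M" by (intro borel_measurable_power Fm[OF sumYF])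
    fix x show "\<bar>(\<Sum>j<i. Y j x)^k\<bar> \<le> (real i * (2 * K))^k"
      unfolding power_abs by (intro power_mono sumYb) simp
  qed
  have "(\<integral>x. (\<Sum>j<n. Y j x)^4 \<partial>M) \<le> 8 * (2 * K)^4 * (real n)\<^sup>2"
  proof (rule bounded_martingale_fourth_moment)
    show "Y i \<in> borel_measurable M" for i by (rule Fm[OF YF])
    show "(\<integral>x. (\<Sum>j<i. Y j x)^3 * Y i x \<partial>M) = 0" for i
      using Y_orth[OF powL borel_measurable_power[OF sumYF], of i 3] by (simp add: l2_inner_def)
    show "(\<integral>x. (\<Sum>j<i. Y j x) * Y i x \<partial>M) = 0" for i
      using Y_orth[OF sumYL sumYF, of i] by (simp add: l2_inner_def)
  qed (rule Yb)
  moreover have "(l2_norm M (\<lambda>x. \<Sum>j<n. R j x))\<^sup>2 \<le> real n * \<delta>"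
    by (rule orthogonal_increments_norm[OF RL Rn R_orth[OF sumRL sumRF]])
  moreover have "(\<Sum>i<n. A i x + B i x) = (\<Sum>j<n. Y j x) + (\<Sum>j<n. R j x)" for x
    unfolding Y_def R_def by (simp add: sum.distrib[symmetric])
  moreover have "bounded (range (\<lambda>x. \<Sum>j<n. Y j x))"
    using sumYb[of _ n] by (auto simp: bounded_iff)
  ultimately show ?thesis
    using that[of "\<lambda>x. \<Sum>j<n. Y j x" "\<lambda>x. \<Sum>j<n. R j x"] Fm[OF sumYF] sumRL by blast
qed

text \<open>
  Where \<open>\<bar>S\<bar> \<le> 2 \<bar>R\<bar>\<close> the remainder controls \<open>S\<^sup>2\<close>; elsewhere \<open>\<bar>S\<bar> \<le> 2 \<bar>Y\<bar>\<close> and \<open>S\<^sup>2 > m\<close>, so that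
  \<open>S\<^sup>2 \<le> S\<^sup>4 / m \<le> 16 Y\<^sup>4 / m\<close>.
\<close>

lemma truncated_second_moment_le:
  assumes S: "S \<in> L2 M" and Y: "Y \<in> borel_measurable M" "bounded (range Y)" and R: "R \<in> L2 M"
    and eq: "AE x in M. S x = Y x + R x" and m: "0 < m"
  shows "tail_moment M m S \<le> 4 * (l2_norm M R)\<^sup>2 + 16 / m * (\<integral>x. (Y x)^4 \<partial>M)"
proof -
  obtain b where b: "\<And>x. \<bar>Y x\<bar> \<le> b" using Y(2) by (auto simp: bounded_iff)
  have Y4: "integrable M (\<lambda>x. (Y x)^4)"
  proof (rule integrable_const_bound[where B="b^4"])
    have "norm ((Y x)^4) \<le> b^4" for x
      unfolding real_norm_def power_abs by (intro power_mono b) simp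
    then show "AE x in M. norm ((Y x)^4) \<le> b^4" by simp
  qed (intro borel_measurable_power Y(1))
  have [measurable]: "S \<in> borel_measurable M" by (rule L2_measurable[OF S])
  have i1: "integrable M (\<lambda>x. indicator {x. m < (S x)\<^sup>2} x * (S x)\<^sup>2)"
  proof (rule Bochner_Integration.integrable_bound[OF L2_sq_integrable[OF S]])
    have "{x \<in> space M. m < (S x)\<^sup>2} \<in> sets M" by measurable
    then have "(\<lambda>x. indicat_real {x \<in> space M. m < (S x)\<^sup>2} x * (S x)\<^sup>2) \<in> borel_measurable M"
      by (intro borel_measurable_times borel_measurable_indicator) auto
    then show "(\<lambda>x. indicat_real {x. m < (S x)\<^sup>2} x * (S x)\<^sup>2) \<in> borel_measurable M"
      by (rule measurable_cong[THEN iffD1, rotated]) (auto simp: indicator_def)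
  qed (auto simp: indicator_def)
  have "tail_moment M m S \<le> (\<integral>x. 4 * (R x)\<^sup>2 + 16 / m * (Y x)^4 \<partial>M)"
  proof (rule integral_mono_AE[OF i1])
    show "integrable M (\<lambda>x. 4 * (R x)\<^sup>2 + 16 / m * (Y x)^4)"
      using L2_sq_integrable[OF R] Y4 by simp
    show "AE x in M. indicator {x. m < (S x)\<^sup>2} x * (S x)\<^sup>2 \<le> 4 * (R x)\<^sup>2 + 16 / m * (Y x)^4"
      using eq
    proof eventually_elim
      case (elim x)
      have p: "0 \<le> 16 / m * (Y x)^4" "0 \<le> 4 * (R x)\<^sup>2" using m by auto
      show ?case
      proof (cases "m < (S x)\<^sup>2")
        case True
        then have ind: "indicator {x. m < (S x)\<^sup>2} x * (S x)\<^sup>2 = (S x)\<^sup>2" by simp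
        show ?thesis
        proof (cases "\<bar>Y x\<bar> \<le> \<bar>R x\<bar>")
          case True
          then have "\<bar>S x\<bar> \<le> 2 * \<bar>R x\<bar>" using elim by simp
          then have "\<bar>S x\<bar>\<^sup>2 \<le> (2 * \<bar>R x\<bar>)\<^sup>2" by (intro power_mono) auto
          then have "(S x)\<^sup>2 \<le> 4 * (R x)\<^sup>2" by (simp add: power_mult_distrib)
          then show ?thesis unfolding ind using p by linarith
        next
          case False
          then have "\<bar>S x\<bar> \<le> 2 * \<bar>Y x\<bar>" using elim by simp
          then have "\<bar>S x\<bar>\<^sup>2 \<le> (2 * \<bar>Y x\<bar>)\<^sup>2" by (intro power_mono) auto
          then have s: "(S x)\<^sup>2 \<le> 4 * (Y x)\<^sup>2" by (simp add: power_mult_distrib)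
          then have "m \<le> 4 * (Y x)\<^sup>2" using True by simp
          then have "4 * (Y x)\<^sup>2 * m \<le> 4 * (Y x)\<^sup>2 * (4 * (Y x)\<^sup>2)" by (intro mult_left_mono) auto
          then have "4 * (Y x)\<^sup>2 \<le> 16 / m * (Y x)^4" using m by (simp add: field_simps power2_eq_square power4_eq_xxxx)
          then show ?thesis unfolding ind using s p by linarith
        qed
      qed (use p in auto)
    qed
  qed
  also have "\<dots> = 4 * (l2_norm M R)\<^sup>2 + 16 / m * (\<integral>x. (Y x)^4 \<partial>M)"
    using L2_sq_integrable[OF R] Y4 by (simp add: l2_norm_sq')
  finally show ?thesis .
qed

end

section \<open>The central limit theorem for strongly mixing sequences\<close>

lemma cmod_iexp_diff: "cmod (iexp x - iexp y) \<le> \<bar>x - y\<bar>"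
proof -
  have "iexp y * iexp (x - y) = iexp x" by (simp add: mult_exp_exp algebra_simps)
  then have "iexp x - iexp y = iexp y * (iexp (x - y) - 1)" by (simp add: algebra_simps)
  then have "cmod (iexp x - iexp y) = cmod (iexp (x - y) - 1)"
    by (simp add: norm_mult)
  also have "\<dots> \<le> \<bar>x - y\<bar>" using iexp_approx1[of "x - y" 0] by simp
  finally show ?thesis .
qed

lemma abs_exp_minus_linear_le:
  fixes x :: real assumes "0 \<le> x" shows "\<bar>1 - x - exp (- x)\<bar> \<le> x\<^sup>2"
proof -
  have "1 - x \<le> exp (- x)" using exp_ge_add_one_self[of "- x"] by simp
  moreover have "exp (- x) \<le> 1 - x + x\<^sup>2"
  proof -
    have "exp (- x) = 1 / exp x" by (simp add: exp_minus field_simps)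
    also have "\<dots> \<le> 1 / (1 + x)" using exp_ge_add_one_self[of x] assms by (intro divide_left_mono) auto
    also have "\<dots> \<le> 1 - x + x\<^sup>2"
    proof -
      have "1 \<le> (1 - x + x\<^sup>2) * (1 + x)" using assms by (simp add: algebra_simps power2_eq_square)
      then show ?thesis using assms by (simp add: divide_le_eq)
    qed
    finally show ?thesis .
  qed
  ultimately show ?thesis by simp
qed

lemma abs_exp_minus_diff_le:
  fixes x y :: real assumes "0 \<le> x" "0 \<le> y" shows "\<bar>exp (- x) - exp (- y)\<bar> \<le> \<bar>x - y\<bar>"
proof -
  have *: "exp (- a) - exp (- b) \<le> b - a" if "0 \<le> a" "a \<le> b" for a b :: real
  proof -
    have "exp (- a) - exp (- b) = exp (- a) * (1 - exp (- (b - a)))" by (simp add: algebra_simps flip: exp_add)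
    also have "\<dots> \<le> 1 * (1 - exp (- (b - a)))" using that by (intro mult_right_mono) auto
    also have "\<dots> \<le> b - a"
    proof -
      define z where "z = exp (- (b - a))"
      have "1 + - (b - a) \<le> z" unfolding z_def by (rule exp_ge_add_one_self)
      then show ?thesis unfolding z_def[symmetric] by simp
    qed
    finally show ?thesis .
  qed
  show ?thesis
  proof (cases "x \<le> y")
    case True
    then show ?thesis using *[of x y] assms by simp
  next
    case False
    then show ?thesis using *[of y x] assms by simp
  qed
qed

lemma sum_block:
  fixes g :: "nat \<Rightarrow> real"
  shows "sum g {0..<k * m} = (\<Sum>j<k. sum g {j * m..<j * m + m})"
proof (induction k)
  case (Suc k)
  have "sum g {0..<Suc k * m} = sum g {0..<k * m} + sum g {k * m..<k * m + m}"
    by (simp add: sum.atLeastLessThan_concat add.commute)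
  then show ?case using Suc by simp
qed simp

text \<open>
  Stationarity enters through the sums only: their variance depends on their length \<open>p\<close>, and their
  normalised squares are uniformly integrable uniformly in the starting point \<open>a\<close>.
\<close>

locale mixing_sequence = prob_space M for M :: "'a measure" +
  fixes \<xi> :: "nat \<Rightarrow> 'a \<Rightarrow> real" and Pa Fu :: "nat \<Rightarrow> 'a measure" and \<alpha> :: "nat \<Rightarrow> real"
    and V :: "nat \<Rightarrow> real" and c d :: real and n0 :: nat
  assumes past_subalgebra: "\<And>m. subalgebra M (Pa m)" and future_subalgebra: "\<And>m. subalgebra M (Fu m)"
    and past_measurable: "\<And>i m. i < m \<Longrightarrow> \<xi> i \<in> borel_measurable (Pa m)"
    and future_measurable: "\<And>i m. m \<le> i \<Longrightarrow> \<xi> i \<in> borel_measurable (Fu m)"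
    and mixing: "\<And>m r F G. F \<in> borel_measurable (Pa m) \<Longrightarrow> G \<in> borel_measurable (Fu (m + r)) \<Longrightarrow>
        (\<And>x. 0 \<le> F x \<and> F x \<le> 1) \<Longrightarrow> (\<And>x. 0 \<le> G x \<and> G x \<le> 1) \<Longrightarrow>
        \<bar>(\<integral>x. F x * G x \<partial>M) - (\<integral>x. F x \<partial>M) * (\<integral>x. G x \<partial>M)\<bar> \<le> \<alpha> r"
    and \<alpha>_tendsto: "\<alpha> \<longlonglongrightarrow> 0"
    and \<xi>_L2: "\<And>i. \<xi> i \<in> L2 M" and \<xi>_mean: "\<And>i. (\<integral>x. \<xi> i x \<partial>M) = 0"
    and variance: "\<And>a p. (l2_norm M (\<lambda>x. \<Sum>i\<in>{a..<a+p}. \<xi> i x))\<^sup>2 = V p"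
    and ui: "\<And>\<epsilon>. 0 < \<epsilon> \<Longrightarrow> \<exists>K>0. \<forall>a p. 1 \<le> p \<longrightarrow>
        tail_moment M (K * real p) (\<lambda>x. \<Sum>i\<in>{a..<a+p}. \<xi> i x) \<le> \<epsilon> * real p"
    and c_pos: "0 < c" and lower: "\<And>n. n0 \<le> n \<Longrightarrow> c * real n \<le> V n" and upper: "\<And>n. V n \<le> d * real n"
begin

definition T :: "nat \<Rightarrow> nat \<Rightarrow> 'a \<Rightarrow> real" where
  "T a p x = (\<Sum>i\<in>{a..<a+p}. \<xi> i x)"

lemma T_L2: "T a p \<in> L2 M"
  unfolding T_def[abs_def] by (intro L2_sum \<xi>_L2)

lemma T_norm: "(l2_norm M (T a p))\<^sup>2 = V p"
  unfolding T_def[abs_def] by (rule variance)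

lemma T_mean: "(\<integral>x. T a p x \<partial>M) = 0"
  unfolding T_def[abs_def] by (simp add: \<xi>_mean L2_integrable[OF \<xi>_L2])

lemma T_past: "a + p \<le> m \<Longrightarrow> T a p \<in> borel_measurable (Pa m)"
  unfolding T_def[abs_def] by (intro borel_measurable_sum past_measurable) auto

lemma T_future: "m \<le> a \<Longrightarrow> T a p \<in> borel_measurable (Fu m)"
  unfolding T_def[abs_def] by (intro borel_measurable_sum future_measurable) auto

lemma d_pos: "0 < d"
proof -
  have "c * real (Suc n0) \<le> V (Suc n0)" by (rule lower) simp
  also have "\<dots> \<le> d * real (Suc n0)" by (rule upper)
  finally have "c \<le> d" by (rule mult_right_le_imp_le) simp
  then show ?thesis using c_pos by simp
qed

lemma V_nonneg: "0 \<le> V p"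
  using T_norm[of 0 p] by (metis zero_le_power2)

lemma T_norm_le: "l2_norm M (T a p) \<le> sqrt (d * real p)"
  using T_norm[of a p] upper[of p] by (intro real_le_rsqrt) simp

lemma past_M: "f \<in> borel_measurable (Pa m) \<Longrightarrow> f \<in> borel_measurable M"
  by (rule measurable_from_subalg[OF past_subalgebra])
lemma future_M: "f \<in> borel_measurable (Fu m) \<Longrightarrow> f \<in> borel_measurable M"
  by (rule measurable_from_subalg[OF future_subalgebra])

lemma bounded_integrable: "f \<in> borel_measurable M \<Longrightarrow> (\<And>x. \<bar>f x\<bar> \<le> B) \<Longrightarrow> integrable M f" for f :: "'a \<Rightarrow> real"
  by (intro integrable_const_bound[where B=B]) auto

text \<open>
  The factor \<open>4 a b\<close> comes from mapping \<open>{-a..a}\<close> and \<open>{-b..b}\<close> affinely onto \<open>{0..1}\<close>.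
\<close>

lemma covariance_bounded:
  assumes F: "F \<in> borel_measurable (Pa m)" "\<And>x. \<bar>F x\<bar> \<le> a" and G: "G \<in> borel_measurable (Fu (m + r))" "\<And>x. \<bar>G x\<bar> \<le> b"
    and ab: "0 < a" "0 < b"
  shows "\<bar>(\<integral>x. F x * G x \<partial>M) - (\<integral>x. F x \<partial>M) * (\<integral>x. G x \<partial>M)\<bar> \<le> 4 * a * b * \<alpha> r"
proof -
  define F' where "F' x = (F x + a) / (2 * a)" for x
  define G' where "G' x = (G x + b) / (2 * b)" for x
  have F'm: "F' \<in> borel_measurable (Pa m)" unfolding F'_def[abs_def] using F(1) by (intro borel_measurable_divide borel_measurable_add) auto
  have G'm: "G' \<in> borel_measurable (Fu (m + r))" unfolding G'_def[abs_def] using G(1) by (intro borel_measurable_divide borel_measurable_add) auto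
  have F'b: "0 \<le> F' x \<and> F' x \<le> 1" for x unfolding F'_def using F(2)[of x] ab by (simp add: abs_le_iff)
  have G'b: "0 \<le> G' x \<and> G' x \<le> 1" for x unfolding G'_def using G(2)[of x] ab by (simp add: abs_le_iff)
  note m = mixing[OF F'm G'm F'b G'b]
  have iF: "integrable M F'" by (rule bounded_integrable[OF past_M[OF F'm], of 1]) (use F'b in auto)
  have iG: "integrable M G'" by (rule bounded_integrable[OF future_M[OF G'm], of 1]) (use G'b in auto)
  have iFG: "integrable M (\<lambda>x. F' x * G' x)"
    by (rule bounded_integrable[OF borel_measurable_times[OF past_M[OF F'm] future_M[OF G'm]], of 1])
      (use F'b G'b in \<open>auto simp: abs_mult intro!: mult_le_one\<close>)
  have eF: "F = (\<lambda>x. 2 * a * F' x - a)" and eG: "G = (\<lambda>x. 2 * b * G' x - b)"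
    unfolding F'_def G'_def using ab by auto
  have 1: "(\<integral>x. F x \<partial>M) = 2 * a * (\<integral>x. F' x \<partial>M) - a" unfolding eF using iF by (simp add: prob_space)
  have 2: "(\<integral>x. G x \<partial>M) = 2 * b * (\<integral>x. G' x \<partial>M) - b" unfolding eG using iG by (simp add: prob_space)
  have "(\<integral>x. F x * G x \<partial>M) = (\<integral>x. 4 * a * b * (F' x * G' x) - 2 * a * b * F' x - 2 * a * b * G' x + a * b \<partial>M)"
    unfolding eF eG by (intro Bochner_Integration.integral_cong) (auto simp: algebra_simps)
  also have "\<dots> = 4 * a * b * (\<integral>x. F' x * G' x \<partial>M) - 2 * a * b * (\<integral>x. F' x \<partial>M) - 2 * a * b * (\<integral>x. G' x \<partial>M) + a * b"
    using iF iG iFG by (simp add: prob_space)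
  finally have 3: "(\<integral>x. F x * G x \<partial>M) = \<dots>" .
  have "(\<integral>x. F x * G x \<partial>M) - (\<integral>x. F x \<partial>M) * (\<integral>x. G x \<partial>M)
     = 4 * a * b * ((\<integral>x. F' x * G' x \<partial>M) - (\<integral>x. F' x \<partial>M) * (\<integral>x. G' x \<partial>M))"
    unfolding 1 2 3 by (simp add: algebra_simps)
  then have "\<bar>(\<integral>x. F x * G x \<partial>M) - (\<integral>x. F x \<partial>M) * (\<integral>x. G x \<partial>M)\<bar>
     = 4 * a * b * \<bar>(\<integral>x. F' x * G' x \<partial>M) - (\<integral>x. F' x \<partial>M) * (\<integral>x. G' x \<partial>M)\<bar>"
    using ab by (simp add: abs_mult)
  also have "\<dots> \<le> 4 * a * b * \<alpha> r" using m ab by (intro mult_left_mono) auto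
  finally show ?thesis .
qed

definition cf :: "('a \<Rightarrow> real) \<Rightarrow> complex" where
  "cf U = (\<integral>x. iexp (U x) \<partial>M)"

lemma cf_integrable: "U \<in> borel_measurable M \<Longrightarrow> integrable M (\<lambda>x. iexp (U x))"
  by (intro integrable_const_bound[where B=1]) auto

lemma cmod_cf_le_1: "U \<in> borel_measurable M \<Longrightarrow> cmod (cf U) \<le> 1"
proof -
  have "cmod (cf U) \<le> (\<integral>x. cmod (iexp (U x)) \<partial>M)" unfolding cf_def by (rule integral_norm_bound)
  then show ?thesis by (simp add: prob_space)
qed

lemma cf_split: "U \<in> borel_measurable M \<Longrightarrow> Re (cf U) = (\<integral>x. cos (U x) \<partial>M) \<and> Im (cf U) = (\<integral>x. sin (U x) \<partial>M)"
  unfolding cf_def using cf_integrable[of U] by (simp add: Re_exp Im_exp flip: integral_Re integral_Im)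

text \<open>
  Covariances of the four products of sine and cosine; real and imaginary part each involve two of
  them.
\<close>

lemma cf_mixing:
  assumes U: "U \<in> borel_measurable (Pa m)" and W: "W \<in> borel_measurable (Fu (m + r))"
  shows "cmod (cf (\<lambda>x. U x + W x) - cf U * cf W) \<le> 16 * \<alpha> r"
proof -
  have Um: "U \<in> borel_measurable M" and Wm: "W \<in> borel_measurable M" using past_M[OF U] future_M[OF W] by auto
  have UWm: "(\<lambda>x. U x + W x) \<in> borel_measurable M" using Um Wm by (rule borel_measurable_add)
  note b = covariance_bounded[where a=1 and b=1 and m=m and r=r]
  have cU: "(\<lambda>x. cos (U x)) \<in> borel_measurable (Pa m)" "(\<lambda>x. sin (U x)) \<in> borel_measurable (Pa m)"
    using U by measurable
  have cW: "(\<lambda>x. cos (W x)) \<in> borel_measurable (Fu (m + r))" "(\<lambda>x. sin (W x)) \<in> borel_measurable (Fu (m + r))"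
    using W by measurable
  have bi: "integrable M (\<lambda>x. g (U x) * h (W x))" if "g \<in> {cos, sin}" "h \<in> {cos, sin}" for g h :: "real \<Rightarrow> real"
  proof (rule bounded_integrable[where B=1])
    show "(\<lambda>x. g (U x) * h (W x)) \<in> borel_measurable M" using that Um Wm by auto
    show "\<bar>g (U x) * h (W x)\<bar> \<le> 1" for x using that by (auto simp: abs_mult intro!: mult_le_one)
  qed
  have cc: "\<bar>(\<integral>x. cos (U x) * cos (W x) \<partial>M) - (\<integral>x. cos (U x) \<partial>M) * (\<integral>x. cos (W x) \<partial>M)\<bar> \<le> 4 * \<alpha> r"
    using b[OF cU(1) _ cW(1)] by simp
  have ss: "\<bar>(\<integral>x. sin (U x) * sin (W x) \<partial>M) - (\<integral>x. sin (U x) \<partial>M) * (\<integral>x. sin (W x) \<partial>M)\<bar> \<le> 4 * \<alpha> r"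
    using b[OF cU(2) _ cW(2)] by simp
  have cs: "\<bar>(\<integral>x. cos (U x) * sin (W x) \<partial>M) - (\<integral>x. cos (U x) \<partial>M) * (\<integral>x. sin (W x) \<partial>M)\<bar> \<le> 4 * \<alpha> r"
    using b[OF cU(1) _ cW(2)] by simp
  have sc: "\<bar>(\<integral>x. sin (U x) * cos (W x) \<partial>M) - (\<integral>x. sin (U x) \<partial>M) * (\<integral>x. cos (W x) \<partial>M)\<bar> \<le> 4 * \<alpha> r"
    using b[OF cU(2) _ cW(1)] by simp
  have R: "(\<integral>x. cos (U x + W x) \<partial>M) = (\<integral>x. cos (U x) * cos (W x) \<partial>M) - (\<integral>x. sin (U x) * sin (W x) \<partial>M)"
    unfolding cos_add by (rule Bochner_Integration.integral_diff) (auto intro!: bi)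
  have I: "(\<integral>x. sin (U x + W x) \<partial>M) = (\<integral>x. sin (U x) * cos (W x) \<partial>M) + (\<integral>x. cos (U x) * sin (W x) \<partial>M)"
    unfolding sin_add by (rule Bochner_Integration.integral_add) (auto intro!: bi)
  have "\<bar>Re (cf (\<lambda>x. U x + W x) - cf U * cf W)\<bar> \<le> 8 * \<alpha> r"
    using cf_split[OF Um] cf_split[OF Wm] cf_split[OF UWm] R cc ss by (simp add: abs_le_iff)
  moreover have "\<bar>Im (cf (\<lambda>x. U x + W x) - cf U * cf W)\<bar> \<le> 8 * \<alpha> r"
    using cf_split[OF Um] cf_split[OF Wm] cf_split[OF UWm] I cs sc by (simp add: abs_le_iff)
  ultimately show ?thesis
    using cmod_le[of "cf (\<lambda>x. U x + W x) - cf U * cf W"] by linarith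
qed

text \<open>
  Blocks of length \<open>p\<close> separated by gaps of length \<open>q\<close> are independent up to \<open>16 \<eta>\<close> per block.
\<close>

lemma cf_blocks:
  assumes "\<And>r. q \<le> r \<Longrightarrow> \<alpha> r \<le> \<eta>"
  shows "cmod (cf (\<lambda>x. \<Sum>j<k. s * T (j * (p + q)) p x) - (\<Prod>j<k. cf (\<lambda>x. s * T (j * (p + q)) p x))) \<le> real k * (16 * \<eta>)"
proof (induction k)
  case 0 then show ?case by (simp add: cf_def prob_space)
next
  case (Suc k)
  let ?U = "\<lambda>x. \<Sum>j<k. s * T (j * (p + q)) p x" and ?W = "\<lambda>x. s * T (k * (p + q)) p x"
  \<comment> \<open>end of the last of the first \<open>k\<close> blocks; for \<open>k = 0\<close> the truncated difference is \<open>0\<close> and there is nothing to separate\<close>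
  define m where "m = k * (p + q) - q"
  have pa: "j * (p + q) + p \<le> m" if "j < k" for j
  proof -
    have "Suc j * (p + q) \<le> k * (p + q)" using that by (intro mult_le_mono1) simp
    then show ?thesis unfolding m_def by simp
  qed
  have U: "?U \<in> borel_measurable (Pa m)"
    using pa by (intro borel_measurable_sum borel_measurable_times borel_measurable_const T_past) auto
  define r where "r = k * (p + q) - m"
  have W: "?W \<in> borel_measurable (Fu (m + r))"
    unfolding r_def m_def by (intro borel_measurable_times borel_measurable_const T_future) simp
  have Um: "?U \<in> borel_measurable M" and Wm: "?W \<in> borel_measurable M"
    by (rule past_M[OF U], rule future_M[OF W])
  have "cmod (cf (\<lambda>x. ?U x + ?W x) - cf ?U * cf ?W) \<le> 16 * \<eta>"
  proof (cases "k = 0")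
    case True
    have "\<eta> \<ge> 0"
    proof (rule LIMSEQ_le_const2[OF \<alpha>_tendsto])
      show "\<exists>N. \<forall>n\<ge>N. \<alpha> n \<le> \<eta>" using assms by blast
    qed
    then show ?thesis using True by (simp add: cf_def prob_space)
  next
    case False
    then have "q \<le> r" unfolding r_def m_def by (cases k) auto
    then show ?thesis using cf_mixing[OF U W] assms[of r] by simp
  qed
  moreover have "cmod (cf ?U * cf ?W - (\<Prod>j<k. cf (\<lambda>x. s * T (j * (p + q)) p x)) * cf ?W)
     \<le> real k * (16 * \<eta>)"
  proof -
    have "cmod (cf ?U * cf ?W - (\<Prod>j<k. cf (\<lambda>x. s * T (j * (p + q)) p x)) * cf ?W)
      = cmod (cf ?U - (\<Prod>j<k. cf (\<lambda>x. s * T (j * (p + q)) p x))) * cmod (cf ?W)"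
      by (simp add: left_diff_distrib[symmetric] norm_mult)
    also have "\<dots> \<le> cmod (cf ?U - (\<Prod>j<k. cf (\<lambda>x. s * T (j * (p + q)) p x))) * 1"
      using cmod_cf_le_1[OF Wm] by (intro mult_left_mono) auto
    finally show ?thesis using Suc by simp
  qed
  ultimately have "cmod (cf (\<lambda>x. ?U x + ?W x) - (\<Prod>j<k. cf (\<lambda>x. s * T (j * (p + q)) p x)) * cf ?W) \<le> 16 * \<eta> + real k * (16 * \<eta>)"
    by (rule norm_diff_triangle_le)
  then show ?case by (simp add: algebra_simps)
qed

definition trunc_T :: "real \<Rightarrow> nat \<Rightarrow> nat \<Rightarrow> 'a \<Rightarrow> real" where
  "trunc_T K a p x = (if (T a p x)\<^sup>2 \<le> K * real p then T a p x else 0)"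

lemma trunc_T_measurable: "T a p \<in> borel_measurable F \<Longrightarrow> trunc_T K a p \<in> borel_measurable F"
proof -
  assume [measurable]: "T a p \<in> borel_measurable F"
  show ?thesis unfolding trunc_T_def[abs_def] by measurable
qed

lemma truncated_block:
  assumes ub: "\<And>a p. 1 \<le> p \<Longrightarrow> tail_moment M (K * real p) (T a p) \<le> \<epsilon> * real p"
    and p: "1 \<le> p" and K: "0 < K"
  shows "trunc_T K a p \<in> L2 M" "\<bar>trunc_T K a p x\<bar> \<le> sqrt (K * real p)"
    "l2_norm M (\<lambda>x. T a p x - trunc_T K a p x) \<le> sqrt (\<epsilon> * real p)" "\<bar>\<integral>x. trunc_T K a p x \<partial>M\<bar> \<le> sqrt (\<epsilon> * real p)"
    "l2_norm M (trunc_T K a p) \<le> sqrt (d * real p)"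
proof -
  let ?X = "trunc_T K a p"
  have Tm[measurable]: "T a p \<in> borel_measurable M" by (rule L2_measurable[OF T_L2])
  have Xm: "?X \<in> borel_measurable M" by (rule trunc_T_measurable[OF Tm])
  have b: "\<bar>?X x\<bar> \<le> sqrt (K * real p)" for x
    using K by (auto simp: trunc_T_def intro!: real_le_rsqrt)
  then show "\<bar>?X x\<bar> \<le> sqrt (K * real p)" .
  show XL: "?X \<in> L2 M" by (rule L2_bounded[OF Xm b])
  have DL: "(\<lambda>x. T a p x - ?X x) \<in> L2 M" by (intro L2_closed T_L2 XL)
  have "(l2_norm M (\<lambda>x. T a p x - ?X x))\<^sup>2 = tail_moment M (K * real p) (T a p)"
    unfolding l2_norm_sq' by (intro Bochner_Integration.integral_cong) (auto simp: indicator_def trunc_T_def)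
  also have "\<dots> \<le> \<epsilon> * real p" by (rule ub[OF p])
  finally show n: "l2_norm M (\<lambda>x. T a p x - ?X x) \<le> sqrt (\<epsilon> * real p)" by (rule real_le_rsqrt)
  have "(\<integral>x. T a p x - ?X x \<partial>M) = - (\<integral>x. ?X x \<partial>M)"
    using L2_integrable[OF T_L2] L2_integrable[OF XL] by (simp add: T_mean)
  then have "\<bar>\<integral>x. ?X x \<partial>M\<bar> \<le> (\<integral>x. \<bar>T a p x - ?X x\<bar> \<partial>M)"
    using integral_abs_bound[of M "\<lambda>x. T a p x - ?X x"] by simp
  also have "\<dots> \<le> sqrt (\<epsilon> * real p)" using abs_integral_le_l2_norm[OF DL] n by simp
  finally show "\<bar>\<integral>x. ?X x \<partial>M\<bar> \<le> sqrt (\<epsilon> * real p)" .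
  have "(l2_norm M ?X)\<^sup>2 \<le> (l2_norm M (T a p))\<^sup>2"
    unfolding l2_norm_sq' by (intro integral_mono L2_sq_integrable XL T_L2) (auto simp: trunc_T_def)
  also have "\<dots> \<le> d * real p" using T_norm upper by simp
  finally show "l2_norm M ?X \<le> sqrt (d * real p)" by (rule real_le_rsqrt)
qed

text \<open>
  Mixing bounds covariances of bounded variables only. Cut each block sum off at a multiple of its
  standard deviation scale \<open>sqrt p\<close>: the loss is small in \<open>L\<^sup>2\<close>, uniformly in \<open>p\<close>, by uniform
  integrability.
\<close>

lemma separated_blocks_covariance:
  assumes \<eta>: "0 < \<eta>"
  obtains q0 where "\<And>a b p. 1 \<le> p \<Longrightarrow> a + p + q0 \<le> b \<Longrightarrow> \<bar>l2_inner M (T a p) (T b p)\<bar> \<le> \<eta> * real p"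
proof -
  \<comment> \<open>\<open>\<eta> / 4\<close> for the product of the means, \<open>(\<eta> / 8)\<^sup>2 / d\<close> for each of the two replacements of a block by its cut-off\<close>
  define \<epsilon> where "\<epsilon> = min (\<eta> / 4) ((\<eta> / 8)\<^sup>2 / d)"
  have e0: "0 < \<epsilon>" unfolding \<epsilon>_def using \<eta> d_pos by simp
  have e1: "\<epsilon> \<le> \<eta> / 4" unfolding \<epsilon>_def by (rule min.cobounded1)
  have e2: "sqrt (\<epsilon> * d) \<le> \<eta> / 8"
  proof (rule real_le_lsqrt)
    have "\<epsilon> * d \<le> (\<eta> / 8)\<^sup>2 / d * d" unfolding \<epsilon>_def using d_pos by (intro mult_right_mono) auto
    then show "\<epsilon> * d \<le> (\<eta> / 8)\<^sup>2" using d_pos by simp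
  qed (use \<eta> in simp)
  obtain K where K: "0 < K" "\<And>a p. 1 \<le> p \<Longrightarrow> tail_moment M (K * real p) (T a p) \<le> \<epsilon> * real p"
    using ui[OF e0] unfolding T_def by blast
  have "\<forall>\<^sub>F r in sequentially. \<alpha> r < \<eta> / (16 * K)"
    using \<alpha>_tendsto \<eta> K by (intro order_tendstoD(2)) auto
  then obtain q0 where q0: "\<And>r. q0 \<le> r \<Longrightarrow> \<alpha> r < \<eta> / (16 * K)" by (auto simp: eventually_sequentially)
  have "\<bar>l2_inner M (T a p) (T b p)\<bar> \<le> \<eta> * real p" if p: "1 \<le> p" and ab: "a + p + q0 \<le> b" for a b p
  proof -
    define X where "X a = trunc_T K a p" for a
    note t = truncated_block[OF K(2) p K(1), folded X_def]
    have sp: "sqrt (\<epsilon> * real p) * sqrt (d * real p) = sqrt (\<epsilon> * d) * real p"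
    proof -
      have "sqrt (\<epsilon> * real p) * sqrt (d * real p) = sqrt (\<epsilon> * d * (real p)\<^sup>2)"
        by (simp add: real_sqrt_mult[symmetric] power2_eq_square mult_ac)
      then show ?thesis by (simp add: real_sqrt_mult)
    qed
    have Xm: "X a \<in> borel_measurable (Pa (a + p))" "X b \<in> borel_measurable (Fu b)"
      unfolding X_def by (intro trunc_T_measurable T_past T_future; simp)+
    define r where "r = b - (a + p)"
    have r: "b = (a + p) + r" "q0 \<le> r" using ab unfolding r_def by auto
    have Kp: "0 < sqrt (K * real p)" using K p by simp
    have Xb: "X b \<in> borel_measurable (Fu ((a + p) + r))" using Xm(2) unfolding r(1)[symmetric] .
    have "\<bar>(\<integral>x. X a x * X b x \<partial>M) - (\<integral>x. X a x \<partial>M) * (\<integral>x. X b x \<partial>M)\<bar> \<le> 4 * sqrt (K * real p) * sqrt (K * real p) * \<alpha> r"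
      by (rule covariance_bounded[OF Xm(1) t(2) Xb t(2) Kp Kp])
    also have "4 * sqrt (K * real p) * sqrt (K * real p) * \<alpha> r = 4 * (K * real p) * \<alpha> r" using K by simp
    also have "\<dots> \<le> 4 * (K * real p) * (\<eta> / (16 * K))" using q0[OF r(2)] K by (intro mult_left_mono) auto
    also have "\<dots> = \<eta> / 4 * real p" using K by (simp add: field_simps)
    finally have 1: "\<bar>(\<integral>x. X a x * X b x \<partial>M) - (\<integral>x. X a x \<partial>M) * (\<integral>x. X b x \<partial>M)\<bar> \<le> \<eta> / 4 * real p" .
    have "\<bar>(\<integral>x. X a x \<partial>M) * (\<integral>x. X b x \<partial>M)\<bar> \<le> sqrt (\<epsilon> * real p) * sqrt (\<epsilon> * real p)"
      unfolding abs_mult by (intro mult_mono t(4)) (use e0 in auto)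
    also have "\<dots> \<le> \<eta> / 4 * real p" using e0 mult_right_mono[OF e1, of "real p"] by simp
    finally have 2: "\<bar>(\<integral>x. X a x \<partial>M) * (\<integral>x. X b x \<partial>M)\<bar> \<le> \<eta> / 4 * real p" .
    have 3: "\<bar>l2_inner M (X a) (X b)\<bar> \<le> \<eta> / 2 * real p"
      unfolding l2_inner_def using 1 2 by linarith
    have "\<bar>l2_inner M (\<lambda>x. T a p x - X a x) (T b p)\<bar> \<le> sqrt (\<epsilon> * real p) * sqrt (d * real p)"
      by (rule order_trans[OF l2_Cauchy_Schwarz mult_mono]) (use t T_L2 T_norm_le e0 d_pos in \<open>auto intro: L2_closed l2_norm_nonneg\<close>)
    then have 4: "\<bar>l2_inner M (T a p) (T b p) - l2_inner M (X a) (T b p)\<bar> \<le> \<eta> / 8 * real p"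
      using e2 mult_right_mono[OF e2, of "real p"] unfolding sp by (simp add: l2_inner_diff_left T_L2 t(1))
    have "\<bar>l2_inner M (X a) (\<lambda>x. T b p x - X b x)\<bar> \<le> sqrt (d * real p) * sqrt (\<epsilon> * real p)"
      by (rule order_trans[OF l2_Cauchy_Schwarz mult_mono]) (use t T_L2 e0 d_pos in \<open>auto intro: L2_closed l2_norm_nonneg\<close>)
    then have 5: "\<bar>l2_inner M (X a) (T b p) - l2_inner M (X a) (X b)\<bar> \<le> \<eta> / 8 * real p"
      using e2 mult_right_mono[OF e2, of "real p"] unfolding mult.commute[of "sqrt (d * real p)"] sp
      by (simp add: l2_inner_diff_right T_L2 t(1))
    have "\<bar>l2_inner M (T a p) (T b p)\<bar> \<le> (\<eta> / 8 * real p) + (\<eta> / 8 * real p) + \<eta> / 2 * real p"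
      using 3 4 5 by linarith
    also have "\<dots> \<le> \<eta> * real p" using \<eta> by simp
    finally show ?thesis .
  qed
  then show ?thesis using that by blast
qed

text \<open>
  Taylor expansion to second order, with the remainder \<open>min (6 X\<^sup>2) (\<bar>t\<bar> \<bar>X\<bar>\<^sup>3)\<close>: the quadratic
  bound is used where the block sum is large, the cubic bound elsewhere.
\<close>

lemma cf_single_block:
  assumes ub: "\<And>a p. 1 \<le> p \<Longrightarrow> tail_moment M (K * real p) (T a p) \<le> \<epsilon> * real p"
    and p: "1 \<le> p" and K: "0 < K" and \<sigma>: "0 < \<sigma>"
  shows "cmod (cf (\<lambda>x. t / \<sigma> * T a p x) - complex_of_real (1 - t\<^sup>2 * V p / (2 * \<sigma>\<^sup>2)))
    \<le> t\<^sup>2 / 6 * ((6 * \<epsilon> + \<bar>t\<bar> * sqrt (K * real p) / \<sigma> * d) * real p / \<sigma>\<^sup>2)"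
proof -
  let ?X = "\<lambda>x. T a p x / \<sigma>"
  have XL: "?X \<in> L2 M" by (intro L2_closed T_L2)
  have Xm: "?X \<in> borel_measurable M" by (rule L2_measurable[OF XL])
  have TL: "integrable M (\<lambda>x. (T a p x)\<^sup>2)" by (rule L2_sq_integrable[OF T_L2])
  have Tm[measurable]: "T a p \<in> borel_measurable M" by (rule L2_measurable[OF T_L2])
  have mean: "expectation ?X = 0" by (simp add: T_mean)
  have sq: "(\<integral>x. (T a p x)\<^sup>2 \<partial>M) = V p" using T_norm[of a p] by (simp add: l2_norm_sq')
  have "variance ?X = V p / \<sigma>\<^sup>2" unfolding mean using sq by (simp add: power_divide)
  from char_approx3'[OF Xm L2_integrable[OF XL] L2_sq_integrable[OF XL] mean this refl, of t]
  have 1: "cmod (char (distr M borel ?X) t - (1 - t\<^sup>2 * (V p / \<sigma>\<^sup>2) / 2))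
     \<le> t\<^sup>2 / 6 * (\<integral>x. min (6 * (?X x)\<^sup>2) (\<bar>t\<bar> * \<bar>?X x\<bar>^3) \<partial>M)" by simp
  have 2: "char (distr M borel ?X) t = cf (\<lambda>x. t / \<sigma> * T a p x)"
    unfolding char_def cf_def using Xm by (subst integral_distr) auto
  define I where "I x = indicat_real {x. K * real p < (T a p x)\<^sup>2} x * (T a p x)\<^sup>2" for x
  have Ii: "integrable M I"
  proof (rule Bochner_Integration.integrable_bound[OF TL])
    have "I = (\<lambda>x. if K * real p < (T a p x)\<^sup>2 then (T a p x)\<^sup>2 else 0)" by (auto simp: I_def)
    then show "I \<in> borel_measurable M" by simp
  qed (auto simp: I_def indicator_def)
  have "(\<integral>x. min (6 * (?X x)\<^sup>2) (\<bar>t\<bar> * \<bar>?X x\<bar>^3) \<partial>M)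
     \<le> (\<integral>x. 6 / \<sigma>\<^sup>2 * I x + \<bar>t\<bar> * sqrt (K * real p) / \<sigma> / \<sigma>\<^sup>2 * (T a p x)\<^sup>2 \<partial>M)"
  proof (rule integral_mono)
    show "integrable M (\<lambda>x. min (6 * (?X x)\<^sup>2) (\<bar>t\<bar> * \<bar>?X x\<bar>^3))"
    proof (rule Bochner_Integration.integrable_bound)
      show "integrable M (\<lambda>x. 6 * (?X x)\<^sup>2)" using L2_sq_integrable[OF XL] by simp
    qed auto
    show "integrable M (\<lambda>x. 6 / \<sigma>\<^sup>2 * I x + \<bar>t\<bar> * sqrt (K * real p) / \<sigma> / \<sigma>\<^sup>2 * (T a p x)\<^sup>2)"
      using Ii TL by simp
    fix x
    have nn: "0 \<le> \<bar>t\<bar> * sqrt (K * real p) / \<sigma> / \<sigma>\<^sup>2 * (T a p x)\<^sup>2" "0 \<le> 6 / \<sigma>\<^sup>2 * I x"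
      using \<sigma> K by (auto simp: I_def)
    show "min (6 * (?X x)\<^sup>2) (\<bar>t\<bar> * \<bar>?X x\<bar>^3) \<le> 6 / \<sigma>\<^sup>2 * I x + \<bar>t\<bar> * sqrt (K * real p) / \<sigma> / \<sigma>\<^sup>2 * (T a p x)\<^sup>2"
    proof (cases "K * real p < (T a p x)\<^sup>2")
      case True
      then have "6 * (?X x)\<^sup>2 = 6 / \<sigma>\<^sup>2 * I x" by (simp add: I_def power_divide)
      then show ?thesis using nn by linarith
    next
      case False
      then have "\<bar>T a p x\<bar> \<le> sqrt (K * real p)" by (intro real_le_rsqrt) auto
      then have "\<bar>T a p x\<bar> * (T a p x)\<^sup>2 \<le> sqrt (K * real p) * (T a p x)\<^sup>2" by (intro mult_right_mono) auto
      then have "\<bar>t\<bar> / \<sigma>^3 * (\<bar>T a p x\<bar> * (T a p x)\<^sup>2) \<le> \<bar>t\<bar> / \<sigma>^3 * (sqrt (K * real p) * (T a p x)\<^sup>2)"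
        using \<sigma> by (intro mult_left_mono) auto
      moreover have "\<bar>t\<bar> * \<bar>?X x\<bar>^3 = \<bar>t\<bar> / \<sigma>^3 * (\<bar>T a p x\<bar> * (T a p x)\<^sup>2)"
        using \<sigma> by (simp add: power_divide abs_divide power3_eq_cube power2_eq_square abs_mult[symmetric] mult_ac)
      moreover have "\<bar>t\<bar> / \<sigma>^3 * (sqrt (K * real p) * (T a p x)\<^sup>2) = \<bar>t\<bar> * sqrt (K * real p) / \<sigma> / \<sigma>\<^sup>2 * (T a p x)\<^sup>2"
        using \<sigma> by (simp add: power3_eq_cube power2_eq_square field_simps)
      ultimately have "\<bar>t\<bar> * \<bar>?X x\<bar>^3 \<le> \<bar>t\<bar> * sqrt (K * real p) / \<sigma> / \<sigma>\<^sup>2 * (T a p x)\<^sup>2" by simp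
      then show ?thesis using nn by linarith
    qed
  qed
  also have "\<dots> = 6 / \<sigma>\<^sup>2 * (\<integral>x. I x \<partial>M) + \<bar>t\<bar> * sqrt (K * real p) / \<sigma> / \<sigma>\<^sup>2 * V p"
    using Ii TL sq by simp
  also have "\<dots> \<le> 6 / \<sigma>\<^sup>2 * (\<epsilon> * real p) + \<bar>t\<bar> * sqrt (K * real p) / \<sigma> / \<sigma>\<^sup>2 * (d * real p)"
    using ub[OF p, of a] upper[of p] \<sigma> K unfolding I_def by (intro add_mono mult_left_mono) auto
  also have "\<dots> = (6 * \<epsilon> + \<bar>t\<bar> * sqrt (K * real p) / \<sigma> * d) * real p / \<sigma>\<^sup>2"
    by (simp add: divide_inverse distrib_left distrib_right mult_ac)
  finally have bound: "t\<^sup>2 / 6 * (\<integral>x. min (6 * (?X x)\<^sup>2) (\<bar>t\<bar> * \<bar>?X x\<bar>^3) \<partial>M) \<le> t\<^sup>2 / 6 * ((6 * \<epsilon> + \<bar>t\<bar> * sqrt (K * real p) / \<sigma> * d) * real p / \<sigma>\<^sup>2)"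
    by (intro mult_left_mono) auto
  have "t\<^sup>2 * (V p / \<sigma>\<^sup>2) / 2 = t\<^sup>2 * V p / (2 * \<sigma>\<^sup>2)" by simp
  then have "cmod (cf (\<lambda>x. t / \<sigma> * T a p x) - complex_of_real (1 - t\<^sup>2 * V p / (2 * \<sigma>\<^sup>2)))
     \<le> t\<^sup>2 / 6 * (\<integral>x. min (6 * (?X x)\<^sup>2) (\<bar>t\<bar> * \<bar>?X x\<bar>^3) \<partial>M)" using 1 unfolding 2 by (simp only:)
  with bound show ?thesis by (rule order_trans[rotated])
qed

lemma cf_diff_le:
  assumes "U \<in> L2 M" "W \<in> L2 M"
  shows "cmod (cf U - cf W) \<le> l2_norm M (\<lambda>x. U x - W x)"
proof -
  have m: "U \<in> borel_measurable M" "W \<in> borel_measurable M" using assms by (auto intro: L2_measurable)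
  have D: "(\<lambda>x. U x - W x) \<in> L2 M" by (intro L2_closed assms)
  have D': "cf U - cf W = (\<integral>x. iexp (U x) - iexp (W x) \<partial>M)"
    unfolding cf_def using cf_integrable[OF m(1)] cf_integrable[OF m(2)] by simp
  have "cmod (cf U - cf W) \<le> (\<integral>x. cmod (iexp (U x) - iexp (W x)) \<partial>M)" unfolding D' by (rule integral_norm_bound)
  also have "\<dots> \<le> (\<integral>x. \<bar>U x - W x\<bar> \<partial>M)"
    by (intro integral_mono cmod_iexp_diff integrable_norm[OF Bochner_Integration.integrable_diff]
          integrable_abs[OF L2_integrable[OF D]] cf_integrable m)
  also have "\<dots> \<le> l2_norm M (\<lambda>x. U x - W x)" by (rule abs_integral_le_l2_norm[OF D])
  finally show ?thesis .
qed

lemma T_split: "T a (p + q) x = T a p x + T (a + p) q x"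
  unfolding T_def by (simp add: sum.atLeastLessThan_concat add.assoc)

text \<open>
  Long blocks, gaps, and a remainder shorter than \<open>k\<close> in the application.
\<close>

lemma block_decomposition:
  assumes "k * (p + q) \<le> n"
  shows "T 0 n x = (\<Sum>j<k. T (j * (p + q)) p x) + ((\<Sum>j<k. T (j * (p + q) + p) q x) + T (k * (p + q)) (n - k * (p + q)) x)"
proof -
  have "T 0 n x = T 0 (k * (p + q)) x + T (k * (p + q)) (n - k * (p + q)) x"
    using T_split[of 0 "k * (p + q)" "n - k * (p + q)" x] assms by simp
  also have "T 0 (k * (p + q)) x = (\<Sum>j<k. T (j * (p + q)) (p + q) x)"
    unfolding T_def using sum_block[of "\<lambda>i. \<xi> i x" k "p + q"] by simp
  also have "\<dots> = (\<Sum>j<k. T (j * (p + q)) p x) + (\<Sum>j<k. T (j * (p + q) + p) q x)"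
    unfolding T_split sum.distrib ..
  finally show ?thesis by simp
qed

text \<open>
  The squared norm of the sum of the blocks is \<open>k V p\<close> up to the off-diagonal covariances.
\<close>

lemma blocks_norm:
  assumes sep: "\<And>a b. a + p + q \<le> b \<Longrightarrow> \<bar>l2_inner M (T a p) (T b p)\<bar> \<le> \<eta> * real p" and \<eta>: "0 \<le> \<eta>"
  shows "\<bar>(l2_norm M (\<lambda>x. \<Sum>j<k. T (j * (p + q)) p x))\<^sup>2 - real k * V p\<bar> \<le> (real k)\<^sup>2 * (\<eta> * real p)"
proof -
  let ?U = "\<lambda>j. T (j * (p + q)) p"
  have inner: "l2_inner M (\<lambda>x. \<Sum>j\<in>I. ?U j x) H = (\<Sum>j\<in>I. l2_inner M (?U j) H)" if "H \<in> L2 M" for I H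
    using that by (induction I rule: infinite_finite_induct) (auto simp: l2_inner_zero_left l2_inner_add_left T_L2 L2_sum)
  have off: "\<bar>l2_inner M (?U i) (?U j) - (if i = j then V p else 0)\<bar> \<le> \<eta> * real p" for i j
  proof -
    have lt: "\<bar>l2_inner M (?U i) (?U j)\<bar> \<le> \<eta> * real p" if "i < j" for i j
    proof (rule sep)
      have "Suc i * (p + q) \<le> j * (p + q)" using that by (intro mult_le_mono1) simp
      then show "i * (p + q) + p + q \<le> j * (p + q)" by simp
    qed
    consider "i = j" | "i < j" | "j < i" by linarith
    then show ?thesis
    proof cases
      case 1
      then show ?thesis using T_norm[of "j * (p + q)" p] \<eta> by (simp add: l2_norm_sq)
    next
      case 2 then show ?thesis using lt[of i j] by simp
    next
      case 3 then show ?thesis using lt[of j i] by (simp add: l2_inner_commute)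
    qed
  qed
  have "(l2_norm M (\<lambda>x. \<Sum>j<k. ?U j x))\<^sup>2 = (\<Sum>i<k. \<Sum>j<k. l2_inner M (?U i) (?U j))"
  proof -
    have "(l2_norm M (\<lambda>x. \<Sum>j<k. ?U j x))\<^sup>2 = (\<Sum>i<k. l2_inner M (\<lambda>x. \<Sum>j<k. ?U j x) (?U i))"
      unfolding l2_norm_sq by (subst inner) (auto intro: L2_sum T_L2 simp: l2_inner_commute)
    also have "\<dots> = (\<Sum>i<k. \<Sum>j<k. l2_inner M (?U j) (?U i))" by (intro sum.cong refl inner T_L2)
    finally show ?thesis by (simp add: l2_inner_commute)
  qed
  moreover have "real k * V p = (\<Sum>i<k. \<Sum>j<k. if i = j then V p else 0)" by simp
  ultimately have D: "(l2_norm M (\<lambda>x. \<Sum>j<k. ?U j x))\<^sup>2 - real k * V p = (\<Sum>i<k. \<Sum>j<k. l2_inner M (?U i) (?U j) - (if i = j then V p else 0))"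
    by (simp only: sum_subtractf)
  have "\<bar>(l2_norm M (\<lambda>x. \<Sum>j<k. ?U j x))\<^sup>2 - real k * V p\<bar> \<le> (\<Sum>i<k. \<bar>\<Sum>j<k. l2_inner M (?U i) (?U j) - (if i = j then V p else 0)\<bar>)"
    unfolding D by (rule sum_abs)
  also have "\<dots> \<le> (\<Sum>i<k. \<Sum>j<k. \<bar>l2_inner M (?U i) (?U j) - (if i = j then V p else 0)\<bar>)" by (intro sum_mono sum_abs)
  also have "\<dots> \<le> (\<Sum>i<k. \<Sum>j<k. \<eta> * real p)" by (intro sum_mono off)
  also have "\<dots> = (real k)\<^sup>2 * (\<eta> * real p)" by (simp add: power2_eq_square)
  finally show ?thesis .
qed

text \<open>
  Bernstein's method with \<open>k\<close> blocks. The five errors are, in this order: dropping gaps and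
  remainder (of norm at most \<open>\<rho>\<close>), replacing the blocks by independent ones, Taylor expansion of one
  block, replacing \<open>1 - x\<close> by \<open>exp (- x)\<close>, and replacing \<open>k V p\<close> by \<open>V n\<close>. For fixed \<open>k\<close> and \<open>q\<close>,
  those with \<open>\<rho>\<close> vanish as \<open>n \<rightarrow> \<infinity>\<close>.
\<close>

lemma cf_estimate:
  assumes ub: "\<And>a p. 1 \<le> p \<Longrightarrow> tail_moment M (K * real p) (T a p) \<le> \<epsilon> * real p"
    and K: "0 < K" and \<epsilon>: "0 < \<epsilon>" and \<eta>: "0 < \<eta>" and k: "1 \<le> k"
    and sep: "\<And>a b p. 1 \<le> p \<Longrightarrow> a + p + q \<le> b \<Longrightarrow> \<bar>l2_inner M (T a p) (T b p)\<bar> \<le> \<eta> * real p"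
    and mix: "\<And>r. q \<le> r \<Longrightarrow> \<alpha> r \<le> \<eta>"
    and n: "n0 \<le> n" "k * (q + 1) \<le> n"
  defines "\<sigma> \<equiv> sqrt (V n)" and "\<rho> \<equiv> real k * sqrt (d * real q) + sqrt (d * real k)"
  shows "cmod (cf (\<lambda>x. t / \<sigma> * T 0 n x) - complex_of_real (exp (- (t\<^sup>2 / 2))))
     \<le> \<bar>t\<bar> * \<rho> / \<sigma> + 16 * real k * \<eta> + t\<^sup>2 / 6 * (6 * \<epsilon> / c + \<bar>t\<bar> * sqrt (K / (c * real k)) * d / c)
        + (t\<^sup>2 * d / (2 * c))\<^sup>2 / real k + t\<^sup>2 / 2 * (2 * \<rho> / \<sigma> + \<rho>\<^sup>2 / \<sigma>\<^sup>2 + real k * \<eta> / c)"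
proof -
  \<comment> \<open>the period of the blocks; \<open>n - k m < k\<close> bounds the remainder\<close>
  define m where "m = n div k"
  define p where "p = m - q"
  have "q + 1 \<le> m" unfolding m_def using n(2) k by (simp add: less_eq_div_iff_mult_less_eq mult.commute)
  then have p: "1 \<le> p" "m = p + q" unfolding p_def by auto
  have km: "k * (p + q) \<le> n" unfolding p(2)[symmetric] m_def by simp
  have rest: "n - k * (p + q) \<le> k" unfolding p(2)[symmetric] m_def using k by (simp add: minus_mult_div_eq_mod less_imp_le)
  have "1 \<le> k * (q + 1)" using k by simp
  then have npos: "0 < real n" using n(2) by linarith
  have kp: "real k * real p \<le> real n"
  proof -
    have "k * p \<le> k * (p + q)" by simp
    then have "k * p \<le> n" using km by linarith
    then show ?thesis by (metis of_nat_le_iff of_nat_mult)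
  qed
  have kpos: "0 < real k" using k by simp
  have Vn: "c * real n \<le> V n" by (rule lower[OF n(1)])
  have Vpos: "0 < V n" using Vn c_pos npos by (meson less_le_trans mult_pos_pos)
  have \<sigma>: "0 < \<sigma>" "\<sigma>\<^sup>2 = V n" unfolding \<sigma>_def using Vpos by auto
  have \<rho>0: "0 \<le> \<rho>" unfolding \<rho>_def using d_pos by simp
  have pV: "real p / \<sigma>\<^sup>2 \<le> 1 / (c * real k)"
  proof -
    have "c * (real k * real p) \<le> V n" using mult_left_mono[OF kp, of c] c_pos Vn by linarith
    then show ?thesis unfolding \<sigma>(2) using Vpos c_pos kpos by (simp add: field_simps)
  qed
  let ?U = "\<lambda>j. T (j * (p + q)) p"
  let ?W = "\<lambda>x. \<Sum>j<k. ?U j x"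
  have WL: "?W \<in> L2 M" by (intro L2_sum T_L2)
  have dist: "l2_norm M (\<lambda>x. T 0 n x - ?W x) \<le> \<rho>"
  proof -
    have "(\<lambda>x. T 0 n x - ?W x) = (\<lambda>x. (\<Sum>j<k. T (j * (p + q) + p) q x) + T (k * (p + q)) (n - k * (p + q)) x)"
      using block_decomposition[OF km] by auto
    then have "l2_norm M (\<lambda>x. T 0 n x - ?W x) \<le> l2_norm M (\<lambda>x. \<Sum>j<k. T (j * (p + q) + p) q x) + l2_norm M (T (k * (p + q)) (n - k * (p + q)))"
      using l2_norm_triangle[OF L2_sum[of "{..<k}" "\<lambda>j. T (j * (p + q) + p) q" M] T_L2] T_L2 by simp
    also have "\<dots> \<le> (\<Sum>j<k. l2_norm M (T (j * (p + q) + p) q)) + sqrt (d * real (n - k * (p + q)))"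
      by (intro add_mono l2_norm_sum T_L2 T_norm_le)
    also have "\<dots> \<le> (\<Sum>j<k. sqrt (d * real q)) + sqrt (d * real k)"
      using rest d_pos by (intro add_mono sum_mono T_norm_le) auto
    finally show ?thesis unfolding \<rho>_def by simp
  qed
  have s1: "cmod (cf (\<lambda>x. t / \<sigma> * T 0 n x) - cf (\<lambda>x. t / \<sigma> * ?W x)) \<le> \<bar>t\<bar> * \<rho> / \<sigma>"
  proof -
    have "cmod (cf (\<lambda>x. t / \<sigma> * T 0 n x) - cf (\<lambda>x. t / \<sigma> * ?W x)) \<le> l2_norm M (\<lambda>x. t / \<sigma> * T 0 n x - t / \<sigma> * ?W x)"
      by (intro cf_diff_le L2_cmult T_L2 WL)
    also have "(\<lambda>x. t / \<sigma> * T 0 n x - t / \<sigma> * ?W x) = (\<lambda>x. t / \<sigma> * (T 0 n x - ?W x))" by (simp add: right_diff_distrib)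
    also have "l2_norm M \<dots> = \<bar>t\<bar> / \<sigma> * l2_norm M (\<lambda>x. T 0 n x - ?W x)" using \<sigma> by (simp only: l2_norm_cmult abs_divide abs_of_pos)
    also have "\<dots> \<le> \<bar>t\<bar> / \<sigma> * \<rho>" using dist \<sigma> by (intro mult_left_mono) auto
    finally show ?thesis by simp
  qed
  define x where "x = t\<^sup>2 * V p / (2 * \<sigma>\<^sup>2)"
  have x0: "0 \<le> x" unfolding x_def using V_nonneg by simp
  have xle: "x \<le> t\<^sup>2 * d / (2 * c) / real k"
  proof -
    have "x \<le> t\<^sup>2 * (d * real p) / (2 * \<sigma>\<^sup>2)"
      unfolding x_def using upper[of p] by (intro divide_right_mono mult_left_mono) auto
    also have "\<dots> = t\<^sup>2 * d / 2 * (real p / \<sigma>\<^sup>2)" by simp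
    also have "\<dots> \<le> t\<^sup>2 * d / 2 * (1 / (c * real k))" using d_pos by (intro mult_left_mono pV) auto
    finally show ?thesis by simp
  qed
  have s2: "cmod (cf (\<lambda>x. t / \<sigma> * ?W x) - (\<Prod>j<k. cf (\<lambda>x. t / \<sigma> * ?U j x))) \<le> 16 * real k * \<eta>"
  proof -
    have "t / \<sigma> * ?W x = (\<Sum>j<k. t / \<sigma> * ?U j x)" for x by (rule sum_distrib_left)
    moreover have "16 * real k * \<eta> = real k * (16 * \<eta>)" by simp
    ultimately show ?thesis using cf_blocks[where q=q and \<eta>=\<eta> and k=k and s="t / \<sigma>" and p=p, OF mix] by (simp only:)
  qed
  have s3: "cmod (cf (\<lambda>y. t / \<sigma> * ?U j y) - complex_of_real (exp (- x)))
     \<le> (t\<^sup>2 / 6 * (6 * \<epsilon> / c + \<bar>t\<bar> * sqrt (K / (c * real k)) * d / c) + (t\<^sup>2 * d / (2 * c))\<^sup>2 / real k) / real k" for j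
  proof -
    have "cmod (cf (\<lambda>y. t / \<sigma> * ?U j y) - complex_of_real (1 - x)) \<le> t\<^sup>2 / 6 * ((6 * \<epsilon> + \<bar>t\<bar> * sqrt (K * real p) / \<sigma> * d) * real p / \<sigma>\<^sup>2)"
      unfolding x_def by (rule cf_single_block[OF ub p(1) K \<sigma>(1)])
    also have "\<dots> \<le> t\<^sup>2 / 6 * ((6 * \<epsilon> + \<bar>t\<bar> * sqrt (K / (c * real k)) * d) * (1 / (c * real k)))"
    proof -
      have "sqrt (K * real p) / \<sigma> = sqrt (K * (real p / \<sigma>\<^sup>2))"
        using \<sigma>(1) by (simp add: real_sqrt_divide real_sqrt_mult)
      also have "\<dots> \<le> sqrt (K * (1 / (c * real k)))" using pV K by (intro real_sqrt_le_mono mult_left_mono) auto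
      finally have "\<bar>t\<bar> * (sqrt (K * real p) / \<sigma>) * d \<le> \<bar>t\<bar> * sqrt (K / (c * real k)) * d"
        using d_pos by (intro mult_right_mono mult_left_mono) auto
      then have "6 * \<epsilon> + \<bar>t\<bar> * sqrt (K * real p) / \<sigma> * d \<le> 6 * \<epsilon> + \<bar>t\<bar> * sqrt (K / (c * real k)) * d" by simp
      from mult_mono[OF this pV] have "(6 * \<epsilon> + \<bar>t\<bar> * sqrt (K * real p) / \<sigma> * d) * (real p / \<sigma>\<^sup>2)
          \<le> (6 * \<epsilon> + \<bar>t\<bar> * sqrt (K / (c * real k)) * d) * (1 / (c * real k))"
        using \<epsilon> K c_pos d_pos by simp
      then show ?thesis unfolding times_divide_eq_right[symmetric, of _ _ "\<sigma>\<^sup>2"] by (intro mult_left_mono) auto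
    qed
    also have "\<dots> = t\<^sup>2 / 6 * (6 * \<epsilon> / c + \<bar>t\<bar> * sqrt (K / (c * real k)) * d / c) / real k"
      using c_pos kpos by (simp add: field_simps)
    finally have 1: "cmod (cf (\<lambda>y. t / \<sigma> * ?U j y) - complex_of_real (1 - x)) \<le> \<dots>" .
    have "cmod (complex_of_real (1 - x) - complex_of_real (exp (- x))) = \<bar>1 - x - exp (- x)\<bar>"
      by (metis norm_of_real of_real_diff)
    also have "\<dots> \<le> x\<^sup>2" by (rule abs_exp_minus_linear_le[OF x0])
    also have "\<dots> \<le> (t\<^sup>2 * d / (2 * c) / real k)\<^sup>2" by (intro power_mono xle x0)
    also have "\<dots> = (t\<^sup>2 * d / (2 * c))\<^sup>2 / real k / real k" by (simp add: power_divide power2_eq_square)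
    finally have 2: "cmod (complex_of_real (1 - x) - complex_of_real (exp (- x))) \<le> \<dots>" .
    show ?thesis using norm_diff_triangle_le[OF 1 2] by (simp add: add_divide_distrib)
  qed
  have s4: "cmod ((\<Prod>j<k. cf (\<lambda>x. t / \<sigma> * ?U j x)) - complex_of_real (exp (- (real k * x))))
     \<le> t\<^sup>2 / 6 * (6 * \<epsilon> / c + \<bar>t\<bar> * sqrt (K / (c * real k)) * d / c) + (t\<^sup>2 * d / (2 * c))\<^sup>2 / real k" (is "_ \<le> ?b")
  proof -
    have e: "complex_of_real (exp (- (real k * x))) = (\<Prod>j<k. complex_of_real (exp (- x)))"
      by (simp add: exp_of_nat_mult[symmetric] flip: of_real_power)
    have "cmod ((\<Prod>j<k. cf (\<lambda>x. t / \<sigma> * ?U j x)) - (\<Prod>j<k. complex_of_real (exp (- x))))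
       \<le> (\<Sum>j<k. cmod (cf (\<lambda>x. t / \<sigma> * ?U j x) - complex_of_real (exp (- x))))"
    proof (rule norm_prod_diff)
      show "cmod (cf (\<lambda>x. t / \<sigma> * ?U j x)) \<le> 1" for j
        by (intro cmod_cf_le_1 borel_measurable_times borel_measurable_const L2_measurable[OF T_L2])
      show "cmod (complex_of_real (exp (- x))) \<le> 1" using x0 by simp
    qed
    also have "\<dots> \<le> (\<Sum>j<k. ?b / real k)" by (intro sum_mono s3)
    also have "\<dots> = ?b" using kpos by simp
    finally show ?thesis unfolding e .
  qed
  have s5: "cmod (complex_of_real (exp (- (real k * x))) - complex_of_real (exp (- (t\<^sup>2 / 2)))) \<le> t\<^sup>2 / 2 * (2 * \<rho> / \<sigma> + \<rho>\<^sup>2 / \<sigma>\<^sup>2 + real k * \<eta> / c)"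
  proof -
    define w where "w = l2_norm M ?W"
    have w: "\<bar>w - \<sigma>\<bar> \<le> \<rho>"
    proof -
      have "l2_norm M (T 0 n) = \<sigma>" unfolding \<sigma>_def using T_norm[of 0 n] l2_norm_nonneg[of M "T 0 n"] by (metis real_sqrt_unique)
      then show ?thesis using l2_norm_diff_ineq[OF T_L2 WL, of 0 n] dist unfolding w_def by linarith
    qed
    have "\<bar>w\<^sup>2 - \<sigma>\<^sup>2\<bar> \<le> \<rho> * (2 * \<sigma> + \<rho>)"
    proof -
      have "w\<^sup>2 - \<sigma>\<^sup>2 = (w - \<sigma>) * (w + \<sigma>)" by (simp add: power2_eq_square algebra_simps)
      then have "\<bar>w\<^sup>2 - \<sigma>\<^sup>2\<bar> = \<bar>w - \<sigma>\<bar> * \<bar>w + \<sigma>\<bar>" by (simp add: abs_mult)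
      also have "\<dots> \<le> \<rho> * (2 * \<sigma> + \<rho>)" using w \<sigma> \<rho>0 by (intro mult_mono) auto
      finally show ?thesis .
    qed
    moreover have "\<bar>w\<^sup>2 - real k * V p\<bar> \<le> (real k)\<^sup>2 * (\<eta> * real p)"
      unfolding w_def using sep[OF p(1)] \<eta> by (intro blocks_norm) auto
    ultimately have D: "\<bar>real k * V p - \<sigma>\<^sup>2\<bar> \<le> \<rho> * (2 * \<sigma> + \<rho>) + (real k)\<^sup>2 * (\<eta> * real p)" by linarith
    have "cmod (complex_of_real (exp (- (real k * x))) - complex_of_real (exp (- (t\<^sup>2 / 2)))) = \<bar>exp (- (real k * x)) - exp (- (t\<^sup>2 / 2))\<bar>"
      by (metis norm_of_real of_real_diff)
    also have "\<dots> \<le> \<bar>real k * x - t\<^sup>2 / 2\<bar>" using x0 by (intro abs_exp_minus_diff_le) auto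
    also have "real k * x - t\<^sup>2 / 2 = t\<^sup>2 / 2 * ((real k * V p - \<sigma>\<^sup>2) / \<sigma>\<^sup>2)"
      unfolding x_def using \<sigma>(1) by (simp add: field_simps)
    also have "\<bar>\<dots>\<bar> = t\<^sup>2 / 2 * (\<bar>real k * V p - \<sigma>\<^sup>2\<bar> / \<sigma>\<^sup>2)" by (simp add: abs_mult)
    also have "\<dots> \<le> t\<^sup>2 / 2 * ((\<rho> * (2 * \<sigma> + \<rho>) + (real k)\<^sup>2 * (\<eta> * real p)) / \<sigma>\<^sup>2)"
      using D by (intro mult_left_mono divide_right_mono) auto
    also have "(\<rho> * (2 * \<sigma> + \<rho>) + (real k)\<^sup>2 * (\<eta> * real p)) / \<sigma>\<^sup>2 = 2 * \<rho> / \<sigma> + \<rho>\<^sup>2 / \<sigma>\<^sup>2 + (real k)\<^sup>2 * \<eta> * (real p / \<sigma>\<^sup>2)"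
      using \<sigma>(1) by (simp add: field_simps power2_eq_square)
    also have "t\<^sup>2 / 2 * \<dots> \<le> t\<^sup>2 / 2 * (2 * \<rho> / \<sigma> + \<rho>\<^sup>2 / \<sigma>\<^sup>2 + (real k)\<^sup>2 * \<eta> * (1 / (c * real k)))"
      using \<eta> by (intro mult_left_mono add_left_mono pV) auto
    also have "(real k)\<^sup>2 * \<eta> * (1 / (c * real k)) = real k * \<eta> / c" using kpos by (simp add: power2_eq_square)
    finally show ?thesis .
  qed
  show ?thesis
    using norm_diff_triangle_le[OF norm_diff_triangle_le[OF norm_diff_triangle_le[OF s1 s2] s4] s5] by (simp add: add.assoc)
qed

text \<open>
  Constants are chosen in the order \<open>\<epsilon>\<close>, \<open>K\<close>, \<open>k\<close>, \<open>\<eta>\<close>, \<open>q\<close>, and finally \<open>n\<close>; each of the four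
  groups of errors gets a quarter of \<open>e\<close>.
\<close>

theorem cf_tendsto_normal:
  "(\<lambda>n. cf (\<lambda>x. t / sqrt (V n) * T 0 n x)) \<longlonglongrightarrow> complex_of_real (exp (- (t\<^sup>2 / 2)))"
proof (rule tendstoI)
  fix e :: real assume e: "0 < e"
  define \<epsilon> where "\<epsilon> = e * c / (5 * (t\<^sup>2 + 1))"
  have t1: "0 < t\<^sup>2 + 1" by (simp add: add_nonneg_pos)
  have \<epsilon>: "0 < \<epsilon>" unfolding \<epsilon>_def using e c_pos t1 by simp
  have \<epsilon>2: "t\<^sup>2 * \<epsilon> / c < e / 4"
  proof -
    have "t\<^sup>2 * \<epsilon> / c = e / 5 * (t\<^sup>2 / (t\<^sup>2 + 1))" unfolding \<epsilon>_def using c_pos by simp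
    also have "\<dots> \<le> e / 5 * 1" using e t1 by (intro mult_left_mono) (auto simp: divide_le_eq)
    finally show ?thesis using e by simp
  qed
  obtain K where K: "0 < K" "\<And>a p. 1 \<le> p \<Longrightarrow> tail_moment M (K * real p) (T a p) \<le> \<epsilon> * real p"
    using ui[OF \<epsilon>] unfolding T_def by blast
  have "(\<lambda>k. t\<^sup>2 / 6 * (\<bar>t\<bar> * sqrt (K / c * (1 / real k)) * d / c) + (t\<^sup>2 * d / (2 * c))\<^sup>2 * (1 / real k)) \<longlonglongrightarrow> t\<^sup>2 / 6 * (\<bar>t\<bar> * sqrt (K / c * 0) * d / c) + (t\<^sup>2 * d / (2 * c))\<^sup>2 * 0"
    by (intro tendsto_intros lim_1_over_n) (use c_pos in auto)
  then have "\<forall>\<^sub>F k in sequentially. t\<^sup>2 / 6 * (\<bar>t\<bar> * sqrt (K / c * (1 / real k)) * d / c) + (t\<^sup>2 * d / (2 * c))\<^sup>2 * (1 / real k) < e / 4"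
    using e by (intro order_tendstoD(2)) auto
  from eventually_happens'[OF sequentially_bot eventually_conj[OF this eventually_ge_at_top[of 1]]]
  obtain k where k: "1 \<le> k" "t\<^sup>2 / 6 * (\<bar>t\<bar> * sqrt (K / (c * real k)) * d / c) + (t\<^sup>2 * d / (2 * c))\<^sup>2 / real k < e / 4"
    by auto
  \<comment> \<open>the total coefficient of \<open>\<eta>\<close> in the estimate\<close>
  define b where "b = 16 * real k + t\<^sup>2 / 2 * (real k / c)"
  have b0: "0 < b" unfolding b_def using k(1) c_pos by (intro add_pos_nonneg) auto
  define \<eta> where "\<eta> = e / (5 * b)"
  have \<eta>: "0 < \<eta>" unfolding \<eta>_def using e b0 by simp
  have \<eta>2: "16 * real k * \<eta> + t\<^sup>2 / 2 * (real k * \<eta> / c) < e / 4"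
  proof -
    have "16 * real k * \<eta> + t\<^sup>2 / 2 * (real k * \<eta> / c) = b * \<eta>" unfolding b_def by (simp add: algebra_simps)
    also have "\<dots> = e / 5" unfolding \<eta>_def using b0 by simp
    also have "\<dots> < e / 4" using e by simp
    finally show ?thesis .
  qed
  obtain q1 where q1: "\<And>a b p. 1 \<le> p \<Longrightarrow> a + p + q1 \<le> b \<Longrightarrow> \<bar>l2_inner M (T a p) (T b p)\<bar> \<le> \<eta> * real p"
    using separated_blocks_covariance[OF \<eta>] by blast
  have "\<forall>\<^sub>F r in sequentially. \<alpha> r < \<eta>" using \<alpha>_tendsto \<eta> by (intro order_tendstoD(2)) auto
  then obtain q2 where q2: "\<And>r. q2 \<le> r \<Longrightarrow> \<alpha> r < \<eta>" by (auto simp: eventually_sequentially)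
  define q where "q = max q1 q2"
  define \<rho> where "\<rho> = real k * sqrt (d * real q) + sqrt (d * real k)"
  have "filterlim (\<lambda>n. V n) at_top sequentially"
  proof (rule filterlim_at_top_mono)
    show "filterlim (\<lambda>n. c * real n) at_top sequentially"
      using c_pos by (intro filterlim_tendsto_pos_mult_at_top[OF tendsto_const] filterlim_real_sequentially)
    show "\<forall>\<^sub>F n in sequentially. c * real n \<le> V n" using lower by (auto simp: eventually_sequentially)
  qed
  then have inf: "filterlim (\<lambda>n. sqrt (V n)) at_top sequentially"
    by (rule filterlim_compose[OF sqrt_at_top])
  have z: "(\<lambda>n. \<rho> / sqrt (V n)) \<longlonglongrightarrow> 0"
    by (rule tendsto_divide_0[OF tendsto_const filterlim_at_top_imp_at_infinity[OF inf]])
  have "(\<lambda>n. \<bar>t\<bar> * (\<rho> / sqrt (V n)) + t\<^sup>2 / 2 * (2 * (\<rho> / sqrt (V n)) + (\<rho> / sqrt (V n))\<^sup>2)) \<longlonglongrightarrow> \<bar>t\<bar> * 0 + t\<^sup>2 / 2 * (2 * 0 + 0\<^sup>2)"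
    by (intro tendsto_intros z)
  then have "\<forall>\<^sub>F n in sequentially. \<bar>t\<bar> * (\<rho> / sqrt (V n)) + t\<^sup>2 / 2 * (2 * (\<rho> / sqrt (V n)) + (\<rho> / sqrt (V n))\<^sup>2) < e / 4"
    using e by (intro order_tendstoD(2)) auto
  then show "\<forall>\<^sub>F n in sequentially. dist (cf (\<lambda>x. t / sqrt (V n) * T 0 n x)) (complex_of_real (exp (- (t\<^sup>2 / 2)))) < e"
    using eventually_ge_at_top[of "max n0 (k * (q + 1))"]
  proof eventually_elim
    case (elim n)
    have "cmod (cf (\<lambda>x. t / sqrt (V n) * T 0 n x) - complex_of_real (exp (- (t\<^sup>2 / 2))))
     \<le> \<bar>t\<bar> * \<rho> / sqrt (V n) + 16 * real k * \<eta> + t\<^sup>2 / 6 * (6 * \<epsilon> / c + \<bar>t\<bar> * sqrt (K / (c * real k)) * d / c)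
        + (t\<^sup>2 * d / (2 * c))\<^sup>2 / real k + t\<^sup>2 / 2 * (2 * \<rho> / sqrt (V n) + \<rho>\<^sup>2 / (sqrt (V n))\<^sup>2 + real k * \<eta> / c)"
      unfolding \<rho>_def
    proof (rule cf_estimate[OF K(2) K(1) \<epsilon> \<eta> k(1)])
      show "\<bar>l2_inner M (T a p) (T b p)\<bar> \<le> \<eta> * real p" if "1 \<le> p" "a + p + q \<le> b" for a b p
        using q1[OF that(1), of a b] that(2) unfolding q_def by simp
      show "\<alpha> r \<le> \<eta>" if "q \<le> r" for r using q2[of r] that unfolding q_def by simp
    qed (use elim in auto)
    also have "\<dots> = (\<bar>t\<bar> * (\<rho> / sqrt (V n)) + t\<^sup>2 / 2 * (2 * (\<rho> / sqrt (V n)) + (\<rho> / sqrt (V n))\<^sup>2))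
        + (16 * real k * \<eta> + t\<^sup>2 / 2 * (real k * \<eta> / c)) + t\<^sup>2 * \<epsilon> / c
        + (t\<^sup>2 / 6 * (\<bar>t\<bar> * sqrt (K / (c * real k)) * d / c) + (t\<^sup>2 * d / (2 * c))\<^sup>2 / real k)"
      by (simp add: power_divide distrib_left)
    also have "\<dots> < e" using elim(1) \<eta>2 \<epsilon>2 k(2) by linarith
    finally show ?case by (simp add: dist_norm)
  qed
qed

end

context ergodic_diffusion
begin

section \<open>An upper bound for the variance\<close>

text \<open>
  The second moment of the integral of \<open>r\<close> over a time interval of length \<open>t\<close>, see \<open>moment_eq\<close>.
\<close>

definition moment :: "('a \<Rightarrow> real) \<Rightarrow> real \<Rightarrow> real" where
  "moment r t = 2 * (LINT s:{0..t}|lborel. corr_integral r s)"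

lemma moment_eq: "r \<in> L2 mu \<Longrightarrow> 0 \<le> a \<Longrightarrow> 0 \<le> t \<Longrightarrow> (l2_norm N (path_integral r a (a + t)))\<^sup>2 = moment r t"
  unfolding moment_def by (rule second_moment)

lemma moment_nonneg: "r \<in> L2 mu \<Longrightarrow> 0 \<le> t \<Longrightarrow> 0 \<le> moment r t"
  using moment_eq[of r 0 t] by (metis order_refl zero_le_power2)

lemma moment_continuous: "r \<in> L2 mu \<Longrightarrow> continuous_on {0..} (moment r)"
  unfolding moment_def by (intro continuous_on_mult_left continuous_on_LINT corr_integral_continuous)

text \<open>
  Two integrations by parts: the correlation is half the second derivative of \<open>moment r\<close>.
\<close>

lemma laplace_moment:
  assumes r: "r \<in> L2 mu" and l: "0 < l"
  shows "laplace l (corr r) = l\<^sup>2 / 2 * laplace l (moment r)" "set_integrable lborel {0..} (\<lambda>s. exp (- l * s) * moment r s)"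
proof -
  let ?I = "\<lambda>t. LINT s:{0..t}|lborel. corr_integral r s"
  have b0: "\<bar>corr r s\<bar> \<le> (l2_norm mu r)\<^sup>2 * exp ((l / 2) * s)" if "0 \<le> s" for s
  proof -
    have "\<bar>corr r s\<bar> \<le> (l2_norm mu r)\<^sup>2 * 1" using corr_abs_le[OF r that] by simp
    also have "\<dots> \<le> (l2_norm mu r)\<^sup>2 * exp ((l / 2) * s)" using that l by (intro mult_left_mono) auto
    finally show ?thesis .
  qed
  have l2: "0 < l / 2" "l / 2 < l" using l by auto
  have I: "(\<lambda>t. LINT s:{0..t}|lborel. corr r s) = corr_integral r" by (simp add: fun_eq_iff corr_integral_def)
  have b1: "\<bar>corr_integral r s\<bar> \<le> ((l2_norm mu r)\<^sup>2 / (l / 2)) * exp ((l / 2) * s)" if "0 \<le> s" for s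
    unfolding corr_integral_def by (rule laplace_LINT(1)[OF corr_continuous[OF r] _ l2 that]) (rule b0)
  have 1: "laplace l (corr r) = l * laplace l (corr_integral r)"
    unfolding I[symmetric] by (rule laplace_LINT(2)[OF corr_continuous[OF r] _ l2]) (rule b0)
  have b2: "\<bar>?I s\<bar> \<le> ((l2_norm mu r)\<^sup>2 / (l / 2) / (l / 2)) * exp ((l / 2) * s)" if "0 \<le> s" for s
    by (rule laplace_LINT(1)[OF corr_integral_continuous[OF r] _ l2 that]) (rule b1)
  have 2: "laplace l (corr_integral r) = l * laplace l ?I"
    by (rule laplace_LINT(2)[OF corr_integral_continuous[OF r] _ l2]) (rule b1)
  have m: "moment r = (\<lambda>t. 2 * ?I t)" by (simp add: moment_def fun_eq_iff)
  have c: "continuous_on {0..} (moment r)" by (rule moment_continuous[OF r])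
  have b: "\<bar>moment r s\<bar> \<le> 2 * ((l2_norm mu r)\<^sup>2 / (l / 2) / (l / 2)) * exp (l / 2 * s)" if "0 \<le> s" for s
    using b2[OF that] unfolding moment_def abs_mult by simp
  show "set_integrable lborel {0..} (\<lambda>s. exp (- l * s) * moment r s)"
    by (rule laplace_integrable[OF c b l2(2)])
  have "laplace l (moment r) = 2 * laplace l ?I"
    unfolding m laplace_def by (simp add: mult.left_commute[of _ 2] set_integral_mult_right)
  then show "laplace l (corr r) = l\<^sup>2 / 2 * laplace l (moment r)"
    using 1 2 by (simp add: power2_eq_square)
qed

lemma moment_subadditive:
  assumes r: "r \<in> L2 mu" and s: "0 \<le> s" "s \<le> t"
  shows "moment r t \<le> 2 * moment r s + 2 * moment r (t - s)"
proof -
  have L: "path_integral r 0 s \<in> L2 N" "path_integral r s t \<in> L2 N" "path_integral r 0 t \<in> L2 N"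
    using s by (auto intro!: path_integral_L2 r)
  have "l2_norm N (path_integral r 0 t) = l2_norm N (\<lambda>\<omega>. path_integral r 0 s \<omega> + path_integral r s t \<omega>)"
    by (rule l2_norm_cong_AE[OF path_integral_split[OF r order_refl s]]) (intro L2_measurable L2_closed L)+
  also have "\<dots> \<le> l2_norm N (path_integral r 0 s) + l2_norm N (path_integral r s t)"
    by (rule l2_norm_triangle[OF L(1,2)])
  finally have "(l2_norm N (path_integral r 0 t))\<^sup>2 \<le> (l2_norm N (path_integral r 0 s) + l2_norm N (path_integral r s t))\<^sup>2"
    by (intro power_mono l2_norm_nonneg)
  also have "\<dots> \<le> 2 * (l2_norm N (path_integral r 0 s))\<^sup>2 + 2 * (l2_norm N (path_integral r s t))\<^sup>2"
    using zero_le_power2[of "l2_norm N (path_integral r 0 s) - l2_norm N (path_integral r s t)"] unfolding power2_sum power2_diff by linarith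
  finally show ?thesis
    using moment_eq[OF r order_refl, of t] moment_eq[OF r order_refl, of s] moment_eq[OF r, of s "t - s"] s by simp
qed

text \<open>
  Test the dual bound with the resolvent \<open>u\<close> of \<open>r\<close>. Its energy is \<open>\<langle>u, r\<rangle> - l \<langle>u, u\<rangle>\<close>, so that
  \<open>x = \<langle>u, r\<rangle>\<close> satisfies \<open>x\<^sup>2 \<le> \<epsilon> x\<close>.
\<close>

lemma laplace_corr_le:
  assumes r: "r \<in> L2 mu" and \<epsilon>: "0 \<le> \<epsilon>" and l: "0 < l"
    and H: "\<And>F G. (F, G) \<in> S.gen \<Longrightarrow> (l2_inner mu r F)\<^sup>2 \<le> \<epsilon> * (- l2_inner mu F G)"
  shows "laplace l (corr r) \<le> \<epsilon>"
proof -
  obtain u where u: "u \<in> L2 mu" "\<And>H. H \<in> L2 mu \<Longrightarrow> l2_inner mu u H = laplace l (\<lambda>s. l2_inner mu (P s r) H)"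
    using S.resolvent_exists[OF r l] by blast
  have g: "(u, \<lambda>x. l * u x - r x) \<in> S.gen" by (rule S.resolvent_in_generator[OF r l u])
  define x where "x = l2_inner mu u r"
  have "corr r = (\<lambda>s. l2_inner mu (P s r) r)" by (simp add: fun_eq_iff corr_def)
  then have x: "x = laplace l (corr r)" unfolding x_def u(2)[OF r] by simp
  have "l2_inner mu u (\<lambda>x. l * u x - r x) = l * l2_inner mu u u - x"
    unfolding x_def using u(1) r by (simp add: l2_inner_simps L2_closed)
  then have "x\<^sup>2 \<le> \<epsilon> * (x - l * l2_inner mu u u)"
    using H[OF g] by (simp add: x_def l2_inner_commute)
  also have "\<dots> \<le> \<epsilon> * x" using \<epsilon> l l2_inner_nonneg[of mu u] by (intro mult_left_mono) auto
  finally have "x * x \<le> \<epsilon> * x" by (simp add: power2_eq_square)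
  then have "x \<le> \<epsilon>" using \<epsilon> by (cases "0 < x") auto
  then show ?thesis unfolding x .
qed

text \<open>
  The Laplace transform of the variance is bounded by \<open>2 \<epsilon> / l\<^sup>2\<close>, which bounds averages of the
  variance over \<open>{0..t}\<close>, with \<open>l = 1/t\<close>; subadditivity bounds the value at \<open>t\<close> by four times the
  average.
\<close>

lemma moment_upper_bound:
  assumes r: "r \<in> L2 mu" and \<epsilon>: "0 \<le> \<epsilon>" and t: "0 < t"
    and H: "\<And>F G. (F, G) \<in> S.gen \<Longrightarrow> (l2_inner mu r F)\<^sup>2 \<le> \<epsilon> * (- l2_inner mu F G)"
  shows "moment r t \<le> 8 * exp 1 * \<epsilon> * t"
proof -
  \<comment> \<open>up to time \<open>t\<close> the weight \<open>exp (- l s)\<close> is at least \<open>exp (- 1)\<close>\<close>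
  define l where "l = 1 / t"
  have l: "0 < l" unfolding l_def using t by simp
  let ?m = "moment r"
  have c: "continuous_on {0..t} ?m" by (rule continuous_on_subset[OF moment_continuous[OF r]]) auto
  have c': "continuous_on {0..t} (\<lambda>s. ?m (t - s))"
    by (rule continuous_on_compose2[OF c]) (auto intro!: continuous_intros)
  have i: "set_integrable lborel {0..t} ?m" "set_integrable lborel {0..t} (\<lambda>s. ?m (t - s))"
    by (intro borel_integrable_atLeastAtMost' c c')+
  have "t * ?m t = (LINT s:{0..t}|lborel. ?m t)" using t by (simp add: LINT_const)
  also have "\<dots> \<le> (LINT s:{0..t}|lborel. 2 * ?m s + 2 * ?m (t - s))"
    using i by (intro set_integral_mono moment_subadditive[OF r] set_integral_add(1)) (auto intro!: borel_integrable_atLeastAtMost' continuous_intros)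
  also have "\<dots> = 4 * (LINT s:{0..t}|lborel. ?m s)"
    using i LINT_reflect[of t ?m] by (subst set_integral_add(2)) auto
  finally have 1: "t * ?m t \<le> 4 * (LINT s:{0..t}|lborel. ?m s)" .
  have "(LINT s:{0..t}|lborel. ?m s) \<le> exp 1 * laplace l ?m"
  proof -
    have "(LINT s:{0..t}|lborel. ?m s) \<le> (LINT s:{0..}|lborel. exp 1 * (exp (- l * s) * ?m s))"
      unfolding set_lebesgue_integral_def
    proof (rule integral_mono)
      show "integrable lborel (\<lambda>s. indicat_real {0..t} s *\<^sub>R ?m s)" using i(1) unfolding set_integrable_def .
      show "integrable lborel (\<lambda>s. indicat_real {0..} s *\<^sub>R (exp 1 * (exp (- l * s) * ?m s)))"
        using set_integrable_mult_right[of "exp 1", OF laplace_moment(2)[OF r l]] unfolding set_integrable_def by simp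
      fix s :: real
      show "indicat_real {0..t} s *\<^sub>R ?m s \<le> indicat_real {0..} s *\<^sub>R (exp 1 * (exp (- l * s) * ?m s))"
      proof (cases "s \<in> {0..t}")
        case True
        have "1 * ?m s \<le> exp (1 - l * s) * ?m s"
          using True t moment_nonneg[OF r, of s] unfolding l_def by (intro mult_right_mono) (auto simp: field_simps)
        also have "\<dots> = exp 1 * (exp (- l * s) * ?m s)" by (simp add: exp_diff exp_minus field_simps)
        finally show ?thesis using True by simp
      next
        case False
        then show ?thesis using moment_nonneg[OF r, of s] by (auto simp: indicator_def)
      qed
    qed
    then show ?thesis unfolding laplace_def by (simp add: set_integral_mult_right)
  qed
  also have "\<dots> \<le> exp 1 * (2 * \<epsilon> * t\<^sup>2)"
  proof -
    have "l\<^sup>2 / 2 * laplace l ?m \<le> \<epsilon>" using laplace_corr_le[OF r \<epsilon> l H] laplace_moment(1)[OF r l] by simp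
    then have "laplace l ?m \<le> 2 * \<epsilon> * t\<^sup>2" unfolding l_def using t by (simp add: field_simps)
    then show ?thesis by simp
  qed
  finally have "4 * (LINT s:{0..t}|lborel. ?m s) \<le> t * (8 * exp 1 * \<epsilon> * t)" by (simp add: power2_eq_square mult_ac)
  with 1 have "t * ?m t \<le> t * (8 * exp 1 * \<epsilon> * t)" by (rule order_trans)
  then show ?thesis using t by simp
qed

section \<open>Uniform integrability of the normalised squares\<close>

lemma abs_LINT_unit_le:
  fixes g :: "real \<Rightarrow> real"
  assumes "\<And>s. \<bar>g s\<bar> \<le> K"
  shows "\<bar>LINT s:{c..c+1}|lborel. g s\<bar> \<le> K"
proof (cases "set_integrable lborel {c..c+1} g")
  case True
  then show ?thesis using LINT_abs_le'[OF True, of K] assms by simp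
next
  case False
  then have "(LINT s:{c..c+1}|lborel. g s) = 0"
    unfolding set_integrable_def set_lebesgue_integral_def by (rule not_integrable_integral_eq)
  then show ?thesis using assms[of 0] by simp
qed

lemma bwd_eq_fwd: "bwd v k a b = fwd (\<lambda>x. - v x) k a b"
  by (simp add: fun_eq_iff bwd_def fwd_def)

lemma fwd_trunc_bounded: "\<bar>fwd (trunc m v) (trunc m k) c (c + 1) \<omega>\<bar> \<le> 3 * real m"
  unfolding fwd_def path_integral_def
  using abs_LINT_unit_le[of "\<lambda>s. trunc m k (X s \<omega>)" "real m" c, OF abs_trunc_le(1)]
    abs_trunc_le(1)[of m v "X (c + 1) \<omega>"] abs_trunc_le(1)[of m v "X c \<omega>"] by linarith

text \<open>
  Truncating \<open>v\<close> and \<open>k\<close> at a level that does not depend on the time interval changes the increments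
  over all unit intervals by a small amount in \<open>L\<^sup>2\<close>, by stationarity.
\<close>

lemma fwd_trunc_close:
  assumes v: "v \<in> L2 mu" and k: "k \<in> L2 mu" and \<delta>: "0 < \<delta>"
  obtains m where "\<And>c. 0 \<le> c \<Longrightarrow> (l2_norm N (\<lambda>\<omega>. fwd v k c (c + 1) \<omega> - fwd (trunc m v) (trunc m k) c (c + 1) \<omega>))\<^sup>2 \<le> \<delta>"
proof -
  have t: "((\<lambda>m. l2_norm mu (\<lambda>x. trunc m F x - F x)) \<longlongrightarrow> 0) sequentially" if "F \<in> L2 mu" for F
    using trunc_tendsto[OF that] unfolding L2_tendsto_iff .
  have "((\<lambda>m. 2 * l2_norm mu (\<lambda>x. trunc m v x - v x) + l2_norm mu (\<lambda>x. trunc m k x - k x)) \<longlongrightarrow> 2 * 0 + 0) sequentially"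
    by (intro tendsto_intros t v k)
  then have "\<forall>\<^sub>F m in sequentially. 2 * l2_norm mu (\<lambda>x. trunc m v x - v x) + l2_norm mu (\<lambda>x. trunc m k x - k x) < sqrt \<delta>"
    using \<delta> by (intro order_tendstoD(2)) auto
  from eventually_happens'[OF sequentially_bot this] obtain m where
    m: "2 * l2_norm mu (\<lambda>x. trunc m v x - v x) + l2_norm mu (\<lambda>x. trunc m k x - k x) < sqrt \<delta>" by blast
  let ?v = "\<lambda>x. v x - trunc m v x" and ?k = "\<lambda>x. 1 * k x + -1 * trunc m k x"
  have T: "trunc m v \<in> L2 mu" "trunc m k \<in> L2 mu" by (intro mu.trunc_L2 L2_measurable v k)+
  have D: "?v \<in> L2 mu" "?k \<in> L2 mu" by (intro L2_closed L2_lincomb v k T)+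
  have m': "2 * l2_norm mu ?v + l2_norm mu ?k < sqrt \<delta>"
    using m by (simp add: l2_norm_minus_commute[of mu v] l2_norm_minus_commute[of mu k])
  have "(l2_norm N (\<lambda>\<omega>. fwd v k c (c + 1) \<omega> - fwd (trunc m v) (trunc m k) c (c + 1) \<omega>))\<^sup>2 \<le> \<delta>" if c: "0 \<le> c" for c
  proof -
    have c1: "0 \<le> c + 1" "c \<le> c + 1" using c by auto
    have L: "fwd v k c (c + 1) \<in> L2 N" "fwd (trunc m v) (trunc m k) c (c + 1) \<in> L2 N"
      "(\<lambda>\<omega>. ?v (X (c + 1) \<omega>)) \<in> L2 N" "(\<lambda>\<omega>. ?v (X c \<omega>)) \<in> L2 N" "path_integral ?k c (c + 1) \<in> L2 N"
      using fwd_bwd_L2(1)[OF v k c c1(2)] fwd_bwd_L2(1)[OF T c c1(2)] comp_X_L2[OF D(1) c1(1)] comp_X_L2[OF D(1) c]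
        path_integral_L2[OF D(2) c c1(2)] by auto
    have "AE \<omega> in N. fwd v k c (c + 1) \<omega> - fwd (trunc m v) (trunc m k) c (c + 1) \<omega>
        = ?v (X (c + 1) \<omega>) - ?v (X c \<omega>) - path_integral ?k c (c + 1) \<omega>"
      using path_integral_lincomb[OF k T(2) c c1(2), of 1 "-1"]
      by eventually_elim (simp add: fwd_def)
    then have "l2_norm N (\<lambda>\<omega>. fwd v k c (c + 1) \<omega> - fwd (trunc m v) (trunc m k) c (c + 1) \<omega>)
        = l2_norm N (\<lambda>\<omega>. ?v (X (c + 1) \<omega>) - ?v (X c \<omega>) - path_integral ?k c (c + 1) \<omega>)"
      by (rule l2_norm_cong_AE) (intro L2_measurable L2_diff L)+
    also have "\<dots> \<le> l2_norm N (\<lambda>\<omega>. ?v (X (c + 1) \<omega>) - ?v (X c \<omega>)) + l2_norm N (path_integral ?k c (c + 1))"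
      by (intro l2_norm_triangle_diff L2_diff L)
    also have "\<dots> \<le> (l2_norm mu ?v + l2_norm mu ?v) + l2_norm mu ?k"
      using l2_norm_triangle_diff[OF L(3,4)] l2_norm_X[OF D(1) c1(1)] l2_norm_X[OF D(1) c] path_integral_norm[OF D(2) c c1(2)] by simp
    also have "\<dots> \<le> sqrt \<delta>" using m' by simp
    finally have "(l2_norm N (\<lambda>\<omega>. fwd v k c (c + 1) \<omega> - fwd (trunc m v) (trunc m k) c (c + 1) \<omega>))\<^sup>2 \<le> (sqrt \<delta>)\<^sup>2"
      by (intro power_mono l2_norm_nonneg)
    then show ?thesis using \<delta> by simp
  qed
  then show ?thesis using that by blast
qed

text \<open>
  The outcome of \<open>martingale_truncation\<close> for a sum \<open>Z\<close> of \<open>n\<close> increments.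
\<close>

definition bounded_plus_small :: "real \<Rightarrow> real \<Rightarrow> real \<Rightarrow> ('w \<Rightarrow> real) \<Rightarrow> bool" where
  "bounded_plus_small C \<delta> n Z \<longleftrightarrow> (\<exists>Y R. Y \<in> borel_measurable N \<and> bounded (range Y) \<and> R \<in> L2 N \<and>
      (\<forall>\<omega>. Z \<omega> = Y \<omega> + R \<omega>) \<and> (\<integral>\<omega>. (Y \<omega>)^4 \<partial>N) \<le> C * n\<^sup>2 \<and> (l2_norm N R)\<^sup>2 \<le> n * \<delta>)"

lemma fwd_unit_decomposition:
  assumes v: "v \<in> L2 mu" and k: "k \<in> L2 mu" and \<delta>: "0 < \<delta>"
  obtains K A B where "\<And>c \<omega>. fwd v k c (c + 1) \<omega> = A c \<omega> + B c \<omega>" "\<And>c \<omega>. \<bar>A c \<omega>\<bar> \<le> K"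
    "\<And>c. 0 \<le> c \<Longrightarrow> A c \<in> borel_measurable (generated_by Om X {c..c+1})"
    "\<And>c. 0 \<le> c \<Longrightarrow> B c \<in> borel_measurable (generated_by Om X {c..c+1})"
    "\<And>c. 0 \<le> c \<Longrightarrow> B c \<in> L2 N" "\<And>c. 0 \<le> c \<Longrightarrow> (l2_norm N (B c))\<^sup>2 \<le> \<delta>"
proof -
  obtain m where m: "\<And>c. 0 \<le> c \<Longrightarrow> (l2_norm N (\<lambda>\<omega>. fwd v k c (c + 1) \<omega> - fwd (trunc m v) (trunc m k) c (c + 1) \<omega>))\<^sup>2 \<le> \<delta>"
    using fwd_trunc_close[OF assms] by blast
  have T: "trunc m v \<in> L2 mu" "trunc m k \<in> L2 mu" by (intro mu.trunc_L2 L2_measurable v k)+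
  define A where "A c = fwd (trunc m v) (trunc m k) c (c + 1)" for c
  define B where "B c \<omega> = fwd v k c (c + 1) \<omega> - A c \<omega>" for c \<omega>
  show ?thesis
  proof (rule that)
    show "fwd v k c (c + 1) \<omega> = A c \<omega> + B c \<omega>" for c \<omega> by (simp add: B_def)
    show "\<bar>A c \<omega>\<bar> \<le> 3 * real m" for c \<omega> unfolding A_def by (rule fwd_trunc_bounded)
    fix c :: real assume c: "0 \<le> c"
    have c1: "c \<le> c + 1" by simp
    show "A c \<in> borel_measurable (generated_by Om X {c..c+1})" unfolding A_def by (rule fwd_bwd_measurable(1)[OF T c c1])
    then show "B c \<in> borel_measurable (generated_by Om X {c..c+1})"
      unfolding B_def by (intro borel_measurable_diff fwd_bwd_measurable(1)[OF v k c c1])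
    show "B c \<in> L2 N" unfolding B_def A_def by (intro L2_diff fwd_bwd_L2(1)[OF v k c c1] fwd_bwd_L2(1)[OF T c c1])
    show "(l2_norm N (B c))\<^sup>2 \<le> \<delta>" unfolding B_def A_def by (rule m[OF c])
  qed
qed

lemma fwd_sum_decomposition:
  assumes v: "(v, k) \<in> S.gen" and \<delta>: "0 < \<delta>"
  obtains C where "0 \<le> C"
    "\<And>a p. bounded_plus_small C \<delta> (real p) (\<lambda>\<omega>. \<Sum>i<p. fwd v k (real (a + i)) (real (a + i) + 1) \<omega>)"
proof -
  obtain K A B where AB: "\<And>c \<omega>. fwd v k c (c + 1) \<omega> = A c \<omega> + B c \<omega>" "\<And>c \<omega>. \<bar>A c \<omega>\<bar> \<le> K"
    "\<And>c. 0 \<le> c \<Longrightarrow> A c \<in> borel_measurable (generated_by Om X {c..c+1})"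
    "\<And>c. 0 \<le> c \<Longrightarrow> B c \<in> borel_measurable (generated_by Om X {c..c+1})"
    "\<And>c. 0 \<le> c \<Longrightarrow> B c \<in> L2 N" "\<And>c. 0 \<le> c \<Longrightarrow> (l2_norm N (B c))\<^sup>2 \<le> \<delta>"
    by (rule fwd_unit_decomposition[OF S.generator_L2[OF v] \<delta>]) (rule that)
  have "bounded_plus_small (8 * (2 * K)^4) \<delta> (real p) (\<lambda>\<omega>. \<Sum>i<p. fwd v k (real (a + i)) (real (a + i) + 1) \<omega>)" for a p
  proof -
    have sub: "{real (a + i)..real (a + i) + 1} \<subseteq> {0..real (a + Suc i)}" for i by auto
    obtain Y R where "Y \<in> borel_measurable N" "bounded (range Y)" "R \<in> L2 N"
      "\<And>\<omega>. (\<Sum>i<p. A (real (a + i)) \<omega> + B (real (a + i)) \<omega>) = Y \<omega> + R \<omega>"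
      "(\<integral>\<omega>. (Y \<omega>)^4 \<partial>N) \<le> 8 * (2 * K)^4 * (real p)\<^sup>2" "(l2_norm N R)\<^sup>2 \<le> real p * \<delta>"
    proof (rule N.martingale_truncation[of "\<lambda>i. past Om X (real (a + i))" "\<lambda>i. A (real (a + i))" K "\<lambda>i. B (real (a + i))" \<delta> p])
      show "subalgebra N (past Om X (real (a + i)))" for i by (rule subalgebra_generated_by) auto
      show "sets (past Om X (real (a + i))) \<subseteq> sets (past Om X (real (a + j)))" if "i \<le> j" for i j
        using that by (intro generated_by_mono) auto
      show "A (real (a + i)) \<in> borel_measurable (past Om X (real (a + Suc i)))" for i
        by (rule measurable_generated_by_mono[OF AB(3) sub]) simp
      show "B (real (a + i)) \<in> borel_measurable (past Om X (real (a + Suc i)))" for i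
        by (rule measurable_generated_by_mono[OF AB(4) sub]) simp
      show "l2_inner N W (\<lambda>\<omega>. A (real (a + i)) \<omega> + B (real (a + i)) \<omega>) = 0" if "W \<in> L2 N" "W \<in> borel_measurable (past Om X (real (a + i)))" for i W
        using fwd_orthogonal[OF v _ _ that, of "real (a + i) + 1"] unfolding AB(1)[symmetric] by simp
    qed (use AB in auto)
    then show ?thesis unfolding bounded_plus_small_def by (intro exI[of _ Y] exI[of _ R]) (simp add: AB(1))
  qed
  then show ?thesis using that[of "8 * (2 * K)^4"] by simp
qed

text \<open>
  The increments are martingale differences when they are read backwards from \<open>a + p\<close>. The
  filtration is \<open>F i = future (a + (p - i))\<close>; for \<open>i \<ge> p\<close> it is constant and the increments are set
  to \<open>0\<close>.
\<close>

lemma bwd_sum_decomposition: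
  assumes v: "(v, k) \<in> L2_adjoint mu S.gen" and \<delta>: "0 < \<delta>"
  obtains C where "0 \<le> C"
    "\<And>a p. bounded_plus_small C \<delta> (real p) (\<lambda>\<omega>. \<Sum>i<p. bwd v k (real (a + i)) (real (a + i) + 1) \<omega>)"
proof -
  have L: "(\<lambda>x. - v x) \<in> L2 mu" "k \<in> L2 mu" using v by (auto simp: L2_adjoint_iff intro: L2_closed)
  obtain K A B where AB: "\<And>c \<omega>. bwd v k c (c + 1) \<omega> = A c \<omega> + B c \<omega>" "\<And>c \<omega>. \<bar>A c \<omega>\<bar> \<le> K"
    "\<And>c. 0 \<le> c \<Longrightarrow> A c \<in> borel_measurable (generated_by Om X {c..c+1})"
    "\<And>c. 0 \<le> c \<Longrightarrow> B c \<in> borel_measurable (generated_by Om X {c..c+1})"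
    "\<And>c. 0 \<le> c \<Longrightarrow> B c \<in> L2 N" "\<And>c. 0 \<le> c \<Longrightarrow> (l2_norm N (B c))\<^sup>2 \<le> \<delta>"
    by (rule fwd_unit_decomposition[OF L \<delta>]) (rule that[unfolded bwd_eq_fwd])
  have K0: "0 \<le> K" using AB(2)[of 0 undefined] by simp
  have "bounded_plus_small (8 * (2 * K)^4) \<delta> (real p) (\<lambda>\<omega>. \<Sum>i<p. bwd v k (real (a + i)) (real (a + i) + 1) \<omega>)" for a p
  proof -
    define t where "t i = real (a + (p - Suc i))" for i
    define A' where "A' i \<omega> = (if i < p then A (t i) \<omega> else 0)" for i \<omega>
    define B' where "B' i \<omega> = (if i < p then B (t i) \<omega> else 0)" for i \<omega>
    define F where "F i = future Om X (real (a + (p - i)))" for i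
    have sub: "{t i..t i + 1} \<subseteq> {t i..}" and t0: "0 \<le> t i" for i by (auto simp: t_def)
    obtain Y R where YR: "Y \<in> borel_measurable N" "bounded (range Y)" "R \<in> L2 N"
      "\<And>\<omega>. (\<Sum>i<p. A' i \<omega> + B' i \<omega>) = Y \<omega> + R \<omega>"
      "(\<integral>\<omega>. (Y \<omega>)^4 \<partial>N) \<le> 8 * (2 * K)^4 * (real p)\<^sup>2" "(l2_norm N R)\<^sup>2 \<le> real p * \<delta>"
    proof (rule N.martingale_truncation[of F A' K B' \<delta> p])
      show "subalgebra N (F i)" for i unfolding F_def by (rule subalgebra_generated_by) auto
      show "sets (F i) \<subseteq> sets (F j)" if "i \<le> j" for i j
        unfolding F_def using that by (intro generated_by_mono) auto
      show "A' i \<in> borel_measurable (F (Suc i))" for i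
        using measurable_generated_by_mono[OF AB(3)[OF t0] sub, of i] unfolding A'_def F_def t_def by (cases "i < p") auto
      show "B' i \<in> borel_measurable (F (Suc i))" for i
        using measurable_generated_by_mono[OF AB(4)[OF t0] sub, of i] unfolding B'_def F_def t_def by (cases "i < p") auto
      show "\<bar>A' i \<omega>\<bar> \<le> K" for i \<omega> unfolding A'_def using AB(2) K0 by simp
      show "B' i \<in> L2 N" for i unfolding B'_def using AB(5)[OF t0] by (cases "i < p") (auto intro: L2_zero)
      show "(l2_norm N (B' i))\<^sup>2 \<le> \<delta>" for i
        unfolding B'_def using AB(6)[OF t0] \<delta> by (cases "i < p") (auto simp: l2_norm_zero)
      show "l2_inner N W (\<lambda>\<omega>. A' i \<omega> + B' i \<omega>) = 0" if W: "W \<in> L2 N" "W \<in> borel_measurable (F i)" for i W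
      proof (cases "i < p")
        case True
        then have "real (a + (p - i)) = t i + 1" by (simp add: t_def of_nat_diff)
        then have "W \<in> borel_measurable (future Om X (t i + 1))" using W(2) unfolding F_def by simp
        then have "l2_inner N W (bwd v k (t i) (t i + 1)) = 0" by (intro bwd_orthogonal[OF v t0 _ W(1)]) simp_all
        moreover have "(\<lambda>\<omega>. A' i \<omega> + B' i \<omega>) = bwd v k (t i) (t i + 1)" using True by (simp add: A'_def B'_def AB(1) fun_eq_iff)
        ultimately show ?thesis by simp
      qed (simp add: A'_def B'_def l2_inner_zero_right)
    qed blast
    have "(\<Sum>i<p. bwd v k (real (a + i)) (real (a + i) + 1) \<omega>) = (\<Sum>i<p. A' i \<omega> + B' i \<omega>)" for \<omega>
    proof -
      have "(\<Sum>i<p. A' i \<omega> + B' i \<omega>) = (\<Sum>i<p. bwd v k (t i) (t i + 1) \<omega>)"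
        by (intro sum.cong) (auto simp: A'_def B'_def AB(1))
      then show ?thesis
        unfolding t_def using sum.nat_diff_reindex[where g="\<lambda>i. bwd v k (real (a + i)) (real (a + i) + 1) \<omega>" and n=p] by simp
    qed
    then show ?thesis unfolding bounded_plus_small_def using YR by (intro exI[of _ Y] exI[of _ R]) simp
  qed
  then show ?thesis using that[of "8 * (2 * K)^4"] by simp
qed

text \<open>
  Unit intervals are glued almost surely, as \<open>h\<close> may fail to be integrable along some paths.
\<close>

lemma path_integral_sum:
  assumes h: "h \<in> L2 mu"
  shows "AE \<omega> in N. (\<Sum>i\<in>{c..<c+p}. path_integral h (real i) (real i + 1) \<omega>) = path_integral h (real c) (real c + real p) \<omega>"
proof (induction p)
  case 0
  have "path_integral h (real c) (real c + real 0) \<omega> = 0" for \<omega>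
    unfolding path_integral_def using LINT_singleton[of "real c" "\<lambda>s. h (X s \<omega>)"] by simp
  then show ?case by simp
next
  case (Suc p)
  have "0 \<le> real c" "real c \<le> real c + real p" "real c + real p \<le> real c + real (Suc p)" by auto
  from Suc path_integral_split[OF h this] show ?case
    by eventually_elim (simp add: add_ac)
qed

lemma fourth_power_mean: "((x + y) / 2)^4 \<le> (x^4 + y^4) / 2" for x y :: real
proof -
  have sq: "((x + y) / 2)\<^sup>2 \<le> (x\<^sup>2 + y\<^sup>2) / 2" for x y :: real
    using zero_le_power2[of "x - y"] unfolding power_divide power2_sum power2_diff by simp
  have "((x + y) / 2)^4 = (((x + y) / 2)\<^sup>2)\<^sup>2" by simp
  also have "\<dots> \<le> ((x\<^sup>2 + y\<^sup>2) / 2)\<^sup>2" by (intro power_mono sq) simp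
  also have "\<dots> \<le> ((x\<^sup>2)\<^sup>2 + (y\<^sup>2)\<^sup>2) / 2" by (rule sq)
  finally show ?thesis by simp
qed

text \<open>
  With \<open>v\<close> from \<open>H_minus_one_approximation\<close>, the sum is the integral of \<open>r\<close>, small in \<open>L\<^sup>2\<close> compared
  to \<open>sqrt p\<close>, plus half of a forward and a backward martingale. Both are bounded up to a small
  error, and \<open>truncated_second_moment_le\<close> applies to the sum. The choices of \<open>\<epsilon>\<close> and \<open>\<delta>\<close> make the
  contribution of the small parts \<open>e p / 2\<close>; \<open>K\<close> does the same for the bounded parts.
\<close>

theorem square_uniformly_integrable:
  assumes sym: "ergodic_symmetrization X PP mu" and f: "f \<in> L2 mu" and c: "0 \<le> c"
    and H: "\<And>F G. (F, G) \<in> S.gen \<Longrightarrow> (l2_inner mu f F)\<^sup>2 \<le> c * (- l2_inner mu F G)"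
    and e: "0 < e"
  shows "\<exists>K>0. \<forall>a p. 1 \<le> p \<longrightarrow>
     tail_moment N (K * real p) (\<lambda>\<omega>. \<Sum>i\<in>{a..<a+p}. path_integral f (real i) (real i + 1) \<omega>) \<le> e * real p"
proof -
  obtain PS where PS: "L2_contraction_semigroup mu PS" "L2_generator mu PS = L2_closure mu (symmetric_part mu S.gen)"
    using sym markov_semigroup_contraction[OF mu_prob] unfolding ergodic_symmetrization_def by blast
  define \<epsilon> where "\<epsilon> = e / (256 * exp 1)"
  define \<delta> where "\<delta> = e / 32"
  have ed: "0 < \<epsilon>" "0 < \<delta>" unfolding \<epsilon>_def \<delta>_def using e by auto
  obtain v a b where v: "(v, a) \<in> S.gen" "(v, b) \<in> L2_adjoint mu S.gen"
    and r: "\<And>F G. (F, G) \<in> S.gen \<Longrightarrow> (l2_inner mu (\<lambda>x. f x + (a x + b x) / 2) F)\<^sup>2 \<le> \<epsilon> * (- l2_inner mu F G)"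
    using S.H_minus_one_approximation[OF PS f c ed(1) H] by blast
  define r where "r x = f x + (a x + b x) / 2" for x
  have L: "v \<in> L2 mu" "a \<in> L2 mu" "b \<in> L2 mu" using S.generator_L2[OF v(1)] v(2) by (auto simp: L2_adjoint_iff)
  have rL: "r \<in> L2 mu" unfolding r_def by (intro L2_closed f L)
  have rm: "moment r t \<le> 8 * exp 1 * \<epsilon> * t" if "0 < t" for t
    using moment_upper_bound[OF rL less_imp_le[OF ed(1)] that r[folded r_def]] .
  obtain C1 where C1: "0 \<le> C1"
      "\<And>c p. bounded_plus_small C1 \<delta> (real p) (\<lambda>\<omega>. \<Sum>i<p. fwd v a (real (c + i)) (real (c + i) + 1) \<omega>)"
    by (rule fwd_sum_decomposition[OF v(1) ed(2)]) (rule that)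
  obtain C2 where C2: "0 \<le> C2"
      "\<And>c p. bounded_plus_small C2 \<delta> (real p) (\<lambda>\<omega>. \<Sum>i<p. bwd v b (real (c + i)) (real (c + i) + 1) \<omega>)"
    by (rule bwd_sum_decomposition[OF v(2) ed(2)]) (rule that)
  define K where "K = 16 * (C1 + C2) / e + 1"
  have K: "0 < K" unfolding K_def using C1(1) C2(1) e by (intro add_nonneg_pos) auto
  have "tail_moment N (K * real p) (\<lambda>\<omega>. \<Sum>i\<in>{c..<c+p}. path_integral f (real i) (real i + 1) \<omega>) \<le> e * real p" if p: "1 \<le> p" for c p
  proof -
    obtain Y1 R1 where Y1: "Y1 \<in> borel_measurable N" "bounded (range Y1)" "R1 \<in> L2 N"
      "\<forall>\<omega>. (\<Sum>i<p. fwd v a (real (c + i)) (real (c + i) + 1) \<omega>) = Y1 \<omega> + R1 \<omega>"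
      "(\<integral>\<omega>. (Y1 \<omega>)^4 \<partial>N) \<le> C1 * (real p)\<^sup>2" "(l2_norm N R1)\<^sup>2 \<le> real p * \<delta>"
      using C1(2)[of p c] unfolding bounded_plus_small_def by (elim exE conjE) (rule that)
    obtain Y2 R2 where Y2: "Y2 \<in> borel_measurable N" "bounded (range Y2)" "R2 \<in> L2 N"
      "\<forall>\<omega>. (\<Sum>i<p. bwd v b (real (c + i)) (real (c + i) + 1) \<omega>) = Y2 \<omega> + R2 \<omega>"
      "(\<integral>\<omega>. (Y2 \<omega>)^4 \<partial>N) \<le> C2 * (real p)\<^sup>2" "(l2_norm N R2)\<^sup>2 \<le> real p * \<delta>"
      using C2(2)[of p c] unfolding bounded_plus_small_def by (elim exE conjE) (rule that)
    let ?S = "\<lambda>\<omega>. \<Sum>i\<in>{c..<c+p}. path_integral f (real i) (real i + 1) \<omega>"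
    let ?r = "path_integral r (real c) (real c + real p)"
    define Y where "Y \<omega> = (Y1 \<omega> + Y2 \<omega>) / 2" for \<omega>
    define R where "R \<omega> = ?r \<omega> + (R1 \<omega> + R2 \<omega>) / 2" for \<omega>
    have rp: "?r \<in> L2 N" by (intro path_integral_L2 rL) auto
    have RL: "R \<in> L2 N" unfolding R_def by (intro L2_closed rp Y1(3) Y2(3))
    have SL: "?S \<in> L2 N" by (intro L2_sum path_integral_L2 f) auto
    have "AE \<omega> in N. ?S \<omega> = Y \<omega> + R \<omega>"
    proof -
      have u: "AE \<omega> in N. path_integral f (real i) (real i + 1) \<omega> = path_integral r (real i) (real i + 1) \<omega>
          + (fwd v a (real i) (real i + 1) \<omega> + bwd v b (real i) (real i + 1) \<omega>) / 2" for i
      proof -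
        have f': "f = (\<lambda>x. 1 * r x + (-1/2) * (1 * a x + 1 * b x))" by (simp add: fun_eq_iff r_def)
        have ab: "(\<lambda>x. 1 * a x + 1 * b x) \<in> L2 mu" by (intro L2_lincomb L)
        have i: "0 \<le> real i" "real i \<le> real i + 1" by auto
        show ?thesis
          using path_integral_lincomb[OF rL ab i, of 1 "-1/2", folded f'] path_integral_lincomb[OF L(2,3) i, of 1 1]
          by eventually_elim (simp add: fwd_def bwd_def field_simps)
      qed
      have s: "AE \<omega> in N. (\<Sum>i\<in>{c..<c+p}. path_integral r (real i) (real i + 1) \<omega>) = path_integral r (real c) (real c + real p) \<omega>"
        for p by (rule path_integral_sum[OF rL])
      have "AE \<omega> in N. \<forall>i\<in>{c..<c+p}. path_integral f (real i) (real i + 1) \<omega> = path_integral r (real i) (real i + 1) \<omega>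
          + (fwd v a (real i) (real i + 1) \<omega> + bwd v b (real i) (real i + 1) \<omega>) / 2"
        by (intro AE_finite_allI u) simp
      then show ?thesis using s[of p]
      proof eventually_elim
        case (elim \<omega>)
        have sh: "(\<Sum>i\<in>{c..<c+p}. g i) = (\<Sum>i<p. g (c + i))" for g :: "nat \<Rightarrow> real"
          using sum.shift_bounds_nat_ivl[of g 0 c p] by (simp add: atLeast0LessThan add.commute)
        have "?S \<omega> = (\<Sum>i\<in>{c..<c+p}. path_integral r (real i) (real i + 1) \<omega>
          + (fwd v a (real i) (real i + 1) \<omega> + bwd v b (real i) (real i + 1) \<omega>) / 2)"
          using elim(1) by (intro sum.cong) auto
        also have "\<dots> = ?r \<omega> + ((\<Sum>i\<in>{c..<c+p}. fwd v a (real i) (real i + 1) \<omega>) + (\<Sum>i\<in>{c..<c+p}. bwd v b (real i) (real i + 1) \<omega>)) / 2"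
          using elim(2) by (simp only: sum.distrib sum_divide_distrib[symmetric])
        also have "\<dots> = ?r \<omega> + ((Y1 \<omega> + R1 \<omega>) + (Y2 \<omega> + R2 \<omega>)) / 2"
          unfolding sh Y1(4)[rule_format] Y2(4)[rule_format] ..
        finally show ?case unfolding Y_def R_def by (simp add: add_divide_distrib)
      qed
    qed
    moreover have Ym: "Y \<in> borel_measurable N" unfolding Y_def using Y1(1) Y2(1) by measurable
    moreover have Yb: "bounded (range Y)"
    proof -
      obtain B1 B2 where B: "\<And>\<omega>. \<bar>Y1 \<omega>\<bar> \<le> B1" "\<And>\<omega>. \<bar>Y2 \<omega>\<bar> \<le> B2" using Y1(2) Y2(2) unfolding bounded_iff by auto
      have "\<bar>Y \<omega>\<bar> \<le> B1 + B2" for \<omega> using B(1)[of \<omega>] B(2)[of \<omega>] abs_triangle_ineq[of "Y1 \<omega>" "Y2 \<omega>"] abs_ge_zero[of "Y1 \<omega>"] abs_ge_zero[of "Y2 \<omega>"]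
        unfolding Y_def abs_divide by simp
      then show ?thesis unfolding bounded_iff by auto
    qed
    moreover have "0 < K * real p" using K p by simp
    ultimately have "tail_moment N (K * real p) ?S
       \<le> 4 * (l2_norm N R)\<^sup>2 + 16 / (K * real p) * (\<integral>\<omega>. (Y \<omega>)^4 \<partial>N)"
      using SL RL by (intro N.truncated_second_moment_le)
    also have "\<dots> \<le> 4 * (e / 8 * real p) + 16 / (K * real p) * ((C1 + C2) / 2 * (real p)\<^sup>2)"
    proof (intro add_mono mult_left_mono)
      have "l2_norm N R \<le> l2_norm N ?r + l2_norm N (\<lambda>\<omega>. (R1 \<omega> + R2 \<omega>) / 2)"
        unfolding R_def by (intro l2_norm_triangle rp L2_closed Y1(3) Y2(3))
      also have "l2_norm N (\<lambda>\<omega>. (R1 \<omega> + R2 \<omega>) / 2) \<le> (l2_norm N R1 + l2_norm N R2) / 2"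
        using l2_norm_triangle[OF Y1(3) Y2(3)] by (simp add: l2_norm_divide)
      also have "\<dots> \<le> sqrt (real p * \<delta>)"
        using real_le_rsqrt[OF Y1(6)] real_le_rsqrt[OF Y2(6)] by simp
      finally have "(l2_norm N R)\<^sup>2 \<le> (l2_norm N ?r + sqrt (real p * \<delta>))\<^sup>2" by (intro power_mono l2_norm_nonneg) simp
      also have "\<dots> \<le> 2 * (l2_norm N ?r)\<^sup>2 + 2 * (sqrt (real p * \<delta>))\<^sup>2"
        using zero_le_power2[of "l2_norm N ?r - sqrt (real p * \<delta>)"] unfolding power2_sum power2_diff by linarith
      also have "\<dots> = 2 * moment r (real p) + 2 * (real p * \<delta>)"
        using moment_eq[OF rL, of "real c" "real p"] ed by simp
      also have "\<dots> \<le> 2 * (8 * exp 1 * \<epsilon> * real p) + 2 * (real p * \<delta>)" using p by (intro add_mono mult_left_mono rm) auto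
      also have "\<dots> = e / 8 * real p" unfolding \<epsilon>_def \<delta>_def by simp
      finally show "(l2_norm N R)\<^sup>2 \<le> e / 8 * real p" .
    next
      obtain B1 B2 where B: "\<And>\<omega>. \<bar>Y1 \<omega>\<bar> \<le> B1" "\<And>\<omega>. \<bar>Y2 \<omega>\<bar> \<le> B2" using Y1(2) Y2(2) unfolding bounded_iff by auto
      have i: "integrable N (\<lambda>\<omega>. (Y1 \<omega>)^4)" "integrable N (\<lambda>\<omega>. (Y2 \<omega>)^4)"
        by (rule N.integrable_const_bound[where B="B1^4"], use power_mono[OF B(1) abs_ge_zero, where n=4] Y1(1) in \<open>simp_all add: power_abs\<close>)
          (rule N.integrable_const_bound[where B="B2^4"], use power_mono[OF B(2) abs_ge_zero, where n=4] Y2(1) in \<open>simp_all add: power_abs\<close>)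
      have "(\<integral>\<omega>. (Y \<omega>)^4 \<partial>N) \<le> (\<integral>\<omega>. ((Y1 \<omega>)^4 + (Y2 \<omega>)^4) / 2 \<partial>N)"
      proof (rule integral_mono_AE')
        show "AE \<omega> in N. (Y \<omega>)^4 \<le> ((Y1 \<omega>)^4 + (Y2 \<omega>)^4) / 2"
          unfolding Y_def by (intro AE_I2 fourth_power_mean)
      qed (use i in auto)
      also have "\<dots> = ((\<integral>\<omega>. (Y1 \<omega>)^4 \<partial>N) + (\<integral>\<omega>. (Y2 \<omega>)^4 \<partial>N)) / 2" using i by simp
      also have "\<dots> \<le> (C1 + C2) / 2 * (real p)\<^sup>2" using Y1(5) Y2(5) by (simp add: distrib_right)
      finally show "(\<integral>\<omega>. (Y \<omega>)^4 \<partial>N) \<le> (C1 + C2) / 2 * (real p)\<^sup>2" .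
    qed (use K in auto)
    also have "16 / (K * real p) * ((C1 + C2) / 2 * (real p)\<^sup>2) = 8 * (C1 + C2) / K * real p"
      using p K by (simp add: power2_eq_square)
    also have "\<dots> \<le> e / 2 * real p"
    proof (intro mult_right_mono)
      have "8 * (C1 + C2) \<le> e / 2 * K" unfolding K_def using e by (simp add: field_simps)
      then show "8 * (C1 + C2) / K \<le> e / 2" using K by (simp add: divide_le_eq)
    qed simp
    finally show ?thesis by simp
  qed
  then show ?thesis using K by blast
qed

end

context ergodic_diffusion
begin

section \<open>A lower bound for the variance\<close>

lemma moment_linear_lower_bound:
  assumes f: "f \<in> L2 mu" and \<delta>: "0 < \<delta>" and J: "\<forall>\<^sub>F s in at_top. \<delta> \<le> corr_integral f s"
  shows "\<exists>c>0. \<forall>\<^sub>F t in at_top. c * t \<le> moment f t"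
proof -
  from J obtain T1 where T1: "\<And>s. T1 \<le> s \<Longrightarrow> \<delta> \<le> corr_integral f s" by (auto simp: eventually_at_top_linorder)
  define T0 where "T0 = max 0 T1"
  have T0: "0 \<le> T0" "\<And>s. T0 \<le> s \<Longrightarrow> \<delta> \<le> corr_integral f s" using T1 unfolding T0_def by auto
  have "\<delta> * t \<le> moment f t" if t: "2 * T0 \<le> t" for t
  proof -
    have t': "T0 \<le> t" using t T0(1) by simp
    have c: "continuous_on {a..b} (corr_integral f)" if "0 \<le> a" for a b
      by (rule continuous_on_subset[OF corr_integral_continuous[OF f]]) (use that in auto)
    have i: "set_integrable lborel {0..t} (corr_integral f)" "set_integrable lborel {T0..t} (corr_integral f)"
      by (intro borel_integrable_atLeastAtMost' c T0(1) order_refl)+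
    have "(t - T0) * \<delta> = (LINT s:{T0..t}|lborel. \<delta>)" using t' by (simp add: LINT_const)
    also have "\<dots> \<le> (LINT s:{T0..t}|lborel. corr_integral f s)"
      by (intro set_integral_mono i T0(2) borel_integrable_atLeastAtMost' continuous_on_const) auto
    finally have 1: "(t - T0) * \<delta> \<le> (LINT s:{T0..t}|lborel. corr_integral f s)" .
    have "moment f t = moment f T0 + 2 * (LINT s:{T0..t}|lborel. corr_integral f s)"
      unfolding moment_def LINT_split[OF i(1) T0(1) t'] by simp
    then have "2 * ((t - T0) * \<delta>) \<le> moment f t" using 1 moment_nonneg[OF f T0(1)] by linarith
    moreover have "\<delta> * t \<le> 2 * ((t - T0) * \<delta>)" using mult_left_mono[OF t, of \<delta>] \<delta> by (simp add: algebra_simps)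
    ultimately show ?thesis by linarith
  qed
  then show ?thesis using \<delta> by (auto simp: eventually_at_top_linorder)
qed

text \<open>
  The adjoint moves back: \<open>\<langle>P\<^sub>s f, P\<^sub>s\<^sup>* f\<rangle> = \<langle>P\<^sub>s P\<^sub>s f, f\<rangle>\<close>.
\<close>

lemma beta_fun_eq:
  assumes f: "f \<in> L2 mu" and s: "0 \<le> s"
  shows "beta_fun X PP mu f s = corr f (2 * s)"
proof -
  obtain g0 where "g0 \<in> L2 mu" "\<And>F. F \<in> L2 mu \<Longrightarrow> l2_inner mu (P s F) f = l2_inner mu F g0"
    using S.adjoint_exists[OF s f] by blast
  then have "\<exists>g. g \<in> L2 mu \<and> (\<forall>h\<in>L2 mu. (\<integral>x. P s h x * f x \<partial>mu) = (\<integral>x. h x * g x \<partial>mu))"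
    unfolding l2_inner_def by blast
  from someI_ex[OF this, folded adjoint_op_def]
  have a: "(\<integral>x. P s h x * f x \<partial>mu) = (\<integral>x. h x * adjoint_op mu (P s) f x \<partial>mu)" if "h \<in> L2 mu" for h using that by blast
  have "beta_fun X PP mu f s = l2_inner mu (P s (P s f)) f"
    using a[OF P_L2(1)[OF f s]] by (simp add: beta_fun_def l2_inner_def)
  also have "\<dots> = corr f (2 * s)" unfolding corr_def using S.l2_inner_Q_add[OF s s f f] by (simp only: mult_2)
  finally show ?thesis .
qed

lemma integral_beta_fun:
  assumes f: "f \<in> L2 mu"
  shows "(LINT s:{0..t}|lborel. beta_fun X PP mu f s) = corr_integral f (2 * t) / 2"
proof -
  have "corr_integral f (2 * t) = 2 * (\<integral>s. indicator {0..2 * t} (2 * s) * corr f (2 * s) \<partial>lborel)"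
    unfolding corr_integral_def set_lebesgue_integral_def
    using lborel_integral_real_affine[of 2 "\<lambda>s. indicator {0..2 * t} s *\<^sub>R corr f s" 0] by simp
  also have "(\<lambda>s. indicator {0..2 * t} (2 * s) * corr f (2 * s)) = (\<lambda>s. indicator {0..t} s * beta_fun X PP mu f s)"
    by (auto simp: indicator_def beta_fun_eq[OF f] fun_eq_iff)
  finally show ?thesis by (simp add: set_lebesgue_integral_def)
qed

lemma P_const: "P t (\<lambda>_. c) = (\<lambda>_. c)"
proof
  fix x
  interpret prob_space "PP x" by (rule PP_prob)
  show "P t (\<lambda>_. c) x = c" unfolding semigroup_def by (simp add: prob_space)
qed

text \<open>
  \<open>\<langle>u, H\<rangle>\<close> is \<open>l\<close> times the Laplace transform of \<open>t \<mapsto> \<langle>H(X\<^sub>0), S\<^sub>t(f)\<rangle>\<close>, which is bounded by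
  \<open>sqrt K\<close> times the norm of \<open>H\<close>, and \<open>\<langle>u, f\<rangle>\<close> is \<open>l\<^sup>2 / 2\<close> times the Laplace transform of the
  bounded function \<open>moment f\<close>.
\<close>

lemma bounded_moment_resolvent:
  assumes f: "f \<in> L2 mu" and K: "\<And>t. 0 \<le> t \<Longrightarrow> moment f t \<le> K" and l: "0 < l"
    and u: "u \<in> L2 mu" "\<And>H. H \<in> L2 mu \<Longrightarrow> l2_inner mu u H = laplace l (\<lambda>s. l2_inner mu (P s f) H)"
  shows "l2_norm mu u \<le> sqrt K" "\<bar>l2_inner mu u f\<bar> \<le> l / 2 * K"
proof -
  have K0: "0 \<le> K" using K[of 0] moment_nonneg[OF f, of 0] by simp
  show "l2_norm mu u \<le> sqrt K"
  proof (rule l2_norm_le_if_weak[OF u(1)])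
    fix H assume H: "H \<in> L2 mu"
    define c where "c s = l2_inner mu (P s f) H" for s
    have c: "continuous_on {0..} c" unfolding c_def by (rule S.continuous_on_l2_inner_Q[OF f H])
    have b: "\<bar>c s\<bar> \<le> (l2_norm mu f * l2_norm mu H) * exp (l / 2 * s)" if "0 \<le> s" for s
    proof -
      have "\<bar>c s\<bar> \<le> (l2_norm mu f * l2_norm mu H) * 1" unfolding c_def using S.abs_l2_inner_Q_le[OF that f H] by simp
      also have "\<dots> \<le> (l2_norm mu f * l2_norm mu H) * exp (l / 2 * s)"
        using that l by (intro mult_left_mono) (auto intro: mult_nonneg_nonneg l2_norm_nonneg)
      finally show ?thesis .
    qed
    define I where "I t = (LINT s:{0..t}|lborel. c s)" for t
    have 1: "laplace l c = l * laplace l I"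
      unfolding I_def
      by (rule laplace_LINT(2)[OF c, where a="l / 2" and K="l2_norm mu f * l2_norm mu H"]) (rule b, use l in auto)
    have I: "\<bar>I t\<bar> \<le> l2_norm mu H * sqrt K" if t: "0 \<le> t" for t
    proof -
      have HX: "(\<lambda>\<omega>. H (X 0 \<omega>)) \<in> L2 N" by (rule comp_X_L2[OF H order_refl])
      have "I t = (LINT s:{0..t}|lborel. l2_inner N (\<lambda>\<omega>. H (X 0 \<omega>)) (\<lambda>\<omega>. f (X s \<omega>)))"
        unfolding I_def c_def
      proof (rule set_lebesgue_integral_cong)
        show "\<forall>s. s \<in> {0..t} \<longrightarrow> l2_inner mu (P s f) H = l2_inner N (\<lambda>\<omega>. H (X 0 \<omega>)) (\<lambda>\<omega>. f (X s \<omega>))"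
        proof (intro allI impI)
          fix s assume s: "s \<in> {0..t}"
          then show "l2_inner mu (P s f) H = l2_inner N (\<lambda>\<omega>. H (X 0 \<omega>)) (\<lambda>\<omega>. f (X s \<omega>))"
            using Markov_two_times[of f H 0 s] f H by (simp add: l2_inner_commute)
        qed
      qed simp
      also have "\<dots> = l2_inner N (\<lambda>\<omega>. H (X 0 \<omega>)) (path_integral f 0 t)"
        by (rule path_integral_inner[OF f order_refl t HX, symmetric])
      finally have "\<bar>I t\<bar> \<le> l2_norm mu H * l2_norm N (path_integral f 0 t)"
        using l2_Cauchy_Schwarz[OF HX path_integral_L2[OF f order_refl t]] l2_norm_X[OF H order_refl] by simp
      also have "\<dots> \<le> l2_norm mu H * sqrt K"
        using moment_eq[OF f order_refl t] K[OF t] by (intro mult_left_mono real_le_rsqrt l2_norm_nonneg) simp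
      finally show ?thesis .
    qed
    have "\<bar>laplace l I\<bar> \<le> l2_norm mu H * sqrt K / l"
      unfolding I_def by (rule laplace_abs_le[OF continuous_on_LINT[OF c] I[unfolded I_def] l])
    then have "l * \<bar>laplace l I\<bar> \<le> l2_norm mu H * sqrt K" using l by (simp add: field_simps)
    moreover have "l2_inner mu u H = laplace l c" unfolding u(2)[OF H] c_def ..
    ultimately show "\<bar>l2_inner mu u H\<bar> \<le> sqrt K * l2_norm mu H" using 1 l by (simp add: abs_mult mult.commute)
  qed (use K0 in simp)
  have "corr f = (\<lambda>s. l2_inner mu (P s f) f)" by (simp add: fun_eq_iff corr_def)
  then have uf: "l2_inner mu u f = l\<^sup>2 / 2 * laplace l (moment f)" using u(2)[OF f] laplace_moment(1)[OF f l] by simp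
  have "\<bar>laplace l (moment f)\<bar> \<le> K / l"
    by (rule laplace_abs_le[OF moment_continuous[OF f] _ l]) (use K moment_nonneg[OF f] in auto)
  then have "l\<^sup>2 / 2 * \<bar>laplace l (moment f)\<bar> \<le> l\<^sup>2 / 2 * (K / l)" by (intro mult_left_mono) auto
  then have "\<bar>l2_inner mu u f\<bar> \<le> l\<^sup>2 / 2 * (K / l)" unfolding uf by (simp add: abs_mult)
  then show "\<bar>l2_inner mu u f\<bar> \<le> l / 2 * K" using l by (simp add: power2_eq_square)
qed

text \<open>
  Dissipativity applied to \<open>u - w\<close>. The right-hand side is a difference of values of a monotone
  function of the resolvent parameter, so boundedness of the norms forces convergence.
\<close>

lemma resolvent_Cauchy:
  assumes f: "f \<in> L2 mu" and l: "0 < l" "l < m"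
    and u: "(u, \<lambda>x. l * u x - f x) \<in> S.gen" and w: "(w, \<lambda>x. m * w x - f x) \<in> S.gen"
  shows "(l2_norm mu (\<lambda>x. u x - w x))\<^sup>2 \<le> (l2_norm mu u)\<^sup>2 - (l2_norm mu w)\<^sup>2"
proof -
  have L: "u \<in> L2 mu" "w \<in> L2 mu" using S.generator_L2(1)[OF u] S.generator_L2(1)[OF w] by auto
  define A B C where "A = l2_inner mu u u" and "B = l2_inner mu w w" and "C = l2_inner mu u w"
  have C': "l2_inner mu w u = C" unfolding C_def by (rule l2_inner_commute)
  have "l2_inner mu (\<lambda>x. 1 * u x + -1 * w x) (\<lambda>x. 1 * (l * u x - f x) + -1 * (m * w x - f x)) \<le> 0"
    by (rule S.generator_dissipative[OF S.generator_lincomb[OF u w]])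
  also have "(\<lambda>x. 1 * (l * u x - f x) + -1 * (m * w x - f x)) = (\<lambda>x. l * u x - m * w x)" by auto
  finally have 1: "l * A + m * B \<le> (l + m) * C"
    using L by (simp add: l2_inner_simps L2_closed C' A_def[symmetric] B_def[symmetric] C_def[symmetric] algebra_simps)
  have D: "(l2_norm mu (\<lambda>x. u x - w x))\<^sup>2 = A + B - 2 * C"
    using L unfolding l2_norm_sq by (simp add: l2_inner_simps L2_closed C' A_def[symmetric] B_def[symmetric] C_def[symmetric])
  have D0: "0 \<le> A + B - 2 * C" unfolding D[symmetric] by simp
  have 2: "(l + m) * (A + B - 2 * C) \<le> (m - l) * (A - B)" using 1 by (simp add: algebra_simps)
  have "0 \<le> (m - l) * (A - B)" using mult_nonneg_nonneg[OF _ D0, of "l + m"] l 2 by simp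
  then have "0 \<le> A - B" using l by (simp add: zero_le_mult_iff)
  then have "(m - l) * (A - B) \<le> (l + m) * (A - B)" using l by (intro mult_right_mono) auto
  with 2 have "(l + m) * (A + B - 2 * C) \<le> (l + m) * (A - B)" by linarith
  then show ?thesis using l unfolding D by (simp add: l2_norm_sq A_def B_def)
qed

text \<open>
  \<open>g\<close> is the limit of the resolvents of \<open>f\<close> at the values \<open>1/n\<close>. Its energy \<open>\<langle>g, f\<rangle>\<close> vanishes since
  \<open>\<langle>u, f\<rangle>\<close> is at most a multiple of the resolvent parameter.
\<close>

lemma Poisson_equation_solvable:
  assumes f: "f \<in> L2 mu" and K: "\<And>t. 0 \<le> t \<Longrightarrow> moment f t \<le> K"
  obtains g where "(g, \<lambda>x. - f x) \<in> S.gen" "l2_inner mu g f = 0"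
proof -
  define l where "l n = 1 / real (Suc n)" for n
  have l: "0 < l n" for n unfolding l_def by simp
  have "\<exists>u. u \<in> L2 mu \<and> (\<forall>H\<in>L2 mu. l2_inner mu u H = laplace (l n) (\<lambda>s. l2_inner mu (P s f) H))" for n
    using S.resolvent_exists[OF f l] by metis
  then obtain u where u: "\<And>n. u n \<in> L2 mu" "\<And>n H. H \<in> L2 mu \<Longrightarrow> l2_inner mu (u n) H = laplace (l n) (\<lambda>s. l2_inner mu (P s f) H)"
    by metis
  have g: "(u n, \<lambda>x. l n * u n x - f x) \<in> S.gen" for n by (rule S.resolvent_in_generator[OF f l u])
  note b = bounded_moment_resolvent[OF f K l u]
  define A where "A n = (l2_norm mu (u n))\<^sup>2" for n
  have D: "(l2_norm mu (\<lambda>x. u n x - u m x))\<^sup>2 \<le> A n - A m" if "m \<le> n" for m n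
  proof (cases "m = n")
    case True then show ?thesis by (simp add: l2_norm_zero)
  next
    case False
    then have "l n < l m" using that unfolding l_def by (simp add: divide_strict_left_mono)
    then show ?thesis unfolding A_def by (rule resolvent_Cauchy[OF f l _ g g])
  qed
  have "convergent A"
  proof (rule Bseq_mono_convergent)
    have "A n \<le> K" for n
      using power_mono[OF b(1)[of n] l2_norm_nonneg, of 2] K[of 0] moment_nonneg[OF f, of 0] unfolding A_def by simp
    then show "Bseq A" by (intro BseqI'[of _ K]) (auto simp: A_def)
    show "\<forall>m n. m \<le> n \<longrightarrow> A m \<le> A n" using D zero_le_power2 by (metis diff_ge_0_iff_ge order_trans)
  qed
  then have Cau: "Cauchy A" by (rule convergent_Cauchy)
  obtain g where g': "g \<in> L2 mu" "L2_tendsto mu u g sequentially"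
  proof (rule mu.L2_complete[of u])
    show "u n \<in> L2 mu" for n by (rule u(1))
    fix e :: real assume e: "0 < e"
    then obtain M where M: "\<And>m n. M \<le> m \<Longrightarrow> M \<le> n \<Longrightarrow> \<bar>A m - A n\<bar> < e\<^sup>2"
      using Cauchy_iff[THEN iffD1, OF Cau, rule_format, of "e\<^sup>2"] by auto
    have "l2_norm mu (\<lambda>x. u m x - u n x) < e" if "M \<le> m" "M \<le> n" for m n
    proof -
      have "(l2_norm mu (\<lambda>x. u m x - u n x))\<^sup>2 \<le> \<bar>A m - A n\<bar>"
        using D[of m n] D[of n m] l2_norm_minus_commute[of mu "u m" "u n"] by (cases "m \<le> n") auto
      then have "(l2_norm mu (\<lambda>x. u m x - u n x))\<^sup>2 < e\<^sup>2" using M[OF that] by linarith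
      then show ?thesis using e by (simp add: power_less_imp_less_base)
    qed
    then show "\<exists>K. \<forall>m\<ge>K. \<forall>n\<ge>K. l2_norm mu (\<lambda>x. u m x - u n x) < e" by blast
  qed blast
  have l0: "l \<longlonglongrightarrow> 0" unfolding l_def using LIMSEQ_inverse_real_of_nat by (simp add: divide_inverse)
  have fm: "(\<lambda>x. - f x) \<in> L2 mu" by (intro L2_closed f)
  show ?thesis
  proof (rule that)
    show "l2_inner mu g f = 0"
    proof (rule LIMSEQ_unique)
      show "(\<lambda>n. l2_inner mu (u n) f) \<longlonglongrightarrow> l2_inner mu g f" by (rule tendsto_l2_inner_left[OF g'(2) u(1) g'(1) f])
      show "(\<lambda>n. l2_inner mu (u n) f) \<longlonglongrightarrow> 0"
      proof (rule Lim_null_comparison)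
        show "\<forall>\<^sub>F n in sequentially. norm (l2_inner mu (u n) f) \<le> l n / 2 * K" using b(2) by simp
        show "(\<lambda>n. l n / 2 * K) \<longlonglongrightarrow> 0" using tendsto_mult_right[OF l0, of "K / 2"] by (simp add: mult.commute[of K])
      qed
    qed
    show "(g, \<lambda>x. - f x) \<in> S.gen"
    proof (rule S.generatorI_mild[OF g'(1) fm])
      fix h H assume h: "0 \<le> (h::real)" and H: "H \<in> L2 mu"
      have lim: "(\<lambda>n. l2_inner mu (P h (u n)) H) \<longlonglongrightarrow> l2_inner mu (P h g) H"
      proof (rule tendsto_l2_inner_left[OF _ _ _ H])
        show "L2_tendsto mu (\<lambda>n. P h (u n)) (P h g) sequentially"
          unfolding L2_tendsto_iff
        proof (rule Lim_null_comparison)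
          show "\<forall>\<^sub>F n in sequentially. norm (l2_norm mu (\<lambda>x. P h (u n) x - P h g x)) \<le> l2_norm mu (\<lambda>x. u n x - g x)"
            using S.Q_diff_norm[OF h u(1) g'(1)] by (simp add: l2_norm_nonneg)
          show "(\<lambda>n. l2_norm mu (\<lambda>x. u n x - g x)) \<longlonglongrightarrow> 0" using g'(2) unfolding L2_tendsto_iff .
        qed
      qed (intro P_L2 u g' h)+
      have eq: "l2_inner mu (P h (u n)) H - l2_inner mu (u n) H
          = l n * (LINT s:{0..h}|lborel. l2_inner mu (P s (u n)) H) + (LINT s:{0..h}|lborel. l2_inner mu (P s (\<lambda>x. - f x)) H)" for n
      proof -
        have i: "set_integrable lborel {0..h} (\<lambda>s. l2_inner mu (P s F) H)" if "F \<in> L2 mu" for F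
          by (intro borel_integrable_atLeastAtMost' S.continuous_on_l2_inner_Q' that H) simp
        have "l2_inner mu (P h (u n)) H - l2_inner mu (u n) H = (LINT s:{0..h}|lborel. l2_inner mu (P s (\<lambda>x. l n * u n x - f x)) H)"
          by (rule S.generator_mild[OF g h H])
        also have "\<dots> = (LINT s:{0..h}|lborel. l n * l2_inner mu (P s (u n)) H + l2_inner mu (P s (\<lambda>x. - f x)) H)"
        proof (rule set_lebesgue_integral_cong)
          show "\<forall>s. s \<in> {0..h} \<longrightarrow> l2_inner mu (P s (\<lambda>x. l n * u n x - f x)) H = l n * l2_inner mu (P s (u n)) H + l2_inner mu (P s (\<lambda>x. - f x)) H"
            using S.l2_inner_Q_lincomb[OF _ u(1) fm H, of _ "l n" n 1] by auto
        qed simp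
        also have "\<dots> = l n * (LINT s:{0..h}|lborel. l2_inner mu (P s (u n)) H) + (LINT s:{0..h}|lborel. l2_inner mu (P s (\<lambda>x. - f x)) H)"
          using i[OF u(1)[of n]] i[OF fm] by (simp add: set_integral_add(2))
        finally show ?thesis .
      qed
      have z: "(\<lambda>n. l n * (LINT s:{0..h}|lborel. l2_inner mu (P s (u n)) H)) \<longlonglongrightarrow> 0"
      proof (rule Lim_null_comparison)
        show "\<forall>\<^sub>F n in sequentially. norm (l n * (LINT s:{0..h}|lborel. l2_inner mu (P s (u n)) H)) \<le> l n * (h * (sqrt K * l2_norm mu H))"
        proof (intro always_eventually allI)
          fix n
          have "\<bar>LINT s:{0..h}|lborel. l2_inner mu (P s (u n)) H\<bar> \<le> (h - 0) * (sqrt K * l2_norm mu H)"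
          proof (rule LINT_abs_le[OF S.continuous_on_l2_inner_Q'[OF u(1) H order_refl] h])
            fix s assume "s \<in> {0..h}"
            then have "\<bar>l2_inner mu (P s (u n)) H\<bar> \<le> l2_norm mu (u n) * l2_norm mu H"
              using S.abs_l2_inner_Q_le[OF _ u(1) H, of s n] by simp
            also have "\<dots> \<le> sqrt K * l2_norm mu H" by (intro mult_right_mono b(1) l2_norm_nonneg)
            finally show "\<bar>l2_inner mu (P s (u n)) H\<bar> \<le> sqrt K * l2_norm mu H" .
          qed
          then show "norm (l n * (LINT s:{0..h}|lborel. l2_inner mu (P s (u n)) H)) \<le> l n * (h * (sqrt K * l2_norm mu H))"
            using l[of n] by (simp add: abs_mult)
        qed
        show "(\<lambda>n. l n * (h * (sqrt K * l2_norm mu H))) \<longlonglongrightarrow> 0" using tendsto_mult_right[OF l0, of "h * (sqrt K * l2_norm mu H)"]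
          by (simp add: mult.commute[of "h * (sqrt K * l2_norm mu H)"])
      qed
      have 1: "(\<lambda>n. l2_inner mu (P h (u n)) H - l2_inner mu (u n) H) \<longlonglongrightarrow> l2_inner mu (P h g) H - l2_inner mu g H"
        by (intro tendsto_diff lim tendsto_l2_inner_left[OF g'(2) u(1) g'(1) H])
      have 2: "(\<lambda>n. l2_inner mu (P h (u n)) H - l2_inner mu (u n) H) \<longlonglongrightarrow> 0 + (LINT s:{0..h}|lborel. l2_inner mu (P s (\<lambda>x. - f x)) H)"
        unfolding eq by (intro tendsto_add z tendsto_const)
      show "l2_inner mu (P h g) H - l2_inner mu g H = (LINT s:{0..h}|lborel. l2_inner mu (P s (\<lambda>x. - f x)) H)"
        using LIMSEQ_unique[OF 1 2] by simp
    qed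
  qed
qed

text \<open>
  \<open>g\<close> maximises the form \<open>\<langle>F, L F\<rangle> \<le> 0\<close>; the first variation vanishes.
\<close>

lemma adjoint_if_energy_zero:
  assumes g: "(g, k) \<in> S.gen" and z: "l2_inner mu g k = 0"
  shows "(g, \<lambda>x. - k x) \<in> L2_adjoint mu S.gen"
  unfolding L2_adjoint_iff
proof (intro conjI allI impI)
  note L = S.generator_L2[OF g]
  show "g \<in> L2 mu" "(\<lambda>x. - k x) \<in> L2 mu" by (intro L L2_closed)+
  fix F G assume F: "(F, G) \<in> S.gen"
  note LF = S.generator_L2[OF F]
  define b where "b = l2_inner mu g G + l2_inner mu F k"
  have q: "0 \<le> s\<^sup>2 * (- l2_inner mu F G) - 2 * s * (b / 2) + 0" for s
  proof -
    have "l2_inner mu (\<lambda>x. 1 * g x + s * F x) (\<lambda>x. 1 * k x + s * G x) \<le> 0"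
      by (rule S.generator_dissipative[OF S.generator_lincomb[OF g F]])
    then show ?thesis using L LF z
      by (simp add: l2_inner_simps L2_closed b_def power2_eq_square algebra_simps)
  qed
  have "(b / 2)\<^sup>2 \<le> 0 * (- l2_inner mu F G)"
    by (rule quadratic_nonneg_imp_discriminant[OF _ q]) (use S.generator_dissipative[OF F] in simp)
  then have "b = 0" by simp
  then show "l2_inner mu G g = l2_inner mu F (\<lambda>x. - k x)"
    unfolding b_def by (simp add: l2_inner_uminus_right l2_inner_commute[of mu G g])
qed

text \<open>
  The solution of \<open>L g = - f\<close> with energy zero satisfies \<open>L\<^sup>* g = f\<close>, so \<open>g\<close> is constant and
  \<open>f = - L g = 0\<close>.
\<close>

lemma bounded_moment_imp_zero:
  assumes sym: "ergodic_symmetrization X PP mu" and f: "f \<in> L2 mu" and K: "\<And>t. 0 \<le> t \<Longrightarrow> moment f t \<le> K"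
  shows "AE x in mu. f x = 0"
proof -
  obtain PS where PS: "L2_contraction_semigroup mu PS" "ergodic_semigroup mu PS"
      "L2_generator mu PS = L2_closure mu (symmetric_part mu S.gen)"
    using sym markov_semigroup_contraction[OF mu_prob] unfolding ergodic_symmetrization_def by blast
  obtain g where g: "(g, \<lambda>x. - f x) \<in> S.gen" "l2_inner mu g f = 0" using Poisson_equation_solvable[OF f K] by blast
  have "(g, \<lambda>x. - (- f x)) \<in> L2_adjoint mu S.gen"
    by (rule adjoint_if_energy_zero[OF g(1)]) (simp add: l2_inner_uminus_right g(2))
  from S.symmetric_kernel_constant[OF PS g(1) this] obtain c where c: "AE x in mu. g x = c" by blast
  have gL: "g \<in> L2 mu" by (rule S.generator_L2(1)[OF g(1)])
  have "(g, \<lambda>x. 0) \<in> S.gen"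
  proof (rule S.generatorI[OF gL L2_zero])
    have "l2_norm mu (\<lambda>x. (P h g x - g x) / h - 0) = 0" if "0 < h" for h
    proof -
      have "AE x in mu. P h g x = P h (\<lambda>_. c) x"
        by (rule S.Q_cong_AE[OF _ gL mu.L2_const c]) (use that in simp)
      with c have "AE x in mu. (P h g x - g x) / h - 0 = 0" by eventually_elim (simp add: P_const)
      then have "l2_norm mu (\<lambda>x. (P h g x - g x) / h - 0) = l2_norm mu (\<lambda>x. 0)"
        by (rule l2_norm_cong_AE) (use that in \<open>auto intro!: L2_measurable L2_closed gL P_L2\<close>)
      then show ?thesis by (simp add: l2_norm_zero)
    qed
    then have "\<forall>\<^sub>F h in at_right 0. l2_norm mu (\<lambda>x. (P h g x - g x) / h - 0) = 0"
      by (auto simp: eventually_at_filter)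
    then show "((\<lambda>h. l2_norm mu (\<lambda>x. (P h g x - g x) / h - 0)) \<longlongrightarrow> 0) (at_right 0)"
      by (rule tendsto_eventually)
  qed
  from S.generator_unique[OF g(1) this] show ?thesis by eventually_elim simp
qed

text \<open>
  \<open>V\<^sub>-\<close> is half the lower limit of \<open>corr_integral f\<close>. Under \<open>(Hpos)\<close>, \<open>corr_integral f\<close> is
  eventually nondecreasing; if it never becomes positive after that time, \<open>moment f\<close> is bounded,
  which \<open>bounded_moment_imp_zero\<close> excludes.
\<close>

theorem moment_lower_bound:
  assumes sym: "ergodic_symmetrization X PP mu" and f: "f \<in> L2 mu" and nz: "\<not> (AE x in mu. f x = 0)"
    and lower: "(\<exists>c>0. \<forall>\<^sub>F t in at_top. c * t \<le> moment f t) \<or> 0 < V_minus X PP mu f \<or> Hpos X PP mu f"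
  shows "\<exists>c>0. \<forall>\<^sub>F t in at_top. c * t \<le> moment f t"
  using lower
proof (elim disjE)
  assume "0 < V_minus X PP mu f"
  then obtain y where y: "0 < y" "y < V_minus X PP mu f" using dense by blast
  then obtain \<delta> where \<delta>: "y = ereal \<delta>" by (cases y) auto
  have "\<forall>\<^sub>F t in at_top. ereal \<delta> < ereal (corr_integral f (2 * t) / 2)"
    using le_Liminf_iff[of "V_minus X PP mu f" at_top "\<lambda>t. ereal (corr_integral f (2 * t) / 2)"] y(2)
    unfolding V_minus_def integral_beta_fun[OF f] \<delta> by auto
  then obtain T where T: "\<And>t. T \<le> t \<Longrightarrow> \<delta> < corr_integral f (2 * t) / 2" by (auto simp: eventually_at_top_linorder)
  have "\<delta> \<le> corr_integral f s" if "2 * T \<le> s" for s using T[of "s / 2"] that y(1) \<delta> by simp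
  then have "\<forall>\<^sub>F s in at_top. \<delta> \<le> corr_integral f s" by (auto simp: eventually_at_top_linorder)
  then show ?thesis using moment_linear_lower_bound[OF f] y(1) \<delta> by simp
next
  assume "Hpos X PP mu f"
  then obtain T1 where T1: "\<And>s. T1 \<le> s \<Longrightarrow> 0 \<le> beta_fun X PP mu f s" by (auto simp: Hpos_def eventually_at_top_linorder)
  define T where "T = 2 * max 0 T1"
  have T0: "0 \<le> T" unfolding T_def by simp
  have pos: "0 \<le> corr f s" if "T \<le> s" for s
    using T1[of "s / 2"] beta_fun_eq[OF f, of "s / 2"] that unfolding T_def by auto
  have c: "continuous_on {a..b} (corr_integral f)" "continuous_on {a..b} (corr f)" if "0 \<le> a" for a b
    by (rule continuous_on_subset[OF corr_integral_continuous[OF f]] continuous_on_subset[OF corr_continuous[OF f]]; use that in auto)+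
  have mono: "corr_integral f s \<le> corr_integral f t" if "T \<le> s" "s \<le> t" for s t
  proof -
    have s: "0 \<le> s" using that T0 by simp
    have "corr_integral f t = corr_integral f s + (LINT r:{s..t}|lborel. corr f r)"
      unfolding corr_integral_def by (intro LINT_split borel_integrable_atLeastAtMost' c s that order_refl)
    moreover have "0 \<le> (LINT r:{s..t}|lborel. corr f r)"
      unfolding set_lebesgue_integral_def by (intro integral_nonneg_AE AE_I2) (use pos that in \<open>auto simp: indicator_def\<close>)
    ultimately show ?thesis by simp
  qed
  show ?thesis
  proof (cases "\<exists>t\<ge>T. 0 < corr_integral f t")
    case True
    then obtain t where t: "T \<le> t" "0 < corr_integral f t" by blast
    have "\<forall>\<^sub>F s in at_top. corr_integral f t \<le> corr_integral f s"
      using mono[OF t(1)] by (auto simp: eventually_at_top_linorder)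
    then show ?thesis by (rule moment_linear_lower_bound[OF f t(2)])
  next
    case False
    have "continuous_on {0..T} (moment f)" by (rule continuous_on_subset[OF moment_continuous[OF f]]) auto
    then have "bounded (moment f ` {0..T})" by (intro compact_imp_bounded compact_continuous_image) auto
    then obtain K where K: "\<forall>t\<in>{0..T}. \<bar>moment f t\<bar> \<le> K" unfolding bounded_iff by auto
    have "moment f t \<le> K" if t: "0 \<le> t" for t
    proof (cases "t \<le> T")
      case True
      then show ?thesis using K t by (auto dest: bspec[of _ _ t])
    next
      case gt: False
      have "moment f t = moment f T + 2 * (LINT s:{T..t}|lborel. corr_integral f s)"
        unfolding moment_def
        by (subst LINT_split[OF _ T0, of t]) (use gt in \<open>auto intro!: borel_integrable_atLeastAtMost' c\<close>)
      moreover have "0 \<le> (LINT s:{T..t}|lborel. - corr_integral f s)"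
        unfolding set_lebesgue_integral_def by (intro integral_nonneg_AE AE_I2) (use False in \<open>auto simp: indicator_def not_less\<close>)
      ultimately show ?thesis using bspec[OF K, of T] T0 by (simp add: set_lebesgue_integral_def)
    qed
    then have "AE x in mu. f x = 0" by (rule bounded_moment_imp_zero[OF sym f])
    then show ?thesis using nz by contradiction
  qed
qed blast

end

context ergodic_diffusion
begin

section \<open>The central limit theorem for the additive functional\<close>

lemma abs_covariance_le_1:
  assumes "F \<in> borel_measurable N" "G \<in> borel_measurable N"
    and "\<And>\<omega>. \<omega> \<in> space Om \<Longrightarrow> 0 \<le> F \<omega> \<and> F \<omega> \<le> 1" "\<And>\<omega>. \<omega> \<in> space Om \<Longrightarrow> 0 \<le> G \<omega> \<and> G \<omega> \<le> 1"
  shows "\<bar>covariance N F G\<bar> \<le> 1"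
proof -
  have I: "0 \<le> (\<integral>\<omega>. H \<omega> \<partial>N)" "(\<integral>\<omega>. H \<omega> \<partial>N) \<le> 1"
    if "H \<in> borel_measurable N" "\<And>\<omega>. \<omega> \<in> space Om \<Longrightarrow> 0 \<le> H \<omega> \<and> H \<omega> \<le> 1" for H :: "'w \<Rightarrow> real"
  proof -
    have i: "integrable N H" by (rule N.integrable_const_bound[where B=1]) (use that in \<open>auto simp: space_N\<close>)
    show "0 \<le> (\<integral>\<omega>. H \<omega> \<partial>N)" by (intro integral_nonneg_AE AE_I2) (use that in \<open>auto simp: space_N\<close>)
    have "(\<integral>\<omega>. H \<omega> \<partial>N) \<le> (\<integral>\<omega>. 1 \<partial>N)" by (intro integral_mono i) (use that in \<open>auto simp: space_N\<close>)
    then show "(\<integral>\<omega>. H \<omega> \<partial>N) \<le> 1" by (simp add: N.prob_space)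
  qed
  have FG: "(\<lambda>\<omega>. F \<omega> * G \<omega>) \<in> borel_measurable N" using assms(1,2) by measurable
  have FG1: "0 \<le> F \<omega> * G \<omega> \<and> F \<omega> * G \<omega> \<le> 1" if "\<omega> \<in> space Om" for \<omega>
    using assms(3)[OF that] assms(4)[OF that] by (auto intro: mult_le_one)
  have "0 \<le> (\<integral>\<omega>. F \<omega> \<partial>N) * (\<integral>\<omega>. G \<omega> \<partial>N)" "(\<integral>\<omega>. F \<omega> \<partial>N) * (\<integral>\<omega>. G \<omega> \<partial>N) \<le> 1"
    using I[OF assms(1,3)] I[OF assms(2,4)] by (auto intro: mult_le_one)
  then show ?thesis unfolding covariance_def using I[OF FG FG1] by (simp add: abs_le_iff)
qed

text \<open>
  The set defining \<open>alpha_mix\<close> is bounded, so its supremum is an upper bound.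
\<close>

lemma covariance_le_alpha_mix:
  assumes "0 \<le> s" "0 \<le> r" "F \<in> borel_measurable (past Om X s)" "G \<in> borel_measurable (future Om X (s + r))"
    and "\<And>\<omega>. 0 \<le> F \<omega> \<and> F \<omega> \<le> 1" "\<And>\<omega>. 0 \<le> G \<omega> \<and> G \<omega> \<le> 1"
  shows "\<bar>(\<integral>\<omega>. F \<omega> * G \<omega> \<partial>N) - (\<integral>\<omega>. F \<omega> \<partial>N) * (\<integral>\<omega>. G \<omega> \<partial>N)\<bar> \<le> alpha_mix Om X PP mu r"
  unfolding alpha_mix_def covariance_def[symmetric]
proof (rule cSup_upper)
  let ?A = "{\<bar>covariance N F G\<bar> | s F G. 0 \<le> s \<and>
       F \<in> borel_measurable (past Om X s) \<and> G \<in> borel_measurable (future Om X (s + r)) \<and>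
       (\<forall>\<omega>\<in>space Om. 0 \<le> F \<omega> \<and> F \<omega> \<le> 1) \<and> (\<forall>\<omega>\<in>space Om. 0 \<le> G \<omega> \<and> G \<omega> \<le> 1)}"
  show "\<bar>covariance N F G\<bar> \<in> ?A" using assms by blast
  have "x \<le> 1" if A: "x \<in> ?A" for x
  proof -
    obtain s F G where x: "x = \<bar>covariance N F G\<bar>" "0 \<le> s" "F \<in> borel_measurable (past Om X s)" "G \<in> borel_measurable (future Om X (s + r))"
       "\<forall>\<omega>\<in>space Om. 0 \<le> F \<omega> \<and> F \<omega> \<le> 1" "\<forall>\<omega>\<in>space Om. 0 \<le> G \<omega> \<and> G \<omega> \<le> 1"
      using A by blast
    show ?thesis unfolding x(1)
      by (rule abs_covariance_le_1[OF generated_by_measurable_N[OF _ x(3)] generated_by_measurable_N[OF _ x(4)]])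
        (use x assms(2) in auto)
  qed
  then show "bdd_above ?A" by (intro bdd_aboveI[where M=1])
qed

lemma additive_functional_eq: "additive_functional X f t = path_integral f 0 t"
  by (simp add: fun_eq_iff additive_functional_def path_integral_def)

lemma path_integral_mean:
  assumes f: "f \<in> L2 mu" and z: "(\<integral>x. f x \<partial>mu) = 0" and a: "0 \<le> a" "a \<le> b"
  shows "(\<integral>\<omega>. path_integral f a b \<omega> \<partial>N) = 0"
proof -
  have "(\<integral>\<omega>. path_integral f a b \<omega> \<partial>N) = l2_inner N (\<lambda>_. 1) (path_integral f a b)" by (simp add: l2_inner_def)
  also have "\<dots> = (LINT s:{a..b}|lborel. l2_inner N (\<lambda>_. 1) (\<lambda>\<omega>. f (X s \<omega>)))"
    by (rule path_integral_inner[OF f a N.L2_const])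
  also have "\<dots> = (LINT s:{a..b}|lborel. 0)"
    by (rule set_lebesgue_integral_cong) (use a z in \<open>auto simp: l2_inner_def integral_X L2_measurable[OF f]\<close>)
  finally show ?thesis by simp
qed

lemma variance_functional_eq:
  assumes f: "f \<in> L2 mu" and z: "(\<integral>x. f x \<partial>mu) = 0" and t: "0 \<le> t"
  shows "variance_functional X PP mu f t = moment f t"
  unfolding variance_functional_def additive_functional_eq path_integral_mean[OF f z order_refl t]
  using moment_eq[OF f order_refl t] by (simp add: l2_norm_sq')

lemma path_integral_mixing_sequence:
  assumes sym: "ergodic_symmetrization X PP mu" and f: "f \<in> L2 mu" and z: "(\<integral>x. f x \<partial>mu) = 0"
    and mix: "strongly_mixing Om X PP mu" and K: "0 \<le> K"
    and H: "\<And>F G. (F, G) \<in> S.gen \<Longrightarrow> (l2_inner mu f F)\<^sup>2 \<le> K * (- l2_inner mu F G)"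
    and c: "0 < c" "\<And>t. T0 \<le> t \<Longrightarrow> c * t \<le> moment f t"
  shows "mixing_sequence N (\<lambda>i. path_integral f (real i) (real i + 1)) (\<lambda>m. past Om X (real m)) (\<lambda>m. future Om X (real m))
     (\<lambda>r. alpha_mix Om X PP mu (real r)) (\<lambda>p. moment f (real p)) c (8 * exp 1 * K) (nat \<lceil>T0\<rceil>)"
proof unfold_locales
  show "subalgebra N (past Om X (real m))" "subalgebra N (future Om X (real m))" for m by (rule subalgebra_generated_by; auto)+
  have gen: "path_integral f (real i) (real i + 1) \<in> borel_measurable (generated_by Om X {real i..real i + 1})" for i
    by (rule path_integral_generated[OF L2_measurable[OF f]]) auto
  show "path_integral f (real i) (real i + 1) \<in> borel_measurable (past Om X (real m))" if "i < m" for i m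
    by (rule measurable_generated_by_mono[OF gen]) (use that in auto)
  show "path_integral f (real i) (real i + 1) \<in> borel_measurable (future Om X (real m))" if "m \<le> i" for i m
    by (rule measurable_generated_by_mono[OF gen]) (use that in auto)
  show "\<bar>(\<integral>x. F x * G x \<partial>N) - (\<integral>x. F x \<partial>N) * (\<integral>x. G x \<partial>N)\<bar> \<le> alpha_mix Om X PP mu (real r)"
    if "F \<in> borel_measurable (past Om X (real m))" "G \<in> borel_measurable (future Om X (real (m + r)))"
      "\<And>x. 0 \<le> F x \<and> F x \<le> 1" "\<And>x. 0 \<le> G x \<and> G x \<le> 1" for m r F G
    using covariance_le_alpha_mix[of "real m" "real r" F G] that by simp
  show "(\<lambda>r. alpha_mix Om X PP mu (real r)) \<longlonglongrightarrow> 0"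
    by (rule filterlim_compose[OF mix[unfolded strongly_mixing_def] filterlim_real_sequentially])
  show "path_integral f (real i) (real i + 1) \<in> L2 N" for i by (rule path_integral_L2[OF f]) auto
  show "(\<integral>x. path_integral f (real i) (real i + 1) x \<partial>N) = 0" for i by (rule path_integral_mean[OF f z]) auto
  show "(l2_norm N (\<lambda>x. \<Sum>i\<in>{a..<a+p}. path_integral f (real i) (real i + 1) x))\<^sup>2 = moment f (real p)" for a p
  proof -
    have "l2_norm N (\<lambda>x. \<Sum>i\<in>{a..<a+p}. path_integral f (real i) (real i + 1) x) = l2_norm N (path_integral f (real a) (real a + real p))"
      by (rule l2_norm_cong_AE[OF path_integral_sum[OF f]]) (auto intro!: L2_measurable L2_sum path_integral_L2 f)
    then show ?thesis using moment_eq[OF f, of "real a" "real p"] by simp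
  qed
  show "\<exists>K>0. \<forall>a p. 1 \<le> p \<longrightarrow> tail_moment N (K * real p) (\<lambda>x. \<Sum>i\<in>{a..<a+p}. path_integral f (real i) (real i + 1) x) \<le> \<epsilon> * real p" if "0 < \<epsilon>" for \<epsilon>
    by (rule square_uniformly_integrable[OF sym f K H that])
  show "0 < c" by (rule c)
  show "c * real n \<le> moment f (real n)" if "nat \<lceil>T0\<rceil> \<le> n" for n by (rule c(2)) (use that in linarith)
  show "moment f (real n) \<le> 8 * exp 1 * K * real n" for n
  proof (cases "n = 0")
    case True
    then show ?thesis by (simp add: moment_def LINT_singleton[of 0, simplified])
  next
    case False
    then show ?thesis by (intro moment_upper_bound[OF f K _ H]) auto
  qed
qed

text \<open>
  From integer to real times: replacing \<open>s\<close> by its integer part changes \<open>S\<^sub>s\<close> and its norm by at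
  most the norm of \<open>f\<close>, hence the normalised sum by \<open>2 \<parallel>f\<parallel> / sqrt (Var S\<^sub>s)\<close> in \<open>L\<^sup>2\<close>.
\<close>

theorem additive_functional_char_tendsto:
  assumes sym: "ergodic_symmetrization X PP mu" and f: "f \<in> L2 mu" and z: "(\<integral>x. f x \<partial>mu) = 0"
    and mix: "strongly_mixing Om X PP mu" and K: "0 \<le> K"
    and H: "\<And>F G. (F, G) \<in> S.gen \<Longrightarrow> (l2_inner mu f F)\<^sup>2 \<le> K * (- l2_inner mu F G)"
    and c: "0 < c" "\<forall>\<^sub>F t in at_top. c * t \<le> moment f t"
  shows "((\<lambda>s. char (distr N borel (\<lambda>\<omega>. additive_functional X f s \<omega> / sqrt (variance_functional X PP mu f s))) t)
     \<longlongrightarrow> complex_of_real (exp (- (t\<^sup>2 / 2)))) at_top"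
proof -
  let ?Z = "\<lambda>s. distr N borel (\<lambda>\<omega>. additive_functional X f s \<omega> / sqrt (variance_functional X PP mu f s))"
  obtain T0 where T0: "\<And>t. T0 \<le> t \<Longrightarrow> c * t \<le> moment f t" using c(2) by (auto simp: eventually_at_top_linorder)
  interpret MS: mixing_sequence N "\<lambda>i. path_integral f (real i) (real i + 1)" "\<lambda>m. past Om X (real m)" "\<lambda>m. future Om X (real m)"
     "\<lambda>r. alpha_mix Om X PP mu (real r)" "\<lambda>p. moment f (real p)" c "8 * exp 1 * K" "nat \<lceil>T0\<rceil>"
    by (rule path_integral_mixing_sequence[OF sym f z mix K H c(1) T0])
  let ?\<sigma> = "\<lambda>s. sqrt (moment f s)"
  let ?n = "\<lambda>s::real. nat \<lfloor>s\<rfloor>"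
  have \<sigma>: "l2_norm N (path_integral f 0 s) = ?\<sigma> s" if "0 \<le> s" for s
    using moment_eq[OF f order_refl that] l2_norm_nonneg[of N "path_integral f 0 s"] by (simp add: real_sqrt_unique)
  have bound: "cmod (char (?Z s) t
      - MS.cf (\<lambda>\<omega>. t / ?\<sigma> (real (?n s)) * MS.T 0 (?n s) \<omega>)) \<le> 2 * \<bar>t\<bar> * l2_norm mu f / ?\<sigma> s"
    if s: "0 \<le> s" and pos: "0 < moment f s" "0 < moment f (real (?n s))" for s
  proof -
    define n where "n = ?n s"
    have n: "0 \<le> real n" "real n \<le> s" "s - real n \<le> 1" unfolding n_def using s by linarith+
    let ?S = "path_integral f 0 s" and ?R = "path_integral f 0 (real n)" and ?D = "path_integral f (real n) s"
    have L: "?S \<in> L2 N" "?R \<in> L2 N" "?D \<in> L2 N" using n s by (auto intro!: path_integral_L2 f)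
    have D: "l2_norm N (\<lambda>\<omega>. ?S \<omega> - ?R \<omega>) \<le> l2_norm mu f"
    proof -
      have "AE \<omega> in N. ?S \<omega> - ?R \<omega> = ?D \<omega>"
        using path_integral_split[OF f order_refl n(1,2)] by eventually_elim simp
      then have "l2_norm N (\<lambda>\<omega>. ?S \<omega> - ?R \<omega>) = l2_norm N ?D" by (rule l2_norm_cong_AE) (intro L2_measurable L2_diff L)+
      also have "\<dots> \<le> (s - real n) * l2_norm mu f" by (rule path_integral_norm[OF f n(1,2)])
      also have "\<dots> \<le> 1 * l2_norm mu f" by (intro mult_right_mono n l2_norm_nonneg)
      finally show ?thesis by simp
    qed
    have sp: "0 < ?\<sigma> s" "0 < ?\<sigma> (real n)" using pos unfolding n_def by auto
    have T: "AE \<omega> in N. MS.T 0 n \<omega> = ?R \<omega>" using path_integral_sum[OF f, of 0 n] unfolding MS.T_def by simp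
    have eq: "(\<lambda>\<omega>. additive_functional X f s \<omega> / sqrt (variance_functional X PP mu f s)) = (\<lambda>\<omega>. ?S \<omega> / ?\<sigma> s)"
      by (simp add: additive_functional_eq variance_functional_eq[OF f z s])
    have "(\<lambda>\<omega>. ?S \<omega> / ?\<sigma> s) \<in> borel_measurable N" by (intro L2_measurable L2_closed L)
    then have "char (?Z s) t = MS.cf (\<lambda>\<omega>. t / ?\<sigma> s * ?S \<omega>)"
      unfolding eq char_def MS.cf_def by (subst integral_distr) auto
    moreover have "MS.cf (\<lambda>\<omega>. t / ?\<sigma> (real n) * MS.T 0 n \<omega>) = MS.cf (\<lambda>\<omega>. t / ?\<sigma> (real n) * ?R \<omega>)"
      unfolding MS.cf_def
    proof (rule integral_cong_AE)
      have "MS.T 0 n \<in> borel_measurable N" "?R \<in> borel_measurable N" by (intro L2_measurable L MS.T_L2)+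
      then show "(\<lambda>x. iexp (t / ?\<sigma> (real n) * MS.T 0 n x)) \<in> borel_measurable N" "(\<lambda>x. iexp (t / ?\<sigma> (real n) * ?R x)) \<in> borel_measurable N"
        by measurable
      show "AE x in N. iexp (t / ?\<sigma> (real n) * MS.T 0 n x) = iexp (t / ?\<sigma> (real n) * ?R x)"
        using T by eventually_elim simp
    qed
    moreover have "cmod (MS.cf (\<lambda>\<omega>. t / ?\<sigma> s * ?S \<omega>) - MS.cf (\<lambda>\<omega>. t / ?\<sigma> (real n) * ?R \<omega>)) \<le> 2 * \<bar>t\<bar> * l2_norm mu f / ?\<sigma> s"
    proof -
      have "cmod (MS.cf (\<lambda>\<omega>. t / ?\<sigma> s * ?S \<omega>) - MS.cf (\<lambda>\<omega>. t / ?\<sigma> (real n) * ?R \<omega>))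
          \<le> l2_norm N (\<lambda>\<omega>. t / ?\<sigma> s * ?S \<omega> - t / ?\<sigma> (real n) * ?R \<omega>)"
        by (intro MS.cf_diff_le L2_closed L)
      also have "\<dots> \<le> l2_norm N (\<lambda>\<omega>. t / ?\<sigma> s * ?S \<omega> - t / ?\<sigma> s * ?R \<omega>) + l2_norm N (\<lambda>\<omega>. t / ?\<sigma> s * ?R \<omega> - t / ?\<sigma> (real n) * ?R \<omega>)"
        by (intro l2_norm_triangle_via L2_closed L)
      also have "l2_norm N (\<lambda>\<omega>. t / ?\<sigma> s * ?S \<omega> - t / ?\<sigma> s * ?R \<omega>) = \<bar>t\<bar> / ?\<sigma> s * l2_norm N (\<lambda>\<omega>. ?S \<omega> - ?R \<omega>)"
        using l2_norm_cmult[of N "t / ?\<sigma> s" "\<lambda>\<omega>. ?S \<omega> - ?R \<omega>"] sp by (simp add: right_diff_distrib abs_divide)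
      also have "l2_norm N (\<lambda>\<omega>. t / ?\<sigma> s * ?R \<omega> - t / ?\<sigma> (real n) * ?R \<omega>) = \<bar>t\<bar> / ?\<sigma> s * \<bar>?\<sigma> s - ?\<sigma> (real n)\<bar>"
      proof -
        have "l2_norm N (\<lambda>\<omega>. t / ?\<sigma> s * ?R \<omega> - t / ?\<sigma> (real n) * ?R \<omega>) = \<bar>t / ?\<sigma> s - t / ?\<sigma> (real n)\<bar> * ?\<sigma> (real n)"
          using l2_norm_cmult[of N "t / ?\<sigma> s - t / ?\<sigma> (real n)" ?R] \<sigma>[OF n(1)] by (simp only: left_diff_distrib)
        also have "\<dots> = \<bar>(t / ?\<sigma> s - t / ?\<sigma> (real n)) * ?\<sigma> (real n)\<bar>" using sp by (simp add: abs_mult)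
        also have "(t / ?\<sigma> s - t / ?\<sigma> (real n)) * ?\<sigma> (real n) = t / ?\<sigma> s * (?\<sigma> (real n) - ?\<sigma> s)" using sp by (simp add: field_simps)
        finally show ?thesis using sp by (simp add: abs_mult abs_divide abs_minus_commute)
      qed
      also have "\<bar>t\<bar> / ?\<sigma> s * l2_norm N (\<lambda>\<omega>. ?S \<omega> - ?R \<omega>) + \<bar>t\<bar> / ?\<sigma> s * \<bar>?\<sigma> s - ?\<sigma> (real n)\<bar>
          \<le> \<bar>t\<bar> / ?\<sigma> s * l2_norm mu f + \<bar>t\<bar> / ?\<sigma> s * l2_norm mu f"
      proof (intro add_mono mult_left_mono D)
        show "\<bar>?\<sigma> s - ?\<sigma> (real n)\<bar> \<le> l2_norm mu f"
          using l2_norm_diff_ineq[OF L(1,2)] D unfolding \<sigma>[OF s] \<sigma>[OF n(1)] by linarith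
      qed (use sp in auto)
      finally show ?thesis by simp
    qed
    ultimately show ?thesis unfolding n_def by simp
  qed
  have n_top: "filterlim ?n sequentially at_top"
    unfolding filterlim_at_top
  proof
    fix Z :: nat
    show "\<forall>\<^sub>F s in at_top. Z \<le> ?n s" by (rule eventually_mono[OF eventually_ge_at_top[of "real Z"]]) (rule le_nat_floor)
  qed
  have inf: "filterlim ?\<sigma> at_top at_top"
  proof (rule filterlim_compose[OF sqrt_at_top], rule filterlim_at_top_mono)
    show "filterlim (\<lambda>s. c * s) at_top at_top"
      using c(1) by (intro filterlim_tendsto_pos_mult_at_top[OF tendsto_const] filterlim_ident)
  qed (rule c(2))
  have ev_pos: "\<forall>\<^sub>F s in at_top. 0 < moment f s"
    using c(2) eventually_gt_at_top[of 0]
    by eventually_elim (use c(1) in \<open>meson less_le_trans mult_pos_pos\<close>)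
  have ev_pos': "\<forall>\<^sub>F s in at_top. 0 < moment f (real (?n s))"
    by (rule eventually_compose_filterlim[OF ev_pos filterlim_compose[OF filterlim_real_sequentially n_top]])
  have "((\<lambda>s. char (?Z s) t
      - MS.cf (\<lambda>\<omega>. t / ?\<sigma> (real (?n s)) * MS.T 0 (?n s) \<omega>)) \<longlongrightarrow> 0) at_top"
  proof (rule Lim_null_comparison)
    show "\<forall>\<^sub>F s in at_top. cmod (char (?Z s) t
      - MS.cf (\<lambda>\<omega>. t / ?\<sigma> (real (?n s)) * MS.T 0 (?n s) \<omega>)) \<le> 2 * \<bar>t\<bar> * l2_norm mu f / ?\<sigma> s"
      using eventually_ge_at_top[of 0] ev_pos ev_pos' by eventually_elim (rule bound)
    show "((\<lambda>s. 2 * \<bar>t\<bar> * l2_norm mu f / ?\<sigma> s) \<longlongrightarrow> 0) at_top"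
      by (rule tendsto_divide_0[OF tendsto_const filterlim_at_top_imp_at_infinity[OF inf]])
  qed
  moreover have "((\<lambda>s. MS.cf (\<lambda>\<omega>. t / ?\<sigma> (real (?n s)) * MS.T 0 (?n s) \<omega>)) \<longlongrightarrow> complex_of_real (exp (- (t\<^sup>2 / 2)))) at_top"
    by (rule filterlim_compose[OF MS.cf_tendsto_normal n_top])
  ultimately show ?thesis using tendsto_add by fastforce
qed

end

text \<open>
  Levy's continuity theorem along every sequence of times tending to infinity.
\<close>

lemma weak_conv_at_topI:
  assumes M: "\<And>s. real_distribution (M s)" and M': "real_distribution M'"
    and char: "\<And>t. ((\<lambda>s. char (M s) t) \<longlongrightarrow> char M' t) at_top"
  shows "weak_conv_at_top M M'"
  unfolding weak_conv_at_top_def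
proof (intro allI impI tendsto_at_topI_sequentially)
  fix x and s :: "nat \<Rightarrow> real" assume x: "isCont (cdf M') x" and s: "filterlim s at_top sequentially"
  have "weak_conv_m (\<lambda>n. M (s n)) M'"
    by (rule levy_continuity[OF M M']) (rule filterlim_compose[OF char s])
  then show "(\<lambda>n. cdf (M (s n)) x) \<longlonglongrightarrow> cdf M' x" using x unfolding weak_conv_m_def weak_conv_def by blast
qed

theorem theorem4p18:
  fixes Om :: "'w measure"
    and X :: "real \<Rightarrow> 'w \<Rightarrow> real ^ 'd"
    and PP :: "real ^ 'd \<Rightarrow> 'w measure"
    and mu :: "(real ^ 'd) measure"
    and f :: "real ^ 'd \<Rightarrow> real"
    and cf :: real
  assumes "ergodic_diffusion Om X PP mu"
    and "ergodic_symmetrization X PP mu"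
    and "f \<in> L2 mu"
    and "\<not> (AE x in mu. f x = 0)"
    and "(\<integral>x. f x \<partial>mu) = 0"
    and "strongly_mixing Om X PP mu"
    and "\<forall>F\<in>dirichlet_domain X PP mu.
           (\<integral>x. f x * F x \<partial>mu)\<^sup>2 \<le> cf\<^sup>2 * (dirichlet_form X PP mu F / 2)"
    and "0 < Liminf at_top (\<lambda>t. ereal (variance_functional X PP mu f t / t))
         \<or> 0 < V_minus X PP mu f
         \<or> Hpos X PP mu f"
  shows "weak_conv_at_top
           (\<lambda>t. distr (mu \<bind> PP) borel
                  (\<lambda>\<omega>. additive_functional X f t \<omega> / sqrt (variance_functional X PP mu f t)))
           std_normal_distribution
         \<and> (\<exists>c>0. \<exists>d>0. \<forall>\<^sub>F t in at_top.
               c \<le> variance_functional X PP mu f t / t \<and> variance_functional X PP mu f t / t \<le> d)"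
proof -
  interpret ergodic_diffusion Om X PP mu by (rule assms(1))
  note f = assms(3) and z = assms(5)
  have H: "(l2_inner mu f F)\<^sup>2 \<le> cf\<^sup>2 * (- l2_inner mu F G)" if "(F, G) \<in> S.gen" for F G
    by (rule dual_norm_bound_on_generator[OF P_contraction_semigroup assms(7) that])
  have "\<exists>c>0. \<forall>\<^sub>F t in at_top. c * t \<le> moment f t" if pos: "0 < Liminf at_top (\<lambda>t. ereal (variance_functional X PP mu f t / t))"
  proof -
    obtain y where y: "0 < y" "y < Liminf at_top (\<lambda>t. ereal (variance_functional X PP mu f t / t))" using pos dense by blast
    then obtain \<delta> where \<delta>: "y = ereal \<delta>" by (cases y) auto
    have "\<forall>\<^sub>F t in at_top. ereal \<delta> < ereal (variance_functional X PP mu f t / t)"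
      using le_Liminf_iff[THEN iffD1, OF order_refl, rule_format, OF y(2)] unfolding \<delta> .
    then have "\<forall>\<^sub>F t in at_top. \<delta> * t \<le> moment f t" using eventually_gt_at_top[of 0]
      by eventually_elim (simp add: variance_functional_eq[OF f z] field_simps)
    then show ?thesis using y(1) \<delta> by auto
  qed
  then obtain c where c: "0 < c" "\<forall>\<^sub>F t in at_top. c * t \<le> moment f t"
    using moment_lower_bound[OF assms(2) f assms(4)] assms(8) by blast
  have "weak_conv_at_top (\<lambda>t. distr N borel (\<lambda>\<omega>. additive_functional X f t \<omega> / sqrt (variance_functional X PP mu f t))) std_normal_distribution"
  proof (rule weak_conv_at_topI)
    show "real_distribution std_normal_distribution" by (rule real_dist_normal_dist)
    fix s
    have "path_integral f 0 s \<in> borel_measurable N"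
    proof (cases "0 \<le> s")
      case True
      then show ?thesis by (intro L2_measurable path_integral_L2 f) auto
    next
      case False
      then have "path_integral f 0 s = (\<lambda>_. 0)" by (simp add: fun_eq_iff path_integral_def set_lebesgue_integral_def)
      then show ?thesis by simp
    qed
    then show "real_distribution (distr N borel (\<lambda>\<omega>. additive_functional X f s \<omega> / sqrt (variance_functional X PP mu f s)))"
      unfolding additive_functional_eq by (intro N.real_distribution_distr) simp
  next
    fix t
    show "((\<lambda>s. char (distr N borel (\<lambda>\<omega>. additive_functional X f s \<omega> / sqrt (variance_functional X PP mu f s))) t)
       \<longlongrightarrow> char std_normal_distribution t) at_top"
      using additive_functional_char_tendsto[OF assms(2) f z assms(6) _ H c] by (simp add: char_std_normal_distribution)
  qed
  moreover have "\<forall>\<^sub>F t in at_top. c \<le> variance_functional X PP mu f t / t \<and> variance_functional X PP mu f t / t \<le> 8 * exp 1 * cf\<^sup>2 + 1"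
    using c(2) eventually_gt_at_top[of 0]
  proof eventually_elim
    case (elim t)
    have "moment f t \<le> 8 * exp 1 * cf\<^sup>2 * t" by (rule moment_upper_bound[OF f _ elim(2) H]) simp_all
    then have "moment f t \<le> (8 * exp 1 * cf\<^sup>2 + 1) * t" using elim(2) by (simp add: distrib_right)
    then show ?case using elim by (simp add: variance_functional_eq[OF f z] pos_divide_le_eq pos_le_divide_eq)
  qed
  \<comment> \<open>the summand \<open>1\<close> makes the upper bound positive without a case distinction on \<open>cf\<close>\<close>
  moreover have "0 < 8 * exp 1 * cf\<^sup>2 + 1" by (simp add: add_nonneg_pos)
  ultimately show ?thesis using c(1) by blast
qed

end
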